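(* Let $b:\mathbb{R}^d\to\mathbb{R}^d$ be of class $C^1$. Assume that $\nabla^s b\le B I_d$ and $\|\nabla b\|\le K$ on $\mathbb{R}^d$, where $B\in\mathbb{R}$ and $K\ge 0$ are constants. Let $T>0$. Then for every initial point $x\in\mathbb{R}^d$, the law $\mathbb{P}_x$ of the solution $(X_t)_{t\in[0,T]}$ of $$dX_t=dB_t+b(X_t)\,dt,\qquad X_0=x,$$ satisfies $\mathbb{P}_x\in T_2(\alpha^2)$ on $C([0,T],\mathbb{R}^d)$ with respect to the pseudo-metric $d_H$, where $$\alpha^2:=\alpha^2(T,K,B)=\begin{cases}2\left(1+\dfrac{K^2}{B^2}\right),&\text{if }B<0,\\[2mm] 2\left(1+K^2\dfrac{e^{2BT}}{2B^2}\right),&\text{if }B>0,\\[2mm] 2\left(1+\dfrac{K^2T^2}{2}\right),&\text{if }B=0.\end{cases}$$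
   Context: $(B_t)$ in the SDE is an $\mathbb{R}^d$-valued standard Brownian motion. $\nabla^s b:=\left(\tfrac12(\partial_i b^j+\partial_j b^i)\right)_{1\le i,j\le d}$ is the symmetrized gradient, $I_d$ the identity matrix, the inequality $\nabla^s b\le BI_d$ is in the sense of nonnegative definiteness at every point, and $\|\nabla b\|$ is the operator norm of the Jacobian. The Cameron–Martin space is $$H:=\left\{\gamma(\cdot)=\int_0^\cdot h(s)\,ds;\ \|\gamma\|_H^2=\int_0^T|h(s)|^2\,ds<+\infty\right\},$$ and $d_H(\gamma_1,\gamma_2):=\|\gamma_1-\gamma_2\|_H$ if $\gamma_1-\gamma_2\in H$, $+\infty$ otherwise. For probability measures $\mu,\nu$ on $C([0,T],\mathbb{R}^d)$, $W_2^{d_H}(\mu,\nu)=\inf_\pi\left(\iint d_H(\gamma_1,\gamma_2)^2\,d\pi\right)^{1/2}$ over couplings $\pi$ of $(\mu,\nu)$; $H(\nu/\mu)=\int\log\frac{d\nu}{d\mu}\,d\nu$ if $\nu\ll\mu$, $+\infty$ otherwise (relative entropy). $\mu\in T_2(C)$ with respect to $d_H$ means $W_2^{d_H}(\mu,\nu)\le\sqrt{2C\,H(\nu/\mu)}$ for every probability measure $\nu$. *)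

theory Defs
  imports "HOL-Probability.Probability"
begin

subsection \<open>Hypotheses on the drift\<close>

definition C1_map :: "(real^'n \<Rightarrow> real^'n) \<Rightarrow> bool" where
  "C1_map b \<longleftrightarrow> (\<forall>y. b differentiable (at y)) \<and> continuous_on UNIV (\<lambda>y. jacobian b (at y))"

text \<open>The entry \<open>jacobian b (at y) $ j $ i\<close> is the partial derivative of the \<open>j\<close>-th
  component of \<open>b\<close> in direction \<open>i\<close>.\<close>

definition sym_grad :: "(real^'n \<Rightarrow> real^'n) \<Rightarrow> real^'n \<Rightarrow> real^'n^'n" where
  "sym_grad b y = (\<chi> i j. (1/2) * (jacobian b (at y) $ j $ i + jacobian b (at y) $ i $ j))"

definition nonneg_definite :: "real^'n^'n \<Rightarrow> bool" where
  "nonneg_definite A \<longleftrightarrow> (\<forall>v. 0 \<le> v \<bullet> (A *v v))"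

definition loewner_le :: "real^'n^'n \<Rightarrow> real^'n^'n \<Rightarrow> bool" where
  "loewner_le A C \<longleftrightarrow> nonneg_definite (C - A)"

definition operator_norm :: "real^'n^'n \<Rightarrow> real" where
  "operator_norm A = onorm (\<lambda>v. A *v v)"


subsection \<open>Path space\<close>

text \<open>A path is a function that is continuous on \<open>{0..T}\<close> and, as everywhere in the library's
  function spaces, extensional, i.e. equal to \<open>undefined\<close> off \<open>{0..T}\<close>. The metric of
  \<open>cfunspace\<close> is the supremum metric.\<close>

definition path_metric :: "real \<Rightarrow> (real \<Rightarrow> real^'n) metric" where
  "path_metric T = cfunspace (top_of_set {0..T}) euclidean_metric"

definition path_space :: "real \<Rightarrow> (real \<Rightarrow> real^'n) measure" where
  "path_space T = sigma (mspace (path_metric T)) {U. openin (mtopology_of (path_metric T)) U}"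


subsection \<open>The Cameron--Martin space and its pseudo-metric\<close>

definition CM_density :: "real \<Rightarrow> (real \<Rightarrow> real^'n) \<Rightarrow> (real \<Rightarrow> real^'n) \<Rightarrow> bool" where
  "CM_density T \<gamma> h \<longleftrightarrow>
     h \<in> borel_measurable borel \<and>
     set_integrable lborel {0..T} (\<lambda>s. (norm (h s))\<^sup>2) \<and>
     (\<forall>t\<in>{0..T}. \<gamma> t = set_lebesgue_integral lborel {0..t} h)"

definition CM_space :: "real \<Rightarrow> (real \<Rightarrow> real^'n) set" where
  "CM_space T = {\<gamma>. \<exists>h. CM_density T \<gamma> h}"

text \<open>The density of a path is unique up to null sets of \<open>{0..T}\<close>, so the norm does not depend
  on the one that is chosen.\<close>

definition CM_norm :: "real \<Rightarrow> (real \<Rightarrow> real^'n) \<Rightarrow> real" where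
  "CM_norm T \<gamma> =
     sqrt (set_lebesgue_integral lborel {0..T} (\<lambda>s. (norm ((SOME h. CM_density T \<gamma> h) s))\<^sup>2))"

definition d_H :: "real \<Rightarrow> (real \<Rightarrow> real^'n) \<Rightarrow> (real \<Rightarrow> real^'n) \<Rightarrow> ennreal" where
  "d_H T \<gamma>1 \<gamma>2 =
     (if (\<lambda>t. \<gamma>1 t - \<gamma>2 t) \<in> CM_space T then ennreal (CM_norm T (\<lambda>t. \<gamma>1 t - \<gamma>2 t)) else \<infinity>)"


subsection \<open>Transport-entropy inequalities\<close>

definition sqrt_ennreal :: "ennreal \<Rightarrow> ennreal" where
  "sqrt_ennreal u = (if u = \<infinity> then \<infinity> else ennreal (sqrt (enn2real u)))"

definition couplings :: "'a measure \<Rightarrow> 'a measure \<Rightarrow> ('a \<times> 'a) measure set" where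
  "couplings \<mu> \<nu> =
     {\<pi>. sets \<pi> = sets (\<mu> \<Otimes>\<^sub>M \<nu>) \<and> distr \<pi> \<mu> fst = \<mu> \<and> distr \<pi> \<nu> snd = \<nu>}"

definition W2 :: "('a \<Rightarrow> 'a \<Rightarrow> ennreal) \<Rightarrow> 'a measure \<Rightarrow> 'a measure \<Rightarrow> ennreal" where
  "W2 d \<mu> \<nu> = (INF \<pi>\<in>couplings \<mu> \<nu>. sqrt_ennreal (\<integral>\<^sup>+(x, y). (d x y)\<^sup>2 \<partial>\<pi>))"

text \<open>\<open>rel_entropy \<nu> \<mu>\<close> is the entropy of \<open>\<nu>\<close> with respect to \<open>\<mu>\<close>. Here
  \<open>entropy_density (exp 1) \<mu> \<nu>\<close> is the natural logarithm of the density of \<open>\<nu>\<close> with respect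
  to \<open>\<mu>\<close>, and \<open>KL_divergence (exp 1) \<mu> \<nu>\<close> is its integral against \<open>\<nu>\<close>. The negative part of
  that logarithm is always \<open>\<nu>\<close>-integrable for probability measures and the integral is
  nonnegative, so if the logarithm is not integrable the integral is infinite; the library's
  \<open>KL_divergence\<close> would be 0 in this case.\<close>

definition rel_entropy :: "'a measure \<Rightarrow> 'a measure \<Rightarrow> ennreal" where
  "rel_entropy \<nu> \<mu> =
     (if absolutely_continuous \<mu> \<nu> \<and> integrable \<nu> (entropy_density (exp 1) \<mu> \<nu>)
      then ennreal (KL_divergence (exp 1) \<mu> \<nu>) else \<infinity>)"

definition T2 :: "('a \<Rightarrow> 'a \<Rightarrow> ennreal) \<Rightarrow> real \<Rightarrow> 'a measure set" where
  "T2 d C = {\<mu>. prob_space \<mu> \<and>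
     (\<forall>\<nu>. prob_space \<nu> \<and> sets \<nu> = sets \<mu> \<longrightarrow>
        W2 d \<mu> \<nu> \<le> sqrt_ennreal (2 * ennreal C * rel_entropy \<nu> \<mu>))}"


subsection \<open>Brownian motion and the stochastic differential equation\<close>

definition filtration_on :: "'w measure \<Rightarrow> real \<Rightarrow> (real \<Rightarrow> 'w measure) \<Rightarrow> bool" where
  "filtration_on M T F \<longleftrightarrow>
     (\<forall>t\<in>{0..T}. subalgebra M (F t)) \<and>
     (\<forall>s\<in>{0..T}. \<forall>t\<in>{s..T}. subalgebra (F t) (F s))"

definition brownian_motion ::
    "'w measure \<Rightarrow> real \<Rightarrow> (real \<Rightarrow> 'w measure) \<Rightarrow> (real \<Rightarrow> 'w \<Rightarrow> real^'n) \<Rightarrow> bool" where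
  "brownian_motion M T F W \<longleftrightarrow>
     (\<forall>t\<in>{0..T}. W t \<in> borel_measurable (F t)) \<and>
     (AE \<omega> in M. W 0 \<omega> = 0) \<and>
     (AE \<omega> in M. continuous_on {0..T} (\<lambda>t. W t \<omega>)) \<and>
     (\<forall>s\<in>{0..T}. \<forall>t\<in>{s<..T}.
        distributed M lborel (\<lambda>\<omega>. W t \<omega> - W s \<omega>)
          (\<lambda>z. ennreal (\<Prod>i\<in>UNIV. normal_density 0 (sqrt (t - s)) (z $ i))) \<and>
        prob_space.indep_set M (sets (F s))
          {(\<lambda>\<omega>. W t \<omega> - W s \<omega>) -` A \<inter> space M | A. A \<in> sets borel})"

text \<open>Because the noise is additive, the equation in integrated form needs no stochastic
  integral.\<close>

definition sde_solution ::
    "'w measure \<Rightarrow> real \<Rightarrow> (real \<Rightarrow> 'w measure) \<Rightarrow> (real \<Rightarrow> 'w \<Rightarrow> real^'n) \<Rightarrow>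
      (real^'n \<Rightarrow> real^'n) \<Rightarrow> real^'n \<Rightarrow> (real \<Rightarrow> 'w \<Rightarrow> real^'n) \<Rightarrow> bool" where
  "sde_solution M T F W b x X \<longleftrightarrow>
     (\<forall>t\<in>{0..T}. X t \<in> borel_measurable (F t)) \<and>
     (\<forall>\<omega>\<in>space M. continuous_on {0..T} (\<lambda>t. X t \<omega>)) \<and>
     (AE \<omega> in M. \<forall>t\<in>{0..T}. X t \<omega> = x + W t \<omega> + integral {0..t} (\<lambda>s. b (X s \<omega>)))"

definition path_law :: "'w measure \<Rightarrow> real \<Rightarrow> (real \<Rightarrow> 'w \<Rightarrow> real^'n) \<Rightarrow> (real \<Rightarrow> real^'n) measure"
  where "path_law M T X = distr M (path_space T) (\<lambda>\<omega>. restrict (\<lambda>t. X t \<omega>) {0..T})"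

definition alpha_sq :: "real \<Rightarrow> real \<Rightarrow> real \<Rightarrow> real" where
  "alpha_sq T K B =
     (if B < 0 then 2 * (1 + K\<^sup>2 / B\<^sup>2)
      else if B > 0 then 2 * (1 + K\<^sup>2 * (exp (2 * B * T) / (2 * B\<^sup>2)))
      else 2 * (1 + K\<^sup>2 * T\<^sup>2 / 2))"

end

theory Submission
  imports Defs
begin

text \<open>The Haar coefficients of Brownian motion are independent standard Gaussian vectors, so the
  solution is a function of a sequence of independent standard Gaussian variables, through the
  Schauder expansion of the driving path. A measure with finite entropy relative to the law of the
  solution lifts to a density on the sequence space, and the Knothe rearrangement onto that density
  has mean squared \<open>l\<^sup>2\<close> displacement at most twice the entropy: coordinatewise this is
  Talagrand's inequality for the monotone transport of a Gaussian on the line, and the conditional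
  entropies add up. An \<open>l\<^sup>2\<close> displacement of the coefficients is a Cameron-Martin displacement \<open>u\<close> of
  the driving path, which moves the solution by \<open>D = u + \<integral>(b(X') - b(X))\<close>; a weighted energy
  estimate for \<open>D\<close> bounds its Cameron-Martin norm.\<close>

section \<open>Transport of a Gaussian on the line\<close>

text \<open>The noise is additive, so the solution is a functional of the driving path, and a
  Cameron-Martin shift of the driver can be followed path by path. The two laws are therefore
  coupled on the noise, and the coupling is then mapped to path space. On sequences of scalars
  conditioning stays elementary: conditional densities are quotients of marginal densities under a
  product measure. Independence of the Haar coefficients is obtained without covariances: the
  increment and the coefficient of a dyadic interval arise from its two halves by an orthogonal map,
  which preserves pairs of independent standard Gaussians. Convergence of the Schauder series is
  inherited from continuity of the Brownian path. The constant has the shape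
  \<open>2 * (1 + K\<^sup>2 * \<kappa>)\<close>: the 2 comes from bounding the square of a sum of
  two velocities, and \<open>\<kappa>\<close> bounds the integral of the squared norm of
  \<open>D\<close> by the squared displacement of the coefficients. The sign of \<open>B\<close>
  enters through the choice of the weight in the energy estimate.\<close>

abbreviation gauss :: "real measure" where
  "gauss \<equiv> density lborel (\<lambda>x. ennreal (std_normal_density x))"

text \<open>Monotone rearrangement of the standard Gaussian onto the law with density
  \<open>g\<close>: the generalized inverse of the target distribution function, taken at the
  Gaussian level of \<open>x\<close>. The infimum makes sense also where the target distribution
  function is flat.\<close>

definition quantile_map :: "(real \<Rightarrow> ennreal) \<Rightarrow> real \<Rightarrow> real" where
  "quantile_map g x = Inf {t. cdf gauss x \<le> cdf (density gauss g) t}"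

text \<open>Subtracting \<open>u - 1\<close> makes the integrand nonnegative, hence integrable in the extended
  sense, and does not change the entropy of a probability density.\<close>

definition ent :: "real \<Rightarrow> real" where
  "ent u = u * ln u - u + 1"

section \<open>The Gaussian measure and convexity of the entropy integrand\<close>

lemma gauss_prob: "prob_space gauss"
  by (rule prob_space_normal_density) simp

lemma gauss_real_distribution: "real_distribution gauss"
  using gauss_prob by (auto simp: real_distribution_def real_distribution_axioms_def)

text \<open>\<open>ent\<close> lies above its tangents, and the tangent at \<open>v\<close> is
  \<open>u * ln v - v + 1\<close>. The bound is affine in \<open>u\<close>, so it survives
  averaging; convexity and the entropy bound for averaged densities both rest on it.\<close>

lemma ent_tangent:
  assumes "0 \<le> u" "0 < v"
  shows "u * ln v \<le> ent u + v - 1"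
proof (cases "u = 0")
  case True then show ?thesis using assms by (simp add: ent_def)
next
  case False
  then have u: "u > 0" using assms by simp
  have "ln (v/u) \<le> v/u - 1" using u assms by (intro ln_le_minus_one) simp
  then have "u * (ln v - ln u) \<le> u * (v/u - 1)" using u assms
    by (intro mult_left_mono) (auto simp: ln_div)
  then show ?thesis using u by (simp add: ent_def algebra_simps)
qed

lemma ent_nonneg: "0 \<le> u \<Longrightarrow> 0 \<le> ent u"
  using ent_tangent[of u 1] by simp

lemma borel_measurable_ent[measurable]: "ent \<in> borel_measurable borel"
  unfolding ent_def by measurable

lemma convex_on_ent: "convex_on {0..} ent"
proof (rule convex_onI)
  fix t x y :: real
  assume t: "0 < t" "t < 1" and xy: "x \<in> {0..}" "y \<in> {0..}"
  \<comment> \<open>The tangent inequalities at the convex combination \<open>z\<close> add up to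
    convexity. There is no tangent at 0, but \<open>z = 0\<close> forces both weighted terms to
    vanish.\<close>
  define z where "z = (1 - t) * x + t * y"
  show "ent ((1 - t) *\<^sub>R x + t *\<^sub>R y) \<le> (1 - t) * ent x + t * ent y"
  proof (cases "z = 0")
    case True
    then have "(1 - t) * x = 0" "t * y = 0" using mult_nonneg_nonneg[of "1-t" x] mult_nonneg_nonneg[of t y] t xy
      unfolding z_def atLeast_iff by linarith+
    then show ?thesis using t by (auto simp: ent_def)
  next
    case False
    then have z: "z > 0" using mult_nonneg_nonneg[of "1-t" x] mult_nonneg_nonneg[of t y] t xy
      unfolding z_def atLeast_iff by linarith
    have 1: "(1 - t) * (x * ln z) \<le> (1 - t) * (ent x + z - 1)"
      using ent_tangent[of x z] xy z t by (intro mult_left_mono) auto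
    have 2: "t * (y * ln z) \<le> t * (ent y + z - 1)"
      using ent_tangent[of y z] xy z t by (intro mult_left_mono) auto
    have "(1 - t) * (x * ln z) + t * (y * ln z) = z * ln z"
      unfolding z_def by (simp add: algebra_simps)
    then have "z * ln z \<le> (1-t) * ent x + t * ent y + z - 1" using 1 2 by (simp add: algebra_simps)
    then show ?thesis unfolding ent_def[of "_ + _"] by (simp add: z_def[symmetric])
  qed
qed simp

section \<open>Distribution functions of the Gaussian and of densities\<close>

lemma gauss_null_singleton: "measure gauss {x} = 0"
proof -
  have "emeasure gauss {x} = (\<integral>\<^sup>+t. ennreal (std_normal_density t) * indicator {x} t \<partial>lborel)"
    by (simp add: emeasure_density)
  also have "\<dots> = 0"
    by (subst nn_integral_0_iff_AE) (auto intro: AE_mp[OF AE_lborel_singleton[of x]])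
  finally show ?thesis by (simp add: measure_def)
qed

lemma gauss_absolutely_continuous_cdf:
  assumes g: "g \<in> borel_measurable borel" and 1: "(\<integral>\<^sup>+s. g s \<partial>gauss) = 1"
  shows "real_distribution (density gauss g)" "isCont (cdf (density gauss g)) x"
proof -
  have p: "prob_space (density gauss g)"
    by (rule prob_spaceI) (use g 1 in \<open>simp add: emeasure_density del: emeasure_lborel_UNIV\<close>)
  then show r: "real_distribution (density gauss g)"
    by (auto simp: real_distribution_def real_distribution_axioms_def)
  interpret real_distribution "density gauss g" by (rule r)
  have e: "emeasure gauss {x} = 0" using gauss_null_singleton[of x]
    by (metis gauss_prob finite_measure.emeasure_eq_measure ennreal_0 prob_space_def)
  have "AE s in gauss. s \<noteq> x" by (rule AE_I[OF _ e]) auto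
  then have "emeasure (density gauss g) {x} = 0" using g
    by (subst emeasure_density) (auto simp: nn_integral_0_iff_AE indicator_def elim!: eventually_mono split: if_splits)
  then have "measure (density gauss g) {x} = 0" by (simp add: measure_def)
  then show "isCont (cdf (density gauss g)) x" using isCont_cdf by simp
qed

lemma cdf_gauss_isCont: "isCont (cdf gauss) x"
proof -
  interpret real_distribution gauss by (rule gauss_real_distribution)
  show ?thesis using isCont_cdf gauss_null_singleton by simp
qed

text \<open>Continuity is required at the single point \<open>x\<close> only, so that densities with
  finitely many jumps can be treated away from the jumps. Near \<open>x\<close> the distribution
  function differs by a constant from an integral started at \<open>x - 1\<close>.\<close>

lemma cdf_density_has_derivative:
  fixes k :: "real \<Rightarrow> real"
  assumes k: "integrable lborel k" "\<And>x. 0 \<le> k x" and c: "isCont k x"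
  shows "(cdf (density lborel (\<lambda>t. ennreal (k t))) has_real_derivative k x) (at x)"
proof -
  let ?F = "cdf (density lborel (\<lambda>t. ennreal (k t)))"
  have F: "?F t = (LINT s:{..t}|lborel. k s)" for t
  proof -
    have "?F t = enn2real (\<integral>\<^sup>+s. ennreal (k s) * indicator {..t} s \<partial>lborel)"
      using k by (simp add: cdf_def measure_def emeasure_density)
    also have "(\<integral>\<^sup>+s. ennreal (k s) * indicator {..t} s \<partial>lborel) = (\<integral>\<^sup>+s. ennreal (k s * indicator {..t} s) \<partial>lborel)"
      by (intro nn_integral_cong) (auto simp: indicator_def)
    also have "\<dots> = ennreal (\<integral>s. k s * indicator {..t} s \<partial>lborel)"
      using k by (intro nn_integral_eq_integral) (auto intro!: integrable_real_mult_indicator)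
    finally show ?thesis using k by (simp add: set_lebesgue_integral_def mult.commute)
  qed
  have si: "set_integrable lborel A k" if "A \<in> sets borel" for A
    using integrable_mult_indicator[of A lborel k] k that by (simp add: set_integrable_def)
  have eq: "?F t = ?F (x - 1) + integral {x-1..t} k" if "t \<in> {x-1..}" for t
  proof -
    have "?F t = (LINT s:({..x-1} \<union> {x-1<..t})|lborel. k s)" using that unfolding F
      by (intro arg_cong[where f="\<lambda>A. set_lebesgue_integral lborel A k"]) auto
    also have "\<dots> = ?F (x-1) + (LINT s:{x-1<..t}|lborel. k s)"
      unfolding F by (intro set_integral_Un si) auto
    also have "(LINT s:{x-1<..t}|lborel. k s) = (LINT s:{x-1..t}|lborel. k s)"
    proof (intro set_integral_null_delta)
      have "sym_diff {x - 1<..t} {x - 1..t} \<subseteq> {x - 1}" by auto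
      then show "sym_diff {x - 1<..t} {x - 1..t} \<in> null_sets lborel"
        by (rule null_sets_subset[rotated 2]) auto
    qed (use k in auto)
    also have "\<dots> = integral {x-1..t} k" by (intro set_borel_integral_eq_integral si) auto
    finally show ?thesis .
  qed
  have "((\<lambda>t. integral {x-1..t} k) has_vector_derivative k x) (at x within {x-1..x+1} - {})"
  proof (rule integral_has_vector_derivative_continuous_at)
    show "k integrable_on {x-1..x+1}" using si[of "{x-1..x+1}"] by (simp add: set_borel_integral_eq_integral(1))
    show "continuous (at x within {x-1..x+1} - {}) k" by (rule continuous_at_imp_continuous_within[OF c])
  qed auto
  then have "((\<lambda>t. integral {x-1..t} k) has_real_derivative k x) (at x)"
    by (simp add: has_real_derivative_iff_has_vector_derivative at_within_Icc_at)
  then have "((\<lambda>t. ?F (x-1) + integral {x-1..t} k) has_real_derivative k x) (at x)"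
    by (auto intro!: derivative_eq_intros)
  then show ?thesis
    by (rule has_field_derivative_transform_within_open[where S="{x-1<..}"]) (auto intro: eq[symmetric])
qed

lemma std_normal_density_has_derivative:
  "(std_normal_density has_real_derivative - x * std_normal_density x) (at x)"
  unfolding std_normal_density_def[abs_def]
  by (auto intro!: derivative_eq_intros simp: field_simps)

lemma cdf_gauss_has_derivative: "(cdf gauss has_real_derivative std_normal_density x) (at x)"
  by (rule cdf_density_has_derivative[OF integrable_normal_density])
    (auto intro: DERIV_isCont[OF std_normal_density_has_derivative])

lemma cdf_gauss_strict_mono: "strict_mono (cdf gauss)"
proof (rule strict_monoI)
  fix x y :: real assume "x < y"
  moreover have "\<exists>d. (cdf gauss has_real_derivative d) (at z) \<and> 0 < d" for z
    by (intro exI[of _ "std_normal_density z"] conjI cdf_gauss_has_derivative normal_density_pos) simp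
  ultimately show "cdf gauss x < cdf gauss y" by (rule DERIV_pos_imp_increasing)
qed

lemma cdf_gauss_bounds: "0 < cdf gauss x" "cdf gauss x < 1"
proof -
  interpret real_distribution gauss by (rule gauss_real_distribution)
  have "cdf gauss (x-1) < cdf gauss x" "cdf gauss x < cdf gauss (x+1)"
    using cdf_gauss_strict_mono by (auto simp: strict_mono_def)
  then show "0 < cdf gauss x" "cdf gauss x < 1"
    using cdf_nonneg[of "x-1"] cdf_bounded_prob[of "x+1"] by linarith+
qed

section \<open>Quantile transforms: image law and measurability\<close>

lemma continuous_cdf_surj:
  assumes "real_distribution D" "\<And>x. isCont (cdf D) x" "0 < u" "u < 1"
  shows "\<exists>x. cdf D x = u"
proof -
  interpret real_distribution D by fact
  have "\<forall>\<^sub>F x in at_bot. cdf D x < u" using cdf_lim_at_bot assms by (simp add: order_tendsto_iff)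
  then obtain a where a: "\<And>x. x \<le> a \<Longrightarrow> cdf D x < u" unfolding eventually_at_bot_linorder by blast
  have "\<forall>\<^sub>F x in at_top. cdf D x > u" using cdf_lim_at_top_prob assms by (simp add: order_tendsto_iff)
  then obtain b where b: "\<And>x. x \<ge> b \<Longrightarrow> cdf D x > u" unfolding eventually_at_top_linorder by blast
  have "\<exists>x\<ge>a. x \<le> max a b \<and> cdf D x = u"
    using a[of a] b[of "max a b"] assms(2) by (intro IVT) (auto intro: less_imp_le)
  then show ?thesis by blast
qed

text \<open>The Galois connection between a distribution function and its generalized inverse,
  available for every \<open>x\<close> because Gaussian levels lie strictly between 0 and 1.
  Measurability, the image law and the limits below are read off from it.\<close>

lemma quantile_map_le_iff:
  assumes "g \<in> borel_measurable borel" "(\<integral>\<^sup>+s. g s \<partial>gauss) = 1"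
  shows "quantile_map g x \<le> t \<longleftrightarrow> cdf gauss x \<le> cdf (density gauss g) t"
proof -
  interpret cdf_distribution "density gauss g"
    using gauss_absolutely_continuous_cdf[OF assms] by (simp add: cdf_distribution_def)
  show ?thesis using pseudoinverse[of "cdf gauss x" t] cdf_gauss_bounds[of x]
    unfolding quantile_map_def by simp
qed

text \<open>In the Knothe map the density depends on coordinates already transported, so joint
  measurability in parameter and point is needed. By the Galois connection a sublevel set compares
  two measurable functions of the pair.\<close>

lemma measurable_quantile_map_param:
  assumes g: "(\<lambda>(y, s). g y s) \<in> borel_measurable (N \<Otimes>\<^sub>M borel)"
    and 1: "\<And>y. y \<in> space N \<Longrightarrow> (\<integral>\<^sup>+s. g y s \<partial>gauss) = 1"
  shows "(\<lambda>(y, x). quantile_map (g y) x) \<in> borel_measurable (N \<Otimes>\<^sub>M borel)"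
proof (rule borel_measurableI_le)
  fix t
  interpret gauss: prob_space gauss by (rule gauss_prob)
  have g'[measurable]: "g y \<in> borel_measurable borel" if "y \<in> space N" for y
    using measurable_Pair2[OF g that] by simp
  have G: "sets gauss = sets borel" by simp
  have g2: "(\<lambda>(y, s). g y s) \<in> borel_measurable (N \<Otimes>\<^sub>M gauss)"
    by (subst measurable_cong_sets[OF sets_pair_measure_cong[OF refl G] refl]) (rule g)
  have [measurable]: "(\<lambda>y. \<integral>\<^sup>+s. g y s * indicator {..t} s \<partial>gauss) \<in> borel_measurable N"
  proof (rule gauss.borel_measurable_nn_integral)
    show "(\<lambda>(y, s). g y s * indicator {..t} s) \<in> borel_measurable (N \<Otimes>\<^sub>M gauss)"
      using g2 by (simp add: case_prod_unfold)
  qed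
  have [measurable]: "cdf gauss \<in> borel_measurable borel"
    by (intro borel_measurable_continuous_onI continuous_at_imp_continuous_on) (auto simp: cdf_gauss_isCont)
  have "{p \<in> space (N \<Otimes>\<^sub>M borel). (case p of (y, x) \<Rightarrow> quantile_map (g y) x) \<le> t} =
    {p \<in> space (N \<Otimes>\<^sub>M borel). cdf gauss (snd p) \<le> enn2real (\<integral>\<^sup>+s. g (fst p) s * indicator {..t} s \<partial>gauss)}"
    by (auto simp: space_pair_measure quantile_map_le_iff 1 cdf_def measure_def emeasure_density)
  also have "\<dots> \<in> sets (N \<Otimes>\<^sub>M borel)" by measurable
  finally show "{p \<in> space (N \<Otimes>\<^sub>M borel). (case p of (y, x) \<Rightarrow> quantile_map (g y) x) \<le> t} \<in> sets (N \<Otimes>\<^sub>M borel)" .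
qed

lemma measurable_quantile_map:
  assumes "g \<in> borel_measurable borel" "(\<integral>\<^sup>+s. g s \<partial>gauss) = 1"
  shows "quantile_map g \<in> borel_measurable borel"
proof -
  have "(\<lambda>(y, x). quantile_map ((\<lambda>_. g) y) x) \<in> borel_measurable (count_space UNIV \<Otimes>\<^sub>M borel)"
    using assms by (intro measurable_quantile_map_param) auto
  from measurable_Pair2[OF this, of undefined] show ?thesis by simp
qed

lemma distr_quantile_map:
  assumes g: "g \<in> borel_measurable borel" and 1: "(\<integral>\<^sup>+s. g s \<partial>gauss) = 1"
  shows "distr gauss borel (quantile_map g) = density gauss g"
proof (rule cdf_unique)
  note [measurable] = measurable_quantile_map[OF assms]
  interpret gauss: real_distribution gauss by (rule gauss_real_distribution)
  show "real_distribution (distr gauss borel (quantile_map g))" by (rule gauss.real_distribution_distr) simp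
  show r: "real_distribution (density gauss g)" by (rule gauss_absolutely_continuous_cdf[OF assms])
  interpret real_distribution "density gauss g" by (rule r)
  show "cdf (distr gauss borel (quantile_map g)) = cdf (density gauss g)"
  proof
    fix t
    let ?u = "cdf (density gauss g) t"
    have *: "cdf (distr gauss borel (quantile_map g)) t = measure gauss {x. cdf gauss x \<le> ?u}"
      by (auto simp: cdf_def[of "distr _ _ _"] measure_distr quantile_map_le_iff[OF assms] vimage_def)
    \<comment> \<open>An interior level is attained by the Gaussian distribution function, so the
      set is a half-line; at the levels 0 and 1 it is empty or everything.\<close>
    consider "?u = 0" | "?u = 1" | "0 < ?u" "?u < 1" using cdf_nonneg[of t] cdf_bounded_prob[of t] by linarith
    then show "cdf (distr gauss borel (quantile_map g)) t = ?u"
    proof cases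
      case 1
      then have "{x. cdf gauss x \<le> ?u} = {}" using cdf_gauss_bounds(1) by (auto simp: not_le)
      then show ?thesis using * 1 by simp
    next
      case 2
      then have "{x. cdf gauss x \<le> ?u} = UNIV" using cdf_gauss_bounds(2) by (auto intro: less_imp_le)
      then show ?thesis using * 2 gauss.prob_space by simp
    next
      case 3
      then obtain x0 where x0: "cdf gauss x0 = ?u"
        using continuous_cdf_surj[OF gauss_real_distribution cdf_gauss_isCont] by blast
      then have "{x. cdf gauss x \<le> ?u} = {..x0}"
        using cdf_gauss_strict_mono by (auto simp: strict_mono_less_eq x0[symmetric])
      then show ?thesis using * x0 by (simp add: cdf_def)
    qed
  qed
qed

section \<open>Gaussian shifts, tails, and transport for bounded densities\<close>

lemma gauss_translate:
  assumes h[measurable]: "h \<in> borel_measurable borel"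
  shows "(\<integral>\<^sup>+s. h s \<partial>gauss) = (\<integral>\<^sup>+s. h (s + a) * ennreal (exp (- a * s - a\<^sup>2 / 2)) \<partial>gauss)"
proof -
  have d: "std_normal_density (s + a) = std_normal_density s * exp (- a * s - a\<^sup>2 / 2)" for s
    by (simp add: std_normal_density_def exp_add[symmetric] field_simps power2_eq_square)
  have "(\<integral>\<^sup>+s. h s \<partial>gauss) = (\<integral>\<^sup>+s. ennreal (std_normal_density s) * h s \<partial>lborel)"
    by (simp add: nn_integral_density)
  also have "\<dots> = (\<integral>\<^sup>+s. ennreal (std_normal_density (a + s)) * h (a + s) \<partial>lborel)"
    using nn_integral_real_affine[of "\<lambda>s. ennreal (std_normal_density s) * h s" 1 a] by simp
  also have "\<dots> = (\<integral>\<^sup>+s. ennreal (std_normal_density s) * (h (s + a) * ennreal (exp (- a * s - a\<^sup>2 / 2))) \<partial>lborel)"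
    by (intro nn_integral_cong) (simp add: add.commute[of a] d ennreal_mult mult_ac)
  also have "\<dots> = (\<integral>\<^sup>+s. h (s + a) * ennreal (exp (- a * s - a\<^sup>2 / 2)) \<partial>gauss)"
    by (simp add: nn_integral_density)
  finally show ?thesis .
qed

text \<open>A unit shift multiplies the Gaussian density by an exponential that is at most
  \<open>exp (y - 1/2)\<close> on the half-line, so far out each unit step reduces the tail by more
  than any prescribed factor. This confines the transport of a bounded density near the ends of a
  large interval.\<close>

lemma gauss_tail_lower: "measure gauss {..y - 1} \<le> exp (y - 1/2) * measure gauss {..y}"
proof -
  interpret prob_space gauss by (rule gauss_prob)
  have "emeasure gauss {..y-1} = (\<integral>\<^sup>+s. indicator {..y-1} s \<partial>gauss)" by simp
  also have "\<dots> = (\<integral>\<^sup>+s. indicator {..y-1} (s + - 1) * ennreal (exp (- (- 1) * s - (- 1)\<^sup>2 / 2)) \<partial>gauss)"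
    by (rule gauss_translate) simp
  also have "\<dots> \<le> (\<integral>\<^sup>+s. ennreal (exp (y - 1/2)) * indicator {..y} s \<partial>gauss)"
    by (intro nn_integral_mono) (auto simp: indicator_def intro!: ennreal_leI)
  also have "\<dots> = ennreal (exp (y - 1/2)) * emeasure gauss {..y}"
    by (subst nn_integral_cmult_indicator) auto
  finally show ?thesis unfolding emeasure_eq_measure by (simp add: ennreal_mult'[symmetric])
qed

lemma gauss_tail_upper: "measure gauss {y + 1<..} \<le> exp (- y - 1/2) * measure gauss {y<..}"
proof -
  interpret prob_space gauss by (rule gauss_prob)
  have "emeasure gauss {y+1<..} = (\<integral>\<^sup>+s. indicator {y+1<..} s \<partial>gauss)" by simp
  also have "\<dots> = (\<integral>\<^sup>+s. indicator {y+1<..} (s + 1) * ennreal (exp (- 1 * s - 1\<^sup>2 / 2)) \<partial>gauss)"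
    by (rule gauss_translate) simp
  also have "\<dots> \<le> (\<integral>\<^sup>+s. ennreal (exp (- y - 1/2)) * indicator {y<..} s \<partial>gauss)"
    by (intro nn_integral_mono) (auto simp: indicator_def intro!: ennreal_leI)
  also have "\<dots> = ennreal (exp (- y - 1/2)) * emeasure gauss {y<..}"
    by (subst nn_integral_cmult_indicator) auto
  finally show ?thesis unfolding emeasure_eq_measure by (simp add: ennreal_mult'[symmetric])
qed

lemma std_normal_density_tendsto_0: "(\<lambda>n. std_normal_density (real n)) \<longlonglongrightarrow> 0"
proof -
  have "filterlim (\<lambda>n. - (real n)\<^sup>2 / 2) at_bot sequentially"
    unfolding minus_divide_left[symmetric] filterlim_uminus_at_bot minus_minus
    by (rule filterlim_at_top_mult_tendsto_pos[where c="1/2" and f="\<lambda>_. 1/2", simplified])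
       (auto intro!: filterlim_pow_at_top filterlim_real_sequentially)
  then have "(\<lambda>n. exp (- (real n)\<^sup>2 / 2)) \<longlonglongrightarrow> 0"
    by (rule filterlim_compose[OF exp_at_bot])
  then have "(\<lambda>n. 1 / sqrt (2 * pi) * exp (- (real n)\<^sup>2 / 2)) \<longlonglongrightarrow> 1 / sqrt (2 * pi) * 0"
    by (intro tendsto_intros)
  then show ?thesis by (simp add: std_normal_density_def)
qed

text \<open>With \<open>\<tau>\<close> the monotone transport and \<open>\<phi>\<close> the Gaussian density, the change of variables
  \<open>k(\<tau>) \<phi>(\<tau>) \<tau>' = \<phi>\<close> gives \<open>ln k(\<tau>) = (\<tau>\<^sup>2 - x\<^sup>2) / 2 - ln \<tau>'\<close>; integrate against \<open>\<phi>\<close>, use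
  \<open>ln \<tau>' \<le> \<tau>' - 1\<close>, and integrate \<open>\<tau>' - 1\<close> by parts.\<close>

lemma talagrand_bounded:
  fixes k :: "real \<Rightarrow> real"
  assumes k[measurable]: "k \<in> borel_measurable borel"
    and c: "0 < c" "\<And>t. c \<le> k t" "\<And>t. k t \<le> C"
    and P: "finite P" "\<And>t. t \<notin> P \<Longrightarrow> isCont k t"
    and one: "(\<integral>\<^sup>+s. ennreal (k s) \<partial>gauss) = 1"
  shows "(\<integral>\<^sup>+x. ennreal ((x - quantile_map (\<lambda>s. ennreal (k s)) x)\<^sup>2) \<partial>gauss)
    \<le> ennreal (2 * (\<integral>s. k s * ln (k s) \<partial>gauss))"
proof -
  define \<nu> where "\<nu> = density gauss (\<lambda>s. ennreal (k s))"
  define F where "F = cdf \<nu>"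
  define \<tau> where "\<tau> = quantile_map (\<lambda>s. ennreal (k s))"
  let ?\<phi> = std_normal_density
  have kpos: "0 < k t" for t using c(1) c(2)[of t] by linarith
  have Cpos: "0 < C" using kpos[of 0] c(3)[of 0] by linarith
  have \<phi>pos: "0 < ?\<phi> t" for t by (rule normal_density_pos) simp
  have km: "(\<lambda>s. ennreal (k s)) \<in> borel_measurable borel" by simp
  interpret gauss: real_distribution gauss by (rule gauss_real_distribution)
  note acd = gauss_absolutely_continuous_cdf[OF km one, folded \<nu>_def]
  interpret \<nu>: real_distribution \<nu> by (rule acd(1))
  have Fcont: "isCont F x" for x unfolding F_def by (rule acd(2))
  have \<tau>m[measurable]: "\<tau> \<in> borel_measurable borel"
    unfolding \<tau>_def by (rule measurable_quantile_map[OF km one])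
  have \<tau>distr: "distr gauss borel \<tau> = \<nu>" unfolding \<tau>_def \<nu>_def by (rule distr_quantile_map[OF km one])
  \<comment> \<open>The lower bound makes \<open>F\<close> strictly increasing, the upper one
    controls the tails of \<open>\<nu>\<close>.\<close>
  have lo: "c * measure gauss A \<le> measure \<nu> A" and up: "measure \<nu> A \<le> C * measure gauss A"
    if [measurable]: "A \<in> sets borel" for A
  proof -
    have e: "emeasure \<nu> A = (\<integral>\<^sup>+s. ennreal (k s) * indicator A s \<partial>gauss)"
      unfolding \<nu>_def by (simp add: emeasure_density)
    have "ennreal c * emeasure gauss A \<le> emeasure \<nu> A"
      unfolding e using c by (subst nn_integral_cmult_indicator[symmetric], simp)
        (auto intro!: nn_integral_mono mult_right_mono ennreal_leI)
    then show "c * measure gauss A \<le> measure \<nu> A"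
      unfolding \<nu>.emeasure_eq_measure gauss.emeasure_eq_measure using c by (simp add: ennreal_mult'[symmetric])
    have "emeasure \<nu> A \<le> ennreal C * emeasure gauss A"
      unfolding e using c by (subst nn_integral_cmult_indicator[symmetric], simp)
        (auto intro!: nn_integral_mono mult_right_mono ennreal_leI)
    then show "measure \<nu> A \<le> C * measure gauss A"
      unfolding \<nu>.emeasure_eq_measure gauss.emeasure_eq_measure using Cpos by (simp add: ennreal_mult'[symmetric])
  qed
  have Fd: "(F has_real_derivative k t * ?\<phi> t) (at t)" if "t \<notin> P" for t
  proof -
    have "\<nu> = density lborel (\<lambda>s. ennreal (k s * ?\<phi> s))"
      unfolding \<nu>_def using kpos by (subst density_density_eq) (auto simp: ennreal_mult' mult.commute less_imp_le)
    moreover have "integrable lborel (\<lambda>s. k s * ?\<phi> s)"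
    proof (rule Bochner_Integration.integrable_bound[where f="\<lambda>s. C * ?\<phi> s"])
      show "AE s in lborel. norm (k s * ?\<phi> s) \<le> norm (C * ?\<phi> s)"
        using kpos c Cpos \<phi>pos by (auto simp: abs_mult less_imp_le intro!: mult_right_mono)
    qed (auto intro!: integrable_mult_right)
    moreover have "isCont (\<lambda>s. k s * ?\<phi> s) t" using P(2)[OF that]
      by (intro continuous_intros) (auto intro: DERIV_isCont[OF std_normal_density_has_derivative])
    ultimately show ?thesis unfolding F_def using kpos
      using cdf_density_has_derivative[of "\<lambda>s. k s * ?\<phi> s" t] by (simp add: less_imp_le)
  qed
  have Fmono: "F s < F t" if "s < t" for s t
  proof -
    have "0 < c * measure gauss {s<..t}"
      using gauss.cdf_diff_eq[OF that] strict_monoD[OF cdf_gauss_strict_mono that] c(1)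
      by (intro mult_pos_pos) linarith+
    also have "\<dots> \<le> measure \<nu> {s<..t}" by (rule lo) simp
    also have "\<dots> = F t - F s" unfolding F_def using \<nu>.cdf_diff_eq[OF that] by simp
    finally show ?thesis by simp
  qed
  have Fle: "F s \<le> F t \<longleftrightarrow> s \<le> t" for s t
    using Fmono[of s t] Fmono[of t s] by (cases s t rule: linorder_cases) auto
  have Finj: "F s = F t \<longleftrightarrow> s = t" for s t using Fle[of s t] Fle[of t s] by auto
  have F01: "0 < F t" "F t < 1" for t
    using Fmono[of "t-1" t] Fmono[of t "t+1"] \<nu>.cdf_nonneg[of "t-1"] \<nu>.cdf_bounded_prob[of "t+1"]
    unfolding F_def by linarith+
  have F\<tau>: "F (\<tau> x) = cdf gauss x" for x
  proof -
    obtain t where t: "F t = cdf gauss x"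
      using continuous_cdf_surj[OF acd] cdf_gauss_bounds[of x] unfolding F_def by blast
    have "cdf gauss x \<le> F (\<tau> x)" using quantile_map_le_iff[OF km one, of x "\<tau> x"]
      unfolding F_def \<nu>_def \<tau>_def by simp
    moreover have "\<tau> x \<le> t" using quantile_map_le_iff[OF km one, of x t] t
      unfolding F_def \<nu>_def \<tau>_def by simp
    ultimately show ?thesis using t Fle by (metis order_antisym)
  qed
  have gmono: "cdf gauss s \<le> cdf gauss t \<longleftrightarrow> s \<le> t" for s t
    using cdf_gauss_strict_mono by (rule strict_mono_less_eq)
  have \<tau>inj: "\<tau> s = \<tau> t \<Longrightarrow> s = t" for s t by (metis F\<tau> gmono order_antisym order_refl)
  define G where "G = inv F"
  have GF: "G (F t) = t" for t unfolding G_def by (rule inv_f_f) (simp add: inj_def Finj)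
  have FG: "F (G u) = u" if u: "0 < u" "u < 1" for u
  proof -
    obtain t where "F t = u" using continuous_cdf_surj[OF acd u] unfolding F_def by blast
    then show ?thesis using GF[of t] by simp
  qed
  \<comment> \<open>\<open>G\<close> is monotone on the open unit interval and takes every real
    value there, so it cannot jump.\<close>
  have "t \<in> G ` {0<..<1}" for t by (rule image_eqI[of t G "F t"]) (simp_all add: GF F01)
  then have "G ` {0<..<1} = UNIV" by blast
  then have "continuous_on {0<..<1} G"
  proof (intro continuous_onI_mono)
    fix u v :: real assume "u \<in> {0<..<1}" "v \<in> {0<..<1}" "u \<le> v"
    then show "G u \<le> G v" using FG[of u] FG[of v] Fle[of "G u" "G v"] by simp
  qed simp
  then have Gcont: "isCont G u" if "0 < u" "u < 1" for u
    using that by (auto simp: continuous_on_eq_continuous_at)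
  have \<tau>G': "G (cdf gauss x) = \<tau> x" for x using GF[of "\<tau> x"] by (simp add: F\<tau>)
  then have \<tau>G: "\<tau> = (\<lambda>x. G (cdf gauss x))" by (simp add: fun_eq_iff)
  have \<tau>cont: "isCont \<tau> x" for x unfolding \<tau>G
    by (rule isCont_o2[OF cdf_gauss_isCont Gcont]) (auto simp: cdf_gauss_bounds)
  \<comment> \<open>The value forced by the change of variables; it is the derivative of
    \<open>\<tau>\<close> wherever \<open>\<tau> x\<close> avoids the exceptional points
    \<open>P\<close>.\<close>
  define \<tau>' where "\<tau>' x = ?\<phi> x / (k (\<tau> x) * ?\<phi> (\<tau> x))" for x
  have \<tau>d: "(\<tau> has_real_derivative \<tau>' x) (at x)" if "\<tau> x \<notin> P" for x
  proof -
    have "DERIV G (cdf gauss x) :> inverse (k (\<tau> x) * ?\<phi> (\<tau> x))"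
    proof (rule DERIV_inverse_function[where a=0 and b=1 and f=F])
      show "DERIV F (G (cdf gauss x)) :> k (\<tau> x) * ?\<phi> (\<tau> x)"
        using Fd[OF that] by (simp add: \<tau>G')
      show "k (\<tau> x) * ?\<phi> (\<tau> x) \<noteq> 0" using kpos[of "\<tau> x"] \<phi>pos[of "\<tau> x"] by simp
    qed (use cdf_gauss_bounds FG Gcont in auto)
    from DERIV_chain2[OF this cdf_gauss_has_derivative]
    show ?thesis unfolding \<tau>'_def by (subst \<tau>G) (simp add: divide_inverse mult.commute)
  qed
  \<comment> \<open>\<open>E\<close> is the boundary term of the integration by parts and
    \<open>E'\<close> its derivative off the exceptional points; \<open>L\<close> is half the cost
    density, and \<open>M\<close> is the logarithm of the density pulled back by
    \<open>\<tau>\<close>.\<close>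
  define E where "E x = (\<tau> x - x) * ?\<phi> x" for x
  define E' where "E' x = (\<tau>' x - 1) * ?\<phi> x - x * (\<tau> x - x) * ?\<phi> x" for x
  define L where "L x = (1/2) * (\<tau> x - x)\<^sup>2 * ?\<phi> x" for x
  define M where "M x = ln (k (\<tau> x)) * ?\<phi> x" for x
  have pw: "L x \<le> M x + E' x" for x
  proof -
    have p: "0 < ?\<phi> x" "0 < ?\<phi> (\<tau> x)" "0 < k (\<tau> x)" using \<phi>pos kpos by auto
    have ln\<phi>: "ln (?\<phi> y) = - ln (sqrt (2 * pi)) - y\<^sup>2/2" for y
      by (simp add: std_normal_density_def ln_div ln_mult)
    have "ln (\<tau>' x) \<le> \<tau>' x - 1" using p by (intro ln_le_minus_one) (simp add: \<tau>'_def)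
    moreover have "ln (\<tau>' x) = (\<tau> x)\<^sup>2/2 - x\<^sup>2/2 - ln (k (\<tau> x))"
      unfolding \<tau>'_def using p by (simp add: ln_div ln_mult ln\<phi>)
    moreover have "(\<tau> x)\<^sup>2/2 - x\<^sup>2/2 = (1/2) * (\<tau> x - x)\<^sup>2 + x * (\<tau> x - x)"
      by (simp add: power2_eq_square algebra_simps)
    ultimately have "(1/2) * (\<tau> x - x)\<^sup>2 \<le> ln (k (\<tau> x)) + ((\<tau>' x - 1) - x * (\<tau> x - x))"
      by linarith
    then have "(1/2) * (\<tau> x - x)\<^sup>2 * ?\<phi> x \<le> (ln (k (\<tau> x)) + ((\<tau>' x - 1) - x * (\<tau> x - x))) * ?\<phi> x"
      using p by (intro mult_right_mono) auto
    then show ?thesis by (simp add: L_def M_def E'_def algebra_simps)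
  qed
  have Econt: "isCont E x" for x unfolding E_def
    by (intro continuous_intros \<tau>cont) (auto intro: DERIV_isCont[OF std_normal_density_has_derivative])
  have Ed: "(E has_real_derivative E' x) (at x)" if "\<tau> x \<notin> P" for x
    unfolding E_def E'_def
    by (auto intro!: derivative_eq_intros \<tau>d[OF that] std_normal_density_has_derivative simp: algebra_simps)
  \<comment> \<open>\<open>\<tau>\<close> is injective, so it meets \<open>P\<close> at finitely
    many points only, and the fundamental theorem of calculus tolerates these because
    \<open>E\<close> is continuous.\<close>
  have finP: "finite {x. \<tau> x \<in> P}"
    using finite_vimageI[OF P(1), of \<tau>] \<tau>inj by (simp add: vimage_def inj_def)
  have E'int: "(E' has_integral E b - E a) {a..b}" if "a \<le> b" for a b
    by (rule fundamental_theorem_of_calculus_interior_strong[OF finP that])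
       (auto simp: has_real_derivative_iff_has_vector_derivative[symmetric] Ed intro!: continuous_at_imp_continuous_on Econt)
  have Lcont: "isCont L x" for x unfolding L_def
    by (intro continuous_intros \<tau>cont) (auto intro: DERIV_isCont[OF std_normal_density_has_derivative])
  have Lpos: "0 \<le> L x" for x unfolding L_def using \<phi>pos[of x] by simp
  have lnb: "\<bar>ln (k t)\<bar> \<le> \<bar>ln c\<bar> + \<bar>ln C\<bar>" for t
  proof -
    have "ln c \<le> ln (k t)" "ln (k t) \<le> ln C" using c kpos[of t] Cpos by (auto simp: ln_le_cancel_iff)
    then show ?thesis by linarith
  qed
  have Mint: "integrable lborel M"
  proof (rule Bochner_Integration.integrable_bound[where f="\<lambda>s. (\<bar>ln c\<bar> + \<bar>ln C\<bar>) * ?\<phi> s"])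
    show "AE s in lborel. norm (M s) \<le> norm ((\<bar>ln c\<bar> + \<bar>ln C\<bar>) * ?\<phi> s)"
      using lnb \<phi>pos by (auto simp: M_def abs_mult less_imp_le intro!: mult_right_mono)
    show "M \<in> borel_measurable lborel" unfolding M_def by measurable
  qed (auto intro!: integrable_mult_right)
  have Mset: "set_integrable lborel A M" if "A \<in> sets borel" for A
    using integrable_mult_indicator[of A lborel M] Mint that by (simp add: set_integrable_def)
  \<comment> \<open>The condition on \<open>R\<close> is the tail comparison that keeps
    \<open>\<tau>\<close> from overshooting \<open>R\<close> or \<open>- R\<close> by more than 1.
    The boundary terms are then at most twice the Gaussian density at \<open>R\<close>, which tends
    to 0.\<close>
  have key: "integral {-R..R} L \<le> (LINT x:{-R..R}|lborel. M x) + 2 * ?\<phi> R"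
    if R: "0 < R" "C * exp (- R - 1/2) < 1" for R
  proof -
    have Mi: "M integrable_on {-R..R}" using Mset[of "{-R..R}"] by (simp add: set_borel_integral_eq_integral(1))
    have E'i: "E' integrable_on {-R..R}" using E'int[of "-R" R] R by auto
    have "integral {-R..R} L \<le> integral {-R..R} (\<lambda>x. M x + E' x)"
      by (rule integral_le[OF _ integrable_add[OF Mi E'i] pw])
         (intro integrable_continuous_real continuous_at_imp_continuous_on ballI Lcont)
    also have "\<dots> = integral {-R..R} M + integral {-R..R} E'"
      by (rule integral_add[OF Mi E'i])
    also have "integral {-R..R} E' = E R - E (-R)" using E'int[of "-R" R] R by (intro integral_unique) simp
    also have "integral {-R..R} M = (LINT x:{-R..R}|lborel. M x)"
      using Mset[of "{-R..R}"] by (simp add: set_borel_integral_eq_integral(2))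
    also have "E R - E (-R) \<le> 2 * ?\<phi> R"
    proof -
      \<comment> \<open>If \<open>\<tau> R\<close> exceeded \<open>R + 1\<close>, the Gaussian mass
        beyond \<open>R\<close> would be at most the \<open>\<nu>\<close>-mass beyond
        \<open>R + 1\<close>, which the tail estimate makes strictly smaller than that same Gaussian
        mass.\<close>
      have "\<tau> R \<le> R + 1"
      proof (rule ccontr)
        assume "\<not> \<tau> R \<le> R + 1"
        then have a: "R + 1 < \<tau> R" by simp
        have pos: "0 < measure gauss {R<..}"
          using gauss.prob_compl[of "{..R}"] cdf_gauss_bounds(2)[of R] by (simp add: cdf_def Compl_eq_Diff_UNIV[symmetric])
        have "measure gauss {R<..} = 1 - cdf gauss R"
          using gauss.prob_compl[of "{..R}"] by (simp add: cdf_def Compl_eq_Diff_UNIV[symmetric])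
        also have "\<dots> = 1 - F (\<tau> R)" by (simp add: F\<tau>)
        also have "\<dots> \<le> 1 - F (R + 1)" using a by (simp add: Fle)
        also have "\<dots> = measure \<nu> {R+1<..}"
          using \<nu>.prob_compl[of "{..R+1}"] by (simp add: F_def cdf_def Compl_eq_Diff_UNIV[symmetric])
        also have "\<dots> \<le> C * measure gauss {R+1<..}" by (rule up) simp
        also have "\<dots> \<le> C * (exp (- R - 1/2) * measure gauss {R<..})"
          using Cpos by (intro mult_left_mono gauss_tail_upper) simp
        also have "\<dots> < 1 * measure gauss {R<..}"
          unfolding mult.assoc[symmetric] using pos R(2) by (intro mult_strict_right_mono)
        finally show False by simp
      qed
      then have 1: "E R \<le> ?\<phi> R" unfolding E_def using \<phi>pos[of R] by simp
      have "- R - 1 \<le> \<tau> (- R)"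
      proof (rule ccontr)
        assume "\<not> - R - 1 \<le> \<tau> (- R)"
        then have a: "\<tau> (- R) < - R - 1" by simp
        have pos: "0 < measure gauss {..-R}" using cdf_gauss_bounds(1)[of "-R"] by (simp add: cdf_def)
        have "measure gauss {..-R} = F (\<tau> (- R))" by (simp add: F\<tau> cdf_def)
        also have "\<dots> \<le> F (- R - 1)" using a by (simp add: Fle)
        also have "\<dots> \<le> C * measure gauss {..-R-1}" using up[of "{..-R-1}"] by (simp add: F_def cdf_def)
        also have "\<dots> \<le> C * (exp (- R - 1/2) * measure gauss {..-R})"
          using Cpos by (intro mult_left_mono gauss_tail_lower) simp
        also have "\<dots> < 1 * measure gauss {..-R}"
          unfolding mult.assoc[symmetric] using pos R(2) by (intro mult_strict_right_mono)
        finally show False by simp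
      qed
      then have "(- R - \<tau> (- R)) * ?\<phi> R \<le> 1 * ?\<phi> R" using \<phi>pos[of R] by (intro mult_right_mono) auto
      moreover have "?\<phi> (- R) = ?\<phi> R" by (simp add: std_normal_density_def)
      ultimately have 2: "- E (- R) \<le> ?\<phi> R" unfolding E_def by (simp add: algebra_simps)
      from 1 2 show ?thesis by simp
    qed
    finally show ?thesis by simp
  qed
  have Lnn: "(\<integral>\<^sup>+x. ennreal (L x) * indicator {-R..R} x \<partial>lborel) = ennreal (integral {-R..R} L)" for R
  proof -
    have "(\<integral>\<^sup>+x. ennreal (indicator {-R..R} x * L x) \<partial>lborel) = ennreal (integral {-R..R} L)"
      by (rule nn_integral_has_integral_lebesgue[OF Lpos])
         (intro integrable_integral integrable_continuous_real continuous_at_imp_continuous_on ballI Lcont)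
    then show ?thesis by (subst nn_integral_cong) (auto simp: indicator_def)
  qed
  have [measurable]: "L \<in> borel_measurable borel" unfolding L_def by measurable
  have lim1: "(\<lambda>n. \<integral>\<^sup>+x. ennreal (L x) * indicator {- real n..real n} x \<partial>lborel) \<longlonglongrightarrow> (\<integral>\<^sup>+x. ennreal (L x) \<partial>lborel)"
  proof (rule nn_integral_LIMSEQ)
    show "incseq (\<lambda>n x. ennreal (L x) * indicator {- real n..real n} x)"
      by (auto simp: incseq_def le_fun_def indicator_def)
    fix x
    have "\<forall>\<^sub>F n in sequentially. \<bar>x\<bar> \<le> real n" by (rule eventually_sequentiallyI[of "nat \<lceil>\<bar>x\<bar>\<rceil>"]) linarith
    then have "\<forall>\<^sub>F n in sequentially. ennreal (L x) * indicator {- real n..real n} x = ennreal (L x)"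
      by eventually_elim (auto simp: indicator_def abs_le_iff)
    then show "(\<lambda>n. ennreal (L x) * indicator {- real n..real n} x) \<longlonglongrightarrow> ennreal (L x)"
      by (rule tendsto_eventually)
  qed auto
  have lim2: "(\<lambda>n. LINT x:{- real n..real n}|lborel. M x) \<longlonglongrightarrow> (\<integral>x. M x \<partial>lborel)"
    unfolding set_lebesgue_integral_def
  proof (rule integral_dominated_convergence[where w="\<lambda>x. norm (M x)"])
    show "AE x in lborel. (\<lambda>n. indicat_real {- real n..real n} x *\<^sub>R M x) \<longlonglongrightarrow> M x"
    proof (rule AE_I2)
      fix x
      have "\<forall>\<^sub>F n in sequentially. \<bar>x\<bar> \<le> real n" by (rule eventually_sequentiallyI[of "nat \<lceil>\<bar>x\<bar>\<rceil>"]) linarith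
      then have "\<forall>\<^sub>F n in sequentially. indicat_real {- real n..real n} x *\<^sub>R M x = M x"
        by eventually_elim (auto simp: indicator_def abs_le_iff)
      then show "(\<lambda>n. indicat_real {- real n..real n} x *\<^sub>R M x) \<longlonglongrightarrow> M x"
        by (rule tendsto_eventually)
    qed
  qed (use Mint in \<open>auto simp: indicator_def intro!: integrable_norm\<close>)
  have "exp (- real n - 1/2) = exp (- 1/2) * exp (- 1) ^ n" for n
    by (simp add: exp_of_nat_mult[symmetric] exp_add[symmetric])
  moreover have "(\<lambda>n. C * (exp (- 1/2) * exp (- 1 :: real) ^ n)) \<longlonglongrightarrow> C * (exp (- 1/2) * 0)"
    by (intro tendsto_mult tendsto_const LIMSEQ_realpow_zero) auto
  ultimately have ev: "\<forall>\<^sub>F n in sequentially. C * exp (- real n - 1/2) < 1"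
    by (simp add: order_tendsto_iff)
  have "(\<integral>\<^sup>+x. ennreal (L x) \<partial>lborel) \<le> ennreal (\<integral>x. M x \<partial>lborel)"
  proof (rule LIMSEQ_le[OF lim1])
    show "(\<lambda>n. ennreal ((LINT x:{- real n..real n}|lborel. M x) + 2 * ?\<phi> (real n))) \<longlonglongrightarrow> ennreal (\<integral>x. M x \<partial>lborel)"
      using tendsto_add[OF lim2 tendsto_mult[OF tendsto_const[of 2] std_normal_density_tendsto_0]]
      by (intro tendsto_ennrealI) simp
    obtain N where N: "\<And>n. n \<ge> N \<Longrightarrow> C * exp (- real n - 1/2) < 1"
      using ev unfolding eventually_sequentially by blast
    show "\<exists>N. \<forall>n\<ge>N. (\<integral>\<^sup>+x. ennreal (L x) * indicator {- real n..real n} x \<partial>lborel)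
      \<le> ennreal ((LINT x:{- real n..real n}|lborel. M x) + 2 * ?\<phi> (real n))"
      using N key by (intro exI[of _ "Suc N"]) (auto simp: Lnn intro!: ennreal_leI)
  qed
  moreover have "(\<integral>x. M x \<partial>lborel) = (\<integral>s. k s * ln (k s) \<partial>gauss)"
  proof -
    have "(\<integral>x. M x \<partial>lborel) = (\<integral>x. ln (k (\<tau> x)) \<partial>gauss)"
      unfolding M_def by (subst integral_density) (auto simp: mult.commute less_imp_le[OF \<phi>pos])
    also have "\<dots> = (\<integral>s. ln (k s) \<partial>\<nu>)"
      unfolding \<tau>distr[symmetric] by (subst integral_distr) auto
    also have "\<dots> = (\<integral>s. k s * ln (k s) \<partial>gauss)"
      unfolding \<nu>_def using kpos by (subst integral_density) (auto simp: less_imp_le)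
    finally show ?thesis .
  qed
  moreover have "(\<integral>\<^sup>+x. ennreal ((x - \<tau> x)\<^sup>2) \<partial>gauss) = 2 * (\<integral>\<^sup>+x. ennreal (L x) \<partial>lborel)"
  proof -
    have "(\<integral>\<^sup>+x. ennreal ((x - \<tau> x)\<^sup>2) \<partial>gauss) = (\<integral>\<^sup>+x. ennreal (?\<phi> x) * ennreal ((x - \<tau> x)\<^sup>2) \<partial>lborel)"
      by (subst nn_integral_density) auto
    also have "\<dots> = (\<integral>\<^sup>+x. 2 * ennreal (L x) \<partial>lborel)"
    proof (rule nn_integral_cong)
      fix x
      have "ennreal (?\<phi> x) * ennreal ((x - \<tau> x)\<^sup>2) = ennreal (2 * L x)"
        unfolding L_def by (subst ennreal_mult[symmetric]) (auto simp: power2_commute[of x] mult.commute)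
      then show "ennreal (?\<phi> x) * ennreal ((x - \<tau> x)\<^sup>2) = 2 * ennreal (L x)" by (simp add: ennreal_mult')
    qed
    finally show ?thesis by (simp add: nn_integral_cmult)
  qed
  ultimately show ?thesis unfolding \<tau>_def[symmetric]
    by (simp add: ennreal_mult' mult_left_mono)
qed

text \<open>Averaging a density over the cells of a finite partition of the line makes it bounded and
  continuous off a finite set, and by Jensen's inequality does not increase its entropy.\<close>

definition cell :: "real set \<Rightarrow> real \<Rightarrow> real set" where
  "cell P t = {p \<in> P. p \<le> t}"

text \<open>A cell is named by the set of points of \<open>P\<close> not exceeding its members, so a
  function constant on cells is a function of a subset of \<open>P\<close>, hence a finite sum over
  \<open>Pow P\<close>.\<close>

lemma sum_cell_indicator:
  assumes "finite P"
  shows "(\<Sum>Q\<in>Pow P. \<sigma> Q * indicator {s. cell P s = Q} t) = (\<sigma> (cell P t) :: real)"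
proof -
  have "(\<Sum>Q\<in>Pow P. \<sigma> Q * indicator {s. cell P s = Q} t) = (\<Sum>Q\<in>{cell P t}. \<sigma> Q * indicator {s. cell P s = Q} t)"
    by (rule sum.mono_neutral_right) (use assms in \<open>auto simp: cell_def indicator_def\<close>)
  then show ?thesis by simp
qed

lemma cell_sets:
  assumes "finite P" shows "{s. cell P s = Q} \<in> sets borel"
proof (cases "Q \<subseteq> P")
  case True
  then have "{s. cell P s = Q} = {s \<in> space borel. \<forall>p\<in>P. (p \<le> s) = (p \<in> Q)}"
    by (auto simp: cell_def)
  also have "\<dots> \<in> sets borel" using assms by (intro sets.sets_Collect_finite_All) auto
  finally show ?thesis .
next
  case False
  then have "{s. cell P s = Q} = {}" by (auto simp: cell_def)
  then show ?thesis by simp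
qed

lemma measurable_cell_function:
  assumes "finite P" shows "(\<lambda>t. \<sigma> (cell P t) :: real) \<in> borel_measurable borel"
proof -
  have [measurable]: "\<And>Q. {s. cell P s = Q} \<in> sets borel" by (rule cell_sets[OF assms])
  show ?thesis unfolding sum_cell_indicator[OF assms, symmetric] by measurable
qed

lemma isCont_cell_function:
  assumes "finite P" "t \<notin> P" shows "isCont (\<lambda>t. \<sigma> (cell P t) :: real) t"
proof -
  have "\<forall>\<^sub>F s in at t. \<forall>p\<in>P. (p \<le> s) = (p \<le> t)"
  proof (intro eventually_ball_finite ballI assms(1))
    fix p assume "p \<in> P"
    with assms consider "p < t" | "t < p" by fastforce
    then show "\<forall>\<^sub>F s in at t. (p \<le> s) = (p \<le> t)"
    proof cases
      case 1
      then have "\<forall>\<^sub>F s in at t. p < s" using order_tendstoD(1)[OF tendsto_ident_at[of t UNIV]] by simp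
      then show ?thesis by eventually_elim (use 1 in auto)
    next
      case 2
      then have "\<forall>\<^sub>F s in at t. s < p" using order_tendstoD(2)[OF tendsto_ident_at[of t UNIV]] by simp
      then show ?thesis by eventually_elim (use 2 in auto)
    qed
  qed
  then have "\<forall>\<^sub>F s in at t. \<sigma> (cell P s) = \<sigma> (cell P t)"
    by eventually_elim (auto simp: cell_def intro!: arg_cong[where f=\<sigma>])
  then show ?thesis unfolding isCont_def by (rule tendsto_eventually)
qed

text \<open>The cells are cut at the first \<open>n\<close> rationals, and a small multiple of 1 is
  mixed in so that the averaged density is bounded below. The bounded case applies to it and
  entropies do not increase. The distribution functions converge at every rational, hence the
  transports converge almost everywhere, and Fatou's lemma passes the cost to the limit.\<close>

theorem talagrand_real:
  assumes g[measurable]: "g \<in> borel_measurable borel" and one: "(\<integral>\<^sup>+s. g s \<partial>gauss) = 1"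
  shows "(\<integral>\<^sup>+x. ennreal ((x - quantile_map g x)\<^sup>2) \<partial>gauss) \<le> 2 * (\<integral>\<^sup>+s. ennreal (ent (enn2real (g s))) \<partial>gauss)"
proof (cases "(\<integral>\<^sup>+s. ennreal (ent (enn2real (g s))) \<partial>gauss) = \<infinity>")
  case True
  then show ?thesis by (simp add: ennreal_mult_top)
next
  case fin: False
  interpret gauss: real_distribution gauss by (rule gauss_real_distribution)
  have ic: "integrable gauss (indicator A :: real \<Rightarrow> real)" if "A \<in> sets borel" for A
    using that by (intro gauss.integrable_const_bound[of _ 1]) (auto simp: indicator_def)
  define h where "h s = enn2real (g s)" for s
  have hm[measurable]: "h \<in> borel_measurable borel" unfolding h_def by measurable
  have h0: "0 \<le> h s" for s by (simp add: h_def)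
  have gh: "AE s in gauss. g s = ennreal (h s)"
  proof -
    have "AE s in gauss. g s \<noteq> \<infinity>" by (rule nn_integral_noteq_infinite) (simp_all add: one)
    then show ?thesis by eventually_elim (simp add: h_def less_top)
  qed
  have hone: "(\<integral>\<^sup>+s. ennreal (h s) \<partial>gauss) = 1"
    using one nn_integral_cong_AE[OF gh] by simp
  have hi: "integrable gauss h" by (rule integrableI_nonneg) (auto simp: h0 hone)
  have h1: "(\<integral>s. h s \<partial>gauss) = 1" using hone h0 by (simp add: integral_eq_nn_integral)
  have ei: "integrable gauss (\<lambda>s. ent (h s))"
    using fin by (intro integrableI_nonneg) (auto simp: h_def less_top ent_nonneg)
  define F where "F t = cdf (density gauss g) t" for t
  define P where "P n = from_nat_into (\<rat> :: real set) ` {..<n::nat}" for n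
  \<comment> \<open>Strictly between 0 and 1 for every \<open>n\<close>: the averaged density needs
    the positive lower bound \<open>e n\<close>, and both weights of the mixture must be
    nonnegative.\<close>
  define e where "e n = 1 / (real n + 2)" for n
  have e: "0 < e n" "e n < 1" for n by (auto simp: e_def)
  have finP: "finite (P n)" for n by (simp add: P_def)
  \<comment> \<open>Mean of the mixture over a cell. On a null cell division by 0 leaves the value
    \<open>e n\<close>, which still respects the lower bound and carries no mass.\<close>
  define \<kappa> where "\<kappa> n Q = (1 - e n) * ((\<integral>s. h s * indicator {s. cell (P n) s = Q} s \<partial>gauss) / measure gauss {s. cell (P n) s = Q}) + e n" for n Q
  define k where "k n t = \<kappa> n (cell (P n) t)" for n t
  define r where "r n t = (1 - e n) * h t + e n" for n t
  have km[measurable]: "k n \<in> borel_measurable borel" for n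
    unfolding k_def by (rule measurable_cell_function[OF finP])
  have klow: "e n \<le> k n t" for n t unfolding k_def \<kappa>_def using e[of n] h0 by simp
  have kpos: "0 < k n t" for n t using klow[of n t] e(1)[of n] by linarith
  have kup: "k n t \<le> (\<Sum>Q\<in>Pow (P n). \<bar>\<kappa> n Q\<bar>)" for n t
  proof -
    have "\<bar>\<kappa> n (cell (P n) t)\<bar> \<le> (\<Sum>Q\<in>Pow (P n). \<bar>\<kappa> n Q\<bar>)"
      by (rule member_le_sum) (auto simp: cell_def finP)
    then show ?thesis unfolding k_def by linarith
  qed
  have rint: "integrable gauss (r n)" for n unfolding r_def using hi by simp
  have kint: "integrable gauss (k n)" for n
    by (rule gauss.integrable_const_bound[of _ "\<Sum>Q\<in>Pow (P n). \<bar>\<kappa> n Q\<bar>"])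
       (use kpos kup in \<open>auto simp: less_imp_le\<close>)
  have cint: "integrable gauss (\<lambda>s. \<sigma> (cell (P n) s) * f s)" if "integrable gauss f" for n \<sigma> and f :: "real \<Rightarrow> real"
  proof (rule Bochner_Integration.integrable_bound[where f="\<lambda>s. (\<Sum>Q\<in>Pow (P n). \<bar>\<sigma> Q\<bar>) * f s"])
    show "AE s in gauss. norm (\<sigma> (cell (P n) s) * f s) \<le> norm ((\<Sum>Q\<in>Pow (P n). \<bar>\<sigma> Q\<bar>) * f s)"
    proof (rule AE_I2)
      fix s
      have "\<bar>\<sigma> (cell (P n) s)\<bar> \<le> (\<Sum>Q\<in>Pow (P n). \<bar>\<sigma> Q\<bar>)"
        by (rule member_le_sum) (auto simp: cell_def finP)
      then have "\<bar>\<sigma> (cell (P n) s)\<bar> * \<bar>f s\<bar> \<le> (\<Sum>Q\<in>Pow (P n). \<bar>\<sigma> Q\<bar>) * \<bar>f s\<bar>"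
        by (rule mult_right_mono) simp
      then show "norm (\<sigma> (cell (P n) s) * f s) \<le> norm ((\<Sum>Q\<in>Pow (P n). \<bar>\<sigma> Q\<bar>) * f s)"
        by (simp add: abs_mult sum_nonneg)
    qed
    have "f \<in> borel_measurable gauss" using that by simp
    then show "(\<lambda>s. \<sigma> (cell (P n) s) * f s) \<in> borel_measurable gauss"
      using measurable_cell_function[OF finP, of \<sigma> n] by (intro borel_measurable_times) simp_all
  qed (use that in simp)
  \<comment> \<open>\<open>k n\<close> is the conditional expectation of \<open>r n\<close> given
    the cells, so the two are interchangeable against functions of the cell.\<close>
  have cell_mean: "(\<integral>s. \<sigma> (cell (P n) s) * k n s \<partial>gauss) = (\<integral>s. \<sigma> (cell (P n) s) * r n s \<partial>gauss)" for n and \<sigma> :: "real set \<Rightarrow> real"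
  proof -
    let ?C = "\<lambda>Q. {s. cell (P n) s = Q}"
    have C[measurable]: "?C Q \<in> sets borel" for Q by (rule cell_sets[OF finP])
    have ind: "integrable gauss (\<lambda>s. h s * indicator (?C Q) s)" for Q
      using hi by (intro integrable_real_mult_indicator) auto
    have 1: "(\<integral>s. (\<sigma> Q * r n s) * indicator (?C Q) s \<partial>gauss) = \<sigma> Q * \<kappa> n Q * measure gauss (?C Q)" for Q
    proof -
      have "(\<integral>s. (\<sigma> Q * r n s) * indicator (?C Q) s \<partial>gauss)
        = (\<integral>s. \<sigma> Q * (1 - e n) * (h s * indicator (?C Q) s) + \<sigma> Q * e n * indicator (?C Q) s \<partial>gauss)"
        by (intro Bochner_Integration.integral_cong) (auto simp: r_def algebra_simps)
      also have "\<dots> = \<sigma> Q * (1 - e n) * (\<integral>s. h s * indicator (?C Q) s \<partial>gauss) + \<sigma> Q * e n * measure gauss (?C Q)"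
        by (subst Bochner_Integration.integral_add) (use ind[of Q] ic[OF C[of Q]] in \<open>auto intro!: integrable_mult_right\<close>)
      also have "\<dots> = \<sigma> Q * \<kappa> n Q * measure gauss (?C Q)"
      proof (cases "measure gauss (?C Q) = 0")
        case True
        then have "emeasure gauss (?C Q) = 0" by (simp add: gauss.emeasure_eq_measure)
        then have "AE s in gauss. s \<notin> ?C Q" by (intro AE_not_in) (auto simp: null_sets_def)
        then have "(\<integral>s. h s * indicator (?C Q) s \<partial>gauss) = 0"
          by (intro integral_eq_zero_AE) (erule eventually_mono, simp add: indicator_def)
        with True show ?thesis by simp
      qed (simp add: \<kappa>_def field_simps)
      finally show ?thesis .
    qed
    have 2: "(\<integral>s. (\<sigma> Q * k n s) * indicator (?C Q) s \<partial>gauss) = \<sigma> Q * \<kappa> n Q * measure gauss (?C Q)" for Q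
    proof -
      have "(\<integral>s. (\<sigma> Q * k n s) * indicator (?C Q) s \<partial>gauss) = (\<integral>s. \<sigma> Q * \<kappa> n Q * indicator (?C Q) s \<partial>gauss)"
        by (intro Bochner_Integration.integral_cong) (auto simp: k_def indicator_def)
      then show ?thesis by simp
    qed
    have 3: "(\<integral>s. \<sigma> (cell (P n) s) * f s \<partial>gauss) = (\<Sum>Q\<in>Pow (P n). \<integral>s. (\<sigma> Q * f s) * indicator (?C Q) s \<partial>gauss)"
      if "integrable gauss f" for f :: "real \<Rightarrow> real"
    proof -
      have "(\<integral>s. \<sigma> (cell (P n) s) * f s \<partial>gauss) = (\<integral>s. (\<Sum>Q\<in>Pow (P n). (\<sigma> Q * f s) * indicator (?C Q) s) \<partial>gauss)"
        by (subst sum_cell_indicator[OF finP, symmetric]) (simp add: sum_distrib_right sum_distrib_left mult_ac)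
      also have "\<dots> = (\<Sum>Q\<in>Pow (P n). \<integral>s. (\<sigma> Q * f s) * indicator (?C Q) s \<partial>gauss)"
        using that by (intro Bochner_Integration.integral_sum integrable_real_mult_indicator integrable_mult_right) auto
      finally show ?thesis .
    qed
    show ?thesis unfolding 3[OF kint] 3[OF rint] 1 2 ..
  qed
  have kone: "(\<integral>s. k n s \<partial>gauss) = 1" for n
    using cell_mean[of "\<lambda>_. 1" n] hi h1 gauss.prob_space by (simp add: r_def)
  have kone': "(\<integral>\<^sup>+s. ennreal (k n s) \<partial>gauss) = 1" for n
    using nn_integral_eq_integral[OF kint, of n] kone[of n] kpos by (simp add: less_imp_le)
  \<comment> \<open>\<open>ln (k n s)\<close> depends on the cell only, so its factor
    \<open>k n\<close> may be replaced by \<open>r n\<close>. The tangent inequality at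
    \<open>k n\<close> then leads to the entropy of \<open>r n\<close>, and convexity with
    \<open>ent 1 = 0\<close> to that of \<open>h\<close>.\<close>
  have kent: "(\<integral>s. k n s * ln (k n s) \<partial>gauss) \<le> (\<integral>s. ent (h s) \<partial>gauss)" for n
  proof -
    have "(\<integral>s. k n s * ln (k n s) \<partial>gauss) = (\<integral>s. ln (\<kappa> n (cell (P n) s)) * k n s \<partial>gauss)"
      by (simp add: k_def mult.commute)
    also have "\<dots> = (\<integral>s. ln (\<kappa> n (cell (P n) s)) * r n s \<partial>gauss)" by (rule cell_mean)
    also have "\<dots> \<le> (\<integral>s. ent (h s) + k n s - 1 \<partial>gauss)"
    proof (rule integral_mono)
      fix s
      have r0: "0 \<le> r n s" using e[of n] h0[of s] by (simp add: r_def)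
      have "ent (r n s) \<le> (1 - e n) * ent (h s) + e n * ent 1"
        using convex_onD[OF convex_on_ent, of "e n" "h s" 1] e[of n] h0[of s] by (simp add: r_def)
      also have "\<dots> \<le> 1 * ent (h s)" using e[of n] ent_nonneg[OF h0[of s]]
        by (simp add: ent_def[of 1] mult_left_le_one_le)
      finally show "ln (\<kappa> n (cell (P n) s)) * r n s \<le> ent (h s) + k n s - 1"
        using ent_tangent[OF r0 kpos[of n s]] by (simp add: k_def mult.commute)
    qed (use cint[OF rint] ei kint in auto)
    also have "\<dots> = (\<integral>s. ent (h s) \<partial>gauss)"
      using ei kint kone gauss.prob_space by simp
    finally show ?thesis .
  qed
  define \<tau> where "\<tau> n = quantile_map (\<lambda>s. ennreal (k n s))" for n
  define Fn where "Fn n = cdf (density gauss (\<lambda>s. ennreal (k n s)))" for n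
  have cost: "(\<integral>\<^sup>+x. ennreal ((x - \<tau> n x)\<^sup>2) \<partial>gauss) \<le> 2 * (\<integral>\<^sup>+s. ennreal (ent (h s)) \<partial>gauss)" for n
  proof -
    have "(\<integral>\<^sup>+x. ennreal ((x - \<tau> n x)\<^sup>2) \<partial>gauss) \<le> ennreal (2 * (\<integral>s. k n s * ln (k n s) \<partial>gauss))"
      unfolding \<tau>_def using e(1)[of n] klow kup
      by (rule talagrand_bounded[OF km _ _ _ finP[of n] _ kone'])
         (auto simp: k_def isCont_cell_function[OF finP])
    also have "\<dots> \<le> ennreal (2 * (\<integral>s. ent (h s) \<partial>gauss))" using kent by (intro ennreal_leI) simp
    also have "\<dots> = 2 * (\<integral>\<^sup>+s. ennreal (ent (h s)) \<partial>gauss)"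
      using nn_integral_eq_integral[OF ei] h0 by (simp add: ennreal_mult' ent_nonneg)
    finally show ?thesis .
  qed
  have km': "(\<lambda>s. ennreal (k n s)) \<in> borel_measurable borel" for n by simp
  \<comment> \<open>Written with \<open>{..<q}\<close>, which is a union of cells as soon as
    \<open>q\<close> is a cut point; the end point itself is null.\<close>
  have F_lt: "F q = (\<integral>s. h s * indicator {..<q} s \<partial>gauss)" for q
  proof -
    have "F q = measure (density gauss g) {..q}" by (simp add: F_def cdf_def)
    also have "\<dots> = enn2real (\<integral>\<^sup>+s. g s * indicator {..q} s \<partial>gauss)" by (simp add: measure_def emeasure_density)
    also have "(\<integral>\<^sup>+s. g s * indicator {..q} s \<partial>gauss) = (\<integral>\<^sup>+s. ennreal (h s * indicator {..<q} s) \<partial>gauss)"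
    proof (rule nn_integral_cong_AE)
      have "AE s in gauss. s \<notin> {q}"
        using gauss_null_singleton[of q] by (intro AE_not_in) (auto simp: null_sets_def gauss.emeasure_eq_measure)
      with gh show "AE s in gauss. g s * indicator {..q} s = ennreal (h s * indicator {..<q} s)"
        by eventually_elim (auto simp: indicator_def)
    qed
    also have "\<dots> = ennreal (\<integral>s. h s * indicator {..<q} s \<partial>gauss)"
      using hi h0 by (intro nn_integral_eq_integral integrable_real_mult_indicator) auto
    finally show ?thesis using h0 by simp
  qed
  have Fn_lt: "Fn n q = (\<integral>s. k n s * indicator {..<q} s \<partial>gauss)" for q n
  proof -
    have "Fn n q = measure (density gauss (\<lambda>s. ennreal (k n s))) {..q}" by (simp add: Fn_def cdf_def)
    also have "\<dots> = enn2real (\<integral>\<^sup>+s. ennreal (k n s) * indicator {..q} s \<partial>gauss)" by (simp add: measure_def emeasure_density)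
    also have "(\<integral>\<^sup>+s. ennreal (k n s) * indicator {..q} s \<partial>gauss) = (\<integral>\<^sup>+s. ennreal (k n s * indicator {..<q} s) \<partial>gauss)"
    proof (rule nn_integral_cong_AE)
      have "AE s in gauss. s \<notin> {q}"
        using gauss_null_singleton[of q] by (intro AE_not_in) (auto simp: null_sets_def gauss.emeasure_eq_measure)
      then show "AE s in gauss. ennreal (k n s) * indicator {..q} s = ennreal (k n s * indicator {..<q} s)"
        by eventually_elim (auto simp: indicator_def)
    qed
    also have "\<dots> = ennreal (\<integral>s. k n s * indicator {..<q} s \<partial>gauss)"
      using kint kpos by (intro nn_integral_eq_integral integrable_real_mult_indicator) (auto simp: less_imp_le)
    finally show ?thesis using kpos by (simp add: less_imp_le)
  qed
  have Fn_eq: "Fn n q = (1 - e n) * F q + e n * measure gauss {..<q}" if "q \<in> P n" for n q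
  proof -
    have c: "indicator {..<q} s = (if q \<in> cell (P n) s then 0 else 1 :: real)" for s
      using that by (auto simp: cell_def indicator_def)
    have "Fn n q = (\<integral>s. (if q \<in> cell (P n) s then 0 else 1) * k n s \<partial>gauss)"
      unfolding Fn_lt by (simp add: c mult.commute)
    also have "\<dots> = (\<integral>s. indicator {..<q} s * r n s \<partial>gauss)"
      using cell_mean[of "\<lambda>Q. if q \<in> Q then 0 else 1" n] by (simp add: c)
    also have "\<dots> = (\<integral>s. (1 - e n) * (h s * indicator {..<q} s) + e n * indicator {..<q} s \<partial>gauss)"
      by (intro Bochner_Integration.integral_cong) (auto simp: r_def algebra_simps)
    also have "\<dots> = (1 - e n) * F q + e n * measure gauss {..<q}"
      unfolding F_lt
      by (subst Bochner_Integration.integral_add) (auto intro!: integrable_mult_right integrable_real_mult_indicator hi ic)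
    finally show ?thesis .
  qed
  have elim: "e \<longlonglongrightarrow> 0" unfolding e_def
    by (intro tendsto_divide_0[OF tendsto_const] filterlim_at_top_imp_at_infinity filterlim_tendsto_add_at_top[OF tendsto_const, of _ _ 2, unfolded add.commute[of 2]] filterlim_real_sequentially)
  have Fn_lim: "(\<lambda>n. Fn n q) \<longlonglongrightarrow> F q" if qr: "q \<in> \<rat>" for q
  proof -
    obtain i where i: "q = from_nat_into \<rat> i"
      using from_nat_into_surj[OF countable_rat qr] by metis
    have "\<forall>\<^sub>F n in sequentially. (1 - e n) * F q + e n * measure gauss {..<q} = Fn n q"
      by (rule eventually_sequentiallyI[of "Suc i"]) (auto intro!: Fn_eq[symmetric] simp: P_def i)
    moreover have "(\<lambda>n. (1 - e n) * F q + e n * measure gauss {..<q}) \<longlonglongrightarrow> (1 - 0) * F q + 0 * measure gauss {..<q}"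
      by (intro tendsto_intros elim)
    ultimately show ?thesis by (simp add: filterlim_cong)
  qed
  have Fiff: "quantile_map g x \<le> t \<longleftrightarrow> cdf gauss x \<le> F t" for x t
    unfolding F_def by (rule quantile_map_le_iff[OF g one])
  have Fniff: "\<tau> n x \<le> t \<longleftrightarrow> cdf gauss x \<le> Fn n t" for n x t
    unfolding Fn_def \<tau>_def by (rule quantile_map_le_iff[OF km' kone'])
  \<comment> \<open>At these \<open>x\<close> some rational \<open>q\<close> satisfies only a weak
    inequality, which convergence does not preserve. There is at most one such \<open>x\<close> for
    each rational, the Gaussian distribution function being injective.\<close>
  define bad where "bad = (\<Union>q\<in>\<rat>. {x. cdf gauss x = F q})"
  have "countable bad" unfolding bad_def
  proof (intro countable_UN countable_rat)
    fix q
    have "{x. cdf gauss x = F q} \<subseteq> {the_elem {x. cdf gauss x = F q}}"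
    proof
      fix x assume x: "x \<in> {x. cdf gauss x = F q}"
      then have "{x. cdf gauss x = F q} = {x}" using strict_mono_eq[OF cdf_gauss_strict_mono, of _ x] by auto
      then show "x \<in> {the_elem {x. cdf gauss x = F q}}" by simp
    qed
    then show "countable {x. cdf gauss x = F q}" by (rule countable_subset) simp
  qed
  then have "AE x in gauss. x \<notin> bad"
  proof -
    have "AE x in gauss. \<forall>y\<in>bad. x \<noteq> y"
    proof (subst AE_ball_countable[OF \<open>countable bad\<close>], intro ballI)
      fix y
      have "AE s in gauss. s \<notin> {y}"
        using gauss_null_singleton[of y] by (intro AE_not_in) (auto simp: null_sets_def gauss.emeasure_eq_measure)
      then show "AE x in gauss. x \<noteq> y" by simp
    qed
    then show ?thesis by eventually_elim auto
  qed
  then have lim: "AE x in gauss. (\<lambda>n. \<tau> n x) \<longlonglongrightarrow> quantile_map g x"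
  proof eventually_elim
    case (elim x)
    show ?case
    proof (rule order_tendstoI)
      fix a assume "a < quantile_map g x"
      then obtain q where q: "q \<in> \<rat>" "a < q" "q < quantile_map g x" using Rats_dense_in_real by blast
      then have "F q < cdf gauss x" using Fiff[of x q] by simp
      then have "\<forall>\<^sub>F n in sequentially. Fn n q < cdf gauss x" by (rule order_tendstoD(2)[OF Fn_lim[OF q(1)]])
      then show "\<forall>\<^sub>F n in sequentially. a < \<tau> n x"
      proof eventually_elim
        case (elim n)
        then show ?case using q(2) Fniff[of n x q] by simp
      qed
    next
      fix a assume "quantile_map g x < a"
      then obtain q where q: "q \<in> \<rat>" "quantile_map g x < q" "q < a" using Rats_dense_in_real by blast
      have "cdf gauss x \<le> F q" using Fiff[of x q] q by simp
      moreover have "cdf gauss x \<noteq> F q" using elim q(1) by (auto simp: bad_def)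
      ultimately have "cdf gauss x < F q" by simp
      then have "\<forall>\<^sub>F n in sequentially. cdf gauss x < Fn n q" by (rule order_tendstoD(1)[OF Fn_lim[OF q(1)]])
      then show "\<forall>\<^sub>F n in sequentially. \<tau> n x < a"
      proof eventually_elim
        case (elim n)
        then show ?case using q(3) Fniff[of n x q] by simp
      qed
    qed
  qed
  have \<tau>m[measurable]: "\<tau> n \<in> borel_measurable borel" for n
    unfolding \<tau>_def by (rule measurable_quantile_map[OF km' kone'])
  have "(\<integral>\<^sup>+x. ennreal ((x - quantile_map g x)\<^sup>2) \<partial>gauss) = (\<integral>\<^sup>+x. liminf (\<lambda>n. ennreal ((x - \<tau> n x)\<^sup>2)) \<partial>gauss)"
  proof (rule nn_integral_cong_AE)
    show "AE x in gauss. ennreal ((x - quantile_map g x)\<^sup>2) = liminf (\<lambda>n. ennreal ((x - \<tau> n x)\<^sup>2))"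
      using lim
    proof eventually_elim
      case (elim x)
      have "(\<lambda>n. ennreal ((x - \<tau> n x)\<^sup>2)) \<longlonglongrightarrow> ennreal ((x - quantile_map g x)\<^sup>2)"
        by (intro tendsto_ennrealI tendsto_intros elim)
      from lim_imp_Liminf[OF _ this] show ?case by simp
    qed
  qed
  also have "\<dots> \<le> liminf (\<lambda>n. \<integral>\<^sup>+x. ennreal ((x - \<tau> n x)\<^sup>2) \<partial>gauss)"
    by (rule nn_integral_liminf) measurable
  also have "\<dots> \<le> liminf (\<lambda>n::nat. 2 * (\<integral>\<^sup>+s. ennreal (ent (h s)) \<partial>gauss))"
    by (intro Liminf_mono always_eventually allI cost)
  also have "\<dots> = 2 * (\<integral>\<^sup>+s. ennreal (ent (h s)) \<partial>gauss)" by (simp add: Liminf_const)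
  finally show ?thesis by (simp add: h_def)
qed

section \<open>The Knothe rearrangement\<close>

text \<open>Chain rule of entropy: \<open>G\<close> is its mean \<open>a\<close> times a probability
  density. When the right-hand side is finite the two sides are equal, since the logarithm of
  \<open>a\<close> splits off and the affine terms of \<open>ent\<close> have matching
  means.\<close>

lemma entropy_jensen_scaled:
  assumes "prob_space N" and G[measurable]: "G \<in> borel_measurable N"
    and a: "a = (\<integral>\<^sup>+s. G s \<partial>N)" "a \<noteq> 0" "a \<noteq> \<infinity>"
  shows "ennreal (ent (enn2real a)) + a * (\<integral>\<^sup>+s. ennreal (ent (enn2real (G s / a))) \<partial>N)
    \<le> (\<integral>\<^sup>+s. ennreal (ent (enn2real (G s))) \<partial>N)"
proof (cases "(\<integral>\<^sup>+s. ennreal (ent (enn2real (G s))) \<partial>N) = \<infinity>")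
  case False
  interpret prob_space N by fact
  define A where "A = enn2real a"
  have aA: "a = ennreal A" and A: "A > 0" using a by (auto simp: A_def less_top enn2real_positive_iff zero_less_iff_neq_zero)
  define h where "h s = enn2real (G s)" for s
  have h0: "0 \<le> h s" for s by (simp add: h_def)
  have hm[measurable]: "h \<in> borel_measurable N" unfolding h_def by measurable
  have "AE s in N. G s \<noteq> \<infinity>" using a by (intro nn_integral_noteq_infinite) auto
  then have "AE s in N. G s = ennreal (h s)" by eventually_elim (simp add: h_def less_top)
  then have hA: "(\<integral>\<^sup>+s. ennreal (h s) \<partial>N) = ennreal A" using nn_integral_cong_AE a(1) aA by metis
  have hi: "integrable N h" by (rule integrableI_nonneg) (auto simp: h0 hA)
  have h1: "(\<integral>s. h s \<partial>N) = A" using hA h0 A by (simp add: integral_eq_nn_integral)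
  have ei: "integrable N (\<lambda>s. ent (h s))"
    using False by (intro integrableI_nonneg) (auto simp: h_def less_top ent_nonneg)
  have scale: "A * ent (h s / A) = ent (h s) - h s * ln A + A - 1 * 1" for s
  proof (cases "h s = 0")
    case True then show ?thesis by (simp add: ent_def)
  next
    case False
    then have "0 < h s" using h0[of s] by simp
    then show ?thesis using A by (simp add: ent_def ln_div field_simps)
  qed
  have Gh: "enn2real (G s / a) = h s / A" for s
    unfolding aA h_def using A by (cases "G s") (auto simp: divide_ennreal ennreal_top_divide)
  have i: "integrable N (\<lambda>s. A * ent (h s / A))" unfolding scale using ei hi by auto
  have "a * (\<integral>\<^sup>+s. ennreal (ent (enn2real (G s / a))) \<partial>N) = (\<integral>\<^sup>+s. ennreal (A * ent (h s / A)) \<partial>N)"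
    unfolding Gh unfolding aA using A by (subst nn_integral_cmult[symmetric]) (auto simp: ennreal_mult')
  also have "\<dots> = ennreal (\<integral>s. A * ent (h s / A) \<partial>N)"
    using i A h0 by (intro nn_integral_eq_integral) (auto intro!: AE_I2 mult_nonneg_nonneg ent_nonneg)
  also have "(\<integral>s. A * ent (h s / A) \<partial>N) = (\<integral>s. ent (h s) \<partial>N) - A * ln A + A - 1"
    unfolding scale using ei hi by (simp add: h1 prob_space)
  finally have "ennreal (ent (enn2real a)) + a * (\<integral>\<^sup>+s. ennreal (ent (enn2real (G s / a))) \<partial>N)
    = ennreal (ent A) + ennreal ((\<integral>s. ent (h s) \<partial>N) - A * ln A + A - 1)" by (simp add: A_def)
  also have "\<dots> = ennreal (\<integral>s. ent (h s) \<partial>N)"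
  proof -
    have "(\<integral>s. A * ent (h s / A) \<partial>N) \<ge> 0" using A h0 by (intro integral_nonneg_AE AE_I2 mult_nonneg_nonneg ent_nonneg) auto
    then have "(\<integral>s. ent (h s) \<partial>N) - A * ln A + A - 1 \<ge> 0"
      unfolding scale using ei hi by (simp add: h1 prob_space)
    moreover have "ent A + ((\<integral>s. ent (h s) \<partial>N) - A * ln A + A - 1) = (\<integral>s. ent (h s) \<partial>N)"
      by (simp add: ent_def[of A])
    ultimately show ?thesis using A ent_nonneg[of A] by (simp add: ennreal_plus[symmetric] del: ennreal_plus)
  qed
  also have "\<dots> = (\<integral>\<^sup>+s. ennreal (ent (enn2real (G s))) \<partial>N)"
    unfolding h_def[symmetric] using ei h0 by (intro nn_integral_eq_integral[symmetric]) (auto simp: ent_nonneg)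
  finally show ?thesis by simp
qed simp

text \<open>The chain rule with its conditional term dropped. Mean 0 is treated apart, as the
  quotient by the mean has no meaning there; both sides are then \<open>ent 0 = 1\<close>.\<close>

lemma entropy_jensen:
  assumes N: "prob_space N" and G[measurable]: "G \<in> borel_measurable N"
    and a: "(\<integral>\<^sup>+s. G s \<partial>N) \<noteq> \<infinity>"
  shows "ennreal (ent (enn2real (\<integral>\<^sup>+s. G s \<partial>N))) \<le> (\<integral>\<^sup>+s. ennreal (ent (enn2real (G s))) \<partial>N)"
proof (cases "(\<integral>\<^sup>+s. G s \<partial>N) = 0")
  case True
  interpret prob_space N by fact
  have "AE s in N. G s = 0" using True by (simp add: nn_integral_0_iff_AE)
  then have "(\<integral>\<^sup>+s. ennreal (ent (enn2real (G s))) \<partial>N) = (\<integral>\<^sup>+s. ennreal (ent 0) \<partial>N)"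
    by (intro nn_integral_cong_AE) auto
  then show ?thesis using True by (simp add: emeasure_space_1)
next
  case False
  show ?thesis
    by (rule order_trans[OF _ entropy_jensen_scaled[OF N G refl False a]]) simp
qed

section \<open>Resampling coordinates of a Gaussian sequence\<close>

abbreviation gauss_seq :: "(nat \<Rightarrow> real) measure" where
  "gauss_seq \<equiv> PiM UNIV (\<lambda>_. gauss)"

lemma prob_space_gauss_seq: "prob_space gauss_seq"
  by (intro prob_space_PiM gauss_prob)

lemma space_gauss_seq: "space gauss_seq = UNIV"
  by (simp add: space_PiM)

text \<open>Overwriting one coordinate by an independent Gaussian leaves the product measure
  unchanged; Fubini's theorem gives both orders of integration.\<close>

lemma gauss_seq_split:
  assumes H[measurable]: "H \<in> borel_measurable gauss_seq"
  shows "(\<integral>\<^sup>+z. H z \<partial>gauss_seq) = (\<integral>\<^sup>+z. (\<integral>\<^sup>+s. H (z(n := s)) \<partial>gauss) \<partial>gauss_seq)"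
    and "(\<integral>\<^sup>+z. H z \<partial>gauss_seq) = (\<integral>\<^sup>+s. (\<integral>\<^sup>+z. H (z(n := s)) \<partial>gauss_seq) \<partial>gauss)"
proof -
  interpret gauss: prob_space gauss by (rule gauss_prob)
  interpret gs: prob_space gauss_seq by (rule prob_space_gauss_seq)
  interpret pair_sigma_finite gauss gauss_seq ..
  have m[measurable]: "(\<lambda>(s, z). z(n := s)) \<in> gauss \<Otimes>\<^sub>M gauss_seq \<rightarrow>\<^sub>M gauss_seq"
    using measurable_fun_upd[of UNIV UNIV n snd "gauss \<Otimes>\<^sub>M gauss_seq" "\<lambda>_. gauss" fst]
    by (simp add: case_prod_unfold)
  note mH = measurable_compose[OF m H]
  have *: "distr (gauss \<Otimes>\<^sub>M gauss_seq) gauss_seq (\<lambda>(s, z). z(n := s)) = gauss_seq"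
    using distr_pair_PiM_eq_PiM[of UNIV "\<lambda>_. gauss" n] gauss_prob by (simp add: insert_absorb)
  have "(\<integral>\<^sup>+z. H z \<partial>gauss_seq) = (\<integral>\<^sup>+z. H z \<partial>distr (gauss \<Otimes>\<^sub>M gauss_seq) gauss_seq (\<lambda>(s, z). z(n := s)))"
    unfolding * ..
  also have "\<dots> = (\<integral>\<^sup>+p. H ((\<lambda>(s, z). z(n := s)) p) \<partial>(gauss \<Otimes>\<^sub>M gauss_seq))"
    by (rule nn_integral_distr) measurable
  finally have **: "(\<integral>\<^sup>+z. H z \<partial>gauss_seq) = (\<integral>\<^sup>+p. H ((\<lambda>(s, z). z(n := s)) p) \<partial>(gauss \<Otimes>\<^sub>M gauss_seq))" .
  show "(\<integral>\<^sup>+z. H z \<partial>gauss_seq) = (\<integral>\<^sup>+s. (\<integral>\<^sup>+z. H (z(n := s)) \<partial>gauss_seq) \<partial>gauss)"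
    unfolding ** by (subst gs.nn_integral_fst[OF mH, symmetric]) simp
  show "(\<integral>\<^sup>+z. H z \<partial>gauss_seq) = (\<integral>\<^sup>+z. (\<integral>\<^sup>+s. H (z(n := s)) \<partial>gauss) \<partial>gauss_seq)"
    unfolding ** by (subst nn_integral_snd[OF mH, symmetric]) simp
qed

definition merge_at :: "nat \<Rightarrow> (nat \<Rightarrow> real) \<Rightarrow> (nat \<Rightarrow> real) \<Rightarrow> nat \<Rightarrow> real" where
  "merge_at n y z = (\<lambda>i. if i < n then y i else z i)"

lemma measurable_merge_at[measurable]:
  "(\<lambda>(y, z). merge_at n y z) \<in> gauss_seq \<Otimes>\<^sub>M gauss_seq \<rightarrow>\<^sub>M gauss_seq"
  unfolding merge_at_def case_prod_unfold
  by (rule measurable_PiM_single') (auto simp: space_PiM split: if_splits)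

lemma merge_at_simps:
  "merge_at 0 y z = z"
  "merge_at (Suc n) y z = merge_at n y (z(n := y n))"
  "merge_at n (y(n := s)) z = merge_at n y z"
  "(merge_at n y z)(n := s) = merge_at n y (z(n := s))"
  by (auto simp: merge_at_def fun_eq_iff less_Suc_eq)

lemma measurable_upd[measurable]:
  "(\<lambda>(y, s). y(n := s)) \<in> gauss_seq \<Otimes>\<^sub>M gauss \<rightarrow>\<^sub>M gauss_seq"
  using measurable_fun_upd[of UNIV UNIV n fst "gauss_seq \<Otimes>\<^sub>M gauss" "\<lambda>_. gauss" snd]
  by (simp add: case_prod_unfold)

text \<open>Induction on \<open>n\<close>: resampling coordinate \<open>n\<close> of
  \<open>y\<close> amounts to resampling it in \<open>z\<close>, where the integral over
  \<open>z\<close> absorbs it.\<close>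

lemma gauss_seq_merge_at:
  assumes H[measurable]: "H \<in> borel_measurable gauss_seq"
  shows "(\<integral>\<^sup>+y. (\<integral>\<^sup>+z. H (merge_at n y z) \<partial>gauss_seq) \<partial>gauss_seq) = (\<integral>\<^sup>+z. H z \<partial>gauss_seq)"
proof (induction n)
  case 0
  show ?case using prob_space.emeasure_space_1[OF prob_space_gauss_seq] by (simp add: merge_at_simps)
next
  case (Suc n)
  interpret gs: prob_space gauss_seq by (rule prob_space_gauss_seq)
  have [measurable]: "(\<lambda>z. merge_at n y z) \<in> gauss_seq \<rightarrow>\<^sub>M gauss_seq" for y
    using measurable_Pair2[OF measurable_merge_at, of y] by (simp add: space_gauss_seq)
  have "(\<integral>\<^sup>+y. (\<integral>\<^sup>+z. H (merge_at (Suc n) y z) \<partial>gauss_seq) \<partial>gauss_seq)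
    = (\<integral>\<^sup>+y. (\<integral>\<^sup>+s. (\<integral>\<^sup>+z. H (merge_at (Suc n) (y(n := s)) z) \<partial>gauss_seq) \<partial>gauss) \<partial>gauss_seq)"
    by (rule gauss_seq_split(1)) measurable
  also have "\<dots> = (\<integral>\<^sup>+y. (\<integral>\<^sup>+s. (\<integral>\<^sup>+z. H (merge_at n y (z(n := s))) \<partial>gauss_seq) \<partial>gauss) \<partial>gauss_seq)"
    by (simp add: merge_at_simps)
  also have "\<dots> = (\<integral>\<^sup>+y. (\<integral>\<^sup>+z. H (merge_at n y z) \<partial>gauss_seq) \<partial>gauss_seq)"
    by (intro nn_integral_cong gauss_seq_split(2)[symmetric]) measurable
  finally show ?case using Suc by simp
qed

section \<open>The triangular map and its law\<close>

locale knothe =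
  fixes f :: "(nat \<Rightarrow> real) \<Rightarrow> ennreal"
  assumes f[measurable]: "f \<in> borel_measurable gauss_seq"
    and one: "(\<integral>\<^sup>+z. f z \<partial>gauss_seq) = 1"
begin

sublocale gauss: prob_space gauss by (rule gauss_prob)
sublocale gs: prob_space gauss_seq by (rule prob_space_gauss_seq)

text \<open>Density of the first \<open>n\<close> coordinates under the law with density
  \<open>f\<close>, kept as a function on whole sequences that reads only those coordinates.\<close>

definition marg :: "nat \<Rightarrow> (nat \<Rightarrow> real) \<Rightarrow> ennreal" where
  "marg n y = (\<integral>\<^sup>+z. f (merge_at n y z) \<partial>gauss_seq)"

text \<open>The value 1 on degenerate marginals keeps every conditional density a probability density.\<close>

definition cond :: "nat \<Rightarrow> (nat \<Rightarrow> real) \<Rightarrow> real \<Rightarrow> ennreal" where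
  "cond n y s = (if marg n y = 0 \<or> marg n y = \<infinity> then 1 else marg (Suc n) (y(n := s)) / marg n y)"

text \<open>Each new coordinate is transported to its conditional law given the coordinates already
  produced, not given those of \<open>z\<close>. The entries from \<open>n\<close> on are
  placeholders.\<close>

primrec Tn :: "nat \<Rightarrow> (nat \<Rightarrow> real) \<Rightarrow> nat \<Rightarrow> real" where
  "Tn 0 z = (\<lambda>_. 0)"
| "Tn (Suc n) z = (Tn n z)(n := quantile_map (cond n (Tn n z)) (z n))"

definition T :: "(nat \<Rightarrow> real) \<Rightarrow> nat \<Rightarrow> real" where
  "T z n = Tn (Suc n) z n"

definition only_before :: "nat \<Rightarrow> ((nat \<Rightarrow> real) \<Rightarrow> 'a) \<Rightarrow> bool" where
  "only_before n h \<longleftrightarrow> (\<forall>y y'. (\<forall>i<n. y i = y' i) \<longrightarrow> h y = h y')"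

lemma measurable_marg[measurable]: "marg n \<in> borel_measurable gauss_seq"
  unfolding marg_def by measurable

lemma measurable_cond: "(\<lambda>(y, s). cond n y s) \<in> borel_measurable (gauss_seq \<Otimes>\<^sub>M gauss)"
  unfolding cond_def case_prod_unfold by measurable

lemma marg_step: "marg n y = (\<integral>\<^sup>+s. marg (Suc n) (y(n := s)) \<partial>gauss)"
proof -
  have [measurable]: "(\<lambda>z. merge_at n y z) \<in> gauss_seq \<rightarrow>\<^sub>M gauss_seq" for y
    using measurable_Pair2[OF measurable_merge_at, of y] by (simp add: space_gauss_seq)
  have "marg n y = (\<integral>\<^sup>+s. (\<integral>\<^sup>+z. f (merge_at n y (z(n := s))) \<partial>gauss_seq) \<partial>gauss)"
    unfolding marg_def by (rule gauss_seq_split(2)) measurable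
  then show ?thesis by (simp add: marg_def merge_at_simps)
qed

text \<open>Tower property: against functions of the first \<open>n\<close> coordinates,
  \<open>f\<close> may be replaced by its conditional expectation \<open>marg n\<close>.\<close>

lemma marg_integral:
  assumes h[measurable]: "h \<in> borel_measurable gauss_seq" and o: "only_before n h"
  shows "(\<integral>\<^sup>+y. h y * marg n y \<partial>gauss_seq) = (\<integral>\<^sup>+y. h y * f y \<partial>gauss_seq)"
proof -
  have s: "(\<lambda>z. merge_at n y z) \<in> gauss_seq \<rightarrow>\<^sub>M gauss_seq" for y
    using measurable_Pair2[OF measurable_merge_at, of y] by (simp add: space_gauss_seq)
  note [measurable] = s
  have e: "h (merge_at n y z) = h y" for y z using o by (auto simp: only_before_def merge_at_def)
  have "h y * marg n y = (\<integral>\<^sup>+z. h (merge_at n y z) * f (merge_at n y z) \<partial>gauss_seq)" for y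
    unfolding marg_def e by (rule nn_integral_cmult[symmetric]) measurable
  then show ?thesis using gauss_seq_merge_at[of "\<lambda>y. h y * f y" n] by simp
qed

lemma marg_finite: "AE y in gauss_seq. marg n y \<noteq> \<infinity>"
proof (rule nn_integral_noteq_infinite)
  show "(\<integral>\<^sup>+y. marg n y \<partial>gauss_seq) \<noteq> \<infinity>"
    using marg_integral[of "\<lambda>_. 1" n] one by (simp add: only_before_def)
qed measurable

lemma upd1[measurable]: "(\<lambda>s. y(n := s)) \<in> gauss \<rightarrow>\<^sub>M gauss_seq"
  using measurable_Pair2[OF measurable_upd, of y] by (simp add: space_gauss_seq)

lemma measurable_cond1: "cond n y \<in> borel_measurable borel"
  using measurable_Pair2[OF measurable_cond, of y n] by (simp add: space_gauss_seq)

lemma cond_one: "(\<integral>\<^sup>+s. cond n y s \<partial>gauss) = 1"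
proof (cases "marg n y = 0 \<or> marg n y = \<infinity>")
  case True then show ?thesis using gauss.emeasure_space_1 by (simp add: cond_def)
next
  case False
  then have "(\<integral>\<^sup>+s. cond n y s \<partial>gauss) = (\<integral>\<^sup>+s. marg (Suc n) (y(n := s)) \<partial>gauss) / marg n y"
    unfolding cond_def by (simp add: nn_integral_divide)
  then show ?thesis using False by (simp add: marg_step[symmetric] ennreal_divide_self less_top)
qed

text \<open>The quotient defining \<open>cond\<close> in multiplicative form, which survives a
  vanishing marginal: by \<open>marg_step\<close> the next marginal then vanishes for almost every
  value of the new coordinate.\<close>

lemma cond_times:
  assumes "marg n y \<noteq> \<infinity>"
  shows "AE s in gauss. cond n y s * marg n y = marg (Suc n) (y(n := s))"
proof (cases "marg n y = 0")
  case True
  then have "AE s in gauss. marg (Suc n) (y(n := s)) = 0"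
    unfolding marg_step[of n y] by (subst (asm) nn_integral_0_iff_AE) measurable
  then show ?thesis by eventually_elim (simp add: True)
next
  case False
  have "x / marg n y * marg n y = x" for x
    using False assms mult_divide_eq_ennreal[of "marg n y" x]
    by (subst mult.commute) (simp add: ennreal_times_divide mult.commute)
  then show ?thesis using assms False by (simp add: cond_def)
qed

lemma cond_only_before:
  assumes "\<forall>i<n. y i = y' i" shows "cond n y = cond n y'"
proof
  fix s
  have "merge_at n y = merge_at n y'" "merge_at (Suc n) (y(n := s)) = merge_at (Suc n) (y'(n := s))"
    using assms by (auto simp: merge_at_def fun_eq_iff)
  then show "cond n y s = cond n y' s" unfolding cond_def marg_def by (simp only:)
qed

lemma Tn_upd: "m \<le> n \<Longrightarrow> Tn m (z(n := s)) = Tn m z"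
  by (induction m) auto

lemma Tn_eq_T: "i < n \<Longrightarrow> Tn n z i = T z i"
  by (induction n) (auto simp: less_Suc_eq T_def)

lemma measurable_Tn[measurable]: "Tn n \<in> gauss_seq \<rightarrow>\<^sub>M gauss_seq"
proof (induction n)
  case 0
  then show ?case by (auto simp: space_gauss_seq intro!: measurable_const)
next
  case (Suc n)
  note [measurable] = Suc
  have q: "(\<lambda>(y, x). quantile_map (cond n y) x) \<in> borel_measurable (gauss_seq \<Otimes>\<^sub>M borel)"
  proof (rule measurable_quantile_map_param)
    have "sets (gauss_seq \<Otimes>\<^sub>M borel) = sets (gauss_seq \<Otimes>\<^sub>M gauss)" by (intro sets_pair_measure_cong) auto
    then show "(\<lambda>(y, s). cond n y s) \<in> borel_measurable (gauss_seq \<Otimes>\<^sub>M borel)"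
      using measurable_cond by (subst measurable_cong_sets[OF _ refl]) auto
  qed (rule cond_one)
  have p: "(\<lambda>z. (Tn n z, z n)) \<in> gauss_seq \<rightarrow>\<^sub>M gauss_seq \<Otimes>\<^sub>M borel"
    using measurable_component_singleton[of n UNIV "\<lambda>_. gauss"] by (intro measurable_Pair Suc) simp
  have "(\<lambda>z. quantile_map (cond n (Tn n z)) (z n)) \<in> borel_measurable gauss_seq"
    using measurable_compose[OF p q] by simp
  then have p2: "(\<lambda>z. (Tn n z, quantile_map (cond n (Tn n z)) (z n))) \<in> gauss_seq \<rightarrow>\<^sub>M gauss_seq \<Otimes>\<^sub>M gauss"
    by (intro measurable_Pair Suc) simp
  have "Tn (Suc n) = (\<lambda>z. (Tn n z)(n := quantile_map (cond n (Tn n z)) (z n)))" by (rule ext) simp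
  then show ?case using measurable_compose[OF p2 measurable_upd[of n]] by (simp only: prod.case)
qed

lemma measurable_T[measurable]: "T \<in> gauss_seq \<rightarrow>\<^sub>M gauss_seq"
proof (rule measurable_PiM_single')
  fix n
  show "(\<lambda>z. T z n) \<in> gauss_seq \<rightarrow>\<^sub>M gauss"
    unfolding T_def by (rule measurable_compose[OF measurable_Tn measurable_component_singleton]) simp
qed (simp add: space_PiM)

text \<open>Integrate over \<open>z n\<close> alone: \<open>Tn n\<close> ignores it, and the
  monotone transport turns the Gaussian into the conditional law, whose density times
  \<open>marg n\<close> is \<open>marg (Suc n)\<close>. The induction runs over all test functions
  because the inner integral is again one, of a shorter past.\<close>

lemma law_Tn:
  assumes "h \<in> borel_measurable gauss_seq" "only_before n h"
  shows "(\<integral>\<^sup>+z. h (Tn n z) \<partial>gauss_seq) = (\<integral>\<^sup>+y. h y * marg n y \<partial>gauss_seq)"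
  using assms
proof (induction n arbitrary: h)
  case 0
  then have "h y = h (\<lambda>_. 0)" for y by (auto simp: only_before_def)
  then have "(\<integral>\<^sup>+y. h y * marg 0 y \<partial>gauss_seq) = (\<integral>\<^sup>+y. h (\<lambda>_. 0) * marg 0 y \<partial>gauss_seq)"
    by (intro nn_integral_cong) metis
  also have "\<dots> = h (\<lambda>_. 0)" using gs.emeasure_space_1 by (simp add: marg_def merge_at_simps one)
  finally show ?case using gs.emeasure_space_1 by simp
next
  case (Suc n)
  note [measurable] = Suc.prems(1) measurable_cond[of n]
  define h' where "h' y = (\<integral>\<^sup>+s. h (y(n := s)) * cond n y s \<partial>gauss)" for y
  note c = cond_only_before
  have h'm: "h' \<in> borel_measurable gauss_seq"
  proof -
    have "(\<lambda>(y, s). h (y(n := s)) * cond n y s) \<in> borel_measurable (gauss_seq \<Otimes>\<^sub>M gauss)"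
      by measurable
    then show ?thesis unfolding h'_def by (rule gauss.borel_measurable_nn_integral)
  qed
  have "only_before n h'" unfolding only_before_def
  proof (intro allI impI)
    fix y y' :: "nat \<Rightarrow> real" assume yy: "\<forall>i<n. y i = y' i"
    then have "h (y(n := s)) = h (y'(n := s))" for s
      using Suc.prems(2) by (auto simp: only_before_def less_Suc_eq)
    then show "h' y = h' y'" unfolding h'_def c[OF yy] by simp
  qed
  note IH = Suc.IH[OF h'm this]
  have "(\<integral>\<^sup>+z. h (Tn (Suc n) z) \<partial>gauss_seq) = (\<integral>\<^sup>+z. (\<integral>\<^sup>+s. h (Tn (Suc n) (z(n := s))) \<partial>gauss) \<partial>gauss_seq)"
    by (rule gauss_seq_split(1)) measurable
  also have "\<dots> = (\<integral>\<^sup>+z. (\<integral>\<^sup>+s. h ((Tn n z)(n := quantile_map (cond n (Tn n z)) s)) \<partial>gauss) \<partial>gauss_seq)"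
    by (simp add: Tn_upd)
  also have "\<dots> = (\<integral>\<^sup>+z. h' (Tn n z) \<partial>gauss_seq)"
  proof (rule nn_integral_cong)
    fix z
    let ?y = "Tn n z"
    have [measurable]: "cond n ?y \<in> borel_measurable borel" by (rule measurable_cond1)
    have hu: "(\<lambda>s. h (?y(n := s))) \<in> borel_measurable borel"
      using measurable_compose[OF upd1 Suc.prems(1), of ?y n] by simp
    have "(\<integral>\<^sup>+s. h (?y(n := quantile_map (cond n ?y) s)) \<partial>gauss) = (\<integral>\<^sup>+s. h (?y(n := s)) \<partial>distr gauss borel (quantile_map (cond n ?y)))"
      using measurable_quantile_map[OF measurable_cond1 cond_one] hu
      by (intro nn_integral_distr[symmetric]) auto
    also have "\<dots> = (\<integral>\<^sup>+s. h (?y(n := s)) \<partial>density gauss (cond n ?y))"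
      unfolding distr_quantile_map[OF measurable_cond1 cond_one] ..
    also have "\<dots> = h' ?y" unfolding h'_def using hu
      by (subst nn_integral_density) (auto simp: mult.commute)
    finally show "(\<integral>\<^sup>+s. h (?y(n := quantile_map (cond n ?y) s)) \<partial>gauss) = h' ?y" .
  qed
  also have "\<dots> = (\<integral>\<^sup>+y. h' y * marg n y \<partial>gauss_seq)" by (rule IH)
  also have "\<dots> = (\<integral>\<^sup>+y. (\<integral>\<^sup>+s. h (y(n := s)) * marg (Suc n) (y(n := s)) \<partial>gauss) \<partial>gauss_seq)"
  proof (rule nn_integral_cong_AE)
    show "AE y in gauss_seq. h' y * marg n y = (\<integral>\<^sup>+s. h (y(n := s)) * marg (Suc n) (y(n := s)) \<partial>gauss)"
      using marg_finite[of n]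
    proof eventually_elim
      case (elim y)
      have [measurable]: "cond n y \<in> borel_measurable gauss" using measurable_cond1 by simp
      have "h' y * marg n y = (\<integral>\<^sup>+s. h (y(n := s)) * cond n y s * marg n y \<partial>gauss)"
        unfolding h'_def by (subst nn_integral_multc) (auto intro!: borel_measurable_times measurable_compose[OF upd1 Suc.prems(1)] simp: measurable_cond1)
      also have "\<dots> = (\<integral>\<^sup>+s. h (y(n := s)) * marg (Suc n) (y(n := s)) \<partial>gauss)"
      proof (rule nn_integral_cong_AE)
        show "AE s in gauss. h (y(n := s)) * cond n y s * marg n y = h (y(n := s)) * marg (Suc n) (y(n := s))"
          using cond_times[OF elim] by eventually_elim (simp add: mult.assoc)
      qed
      finally show ?case .
    qed
  qed
  also have "\<dots> = (\<integral>\<^sup>+y. h y * marg (Suc n) y \<partial>gauss_seq)"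
    by (rule gauss_seq_split(1)[symmetric]) measurable
  finally show ?case .
qed

lemma law_T: "distr gauss_seq gauss_seq T = density gauss_seq f"
proof (rule measure_eqI_PiM_infinite[where I=UNIV and M="\<lambda>_. gauss"])
  fix A and J :: "nat set" assume J: "finite J" and A: "\<And>i. i \<in> J \<Longrightarrow> A i \<in> sets gauss"
  let ?E = "prod_emb UNIV (\<lambda>_. gauss) J (Pi\<^sub>E J A)"
  have E[measurable]: "?E \<in> sets gauss_seq" using J A by (intro sets_PiM_I) auto
  have Em: "y \<in> ?E \<longleftrightarrow> (\<forall>i\<in>J. y i \<in> A i)" for y
    by (auto simp: prod_emb_def PiE_iff space_PiM)
  \<comment> \<open>A cylinder reads finitely many coordinates, and on these \<open>T\<close> agrees
    with the finite stage \<open>Tn n\<close>.\<close>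
  define n where "n = Suc (Max (insert 0 J))"
  have n: "i < n" if "i \<in> J" for i using that J by (auto simp: n_def less_Suc_eq_le)
  have o: "only_before n (indicator ?E :: _ \<Rightarrow> ennreal)"
    unfolding only_before_def by (auto simp: indicator_def Em n)
  have "emeasure (distr gauss_seq gauss_seq T) ?E = (\<integral>\<^sup>+z. indicator ?E (T z) \<partial>gauss_seq)"
    by (subst nn_integral_distr[symmetric, of _ _ gauss_seq]) auto
  also have "\<dots> = (\<integral>\<^sup>+z. indicator ?E (Tn n z) \<partial>gauss_seq)"
    by (intro nn_integral_cong) (auto simp: indicator_def Em n Tn_eq_T)
  also have "\<dots> = (\<integral>\<^sup>+y. indicator ?E y * f y \<partial>gauss_seq)"
    using law_Tn[OF _ o] marg_integral[OF _ o] by simp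
  also have "\<dots> = emeasure (density gauss_seq f) ?E" by (subst emeasure_density) (auto simp: mult.commute)
  finally show "emeasure (distr gauss_seq gauss_seq T) ?E = emeasure (density gauss_seq f) ?E" .
next
  show "finite_measure (distr gauss_seq gauss_seq T)"
    using gs.prob_space_distr[OF measurable_T] by (simp add: prob_space_def)
qed auto

section \<open>Cost and entropy, coordinate by coordinate\<close>

definition H :: "(real \<Rightarrow> ennreal) \<Rightarrow> ennreal" where
  "H g = (\<integral>\<^sup>+s. ennreal (ent (enn2real (g s))) \<partial>gauss)"

lemma measurable_H_cond[measurable]: "(\<lambda>y. H (cond n y)) \<in> borel_measurable gauss_seq"
proof -
  note [measurable] = measurable_cond[of n]
  have "(\<lambda>(y, s). ennreal (ent (enn2real (cond n y s)))) \<in> borel_measurable (gauss_seq \<Otimes>\<^sub>M gauss)"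
    by measurable
  then show ?thesis unfolding H_def by (rule gauss.borel_measurable_nn_integral)
qed

text \<open>Given the earlier coordinates, coordinate \<open>n\<close> of \<open>z\<close> is still
  standard Gaussian and is moved by the monotone transport to the conditional law, so the inequality
  on the line applies under the integral. The produced past \<open>Tn n z\<close> is integrated
  through its density \<open>marg n\<close>.\<close>

lemma cost_step:
  "(\<integral>\<^sup>+z. ennreal ((z n - T z n)\<^sup>2) \<partial>gauss_seq) \<le> 2 * (\<integral>\<^sup>+y. H (cond n y) * marg n y \<partial>gauss_seq)"
proof -
  have [measurable]: "(\<lambda>z. z n) \<in> borel_measurable gauss_seq" "(\<lambda>z. T z n) \<in> borel_measurable gauss_seq"
    using measurable_component_singleton[of n UNIV "\<lambda>_. gauss"]
      measurable_compose[OF measurable_T measurable_component_singleton[of n UNIV "\<lambda>_. gauss"]] by simp_all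
  have "(\<integral>\<^sup>+z. ennreal ((z n - T z n)\<^sup>2) \<partial>gauss_seq)
    = (\<integral>\<^sup>+z. (\<integral>\<^sup>+s. ennreal (((z(n := s)) n - T (z(n := s)) n)\<^sup>2) \<partial>gauss) \<partial>gauss_seq)"
    by (rule gauss_seq_split(1)) measurable
  also have "\<dots> = (\<integral>\<^sup>+z. (\<integral>\<^sup>+s. ennreal ((s - quantile_map (cond n (Tn n z)) s)\<^sup>2) \<partial>gauss) \<partial>gauss_seq)"
    by (simp add: T_def Tn_upd)
  also have "\<dots> \<le> (\<integral>\<^sup>+z. 2 * H (cond n (Tn n z)) \<partial>gauss_seq)"
    unfolding H_def by (intro nn_integral_mono talagrand_real measurable_cond1 cond_one)
  also have "\<dots> = 2 * (\<integral>\<^sup>+z. H (cond n (Tn n z)) \<partial>gauss_seq)"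
    by (rule nn_integral_cmult) (rule measurable_compose[OF measurable_Tn measurable_H_cond])
  also have "(\<integral>\<^sup>+z. H (cond n (Tn n z)) \<partial>gauss_seq) = (\<integral>\<^sup>+y. H (cond n y) * marg n y \<partial>gauss_seq)"
  proof (rule law_Tn[where h="\<lambda>y. H (cond n y)"])
    show "only_before n (\<lambda>y. H (cond n y))" unfolding only_before_def
      using cond_only_before by metis
  qed measurable
  finally show ?thesis .
qed

definition Ent :: "nat \<Rightarrow> ennreal" where
  "Ent n = (\<integral>\<^sup>+y. ennreal (ent (enn2real (marg n y))) \<partial>gauss_seq)"

text \<open>The conditional entropy weighted by the marginal is what the chain rule on the line adds
  when one more coordinate is revealed.\<close>

lemma Ent_step: "Ent n + (\<integral>\<^sup>+y. H (cond n y) * marg n y \<partial>gauss_seq) \<le> Ent (Suc n)"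
proof -
  have "Ent n + (\<integral>\<^sup>+y. H (cond n y) * marg n y \<partial>gauss_seq)
    = (\<integral>\<^sup>+y. ennreal (ent (enn2real (marg n y))) + H (cond n y) * marg n y \<partial>gauss_seq)"
    unfolding Ent_def by (rule nn_integral_add[symmetric]) measurable
  also have "\<dots> \<le> (\<integral>\<^sup>+y. (\<integral>\<^sup>+s. ennreal (ent (enn2real (marg (Suc n) (y(n := s))))) \<partial>gauss) \<partial>gauss_seq)"
  proof (rule nn_integral_mono_AE)
    show "AE y in gauss_seq. ennreal (ent (enn2real (marg n y))) + H (cond n y) * marg n y
      \<le> (\<integral>\<^sup>+s. ennreal (ent (enn2real (marg (Suc n) (y(n := s))))) \<partial>gauss)"
      using marg_finite[of n]
    proof eventually_elim
      case (elim y)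
      have m: "(\<lambda>s. marg (Suc n) (y(n := s))) \<in> borel_measurable gauss"
        by measurable
      show ?case
      proof (cases "marg n y = 0")
        case True
        then show ?thesis using entropy_jensen[OF gauss_prob m] by (simp add: marg_step[symmetric])
      next
        case False
        then show ?thesis
          using entropy_jensen_scaled[OF gauss_prob m marg_step False elim] elim
          by (simp add: H_def cond_def mult.commute)
      qed
    qed
  qed
  also have "\<dots> = Ent (Suc n)" unfolding Ent_def by (rule gauss_seq_split(1)[symmetric]) measurable
  finally show ?thesis .
qed

text \<open>Integrating out the later coordinates averages \<open>f\<close>, and Jensen's inequality
  applies.\<close>

lemma Ent_le: "Ent n \<le> (\<integral>\<^sup>+y. ennreal (ent (enn2real (f y))) \<partial>gauss_seq)"
proof -
  have "Ent n \<le> (\<integral>\<^sup>+y. (\<integral>\<^sup>+z. ennreal (ent (enn2real (f (merge_at n y z)))) \<partial>gauss_seq) \<partial>gauss_seq)"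
    unfolding Ent_def
  proof (rule nn_integral_mono_AE)
    show "AE y in gauss_seq. ennreal (ent (enn2real (marg n y)))
      \<le> (\<integral>\<^sup>+z. ennreal (ent (enn2real (f (merge_at n y z)))) \<partial>gauss_seq)"
      using marg_finite[of n]
    proof eventually_elim
      case (elim y)
      have [measurable]: "(\<lambda>z. merge_at n y z) \<in> gauss_seq \<rightarrow>\<^sub>M gauss_seq"
        using measurable_Pair2[OF measurable_merge_at, of y] by (simp add: space_gauss_seq)
      have "(\<lambda>z. f (merge_at n y z)) \<in> borel_measurable gauss_seq" by measurable
      from entropy_jensen[OF prob_space_gauss_seq this] elim show ?case by (simp add: marg_def)
    qed
  qed
  also have "\<dots> = (\<integral>\<^sup>+y. ennreal (ent (enn2real (f y))) \<partial>gauss_seq)"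
    by (rule gauss_seq_merge_at) measurable
  finally show ?thesis .
qed

theorem cost_T:
  "(\<integral>\<^sup>+z. (\<Sum>n. ennreal ((z n - T z n)\<^sup>2)) \<partial>gauss_seq) \<le> 2 * (\<integral>\<^sup>+y. ennreal (ent (enn2real (f y))) \<partial>gauss_seq)"
proof -
  let ?c = "\<lambda>n. \<integral>\<^sup>+y. H (cond n y) * marg n y \<partial>gauss_seq"
  have [measurable]: "(\<lambda>z. z n) \<in> borel_measurable gauss_seq" "(\<lambda>z. T z n) \<in> borel_measurable gauss_seq" for n
    using measurable_component_singleton[of n UNIV "\<lambda>_. gauss"]
      measurable_compose[OF measurable_T measurable_component_singleton[of n UNIV "\<lambda>_. gauss"]] by simp_all
  \<comment> \<open>The conditional entropies telescope against \<open>Ent\<close>. The resulting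
    bound by the entropy of \<open>f\<close> is uniform in \<open>N\<close>, so the limit of
    \<open>Ent\<close> is never computed.\<close>
  have "(\<Sum>n<N. ?c n) \<le> Ent N" for N
  proof (induction N)
    case (Suc N)
    then have "(\<Sum>n<Suc N. ?c n) \<le> Ent N + ?c N" by (simp add: add_right_mono)
    also have "\<dots> \<le> Ent (Suc N)" by (rule Ent_step)
    finally show ?case .
  qed simp
  then have c: "(\<Sum>n<N. ?c n) \<le> (\<integral>\<^sup>+y. ennreal (ent (enn2real (f y))) \<partial>gauss_seq)" for N
    using Ent_le order_trans by blast
  have "(\<integral>\<^sup>+z. (\<Sum>n. ennreal ((z n - T z n)\<^sup>2)) \<partial>gauss_seq) = (\<Sum>n. \<integral>\<^sup>+z. ennreal ((z n - T z n)\<^sup>2) \<partial>gauss_seq)"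
    by (rule nn_integral_suminf) measurable
  also have "\<dots> \<le> (\<Sum>n. 2 * ?c n)"
    by (intro suminf_le cost_step) auto
  also have "\<dots> = 2 * (\<Sum>n. ?c n)" by simp
  also have "\<dots> \<le> 2 * (\<integral>\<^sup>+y. ennreal (ent (enn2real (f y))) \<partial>gauss_seq)"
    by (intro mult_left_mono suminf_le_const c) auto
  finally show ?thesis .
qed

end

section \<open>Haar coefficients of Brownian motion\<close>

definition vec_normal_density :: "real^'n \<Rightarrow> real" where
  "vec_normal_density z = (\<Prod>i\<in>UNIV. std_normal_density (z $ i))"

abbreviation vec_gauss :: "(real^'n) measure" where
  "vec_gauss \<equiv> density lborel (\<lambda>z. ennreal (vec_normal_density z))"

lemma measurable_vec_nth[measurable]: "(\<lambda>z::real^'n. z $ i) \<in> borel_measurable borel"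
  by (intro borel_measurable_continuous_onI continuous_intros)

lemma measurable_vec_normal_density[measurable]: "vec_normal_density \<in> borel_measurable borel"
  unfolding vec_normal_density_def by measurable

lemma vec_normal_density_nonneg: "0 \<le> vec_normal_density z"
  by (simp add: vec_normal_density_def prod_nonneg)

lemma prod_Basis_vec: "(\<Prod>b\<in>(Basis :: (real^'n) set). f b) = (\<Prod>i\<in>UNIV. f (axis i 1))"
proof -
  have B: "(Basis :: (real^'n) set) = range (\<lambda>i. axis i 1)" by (auto simp: Basis_vec_def)
  have I: "inj (\<lambda>i::'n. axis i (1::real))" by (auto simp: inj_def axis_eq_axis)
  show ?thesis unfolding B prod.reindex[OF I] comp_def ..
qed

lemma emeasure_vec_gauss_box:
  assumes [measurable]: "\<And>i::'n. B i \<in> sets borel"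
  shows "emeasure (vec_gauss :: (real^'n) measure) {v. \<forall>i. v $ i \<in> B i} = (\<Prod>i\<in>UNIV. emeasure gauss (B i))"
proof -
  have S[measurable]: "{v::real^'n. \<forall>i. v $ i \<in> B i} \<in> sets borel" by measurable
  let ?f = "\<lambda>i x. ennreal (std_normal_density x) * indicator (B i) x"
  have "emeasure (vec_gauss :: (real^'n) measure) {v. \<forall>i. v $ i \<in> B i}
    = (\<integral>\<^sup>+v. ennreal (vec_normal_density v) * indicator {v. \<forall>i. v $ i \<in> B i} v \<partial>lborel)"
    by (rule emeasure_density) auto
  also have "\<dots> = (\<integral>\<^sup>+v. (\<Prod>b\<in>Basis. ?f (axis_index b) (v \<bullet> b)) \<partial>(lborel :: (real^'n) measure))"
  proof (rule nn_integral_cong)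
    fix v :: "real^'n"
    have "(\<Prod>b\<in>Basis. ?f (axis_index b) (v \<bullet> b)) = (\<Prod>i\<in>UNIV. ?f i (v $ i))"
      by (simp add: prod_Basis_vec inner_axis axis_index_axis)
    also have "\<dots> = ennreal (vec_normal_density v) * (\<Prod>i\<in>UNIV. indicator (B i) (v $ i))"
      by (simp add: prod.distrib vec_normal_density_def prod_ennreal)
    also have "(\<Prod>i\<in>UNIV. indicator (B i) (v $ i)) = (indicator {v. \<forall>i. v $ i \<in> B i} v :: ennreal)"
      by (auto simp: indicator_def prod_zero_iff)
    finally show "ennreal (vec_normal_density v) * indicator {v. \<forall>i. v $ i \<in> B i} v = (\<Prod>b\<in>Basis. ?f (axis_index b) (v \<bullet> b))"
      by simp
  qed
  also have "\<dots> = (\<Prod>b\<in>Basis. \<integral>\<^sup>+x. ?f (axis_index (b::real^'n)) x \<partial>lborel)"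
    by (rule nn_integral_lborel_prod) auto
  also have "\<dots> = (\<Prod>i\<in>UNIV. emeasure gauss (B i))"
    by (simp add: prod_Basis_vec axis_index_axis emeasure_density)
  finally show ?thesis .
qed

lemma prob_space_vec_gauss: "prob_space (vec_gauss :: (real^'n) measure)"
proof (rule prob_spaceI)
  interpret prob_space gauss by (rule gauss_prob)
  show "emeasure vec_gauss (space (vec_gauss :: (real^'n) measure)) = 1"
    using emeasure_vec_gauss_box[of "\<lambda>_. UNIV"] emeasure_space_1 by simp
qed

lemma nn_integral_lborel_affine:
  fixes t :: "'a::euclidean_space"
  assumes "c \<noteq> 0" and h[measurable]: "h \<in> borel_measurable borel"
  shows "(\<integral>\<^sup>+x. h x \<partial>lborel) = ennreal (\<bar>c\<bar> ^ DIM('a)) * (\<integral>\<^sup>+x. h (t + c *\<^sub>R x) \<partial>lborel)"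
proof -
  have "(\<integral>\<^sup>+x. h x \<partial>lborel) = (\<integral>\<^sup>+x. h x \<partial>density (distr lborel borel (\<lambda>x. t + c *\<^sub>R x)) (\<lambda>_. ennreal (\<bar>c\<bar> ^ DIM('a))))"
    using lborel_affine[OF assms(1), of t] by simp
  then show ?thesis
    by (simp add: nn_integral_density nn_integral_distr nn_integral_cmult)
qed

text \<open>In each coordinate the orthogonal map preserves the sum of squares, hence the product of
  the two densities.\<close>

lemma vec_normal_density_rotate:
  "vec_normal_density ((1 / sqrt 2) *\<^sub>R (s + r)) * vec_normal_density ((1 / sqrt 2) *\<^sub>R (s - r))
    = vec_normal_density s * vec_normal_density (r :: real^'n)"
proof -
  have "std_normal_density ((1 / sqrt 2) * (x + y)) * std_normal_density ((1 / sqrt 2) * (x - y))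
    = std_normal_density x * std_normal_density y" for x y
  proof -
    have "((1 / sqrt 2) * (x + y))\<^sup>2 + ((1 / sqrt 2) * (x - y))\<^sup>2 = x\<^sup>2 + y\<^sup>2"
      unfolding power_mult_distrib power_divide real_sqrt_pow2[of 2, simplified] by (simp add: power2_eq_square field_simps)
    then have "- ((1 / sqrt 2) * (x + y))\<^sup>2 / 2 + - ((1 / sqrt 2) * (x - y))\<^sup>2 / 2 = - x\<^sup>2 / 2 + - y\<^sup>2 / 2"
      by (simp add: field_simps)
    then show ?thesis unfolding std_normal_density_def
      by (metis (no_types, opaque_lifting) exp_add mult.assoc mult.left_commute)
  qed
  then show ?thesis by (simp add: vec_normal_density_def prod.distrib[symmetric])
qed

text \<open>The change of variables is made one vector at a time: \<open>a = sqrt 2 * s - b\<close>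
  at fixed \<open>b\<close>, then \<open>b = (s - r) / sqrt 2\<close> at fixed \<open>s\<close>.
  Only affine substitutions of one vector variable occur, and their Jacobian factors are inverse to
  each other.\<close>

lemma vec_gauss_rotate:
  fixes F :: "(real^'n) \<times> (real^'n) \<Rightarrow> ennreal"
  assumes F[measurable]: "F \<in> borel_measurable (borel \<Otimes>\<^sub>M borel)"
  shows "(\<integral>\<^sup>+a. (\<integral>\<^sup>+b. F ((1 / sqrt 2) *\<^sub>R (a + b), (1 / sqrt 2) *\<^sub>R (a - b)) \<partial>vec_gauss) \<partial>vec_gauss)
    = (\<integral>\<^sup>+a. (\<integral>\<^sup>+b. F (a, b) \<partial>vec_gauss) \<partial>vec_gauss)"
proof -
  let ?d = "vec_normal_density :: real^'n \<Rightarrow> real"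
  let ?q = "1 / sqrt 2 :: real"
  interpret pair_sigma_finite "lborel :: (real^'n) measure" "lborel :: (real^'n) measure" ..
  have dens: "(\<integral>\<^sup>+a. (\<integral>\<^sup>+b. K a b \<partial>vec_gauss) \<partial>vec_gauss)
    = (\<integral>\<^sup>+a. (\<integral>\<^sup>+b. ennreal (?d a * ?d b) * K a b \<partial>lborel) \<partial>lborel)"
    if [measurable]: "(\<lambda>(a, b). K a b) \<in> borel_measurable (borel \<Otimes>\<^sub>M borel)" for K
  proof -
    have K1[measurable]: "K a \<in> borel_measurable borel" for a
      using measurable_Pair2[OF that, of a] by simp
    have K2: "(\<lambda>(a, b). ennreal (?d b) * K a b) \<in> borel_measurable (borel \<Otimes>\<^sub>M lborel)"
    proof -
      have "sets (borel \<Otimes>\<^sub>M lborel) = sets (borel \<Otimes>\<^sub>M (borel :: (real^'n) measure))"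
        by (intro sets_pair_measure_cong) auto
      moreover have "(\<lambda>(a, b). ennreal (?d b) * K a b) \<in> borel_measurable (borel \<Otimes>\<^sub>M borel)" by measurable
      ultimately show ?thesis by (subst measurable_cong_sets[OF _ refl])
    qed
    have [measurable]: "(\<lambda>a. \<integral>\<^sup>+b. ennreal (?d b) * K a b \<partial>lborel) \<in> borel_measurable borel"
      by (rule lborel.borel_measurable_nn_integral[OF K2])
    have "(\<integral>\<^sup>+a. (\<integral>\<^sup>+b. K a b \<partial>vec_gauss) \<partial>vec_gauss)
      = (\<integral>\<^sup>+a. ennreal (?d a) * (\<integral>\<^sup>+b. ennreal (?d b) * K a b \<partial>lborel) \<partial>lborel)"
      by (simp add: nn_integral_density)
    also have "\<dots> = (\<integral>\<^sup>+a. (\<integral>\<^sup>+b. ennreal (?d a * ?d b) * K a b \<partial>lborel) \<partial>lborel)"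
      by (intro nn_integral_cong, subst nn_integral_cmult[symmetric])
         (auto simp: ennreal_mult vec_normal_density_nonneg mult.assoc)
    finally show ?thesis .
  qed
  define G where "G a b = ennreal (?d a * ?d b) * F (?q *\<^sub>R (a + b), ?q *\<^sub>R (a - b))" for a b
  have Gm[measurable]: "(\<lambda>(a, b). G a b) \<in> borel_measurable (borel \<Otimes>\<^sub>M borel)"
    unfolding G_def by measurable
  have Gsub: "(\<lambda>x. G (f x) (g x)) \<in> borel_measurable N"
    if "f \<in> borel_measurable N" "g \<in> borel_measurable N" for f g and N :: "'z measure"
    using measurable_compose[OF measurable_Pair[OF that] Gm] by simp
  have sq: "sqrt 2 * (1 / sqrt 2) = (1::real)" by simp
  have lb: "sets ((lborel :: (real^'n) measure) \<Otimes>\<^sub>M (lborel :: (real^'n) measure)) = sets (borel \<Otimes>\<^sub>M borel)"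
    by (intro sets_pair_measure_cong) auto
  have swap: "(\<integral>\<^sup>+b. (\<integral>\<^sup>+a. K a b \<partial>lborel) \<partial>lborel) = (\<integral>\<^sup>+a. (\<integral>\<^sup>+b. K a b \<partial>lborel) \<partial>lborel)"
    if "(\<lambda>(a, b). K a b) \<in> borel_measurable (borel \<Otimes>\<^sub>M borel)" for K :: "real^'n \<Rightarrow> real^'n \<Rightarrow> ennreal"
    by (rule lborel_pair.Fubini') (use that in \<open>simp add: measurable_cong_sets[OF lb refl]\<close>)
  have "(\<integral>\<^sup>+a. (\<integral>\<^sup>+b. F (?q *\<^sub>R (a + b), ?q *\<^sub>R (a - b)) \<partial>vec_gauss) \<partial>vec_gauss)
    = (\<integral>\<^sup>+a. (\<integral>\<^sup>+b. G a b \<partial>lborel) \<partial>lborel)"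
    unfolding G_def by (rule dens) measurable
  also have "\<dots> = (\<integral>\<^sup>+b. (\<integral>\<^sup>+a. G a b \<partial>lborel) \<partial>lborel)"
    by (rule swap[symmetric]) measurable
  also have "\<dots> = (\<integral>\<^sup>+b. ennreal (sqrt 2 ^ CARD('n)) * (\<integral>\<^sup>+s. G (- b + sqrt 2 *\<^sub>R s) b \<partial>lborel) \<partial>lborel)"
  proof (rule nn_integral_cong)
    fix b :: "real^'n"
    have "(\<integral>\<^sup>+a. G a b \<partial>lborel) = ennreal (\<bar>sqrt 2\<bar> ^ DIM(real^'n)) * (\<integral>\<^sup>+s. G (- b + sqrt 2 *\<^sub>R s) b \<partial>lborel)"
      by (rule nn_integral_lborel_affine) (auto intro!: Gsub)
    then show "(\<integral>\<^sup>+a. G a b \<partial>lborel) = ennreal (sqrt 2 ^ CARD('n)) * (\<integral>\<^sup>+s. G (- b + sqrt 2 *\<^sub>R s) b \<partial>lborel)"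
      by simp
  qed
  also have "\<dots> = ennreal (sqrt 2 ^ CARD('n)) * (\<integral>\<^sup>+b. (\<integral>\<^sup>+s. G (- b + sqrt 2 *\<^sub>R s) b \<partial>lborel) \<partial>lborel)"
  proof (rule nn_integral_cmult)
    have "(\<lambda>p. G (- fst p + sqrt 2 *\<^sub>R snd p) (fst p)) \<in> borel_measurable (borel \<Otimes>\<^sub>M borel)"
      by (rule Gsub) measurable
    then have "(\<lambda>(b, s). G (- b + sqrt 2 *\<^sub>R s) b) \<in> borel_measurable (lborel \<Otimes>\<^sub>M lborel)"
      unfolding measurable_cong_sets[OF lb refl] by (simp add: case_prod_unfold)
    then show "(\<lambda>b. \<integral>\<^sup>+s. G (- b + sqrt 2 *\<^sub>R s) b \<partial>lborel) \<in> borel_measurable lborel"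
      by (rule lborel.borel_measurable_nn_integral)
  qed
  also have "(\<integral>\<^sup>+b. (\<integral>\<^sup>+s. G (- b + sqrt 2 *\<^sub>R s) b \<partial>lborel) \<partial>lborel)
     = (\<integral>\<^sup>+s. (\<integral>\<^sup>+b. G (- b + sqrt 2 *\<^sub>R s) b \<partial>lborel) \<partial>lborel)"
  proof (rule swap)
    have "(\<lambda>p. G (- snd p + sqrt 2 *\<^sub>R fst p) (snd p)) \<in> borel_measurable (borel \<Otimes>\<^sub>M borel)"
      by (rule Gsub) measurable
    then show "(\<lambda>(s, b). G (- b + sqrt 2 *\<^sub>R s) b) \<in> borel_measurable (borel \<Otimes>\<^sub>M borel)"
      by (simp add: case_prod_unfold)
  qed
  also have "\<dots> = (\<integral>\<^sup>+s. ennreal (?q ^ CARD('n)) * (\<integral>\<^sup>+r. G (?q *\<^sub>R (s + r)) (?q *\<^sub>R (s - r)) \<partial>lborel) \<partial>lborel)"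
  proof (rule nn_integral_cong)
    fix s :: "real^'n"
    have e: "- (?q *\<^sub>R s + (- ?q) *\<^sub>R r) + sqrt 2 *\<^sub>R s = ?q *\<^sub>R (s + r)" for r
    proof -
      have "sqrt 2 = ?q + ?q" by (simp add: field_simps)
      then have "sqrt 2 *\<^sub>R s = ?q *\<^sub>R s + ?q *\<^sub>R s" by (metis scaleR_left_distrib)
      then show ?thesis by (simp add: scaleR_right_distrib)
    qed
    have e2: "?q *\<^sub>R s + (- ?q) *\<^sub>R r = ?q *\<^sub>R (s - r)" for r by (simp add: scaleR_diff_right)
    have "(\<integral>\<^sup>+b. G (- b + sqrt 2 *\<^sub>R s) b \<partial>lborel)
      = ennreal (\<bar>- ?q\<bar> ^ DIM(real^'n)) * (\<integral>\<^sup>+r. G (- (?q *\<^sub>R s + (- ?q) *\<^sub>R r) + sqrt 2 *\<^sub>R s) (?q *\<^sub>R s + (- ?q) *\<^sub>R r) \<partial>lborel)"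
      by (rule nn_integral_lborel_affine) (auto intro!: Gsub)
    then show "(\<integral>\<^sup>+b. G (- b + sqrt 2 *\<^sub>R s) b \<partial>lborel)
      = ennreal (?q ^ CARD('n)) * (\<integral>\<^sup>+r. G (?q *\<^sub>R (s + r)) (?q *\<^sub>R (s - r)) \<partial>lborel)"
      unfolding e unfolding e2 by simp
  qed
  also have "\<dots> = ennreal (?q ^ CARD('n)) * (\<integral>\<^sup>+s. (\<integral>\<^sup>+r. G (?q *\<^sub>R (s + r)) (?q *\<^sub>R (s - r)) \<partial>lborel) \<partial>lborel)"
  proof (rule nn_integral_cmult)
    have "(\<lambda>p. G (?q *\<^sub>R (fst p + snd p)) (?q *\<^sub>R (fst p - snd p))) \<in> borel_measurable (borel \<Otimes>\<^sub>M borel)"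
      by (rule Gsub) measurable
    then have "(\<lambda>(s, r). G (?q *\<^sub>R (s + r)) (?q *\<^sub>R (s - r))) \<in> borel_measurable (lborel \<Otimes>\<^sub>M lborel)"
      unfolding measurable_cong_sets[OF lb refl] by (simp add: case_prod_unfold)
    then show "(\<lambda>s. \<integral>\<^sup>+r. G (?q *\<^sub>R (s + r)) (?q *\<^sub>R (s - r)) \<partial>lborel) \<in> borel_measurable lborel"
      by (rule lborel.borel_measurable_nn_integral)
  qed
  also have "ennreal (sqrt 2 ^ CARD('n)) * (ennreal (?q ^ CARD('n)) * I) = I" for I
    by (subst mult.assoc[symmetric]) (simp add: ennreal_mult[symmetric] power_mult_distrib[symmetric])
  also have "(\<integral>\<^sup>+s. (\<integral>\<^sup>+r. G (?q *\<^sub>R (s + r)) (?q *\<^sub>R (s - r)) \<partial>lborel) \<partial>lborel)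
    = (\<integral>\<^sup>+s. (\<integral>\<^sup>+r. ennreal (?d s * ?d r) * F (s, r) \<partial>lborel) \<partial>lborel)"
  proof (intro nn_integral_cong)
    fix s r :: "real^'n"
    \<comment> \<open>The map is an involution, so the arguments of \<open>F\<close> become the new
      variables themselves.\<close>
    have "?q *\<^sub>R (?q *\<^sub>R (s + r) + ?q *\<^sub>R (s - r)) = s" "?q *\<^sub>R (?q *\<^sub>R (s + r) - ?q *\<^sub>R (s - r)) = r"
      by (vector field_simps)+
    then show "G (?q *\<^sub>R (s + r)) (?q *\<^sub>R (s - r)) = ennreal (?d s * ?d r) * F (s, r)"
      unfolding G_def vec_normal_density_rotate by simp
  qed
  also have "\<dots> = (\<integral>\<^sup>+a. (\<integral>\<^sup>+b. F (a, b) \<partial>vec_gauss) \<partial>vec_gauss)"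
    by (rule dens[symmetric]) measurable
  finally show ?thesis .
qed

section \<open>Independent standard Gaussian vectors\<close>

lemma sets_Collect_all_in:
  assumes "finite J" "\<And>j. j \<in> J \<Longrightarrow> X j \<in> M \<rightarrow>\<^sub>M N" "\<And>j. j \<in> J \<Longrightarrow> A j \<in> sets N"
  shows "{\<omega> \<in> space M. \<forall>j\<in>J. X j \<omega> \<in> A j} \<in> sets M"
proof (intro sets.sets_Collect_finite_All assms(1))
  fix j assume "j \<in> J"
  then have "X j -` A j \<inter> space M \<in> sets M" using assms by (intro measurable_sets) auto
  then show "{\<omega> \<in> space M. X j \<omega> \<in> A j} \<in> sets M" by (simp add: vimage_def Int_def conj_commute)
qed

text \<open>Independence and the individual laws in a single formula on boxes, which identifies the
  joint law with a product measure and makes Fubini's theorem available.\<close>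

definition iid_gauss :: "'w measure \<Rightarrow> 'j set \<Rightarrow> ('j \<Rightarrow> 'w \<Rightarrow> real^'n) \<Rightarrow> bool" where
  "iid_gauss M J X \<longleftrightarrow> finite J \<and> (\<forall>j\<in>J. X j \<in> borel_measurable M) \<and>
    (\<forall>A. (\<forall>j\<in>J. A j \<in> sets borel) \<longrightarrow>
      emeasure M {\<omega> \<in> space M. \<forall>j\<in>J. X j \<omega> \<in> A j} = (\<Prod>j\<in>J. emeasure vec_gauss (A j)))"

lemma iid_gauss_distr:
  fixes X :: "'j \<Rightarrow> 'w \<Rightarrow> real^'n"
  assumes "iid_gauss M J X"
  shows "distr M (PiM J (\<lambda>_. vec_gauss)) (\<lambda>\<omega>. \<lambda>j\<in>J. X j \<omega>) = PiM J (\<lambda>_. vec_gauss)"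
    and "(\<lambda>\<omega>. \<lambda>j\<in>J. X j \<omega>) \<in> M \<rightarrow>\<^sub>M PiM J (\<lambda>_. vec_gauss)"
proof -
  interpret vg: prob_space "vec_gauss :: (real^'n) measure" by (rule prob_space_vec_gauss)
  interpret product_sigma_finite "\<lambda>_::'j. vec_gauss :: (real^'n) measure" ..
  have J: "finite J" and [measurable]: "\<And>j. j \<in> J \<Longrightarrow> X j \<in> borel_measurable M"
    and e: "\<And>A. (\<forall>j\<in>J. A j \<in> sets borel) \<Longrightarrow>
      emeasure M {\<omega> \<in> space M. \<forall>j\<in>J. X j \<omega> \<in> A j} = (\<Prod>j\<in>J. emeasure vec_gauss (A j))"
    using assms by (auto simp: iid_gauss_def)
  show m: "(\<lambda>\<omega>. \<lambda>j\<in>J. X j \<omega>) \<in> M \<rightarrow>\<^sub>M PiM J (\<lambda>_. vec_gauss)"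
    by (rule measurable_restrict) simp
  show "distr M (PiM J (\<lambda>_. vec_gauss)) (\<lambda>\<omega>. \<lambda>j\<in>J. X j \<omega>) = PiM J (\<lambda>_. vec_gauss)"
  proof (rule PiM_eqI[OF J])
    fix A assume A: "\<And>j. j \<in> J \<Longrightarrow> A j \<in> sets (vec_gauss :: (real^'n) measure)"
    have "emeasure (distr M (PiM J (\<lambda>_. vec_gauss)) (\<lambda>\<omega>. \<lambda>j\<in>J. X j \<omega>)) (Pi\<^sub>E J A)
      = emeasure M ((\<lambda>\<omega>. \<lambda>j\<in>J. X j \<omega>) -` Pi\<^sub>E J A \<inter> space M)"
      using A J by (intro emeasure_distr m sets_PiM_I_finite) auto
    also have "(\<lambda>\<omega>. \<lambda>j\<in>J. X j \<omega>) -` Pi\<^sub>E J A \<inter> space M = {\<omega> \<in> space M. \<forall>j\<in>J. X j \<omega> \<in> A j}"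
      by (auto simp: PiE_iff)
    also have "emeasure M \<dots> = (\<Prod>j\<in>J. emeasure vec_gauss (A j))" using A by (intro e) auto
    finally show "emeasure (distr M (PiM J (\<lambda>_. vec_gauss)) (\<lambda>\<omega>. \<lambda>j\<in>J. X j \<omega>)) (Pi\<^sub>E J A)
      = (\<Prod>j\<in>J. emeasure vec_gauss (A j))" .
  qed simp
qed

text \<open>Old and new members belong to one family \<open>X\<close>, so the step can be iterated
  with only the index set changing. In the product measure the members in \<open>J\<close>
  contribute a factor \<open>R\<close> that is constant in the two rotated variables, and the
  remaining double integral is invariant.\<close>

lemma iid_gauss_rotate:
  fixes X :: "'j \<Rightarrow> 'w \<Rightarrow> real^'n"
  assumes iid: "iid_gauss M (insert p (insert q J)) X"
    and pq: "p \<noteq> q" "p \<notin> J" "q \<notin> J"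
    and pq': "p' \<noteq> q'" "p' \<notin> J" "q' \<notin> J"
    and X: "\<And>\<omega>. X p' \<omega> = (1 / sqrt 2) *\<^sub>R (X p \<omega> + X q \<omega>)" "\<And>\<omega>. X q' \<omega> = (1 / sqrt 2) *\<^sub>R (X p \<omega> - X q \<omega>)"
  shows "iid_gauss M (insert p' (insert q' J)) X"
proof -
  interpret vg: prob_space "vec_gauss :: (real^'n) measure" by (rule prob_space_vec_gauss)
  interpret product_sigma_finite "\<lambda>_::'j. vec_gauss :: (real^'n) measure" ..
  have J: "finite J" and m: "\<And>j. j \<in> insert p (insert q J) \<Longrightarrow> X j \<in> borel_measurable M"
    using iid by (auto simp: iid_gauss_def)
  have [measurable]: "X p \<in> borel_measurable M" "X q \<in> borel_measurable M" using m by auto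
  have "X p' = (\<lambda>\<omega>. (1 / sqrt 2) *\<^sub>R (X p \<omega> + X q \<omega>))" "X q' = (\<lambda>\<omega>. (1 / sqrt 2) *\<^sub>R (X p \<omega> - X q \<omega>))"
    using X by auto
  then have m': "X p' \<in> borel_measurable M" "X q' \<in> borel_measurable M" by simp_all
  let ?K = "insert p (insert q J)"
  let ?P = "PiM ?K (\<lambda>_. vec_gauss :: (real^'n) measure)"
  show ?thesis unfolding iid_gauss_def
  proof (intro conjI ballI allI impI)
    fix A :: "'j \<Rightarrow> (real^'n) set" assume A: "\<forall>j\<in>insert p' (insert q' J). A j \<in> sets borel"
    then have [measurable]: "A p' \<in> sets borel" "A q' \<in> sets borel" by auto
    define F :: "(real^'n) \<times> (real^'n) \<Rightarrow> ennreal" where "F x = indicator (A p') (fst x) * indicator (A q') (snd x)" for x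
    have Fm[measurable]: "F \<in> borel_measurable (borel \<Otimes>\<^sub>M borel)" unfolding F_def by measurable
    define R where "R v = (\<Prod>j\<in>J. indicator (A j) (v j) :: ennreal)" for v
    define G where "G v = F ((1 / sqrt 2) *\<^sub>R (v p + v q), (1 / sqrt 2) *\<^sub>R (v p - v q)) * R v" for v
    have comp: "(\<lambda>v. v j) \<in> borel_measurable (PiM I (\<lambda>_. vec_gauss :: (real^'n) measure))" if "j \<in> I" for j and I :: "'j set"
      using measurable_component_singleton[OF that, of "\<lambda>_. vec_gauss :: (real^'n) measure"] by simp
    have Rm: "R \<in> borel_measurable (PiM I (\<lambda>_. vec_gauss))" if "J \<subseteq> I" for I
      unfolding R_def using that A
      by (intro borel_measurable_prod_ennreal) (auto intro!: measurable_compose[OF comp borel_measurable_indicator])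
    have Gm: "G \<in> borel_measurable ?P"
    proof -
      have [measurable]: "(\<lambda>v. v p) \<in> borel_measurable ?P" "(\<lambda>v. v q) \<in> borel_measurable ?P" by (auto intro!: comp)
      have [measurable]: "R \<in> borel_measurable ?P" by (rule Rm) auto
      show ?thesis unfolding G_def by measurable
    qed
    have "emeasure M {\<omega> \<in> space M. \<forall>j\<in>insert p' (insert q' J). X j \<omega> \<in> A j}
      = (\<integral>\<^sup>+\<omega>. indicator {\<omega> \<in> space M. \<forall>j\<in>insert p' (insert q' J). X j \<omega> \<in> A j} \<omega> \<partial>M)"
    proof (rule nn_integral_indicator[symmetric])
      show "{\<omega> \<in> space M. \<forall>j\<in>insert p' (insert q' J). X j \<omega> \<in> A j} \<in> sets M"
        using A m m' J by (intro sets_Collect_all_in) auto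
    qed
    also have "\<dots> = (\<integral>\<^sup>+\<omega>. G (\<lambda>j\<in>?K. X j \<omega>) \<partial>M)"
    proof (rule nn_integral_cong)
      fix \<omega> assume w: "\<omega> \<in> space M"
      have "R (\<lambda>j\<in>?K. X j \<omega>) = (\<Prod>j\<in>J. indicator (A j) (X j \<omega>))" unfolding R_def by (rule prod.cong) auto
      also have "\<dots> = (if \<forall>j\<in>J. X j \<omega> \<in> A j then 1 else 0)" using J by (auto simp: indicator_def prod_zero_iff)
      finally show "indicator {\<omega> \<in> space M. \<forall>j\<in>insert p' (insert q' J). X j \<omega> \<in> A j} \<omega> = G (\<lambda>j\<in>?K. X j \<omega>)"
        using w X by (simp add: G_def F_def indicator_def)
    qed
    also have "\<dots> = (\<integral>\<^sup>+v. G v \<partial>?P)"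
      using nn_integral_distr[OF iid_gauss_distr(2)[OF iid], of G] Gm by (simp add: iid_gauss_distr(1)[OF iid])
    also have "\<dots> = (\<integral>\<^sup>+v. (\<integral>\<^sup>+a. G (v(p := a)) \<partial>vec_gauss) \<partial>PiM (insert q J) (\<lambda>_. vec_gauss))"
      using J pq Gm by (intro product_nn_integral_insert) auto
    also have "\<dots> = (\<integral>\<^sup>+v. (\<integral>\<^sup>+b. (\<integral>\<^sup>+a. G (v(q := b, p := a)) \<partial>vec_gauss) \<partial>vec_gauss) \<partial>PiM J (\<lambda>_. vec_gauss))"
    proof (rule product_nn_integral_insert[OF J pq(3)])
      have "(\<lambda>(v, a). G (v(p := a))) \<in> borel_measurable (PiM (insert q J) (\<lambda>_. vec_gauss) \<Otimes>\<^sub>M vec_gauss)"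
        using measurable_compose[OF measurable_fun_upd[of ?K "insert q J" p fst "PiM (insert q J) (\<lambda>_. vec_gauss) \<Otimes>\<^sub>M vec_gauss" "\<lambda>_. vec_gauss" snd] Gm]
        by (auto simp: case_prod_unfold)
      then show "(\<lambda>v. \<integral>\<^sup>+a. G (v(p := a)) \<partial>vec_gauss) \<in> borel_measurable (PiM (insert q J) (\<lambda>_. vec_gauss))"
        by (rule vg.borel_measurable_nn_integral)
    qed
    also have "\<dots> = (\<integral>\<^sup>+v. R v * (emeasure vec_gauss (A p') * emeasure vec_gauss (A q')) \<partial>PiM J (\<lambda>_. vec_gauss))"
    proof (rule nn_integral_cong)
      fix v
      let ?q = "1 / sqrt 2 :: real"
      have Gu: "G (v(q := b, p := a)) = F (?q *\<^sub>R (a + b), ?q *\<^sub>R (a - b)) * R v" for a b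
      proof -
        have "R (v(q := b, p := a)) = R v" unfolding R_def using pq by (intro prod.cong) auto
        then show ?thesis using pq by (simp add: G_def)
      qed
      have Fc: "(\<lambda>(a, b). F (?q *\<^sub>R (a + b), ?q *\<^sub>R (a - b))) \<in> borel_measurable (borel \<Otimes>\<^sub>M borel)" by measurable
      have sv: "sets ((vec_gauss :: (real^'n) measure) \<Otimes>\<^sub>M (vec_gauss :: (real^'n) measure)) = sets (borel \<Otimes>\<^sub>M borel)"
        by (intro sets_pair_measure_cong) auto
      interpret P: pair_sigma_finite "vec_gauss :: (real^'n) measure" "vec_gauss :: (real^'n) measure" ..
      have "(\<integral>\<^sup>+b. (\<integral>\<^sup>+a. G (v(q := b, p := a)) \<partial>vec_gauss) \<partial>vec_gauss)
        = (\<integral>\<^sup>+b. (\<integral>\<^sup>+a. F (?q *\<^sub>R (a + b), ?q *\<^sub>R (a - b)) \<partial>vec_gauss) * R v \<partial>vec_gauss)"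
        unfolding Gu by (intro nn_integral_cong nn_integral_multc) measurable
      also have "\<dots> = (\<integral>\<^sup>+b. (\<integral>\<^sup>+a. F (?q *\<^sub>R (a + b), ?q *\<^sub>R (a - b)) \<partial>vec_gauss) \<partial>vec_gauss) * R v"
      proof (rule nn_integral_multc)
        have "(\<lambda>(b, a). F (?q *\<^sub>R (a + b), ?q *\<^sub>R (a - b))) \<in> borel_measurable (borel \<Otimes>\<^sub>M borel)" by measurable
        then show "(\<lambda>b. \<integral>\<^sup>+a. F (?q *\<^sub>R (a + b), ?q *\<^sub>R (a - b)) \<partial>vec_gauss) \<in> borel_measurable vec_gauss"
          by (intro vg.borel_measurable_nn_integral) (simp add: measurable_cong_sets[OF sv refl])
      qed
      also have "(\<integral>\<^sup>+b. (\<integral>\<^sup>+a. F (?q *\<^sub>R (a + b), ?q *\<^sub>R (a - b)) \<partial>vec_gauss) \<partial>vec_gauss)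
        = (\<integral>\<^sup>+a. (\<integral>\<^sup>+b. F (?q *\<^sub>R (a + b), ?q *\<^sub>R (a - b)) \<partial>vec_gauss) \<partial>vec_gauss)"
        by (rule P.Fubini'[where f="\<lambda>a b. F (?q *\<^sub>R (a + b), ?q *\<^sub>R (a - b))"])
           (use Fc in \<open>simp add: measurable_cong_sets[OF sv refl]\<close>)
      also have "\<dots> = (\<integral>\<^sup>+a. (\<integral>\<^sup>+b. F (a, b) \<partial>vec_gauss) \<partial>vec_gauss)" by (rule vec_gauss_rotate) measurable
      also have "\<dots> = (\<integral>\<^sup>+a. indicator (A p') a * emeasure vec_gauss (A q') \<partial>vec_gauss)"
        unfolding F_def by (intro nn_integral_cong) (simp add: nn_integral_cmult)
      also have "\<dots> = emeasure vec_gauss (A p') * emeasure vec_gauss (A q')"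
        by (subst nn_integral_multc) auto
      finally show "(\<integral>\<^sup>+b. (\<integral>\<^sup>+a. G (v(q := b, p := a)) \<partial>vec_gauss) \<partial>vec_gauss)
        = R v * (emeasure vec_gauss (A p') * emeasure vec_gauss (A q'))" unfolding mult.commute[of "R v"] .
    qed
    also have "\<dots> = (\<integral>\<^sup>+v. R v \<partial>PiM J (\<lambda>_. vec_gauss)) * (emeasure vec_gauss (A p') * emeasure vec_gauss (A q'))"
      by (rule nn_integral_multc) (rule Rm, simp)
    also have "(\<integral>\<^sup>+v. R v \<partial>PiM J (\<lambda>_. vec_gauss)) = (\<Prod>j\<in>J. \<integral>\<^sup>+x. indicator (A j) x \<partial>vec_gauss)"
      unfolding R_def using A by (intro product_nn_integral_prod J) auto
    also have "\<dots> = (\<Prod>j\<in>J. emeasure vec_gauss (A j))" using A by (intro prod.cong) auto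
    finally show "emeasure M {\<omega> \<in> space M. \<forall>j\<in>insert p' (insert q' J). X j \<omega> \<in> A j}
      = (\<Prod>j\<in>insert p' (insert q' J). emeasure vec_gauss (A j))"
      using J pq' by (simp add: mult_ac)
  qed (use J m m' in auto)
qed

text \<open>Dyadic intervals are numbered in heap order: \<open>m = 2\<^sup>N + k\<close> with \<open>k < 2\<^sup>N\<close> stands for
  \<open>[kT/2\<^sup>N, (k+1)T/2\<^sup>N]\<close>, whose halves are \<open>2m\<close> and \<open>2m + 1\<close>. Index 0 is left for the
  constant Haar function.\<close>

fun haar_level :: "nat \<Rightarrow> nat" where
  "haar_level m = (if m < 2 then 0 else Suc (haar_level (m div 2)))"

declare haar_level.simps[simp del]

text \<open>Increment over the dyadic interval numbered \<open>m\<close>, divided by the square root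
  of its length \<open>T / 2 ^ haar_level m\<close>; for Brownian motion this is a standard Gaussian
  vector.\<close>

definition node :: "real \<Rightarrow> (real \<Rightarrow> 'a::real_vector) \<Rightarrow> nat \<Rightarrow> 'a" where
  "node T w m = sqrt (2 ^ haar_level m / T) *\<^sub>R
    (w (T * (real (m - 2 ^ haar_level m) + 1) / 2 ^ haar_level m) - w (T * real (m - 2 ^ haar_level m) / 2 ^ haar_level m))"

text \<open>Integral against \<open>dw\<close> of the Haar function of interval \<open>m\<close>
  normalized in L2, expressed by the normalized increments of the two halves; index 0 is the
  normalized total increment.\<close>

definition haar :: "real \<Rightarrow> (real \<Rightarrow> 'a::real_vector) \<Rightarrow> nat \<Rightarrow> 'a" where
  "haar T w m = (if m = 0 then node T w 1 else (1 / sqrt 2) *\<^sub>R (node T w (2 * m) - node T w (2 * m + 1)))"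

lemma haar_level_eq: "k < 2 ^ N \<Longrightarrow> haar_level (2 ^ N + k) = N"
proof (induction N arbitrary: k)
  case 0 then show ?case by (simp add: haar_level.simps)
next
  case (Suc N)
  have "(2 ^ Suc N + k) div 2 = 2 ^ N + k div 2" by simp
  moreover have "k div 2 < 2 ^ N" using Suc.prems by auto
  moreover have "\<not> 2 ^ Suc N + k < 2" using one_le_power[of 2 N] by (simp add: not_less le_add1 trans_le_add1)
  ultimately show ?case using Suc.IH[of "k div 2"] by (subst haar_level.simps) simp
qed

lemma haar_level_bounds: "1 \<le> m \<Longrightarrow> 2 ^ haar_level m \<le> m \<and> m < 2 * 2 ^ haar_level m"
proof (induction m rule: haar_level.induct)
  case (1 m)
  show ?case
  proof (cases "m < 2")
    case True then show ?thesis using 1 by (simp add: haar_level.simps)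
  next
    case False
    then have "2 ^ haar_level (m div 2) \<le> m div 2 \<and> m div 2 < 2 * 2 ^ haar_level (m div 2)" using 1 by auto
    then show ?thesis using False by (subst (1 2) haar_level.simps) auto
  qed
qed

lemma haar_level_children: "1 \<le> m \<Longrightarrow> haar_level (2 * m) = Suc (haar_level m)" "1 \<le> m \<Longrightarrow> haar_level (2 * m + 1) = Suc (haar_level m)"
  by (subst haar_level.simps, simp)+

text \<open>The sum half of the orthogonal map whose difference half is \<open>haar\<close>: the two
  increments add, and the doubled length accounts for the factor \<open>1 / sqrt 2\<close>.\<close>

lemma node_merge:
  assumes m: "1 \<le> m" and T: "T > 0"
  shows "node T w m = (1 / sqrt 2) *\<^sub>R (node T w (2 * m) + node T w (2 * m + 1))"
proof -
  let ?L = "haar_level m"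
  have b: "2 ^ ?L \<le> m" using haar_level_bounds[OF m] by simp
  then have p: "2 * m - 2 ^ Suc ?L = 2 * (m - 2 ^ ?L)" "2 * m + 1 - 2 ^ Suc ?L = 2 * (m - 2 ^ ?L) + 1" by auto
  define j where "j = real (m - 2 ^ ?L)"
  have s: "sqrt (2 ^ Suc ?L / T) = sqrt 2 * sqrt (2 ^ ?L / T)" by (simp add: real_sqrt_mult[symmetric])
  have e: "T * (2 * j) / 2 ^ Suc ?L = T * j / 2 ^ ?L" "T * (2 * j + 1 + 1) / 2 ^ Suc ?L = T * (j + 1) / 2 ^ ?L"
    by (simp_all add: field_simps)
  have r: "real (2 * (m - 2 ^ ?L)) = 2 * j" "real (2 * (m - 2 ^ ?L) + 1) = 2 * j + 1" by (simp_all add: j_def)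
  have "node T w (2 * m) + node T w (2 * m + 1)
    = sqrt (2 ^ Suc ?L / T) *\<^sub>R (w (T * (2 * j + 1 + 1) / 2 ^ Suc ?L) - w (T * (2 * j) / 2 ^ Suc ?L))"
    unfolding node_def haar_level_children[OF m] p r by (simp add: scaleR_right_distrib[symmetric])
  then show ?thesis unfolding e s by (simp add: node_def j_def)
qed

lemma iid_gauss_reindex:
  fixes X :: "'j \<Rightarrow> 'w \<Rightarrow> real^'n" and f :: "'i \<Rightarrow> 'j"
  assumes "iid_gauss M J X" "inj_on f I" "f ` I = J"
  shows "iid_gauss M I (\<lambda>i. X (f i))"
  unfolding iid_gauss_def
proof (intro conjI allI impI ballI)
  fix A :: "'i \<Rightarrow> (real^'n) set" assume A: "\<forall>i\<in>I. A i \<in> sets borel"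
  define A' where "A' j = A (the_inv_into I f j)" for j
  have A': "A' (f i) = A i" if "i \<in> I" for i using that assms(2) by (simp add: A'_def the_inv_into_f_f)
  have "\<forall>j\<in>J. A' j \<in> sets borel" unfolding assms(3)[symmetric] using A A' by simp
  then have "emeasure M {\<omega> \<in> space M. \<forall>j\<in>J. X j \<omega> \<in> A' j} = (\<Prod>j\<in>J. emeasure vec_gauss (A' j))"
    using assms(1) unfolding iid_gauss_def by blast
  moreover have "(\<Prod>j\<in>J. emeasure vec_gauss (A' j)) = (\<Prod>i\<in>I. emeasure vec_gauss (A i))"
    unfolding assms(3)[symmetric] prod.reindex[OF assms(2)] comp_def by (intro prod.cong) (simp_all add: A')
  moreover have "{\<omega> \<in> space M. \<forall>j\<in>J. X j \<omega> \<in> A' j} = {\<omega> \<in> space M. \<forall>i\<in>I. X (f i) \<omega> \<in> A i}"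
    unfolding assms(3)[symmetric] using A' by auto
  ultimately show "emeasure M {\<omega> \<in> space M. \<forall>i\<in>I. X (f i) \<omega> \<in> A i} = (\<Prod>i\<in>I. emeasure vec_gauss (A i))"
    by simp
next
  show "finite I" using assms by (auto simp: iid_gauss_def finite_image_iff[symmetric])
qed (use assms in \<open>auto simp: iid_gauss_def\<close>)

lemma iid_gauss_cong:
  assumes "\<And>j. j \<in> J \<Longrightarrow> X j = Y j" "iid_gauss M J X" shows "iid_gauss M J Y"
proof -
  have "{\<omega> \<in> space M. \<forall>j\<in>J. X j \<omega> \<in> A j} = {\<omega> \<in> space M. \<forall>j\<in>J. Y j \<omega> \<in> A j}" for A
    using assms(1) by auto
  then show ?thesis using assms unfolding iid_gauss_def by simp
qed

lemma brownian_scaled_increment: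
  fixes W :: "real \<Rightarrow> 'w \<Rightarrow> real^'n"
  assumes bm: "brownian_motion M T F W" and st: "0 \<le> s" "s < t" "t \<le> T"
    and A[measurable]: "A \<in> sets borel" and X: "(\<lambda>\<omega>. W t \<omega> - W s \<omega>) \<in> borel_measurable M"
  shows "emeasure M {\<omega> \<in> space M. sqrt (1 / (t - s)) *\<^sub>R (W t \<omega> - W s \<omega>) \<in> A} = emeasure vec_gauss A"
proof -
  define \<sigma> where "\<sigma> = sqrt (t - s)"
  have \<sigma>: "\<sigma> > 0" using st by (simp add: \<sigma>_def)
  have c: "sqrt (1 / (t - s)) = 1 / \<sigma>" by (simp add: \<sigma>_def real_sqrt_divide)
  have "s \<in> {0..T}" "t \<in> {s<..T}" using st by auto
  then have dist: "distributed M lborel (\<lambda>\<omega>. W t \<omega> - W s \<omega>)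
      (\<lambda>z. ennreal (\<Prod>i\<in>UNIV. normal_density 0 \<sigma> (z $ i)))"
    using bm unfolding brownian_motion_def \<sigma>_def by blast
  have [measurable]: "(\<lambda>z. (1 / \<sigma>) *\<^sub>R z) -` A \<in> sets borel"
    using measurable_sets[of "\<lambda>z. (1 / \<sigma>) *\<^sub>R z" borel borel A] by simp
  have "emeasure M {\<omega> \<in> space M. sqrt (1 / (t - s)) *\<^sub>R (W t \<omega> - W s \<omega>) \<in> A}
    = emeasure (distr M lborel (\<lambda>\<omega>. W t \<omega> - W s \<omega>)) ((\<lambda>z. (1 / \<sigma>) *\<^sub>R z) -` A)"
    unfolding c using X by (subst emeasure_distr) (auto intro!: arg_cong[where f="emeasure M"])
  also have "\<dots> = (\<integral>\<^sup>+z. ennreal (\<Prod>i\<in>UNIV. normal_density 0 \<sigma> (z $ i)) * indicator ((\<lambda>z. (1 / \<sigma>) *\<^sub>R z) -` A) z \<partial>lborel)"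
    unfolding distributed_distr_eq_density[OF dist]
    by (rule emeasure_density) (use distributed_borel_measurable[OF dist] in auto)
  also have "\<dots> = ennreal (\<bar>\<sigma>\<bar> ^ DIM(real^'n)) * (\<integral>\<^sup>+z. ennreal (\<Prod>i\<in>UNIV. normal_density 0 \<sigma> ((0 + \<sigma> *\<^sub>R z) $ i)) * indicator ((\<lambda>z. (1 / \<sigma>) *\<^sub>R z) -` A) (0 + \<sigma> *\<^sub>R z) \<partial>lborel)"
    using \<sigma> by (intro nn_integral_lborel_affine) auto
  also have "\<dots> = (\<integral>\<^sup>+z. ennreal (\<sigma> ^ CARD('n)) * (ennreal (\<Prod>i\<in>UNIV. normal_density 0 \<sigma> ((0 + \<sigma> *\<^sub>R z) $ i)) * indicator ((\<lambda>z. (1 / \<sigma>) *\<^sub>R z) -` A) (0 + \<sigma> *\<^sub>R z)) \<partial>lborel)"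
    using \<sigma> by (subst nn_integral_cmult) auto
  also have "\<dots> = (\<integral>\<^sup>+z. ennreal (vec_normal_density z) * indicator A z \<partial>lborel)"
  proof (rule nn_integral_cong)
    fix z :: "real^'n"
    have "\<sigma> * normal_density 0 \<sigma> (\<sigma> * x) = std_normal_density x" for x
      using \<sigma> by (simp add: normal_density_def real_sqrt_mult field_simps)
    then have "(\<Prod>i\<in>UNIV. \<sigma> * normal_density 0 \<sigma> (\<sigma> * z $ i)) = vec_normal_density z"
      by (simp add: vec_normal_density_def)
    then have "\<sigma> ^ CARD('n) * (\<Prod>i\<in>UNIV. normal_density 0 \<sigma> (\<sigma> * z $ i)) = vec_normal_density z"
      by (simp add: prod.distrib)
    then show "ennreal (\<sigma> ^ CARD('n)) * (ennreal (\<Prod>i\<in>UNIV. normal_density 0 \<sigma> ((0 + \<sigma> *\<^sub>R z) $ i)) * indicator ((\<lambda>z. (1 / \<sigma>) *\<^sub>R z) -` A) (0 + \<sigma> *\<^sub>R z))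
      = ennreal (vec_normal_density z) * indicator A z"
      using \<sigma> by (simp add: mult.assoc[symmetric] ennreal_mult[symmetric] prod_nonneg indicator_def)
  qed
  also have "\<dots> = emeasure vec_gauss A" by (simp add: emeasure_density)
  finally show ?thesis .
qed

section \<open>Independence of the Haar coefficients\<close>

context
  fixes M :: "'w measure" and T :: real and F and W :: "real \<Rightarrow> 'w \<Rightarrow> real^'n"
  assumes M: "prob_space M" and fil: "filtration_on M T F" and bm: "brownian_motion M T F W" and T: "T > 0"
begin

lemma brownian_measurable: "t \<in> {0..T} \<Longrightarrow> W t \<in> borel_measurable M"
  using bm fil measurable_from_subalg unfolding brownian_motion_def filtration_on_def by blast

lemma brownian_measurable_later: "s \<in> {0..T} \<Longrightarrow> t \<in> {s..T} \<Longrightarrow> W s \<in> borel_measurable (F t)"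
  using bm fil measurable_from_subalg unfolding brownian_motion_def filtration_on_def by blast

lemma dyadic_in: "k \<le> 2 ^ N \<Longrightarrow> T * real k / 2 ^ N \<in> {0..T}"
proof -
  assume "k \<le> 2 ^ N"
  then have "real k \<le> 2 ^ N" by (metis of_nat_le_iff of_nat_numeral of_nat_power)
  then show ?thesis using T by (simp add: divide_le_eq)
qed

lemma node_fine:
  assumes "k < 2 ^ N"
  shows "node T w (2 ^ N + k) = sqrt (1 / (T * real (Suc k) / 2 ^ N - T * real k / 2 ^ N)) *\<^sub>R (w (T * real (Suc k) / 2 ^ N) - w (T * real k / 2 ^ N))"
proof -
  have "1 / (T * real (Suc k) / 2 ^ N - T * real k / 2 ^ N) = 2 ^ N / T"
    using T by (simp add: field_simps)
  then show ?thesis unfolding node_def haar_level_eq[OF assms] by (simp add: add.commute)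
qed

lemma node_measurable: "k < 2 ^ N \<Longrightarrow> (\<lambda>\<omega>. node T (\<lambda>t. W t \<omega>) (2 ^ N + k)) \<in> borel_measurable M"
  unfolding node_fine using dyadic_in[of k N] dyadic_in[of "Suc k" N] brownian_measurable
  by (intro borel_measurable_scaleR borel_measurable_diff borel_measurable_const) auto

text \<open>Induction from left to right: the event on the first \<open>K\<close> increments belongs
  to the filtration at the end of the last of them, and the next increment is independent of
  that.\<close>

lemma fine_nodes_iid:
  "iid_gauss M {2 ^ N..<2 ^ Suc N} (\<lambda>m \<omega>. node T (\<lambda>t. W t \<omega>) m)"
proof -
  interpret prob_space M by (rule M)
  let ?X = "\<lambda>m \<omega>. node T (\<lambda>t. W t \<omega>) m"
  let ?t = "\<lambda>k. T * real k / 2 ^ N"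
  have step: "K \<le> 2 ^ N \<Longrightarrow> (\<forall>j\<in>{2 ^ N..<2 ^ N + K}. A j \<in> sets borel) \<Longrightarrow>
    emeasure M {\<omega> \<in> space M. \<forall>j\<in>{2 ^ N..<2 ^ N + K}. ?X j \<omega> \<in> A j} = (\<Prod>j\<in>{2 ^ N..<2 ^ N + K}. emeasure vec_gauss (A j))" for K A
  proof (induction K)
    case 0 then show ?case by (simp add: emeasure_space_1)
  next
    case (Suc K)
    let ?E = "{\<omega> \<in> space M. \<forall>j\<in>{2 ^ N..<2 ^ N + K}. ?X j \<omega> \<in> A j}"
    let ?m = "2 ^ N + K"
    have K: "K < 2 ^ N" using Suc.prems by simp
    have tK: "?t K \<in> {0..T}" "?t (Suc K) \<in> {0..T}" using dyadic_in[of K N] dyadic_in[of "Suc K" N] K by auto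
    have lt: "?t K < ?t (Suc K)" using T by (simp add: divide_strict_right_mono)
    have sp: "space (F (?t K)) = space M" and sub: "sets (F (?t K)) \<subseteq> sets M"
      using fil tK by (auto simp: filtration_on_def subalgebra_def)
    have "{\<omega> \<in> space (F (?t K)). \<forall>j\<in>{2 ^ N..<2 ^ N + K}. ?X j \<omega> \<in> A j} \<in> sets (F (?t K))"
    proof (rule sets_Collect_all_in[where N=borel])
      fix j assume j: "j \<in> {2 ^ N..<2 ^ N + K}"
      then obtain k where k: "j = 2 ^ N + k" "k < K" by (auto simp: le_iff_add)
      have kN: "k < 2 ^ N" using k K by simp
      have "?t k \<le> ?t K" "?t (Suc k) \<le> ?t K" using k T by (auto intro!: divide_right_mono mult_left_mono)
      then show "?X j \<in> borel_measurable (F (?t K))"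
        unfolding k(1) node_fine[OF kN] using dyadic_in[of k N] dyadic_in[of "Suc k" N] kN tK
        by (intro borel_measurable_scaleR borel_measurable_diff borel_measurable_const brownian_measurable_later) auto
    qed (use Suc.prems in auto)
    then have E: "?E \<in> sets (F (?t K))" unfolding sp .
    let ?D = "\<lambda>\<omega>. W (?t (Suc K)) \<omega> - W (?t K) \<omega>"
    let ?c = "sqrt (1 / (?t (Suc K) - ?t K))"
    have Dm: "?D \<in> borel_measurable M" using brownian_measurable tK by (intro borel_measurable_diff) auto
    have Am: "A ?m \<in> sets borel" using Suc.prems by auto
    define B where "B = (\<lambda>v. ?c *\<^sub>R v) -` A ?m"
    have Bm: "B \<in> sets borel" unfolding B_def using measurable_sets[of "\<lambda>v. ?c *\<^sub>R v" borel borel "A ?m"] Am by simp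
    have ind: "indep_set (sets (F (?t K))) {?D -` A \<inter> space M | A. A \<in> sets borel}"
      using bm tK lt unfolding brownian_motion_def by auto
    have "prob (?E \<inter> (?D -` B \<inter> space M)) = prob ?E * prob (?D -` B \<inter> space M)"
      by (rule indep_setD[OF ind E]) (use Bm in blast)
    then have "emeasure M (?E \<inter> (?D -` B \<inter> space M)) = emeasure M ?E * emeasure M (?D -` B \<inter> space M)"
      by (simp add: emeasure_eq_measure ennreal_mult')
    moreover have nf: "node T (\<lambda>t. W t \<omega>) ?m = ?c *\<^sub>R ?D \<omega>" for \<omega> by (rule node_fine[OF K])
    moreover have "?D -` B \<inter> space M = {\<omega> \<in> space M. ?c *\<^sub>R ?D \<omega> \<in> A ?m}" by (auto simp: B_def)
    moreover have "emeasure M {\<omega> \<in> space M. ?c *\<^sub>R ?D \<omega> \<in> A ?m} = emeasure vec_gauss (A ?m)"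
      using tK lt by (intro brownian_scaled_increment[OF bm _ lt _ Am Dm]) auto
    moreover have "{2 ^ N..<2 ^ N + Suc K} = insert ?m {2 ^ N..<2 ^ N + K}" by auto
    moreover have "{\<omega> \<in> space M. \<forall>j\<in>insert ?m {2 ^ N..<2 ^ N + K}. ?X j \<omega> \<in> A j} = ?E \<inter> {\<omega> \<in> space M. ?c *\<^sub>R ?D \<omega> \<in> A ?m}"
      unfolding nf[symmetric] by auto
    moreover have "emeasure M ?E = (\<Prod>j\<in>{2 ^ N..<2 ^ N + K}. emeasure vec_gauss (A j))"
      using Suc.prems by (intro Suc.IH) auto
    ultimately show ?case by (simp add: mult.commute)
  qed
  have S: "2 ^ Suc N = 2 ^ N + (2::nat) ^ N" by simp
  show ?thesis unfolding iid_gauss_def S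
  proof (intro conjI allI impI ballI)
    fix j :: nat assume "j \<in> {2 ^ N..<2 ^ N + 2 ^ N}"
    then obtain k where "j = 2 ^ N + k" "k < 2 ^ N" by (auto simp: le_iff_add)
    then show "?X j \<in> borel_measurable M" using node_measurable by simp
  qed (use step in auto)
qed

text \<open>The dyadic tree is folded upwards from level \<open>N\<close>. For \<open>c\<close>
  decreasing from \<open>2 ^ N\<close> to 1, the increments numbered \<open>c\<close> to
  \<open>2 * c - 1\<close> and the coefficients numbered \<open>c\<close> to
  \<open>2 ^ N - 1\<close> form an independent family. Passing from \<open>Suc c'\<close> to
  \<open>c'\<close> trades the two halves of interval \<open>c'\<close> for its increment and its
  coefficient. At \<open>c = 1\<close> the total increment is the only increment left, and it is
  coefficient 0.\<close>

lemma haar_iid: "iid_gauss M {..<2 ^ N} (\<lambda>m \<omega>. haar T (\<lambda>t. W t \<omega>) m)"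
proof -
  \<comment> \<open>The tags keep increments and coefficients apart, as their numbers
    overlap.\<close>
  define V where "V j \<omega> = (case j of Inl m \<Rightarrow> node T (\<lambda>t. W t \<omega>) m | Inr m \<Rightarrow> haar T (\<lambda>t. W t \<omega>) m)" for j \<omega>
  have "iid_gauss M (Inl ` {c..<2 * c} \<union> Inr ` {c..<2 ^ N}) V" if "1 \<le> c" "c \<le> 2 ^ N" for c
    using that(2)
  proof (induction rule: inc_induct)
    case base
    have "iid_gauss M (Inl ` {2 ^ N..<2 * 2 ^ N} :: (nat + nat) set) (\<lambda>j \<omega>. node T (\<lambda>t. W t \<omega>) (projl j))"
      using iid_gauss_reindex[OF fine_nodes_iid, of projl "Inl ` {2 ^ N..<2 * 2 ^ N} :: (nat + nat) set" N]
      by (simp add: image_image inj_on_def)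
    then have "iid_gauss M (Inl ` {2 ^ N..<2 * 2 ^ N} :: (nat + nat) set) V"
      by (rule iid_gauss_cong[rotated]) (auto simp: V_def fun_eq_iff)
    then show ?case by simp
  next
    case (step c')
    then have c: "1 \<le> c'" "c' < 2 ^ N" using that(1) by auto
    let ?J = "Inl ` {Suc c'..<2 * c'} \<union> Inr ` {Suc c'..<2 ^ N} :: (nat + nat) set"
    have 1: "Inl ` {Suc c'..<2 * Suc c'} \<union> Inr ` {Suc c'..<2 ^ N} = insert (Inl (2 * c')) (insert (Inl (2 * c' + 1)) ?J)"
      using c by (auto simp: image_iff)
    have 2: "Inl ` {c'..<2 * c'} \<union> Inr ` {c'..<2 ^ N} = insert (Inl c') (insert (Inr c') ?J)"
      using c by (auto simp: image_iff)
    show ?case unfolding 2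
    proof (rule iid_gauss_rotate[OF step.IH[unfolded 1]])
      fix \<omega>
      show "V (Inl c') \<omega> = (1 / sqrt 2) *\<^sub>R (V (Inl (2 * c')) \<omega> + V (Inl (2 * c' + 1)) \<omega>)"
        unfolding V_def using node_merge[OF c(1) T] by simp
      show "V (Inr c') \<omega> = (1 / sqrt 2) *\<^sub>R (V (Inl (2 * c')) \<omega> - V (Inl (2 * c' + 1)) \<omega>)"
        unfolding V_def using c by (simp add: haar_def)
    qed (use c in auto)
  qed
  from this[of 1] have base: "iid_gauss M (Inl ` {1..<2} \<union> Inr ` {1..<2 ^ N}) V" by simp
  define f :: "nat \<Rightarrow> nat + nat" where "f m = (if m = 0 then Inl 1 else Inr m)" for m
  have "f ` {..<2 ^ N} = Inl ` {1..<2} \<union> Inr ` {1..<2 ^ N}"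
    by (auto simp: f_def image_iff Bex_def)
  moreover have "inj_on f {..<2 ^ N}" by (auto simp: inj_on_def f_def split: if_splits)
  ultimately have "iid_gauss M {..<2 ^ N} (\<lambda>m. V (f m))" by (intro iid_gauss_reindex[OF base]) auto
  moreover have "V (f m) = (\<lambda>\<omega>. haar T (\<lambda>t. W t \<omega>) m)" for m
    by (auto simp: V_def f_def haar_def fun_eq_iff)
  ultimately show ?thesis by simp
qed

end

section \<open>Sequences of vectors as sequences of scalars\<close>

definition idx :: "nat \<Rightarrow> nat \<times> 'n::finite" where
  "idx = from_nat_into UNIV"

definition pack :: "(nat \<Rightarrow> real) \<Rightarrow> nat \<Rightarrow> real^'n" where
  "pack z m = (\<chi> i. z (inv idx (m, i)))"

definition unpack :: "(nat \<Rightarrow> real^'n) \<Rightarrow> nat \<Rightarrow> real" where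
  "unpack X k = X (fst (idx k :: nat \<times> 'n)) $ snd (idx k :: nat \<times> 'n)"

lemma bij_idx: "bij (idx :: nat \<Rightarrow> nat \<times> 'n::finite)"
proof -
  have "infinite (UNIV :: (nat \<times> 'n) set)" by (simp add: finite_prod)
  then show ?thesis unfolding idx_def by (intro bij_betw_from_nat_into) auto
qed

lemma idx_inv:
  fixes p :: "nat \<times> 'n::finite"
  shows "idx (inv idx p) = p" "inv idx (idx k :: nat \<times> 'n) = k"
  using bij_idx[where 'n='n] by (simp_all add: bij_is_surj surj_f_inv_f bij_is_inj)

lemma pack_unpack: "pack (unpack X) = (X :: nat \<Rightarrow> real^'n)"
  by (simp add: pack_def unpack_def fun_eq_iff vec_eq_iff idx_inv)

lemma suminf_pack:
  fixes z :: "nat \<Rightarrow> real"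
  shows "(\<Sum>m. ennreal ((norm (pack z m :: real^'n))\<^sup>2)) = (\<Sum>k. ennreal ((z k)\<^sup>2))"
proof -
  have "(\<Sum>k. ennreal ((z k)\<^sup>2)) = (\<integral>\<^sup>+k. ennreal ((z k)\<^sup>2) \<partial>count_space UNIV)"
    by (simp add: nn_integral_count_space_nat)
  also have "\<dots> = (\<integral>\<^sup>+p. ennreal ((z (inv idx p))\<^sup>2) \<partial>count_space (UNIV :: (nat \<times> 'n) set))"
    using nn_integral_bij_count_space[OF bij_imp_bij_inv[OF bij_idx[where 'n='n]], of "\<lambda>k. ennreal ((z k)\<^sup>2)"] by simp
  also have "\<dots> = (\<integral>\<^sup>+m. \<integral>\<^sup>+i. ennreal ((z (inv idx (m, i :: 'n)))\<^sup>2) \<partial>count_space UNIV \<partial>count_space UNIV)"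
    by (rule nn_integral_fst_count_space[of "\<lambda>p. ennreal ((z (inv idx p))\<^sup>2)", simplified, symmetric])
  also have "\<dots> = (\<Sum>m. ennreal ((norm (pack z m :: real^'n))\<^sup>2))"
    by (simp add: nn_integral_count_space_nat nn_integral_count_space_finite sum_ennreal norm_vec_def L2_set_def sum_nonneg pack_def)
  finally show ?thesis by simp
qed

text \<open>A cylinder of scalars involves finitely many vectors, all of index below some
  \<open>2 ^ N\<close>. Filled up with \<open>UNIV\<close> in the other coordinates it becomes a box
  for these vectors, where independence at level \<open>N\<close> and the product form of the vector
  Gaussian give the product measure.\<close>

lemma distr_unpack:
  fixes X :: "nat \<Rightarrow> 'w \<Rightarrow> real^'n"
  assumes iid: "\<And>N. iid_gauss M {..<2 ^ N} X" and M: "prob_space M"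
  shows "(\<lambda>\<omega>. unpack (\<lambda>m. X m \<omega>)) \<in> M \<rightarrow>\<^sub>M gauss_seq"
    and "distr M gauss_seq (\<lambda>\<omega>. unpack (\<lambda>m. X m \<omega>)) = gauss_seq"
proof -
  have Xm[measurable]: "X m \<in> borel_measurable M" for m
    using iid[of m] by (auto simp: iid_gauss_def less_exp)
  show m[measurable]: "(\<lambda>\<omega>. unpack (\<lambda>m. X m \<omega>)) \<in> M \<rightarrow>\<^sub>M gauss_seq"
    by (rule measurable_PiM_single') (auto simp: unpack_def space_PiM)
  interpret gs: prob_space gauss_seq by (rule prob_space_gauss_seq)
  interpret gauss: prob_space gauss by (rule gauss_prob)
  interpret M: prob_space M by (rule M)
  interpret product_prob_space "\<lambda>_::nat. gauss" UNIV by standard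
  show "distr M gauss_seq (\<lambda>\<omega>. unpack (\<lambda>m. X m \<omega>)) = gauss_seq"
  proof (rule measure_eqI_PiM_infinite[where I=UNIV and M="\<lambda>_. gauss"])
    fix A and J :: "nat set" assume J: "finite J" and A: "\<And>i. i \<in> J \<Longrightarrow> A i \<in> sets gauss"
    let ?E = "prod_emb UNIV (\<lambda>_. gauss) J (Pi\<^sub>E J A)"
    have E[measurable]: "?E \<in> sets gauss_seq" using J A by (intro sets_PiM_I) auto
    have Em: "y \<in> ?E \<longleftrightarrow> (\<forall>i\<in>J. y i \<in> A i)" for y
      by (auto simp: prod_emb_def PiE_iff space_PiM)
    define N where "N = Suc (Max (insert 0 ((\<lambda>k. fst (idx k :: nat \<times> 'n)) ` J)))"
    have N: "fst (idx k :: nat \<times> 'n) < 2 ^ N" if "k \<in> J" for k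
    proof -
      have "fst (idx k :: nat \<times> 'n) < N" using that J by (auto simp: N_def less_Suc_eq_le intro!: Max_ge)
      then show ?thesis using less_exp[of N] by (rule less_trans)
    qed
    define A' where "A' p = (if inv idx p \<in> J then A (inv idx p) else UNIV)" for p :: "nat \<times> 'n"
    have A': "A' p \<in> sets borel" for p using A by (auto simp: A'_def)
    define B where "B m = {v :: real^'n. \<forall>i. v $ i \<in> A' (m, i)}" for m
    have Bm: "B m \<in> sets borel" for m
    proof -
      note [measurable] = A'
      show ?thesis unfolding B_def by measurable
    qed
    have "emeasure (distr M gauss_seq (\<lambda>\<omega>. unpack (\<lambda>m. X m \<omega>))) ?E
      = emeasure M {\<omega> \<in> space M. \<forall>k\<in>J. unpack (\<lambda>m. X m \<omega>) k \<in> A k}"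
      by (subst emeasure_distr[OF m E]) (auto simp: Em intro!: arg_cong[where f="emeasure M"])
    also have "{\<omega> \<in> space M. \<forall>k\<in>J. unpack (\<lambda>m. X m \<omega>) k \<in> A k} = {\<omega> \<in> space M. \<forall>m\<in>{..<2^N}. X m \<omega> \<in> B m}"
    proof -
      have "(\<forall>k\<in>J. unpack Y k \<in> A k) \<longleftrightarrow> (\<forall>m\<in>{..<2^N}. Y m \<in> B m)" for Y :: "nat \<Rightarrow> real^'n"
      proof
        assume L: "\<forall>k\<in>J. unpack Y k \<in> A k"
        show "\<forall>m\<in>{..<2^N}. Y m \<in> B m" unfolding B_def A'_def
        proof (intro ballI CollectI allI)
          fix m and i :: 'n
          show "Y m $ i \<in> (if inv idx (m, i) \<in> J then A (inv idx (m, i)) else UNIV)"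
            using L[rule_format, of "inv idx (m, i)"] by (simp add: unpack_def idx_inv)
        qed
      next
        assume R: "\<forall>m\<in>{..<2^N}. Y m \<in> B m"
        show "\<forall>k\<in>J. unpack Y k \<in> A k"
        proof
          fix k assume k: "k \<in> J"
          obtain m and i :: 'n where mi: "idx k = (m, i)" by (cases "idx k :: nat \<times> 'n") auto
          have ki: "inv idx (m, i) = k" using idx_inv(2)[of k, where 'n='n] mi by simp
          have "Y m $ i \<in> A' (m, i)" using R N[OF k] mi by (auto simp: B_def)
          then show "unpack Y k \<in> A k" using k ki mi by (simp add: A'_def unpack_def)
        qed
      qed
      then show ?thesis by simp
    qed
    also have "emeasure M \<dots> = (\<Prod>m\<in>{..<2^N}. emeasure vec_gauss (B m))"
      using iid[of N] Bm unfolding iid_gauss_def by blast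
    also have "\<dots> = (\<Prod>m\<in>{..<2^N}. \<Prod>i\<in>UNIV. emeasure gauss (A' (m, i)))"
      unfolding B_def by (intro prod.cong refl emeasure_vec_gauss_box A')
    also have "\<dots> = (\<Prod>p\<in>{..<2^N} \<times> UNIV. emeasure gauss (A' p))"
      by (simp add: prod.cartesian_product case_prod_unfold)
    also have "\<dots> = (\<Prod>p\<in>idx ` J. emeasure gauss (A' p))"
    proof (rule prod.mono_neutral_right)
      show "idx ` J \<subseteq> {..<2^N} \<times> (UNIV :: 'n set)"
      proof
        fix p :: "nat \<times> 'n" assume "p \<in> idx ` J"
        then obtain k where k: "k \<in> J" "p = idx k" by blast
        then show "p \<in> {..<2^N} \<times> (UNIV :: 'n set)" using N[OF k(1)] by (simp add: mem_Times_iff)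
      qed
      show "\<forall>p\<in>{..<2 ^ N} \<times> UNIV - idx ` J. emeasure gauss (A' p) = 1"
      proof
        fix p :: "nat \<times> 'n" assume "p \<in> {..<2 ^ N} \<times> UNIV - idx ` J"
        then have "inv idx p \<notin> J" using idx_inv(1)[of p] by (metis DiffD2 image_eqI)
        then show "emeasure gauss (A' p) = 1" using gauss.emeasure_space_1 by (simp add: A'_def)
      qed
    qed simp
    also have "\<dots> = (\<Prod>k\<in>J. emeasure gauss (A k))"
      using inj_on_subset[OF bij_is_inj[OF bij_idx[where 'n='n]] subset_UNIV, of J]
      by (subst prod.reindex) (auto simp: A'_def idx_inv intro!: prod.cong)
    also have "\<dots> = emeasure gauss_seq ?E"
      using J A by (subst emeasure_PiM_emb) auto
    finally show "emeasure (distr M gauss_seq (\<lambda>\<omega>. unpack (\<lambda>m. X m \<omega>))) ?E = emeasure gauss_seq ?E" .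
  next
    show "finite_measure (distr M gauss_seq (\<lambda>\<omega>. unpack (\<lambda>m. X m \<omega>)))"
      using M.prob_space_distr[OF m] by (simp add: prob_space_def)
  qed auto
qed

section \<open>Schauder expansions and the Cameron-Martin norm\<close>

text \<open>Recovers the normalised increments \<open>node\<close> from the Haar coefficients.\<close>

fun haar_synth :: "(nat \<Rightarrow> 'a::real_vector) \<Rightarrow> nat \<Rightarrow> 'a" where
  "haar_synth z m = (if m < 2 then z 0 else (1 / sqrt 2) *\<^sub>R
    (if even m then haar_synth z (m div 2) + z (m div 2) else haar_synth z (m div 2) - z (m div 2)))"

declare haar_synth.simps[simp del]

definition clamp01 :: "real \<Rightarrow> real" where
  "clamp01 x = max 0 (min 1 x)"

text \<open>Partial Haar series of level \<open>N\<close> at \<open>s\<close>: the normalized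
  increment of the dyadic interval containing \<open>s\<close>, rescaled to a slope.\<close>

definition haar_step :: "real \<Rightarrow> nat \<Rightarrow> (nat \<Rightarrow> 'a::real_vector) \<Rightarrow> real \<Rightarrow> 'a" where
  "haar_step T N z s = sqrt (2 ^ N / T) *\<^sub>R haar_synth z (2 ^ N + nat \<lfloor>s * 2 ^ N / T\<rfloor>)"

text \<open>Primitive of \<open>haar_step\<close>: each dyadic interval contributes a ramp, so the
  sum is the piecewise linear path with the given coefficients.\<close>

definition schauder :: "real \<Rightarrow> nat \<Rightarrow> (nat \<Rightarrow> 'a::real_vector) \<Rightarrow> real \<Rightarrow> 'a" where
  "schauder T N z t = (\<Sum>k<2 ^ N. (sqrt (T / 2 ^ N) * clamp01 (t * 2 ^ N / T - real k)) *\<^sub>R haar_synth z (2 ^ N + k))"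

lemma haar_synth_children:
  "1 \<le> m \<Longrightarrow> haar_synth z (2 * m) = (1 / sqrt 2) *\<^sub>R (haar_synth z m + z m)"
  "1 \<le> m \<Longrightarrow> haar_synth z (2 * m + 1) = (1 / sqrt 2) *\<^sub>R (haar_synth z m - z m)"
  by (subst haar_synth.simps, simp)+

lemma haar_synth_diff: "haar_synth (\<lambda>i. z i - z' i) m = haar_synth z m - haar_synth z' m"
proof (induction m rule: less_induct)
  case (less m)
  show ?case
  proof (cases "m < 2")
    case True then show ?thesis by (simp add: haar_synth.simps)
  next
    case False
    then have e: "haar_synth y m = (1 / sqrt 2) *\<^sub>R
      (if even m then haar_synth y (m div 2) + y (m div 2) else haar_synth y (m div 2) - y (m div 2))" for y :: "nat \<Rightarrow> 'a"
      by (subst haar_synth.simps) simp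
    have IH: "haar_synth (\<lambda>i. z i - z' i) (m div 2) = haar_synth z (m div 2) - haar_synth z' (m div 2)"
      using less.IH[of "m div 2"] False by simp
    show ?thesis unfolding e IH by (cases "even m") (simp_all add: scaleR_diff_right scaleR_right_distrib)
  qed
qed

lemma haar_synth_cong: "(\<And>i. i < 2 ^ N \<Longrightarrow> z i = z' i) \<Longrightarrow> m < 2 * 2 ^ N \<Longrightarrow> haar_synth z m = haar_synth z' m"
proof (induction m rule: less_induct)
  case (less m)
  show ?case
  proof (cases "m < 2")
    case True then show ?thesis using less.prems(1)[of 0] by (simp add: haar_synth.simps)
  next
    case False
    then have "m div 2 < 2 ^ N" "m div 2 < m" using less.prems(2) by auto
    then show ?thesis using less.IH[of "m div 2"] less.prems False by (subst (1 2) haar_synth.simps) simp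
  qed
qed

text \<open>Going down the tree inverts the orthogonal map level by level.\<close>

lemma haar_synth_haar:
  assumes T: "T > 0" and m: "1 \<le> m"
  shows "haar_synth (haar T w) m = node T w m"
  using m
proof (induction m rule: less_induct)
  case (less m)
  show ?case
  proof (cases "m < 2")
    case True
    then have "m = 1" using less.prems by simp
    then show ?thesis by (simp add: haar_synth.simps haar_def)
  next
    case False
    define k where "k = m div 2"
    have k: "1 \<le> k" "k < m" using False by (auto simp: k_def)
    have IH: "haar_synth (haar T w) k = node T w k" using less.IH k by simp
    have half: "(1 / sqrt 2) *\<^sub>R ((1 / sqrt 2) *\<^sub>R (x + x)) = x" for x :: 'a
      by (simp add: scaleR_2[symmetric])
    consider "m = 2 * k" | "m = 2 * k + 1" by (cases "even m") (auto simp: k_def)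
    then show ?thesis
    proof cases
      case 1
      show ?thesis unfolding 1 haar_synth_children(1)[OF k(1)] IH node_merge[OF k(1) T]
        using k half[of "node T w (2 * k)"] by (simp add: haar_def scaleR_right_distrib[symmetric])
    next
      case 2
      show ?thesis unfolding 2 haar_synth_children(2)[OF k(1)] IH node_merge[OF k(1) T]
        using k half[of "node T w (2 * k + 1)"] by (simp add: haar_def scaleR_diff_right[symmetric])
    qed
  qed
qed

lemma schauder_diff: "schauder T N (\<lambda>i. z i - z' i) t = schauder T N z t - schauder T N z' t"
  by (simp add: schauder_def haar_synth_diff scaleR_diff_right sum_subtractf)

lemma haar_step_diff: "haar_step T N (\<lambda>i. z i - z' i) t = haar_step T N z t - haar_step T N z' t"
  by (simp add: haar_step_def haar_synth_diff scaleR_diff_right)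

lemma schauder_0: assumes "T > 0" shows "schauder T N z 0 = 0"
  using assms by (simp add: schauder_def clamp01_def)

lemma continuous_on_schauder:
  assumes "T > 0" shows "continuous_on A (schauder T N (z :: nat \<Rightarrow> 'a::real_normed_vector))"
  unfolding schauder_def[abs_def] clamp01_def using assms by (intro continuous_intros) auto

lemma schauder_haar_eq:
  fixes w :: "real \<Rightarrow> 'a::real_normed_vector"
  assumes T: "T > 0"
  shows "schauder T N (haar T w) t
    = (\<Sum>k<2^N. clamp01 (t * 2 ^ N / T - real k) *\<^sub>R (w (T * real (Suc k) / 2 ^ N) - w (T * real k / 2 ^ N)))"
proof -
  define d where "d k = w (T * real k / 2 ^ N)" for k
  have tm: "(sqrt (T / 2 ^ N) * c) *\<^sub>R haar_synth (haar T w) (2 ^ N + k) = c *\<^sub>R (d (Suc k) - d k)" if "k < 2 ^ N" for k c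
  proof -
    have "haar_synth (haar T w) (2 ^ N + k) = sqrt (2 ^ N / T) *\<^sub>R (d (Suc k) - d k)"
    proof -
      have "1 \<le> 2 ^ N + k" by (rule trans_le_add1, rule one_le_power, simp)
      from haar_synth_haar[OF T this, of w] show ?thesis
        unfolding node_def haar_level_eq[OF that] d_def by (simp add: add.commute)
    qed
    moreover have "sqrt (T / 2 ^ N) * sqrt (2 ^ N / T) = 1" using T by (simp add: real_sqrt_mult[symmetric])
    ultimately show ?thesis by (simp add: mult.commute mult.left_commute)
  qed
  have "schauder T N (haar T w) t = (\<Sum>k<2^N. clamp01 (t * 2 ^ N / T - real k) *\<^sub>R (d (Suc k) - d k))"
    unfolding schauder_def by (intro sum.cong) (auto simp: tm)
  then show ?thesis unfolding d_def .
qed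

text \<open>For the coefficients of \<open>w\<close> the partial sum interpolates
  \<open>w - w 0\<close> on the grid. Elsewhere the error is an oscillation of \<open>w\<close>
  within one cell plus a fraction of one increment.\<close>

lemma schauder_haar:
  fixes w :: "real \<Rightarrow> 'a::real_normed_vector"
  assumes T: "T > 0" and t: "t \<in> {0..T}"
    and osc: "\<And>r s. r \<in> {0..T} \<Longrightarrow> s \<in> {0..T} \<Longrightarrow> \<bar>r - s\<bar> \<le> T / 2 ^ N \<Longrightarrow> norm (w r - w s) \<le> e"
  shows "norm (schauder T N (haar T w) t - (w t - w 0)) \<le> 2 * e"
proof -
  define d where "d k = w (T * real k / 2 ^ N)" for k
  have S: "schauder T N (haar T w) t = (\<Sum>k<2^N. clamp01 (t * 2 ^ N / T - real k) *\<^sub>R (d (Suc k) - d k))"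
    unfolding d_def by (rule schauder_haar_eq[OF T])
  have e0: "0 \<le> e" using osc[of 0 0] T by simp
  have grid: "T * real k / 2 ^ N \<in> {0..T}" if "k \<le> 2 ^ N" for k
  proof -
    have "real k \<le> 2 ^ N" using that by (metis of_nat_le_iff of_nat_numeral of_nat_power)
    then show ?thesis using T by (simp add: divide_le_eq)
  qed
  define x where "x = t * 2 ^ N / T"
  have tx: "t = T * x / 2 ^ N" using T by (simp add: x_def)
  have x: "0 \<le> x" "x \<le> 2 ^ N" using t T by (auto simp: x_def divide_le_eq mult.commute)
  show ?thesis
  \<comment> \<open>The right end point lies in no half-open cell; all ramps are complete
    there.\<close>
  proof (cases "x = 2 ^ N")
    case True
    have "schauder T N (haar T w) t = (\<Sum>k<2^N. d (Suc k) - d k)"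
      unfolding S x_def[symmetric] True
    proof (rule sum.cong)
      fix k :: nat assume "k \<in> {..<2^N}"
      then have "Suc k \<le> 2 ^ N" by simp
      then have "real (Suc k) \<le> 2 ^ N" by (metis of_nat_le_iff of_nat_numeral of_nat_power)
      then show "clamp01 (2 ^ N - real k) *\<^sub>R (d (Suc k) - d k) = d (Suc k) - d k" by (simp add: clamp01_def)
    qed simp
    also have "\<dots> = d (2 ^ N) - d 0" by (rule sum_lessThan_telescope)
    also have "\<dots> = w t - w 0" using True by (simp add: d_def tx)
    finally show ?thesis using e0 by simp
  next
    case False
    define j where "j = nat \<lfloor>x\<rfloor>"
    have j: "real j \<le> x" "x < real j + 1" using x by (auto simp: j_def)
    have jN: "j < 2 ^ N"
    proof -
      have "real j < 2 ^ N" using j x False by linarith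
      then show ?thesis by (metis of_nat_less_iff of_nat_numeral of_nat_power)
    qed
    have "schauder T N (haar T w) t = (\<Sum>k<2^N. if k < j then d (Suc k) - d k else if k = j then (x - real j) *\<^sub>R (d (Suc j) - d j) else 0)"
      unfolding S x_def[symmetric]
    proof (rule sum.cong)
      fix k :: nat
      consider "k < j" | "k = j" | "k > j" by linarith
      then show "clamp01 (x - real k) *\<^sub>R (d (Suc k) - d k) = (if k < j then d (Suc k) - d k else if k = j then (x - real j) *\<^sub>R (d (Suc j) - d j) else 0)"
        using j by cases (auto simp: clamp01_def)
    qed simp
    also have "\<dots> = (\<Sum>k<j. d (Suc k) - d k) + (x - real j) *\<^sub>R (d (Suc j) - d j)"
    proof -
      define q where "q k = (if k < j then d (Suc k) - d k else if k = j then (x - real j) *\<^sub>R (d (Suc j) - d j) else 0)" for k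
      have "{..<2^N} = insert j ({..<j} \<union> {Suc j..<2^N})" using jN by auto
      then have "sum q {..<2^N} = q j + sum q ({..<j} \<union> {Suc j..<2^N})" by simp
      also have "sum q ({..<j} \<union> {Suc j..<2^N}) = sum q {..<j} + sum q {Suc j..<2^N}"
        by (rule sum.union_disjoint) auto
      also have "sum q {Suc j..<2^N} = 0" by (rule sum.neutral) (auto simp: q_def)
      also have "sum q {..<j} = (\<Sum>k<j. d (Suc k) - d k)" by (rule sum.cong) (auto simp: q_def)
      finally show ?thesis by (simp add: q_def add.commute)
    qed
    also have "(\<Sum>k<j. d (Suc k) - d k) = d j - d 0" by (rule sum_lessThan_telescope)
    finally have E: "schauder T N (haar T w) t - (w t - w 0) = (d j - w t) + (x - real j) *\<^sub>R (d (Suc j) - d j)"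
      by (simp add: d_def)
    have "norm (d j - w t) \<le> e" unfolding d_def
    proof (rule osc[OF grid t])
      have "T * real j / 2 ^ N - t = - ((T / 2 ^ N) * (x - real j))" unfolding tx by (simp add: field_simps)
      then have "\<bar>T * real j / 2 ^ N - t\<bar> = (T / 2 ^ N) * (x - real j)" using j T by (simp add: abs_mult)
      also have "\<dots> \<le> (T / 2 ^ N) * 1" using j T by (intro mult_left_mono) auto
      finally show "\<bar>T * real j / 2 ^ N - t\<bar> \<le> T / 2 ^ N" by simp
    qed (use jN in simp)
    moreover have "norm (d (Suc j) - d j) \<le> e" unfolding d_def
    proof (rule osc[OF grid grid])
      have "T * real (Suc j) / 2 ^ N - T * real j / 2 ^ N = T / 2 ^ N" by (simp add: field_simps)
      then show "\<bar>T * real (Suc j) / 2 ^ N - T * real j / 2 ^ N\<bar> \<le> T / 2 ^ N" using T by simp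
    qed (use jN in simp_all)
    then have "norm ((x - real j) *\<^sub>R (d (Suc j) - d j)) \<le> 1 * e"
      unfolding norm_scaleR using j by (intro mult_mono) auto
    ultimately show ?thesis unfolding E using norm_triangle_ineq[of "d j - w t" "(x - real j) *\<^sub>R (d (Suc j) - d j)"] by linarith
  qed
qed

section \<open>Derivatives and energies of the partial sums\<close>

lemma clamp01_has_derivative:
  assumes "x \<noteq> 0" "x \<noteq> 1"
  shows "(clamp01 has_real_derivative (if 0 < x \<and> x < 1 then 1 else 0)) (at x)"
proof -
  consider "x < 0" | "0 < x" "x < 1" | "1 < x" using assms by linarith
  then show ?thesis
  proof cases
    case 1
    then have "((\<lambda>_. 0) has_real_derivative 0) (at x)" by simp
    then have "(clamp01 has_real_derivative 0) (at x)"
      by (rule has_field_derivative_transform_within_open[where S="{..<0}"]) (use 1 in \<open>auto simp: clamp01_def\<close>)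
    then show ?thesis using 1 by simp
  next
    case 2
    have "((\<lambda>y. y) has_real_derivative 1) (at x)" by simp
    then have "(clamp01 has_real_derivative 1) (at x)"
      by (rule has_field_derivative_transform_within_open[where S="{0<..<1}"]) (use 2 in \<open>auto simp: clamp01_def\<close>)
    then show ?thesis using 2 by simp
  next
    case 3
    then have "((\<lambda>_. 1) has_real_derivative 0) (at x)" by simp
    then have "(clamp01 has_real_derivative 0) (at x)"
      by (rule has_field_derivative_transform_within_open[where S="{1<..}"]) (use 3 in \<open>auto simp: clamp01_def\<close>)
    then show ?thesis using 3 by simp
  qed
qed

definition grid :: "real \<Rightarrow> nat \<Rightarrow> real set" where
  "grid T N = (\<lambda>k. T * real k / 2 ^ N) ` {..2 ^ N}"

text \<open>Off the grid exactly one ramp is rising, that of the cell containing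
  \<open>s\<close>.\<close>

lemma schauder_has_derivative:
  fixes z :: "nat \<Rightarrow> 'a::real_normed_vector"
  assumes T: "T > 0" and s: "s \<in> {0<..<T} - grid T N"
  shows "(schauder T N z has_vector_derivative haar_step T N z s) (at s)"
proof -
  define x where "x = s * 2 ^ N / T"
  have sx: "s = T * x / 2 ^ N" using T by (simp add: x_def)
  have x: "0 < x" "x < 2 ^ N" using s T by (auto simp: x_def divide_less_eq mult.commute)
  have xk: "x \<noteq> real k" if "k \<le> 2 ^ N" for k
    using s that unfolding sx grid_def by auto
  define j where "j = nat \<lfloor>x\<rfloor>"
  have j: "real j \<le> x" "x < real j + 1" using x by (auto simp: j_def)
  have jN: "j < 2 ^ N"
  proof -
    have "real j < 2 ^ N" using j x by linarith
    then show ?thesis by (metis of_nat_less_iff of_nat_numeral of_nat_power)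
  qed
  have d: "((\<lambda>t. clamp01 (t * 2 ^ N / T - real k)) has_real_derivative (if k = j then 2 ^ N / T else 0)) (at s)"
    if k: "k < 2 ^ N" for k
  proof -
    have n: "s * 2 ^ N / T - real k \<noteq> 0" "s * 2 ^ N / T - real k \<noteq> 1"
      using xk[of k] xk[of "Suc k"] k unfolding x_def[symmetric] by auto
    have iff: "(0 < s * 2 ^ N / T - real k \<and> s * 2 ^ N / T - real k < 1) = (k = j)"
      unfolding x_def[symmetric] using j xk[of k] k by (cases k j rule: linorder_cases) auto
    have "((\<lambda>t. t * 2 ^ N / T - real k) has_real_derivative 2 ^ N / T) (at s)"
      using T by (auto intro!: derivative_eq_intros)
    from DERIV_chain2[OF clamp01_has_derivative[OF n] this] show ?thesis unfolding iff
      by (cases "k = j") simp_all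
  qed
  have d': "((\<lambda>t. (sqrt (T / 2 ^ N) * clamp01 (t * 2 ^ N / T - real k)) *\<^sub>R v) has_vector_derivative
    (sqrt (T / 2 ^ N) * (if k = j then 2 ^ N / T else 0)) *\<^sub>R v) (at s)" if k: "k < 2 ^ N" for k and v :: 'a
    using has_vector_derivative_scaleR[OF DERIV_cmult[OF d[OF k], of "sqrt (T / 2 ^ N)"] has_vector_derivative_const[of v]] by simp
  have "(schauder T N z has_vector_derivative (\<Sum>k<2^N. (sqrt (T / 2 ^ N) * (if k = j then 2 ^ N / T else 0)) *\<^sub>R haar_synth z (2 ^ N + k))) (at s)"
    unfolding schauder_def[abs_def]
    by (intro has_vector_derivative_sum d') auto
  also have "(\<Sum>k<2^N. (sqrt (T / 2 ^ N) * (if k = j then 2 ^ N / T else 0)) *\<^sub>R haar_synth z (2 ^ N + k)) = haar_step T N z s"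
  proof -
    have "(\<Sum>k<2^N. (sqrt (T / 2 ^ N) * (if k = j then 2 ^ N / T else 0)) *\<^sub>R haar_synth z (2 ^ N + k))
      = (\<Sum>k<2^N. if k = j then (sqrt (T / 2 ^ N) * (2 ^ N / T)) *\<^sub>R haar_synth z (2 ^ N + j) else 0)"
      by (intro sum.cong) auto
    also have "\<dots> = (sqrt (T / 2 ^ N) * (2 ^ N / T)) *\<^sub>R haar_synth z (2 ^ N + j)" using jN by simp
    also have "sqrt (T / 2 ^ N) * (2 ^ N / T) = sqrt (2 ^ N / T)"
    proof -
      have "2 ^ N / T = sqrt (2 ^ N / T) * sqrt (2 ^ N / T)" using T by simp
      moreover have "sqrt (T / 2 ^ N) * sqrt (2 ^ N / T) = 1" using T by (simp add: real_sqrt_mult[symmetric])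
      ultimately show ?thesis by (metis mult.assoc mult_1)
    qed
    finally show ?thesis by (simp add: haar_step_def j_def x_def)
  qed
  finally show ?thesis .
qed

lemma finite_grid: "finite (grid T N)"
  by (simp add: grid_def)

lemma schauder_has_integral:
  fixes z :: "nat \<Rightarrow> 'a::banach"
  assumes T: "T > 0" and t: "t \<in> {0..T}"
  shows "(haar_step T N z has_integral schauder T N z t) {0..t}"
proof -
  have "(haar_step T N z has_integral schauder T N z t - schauder T N z 0) {0..t}"
    by (rule fundamental_theorem_of_calculus_interior_strong[OF finite_grid[of T N]])
       (use t in \<open>auto intro!: schauder_has_derivative T continuous_on_schauder[OF T]\<close>)
  then show ?thesis by (simp add: schauder_0[OF T])
qed

lemma parallelogram: "(norm ((1 / sqrt 2) *\<^sub>R (a + b)))\<^sup>2 + (norm ((1 / sqrt 2) *\<^sub>R (a - b)))\<^sup>2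
    = (norm a)\<^sup>2 + (norm (b :: 'a::real_inner))\<^sup>2"
proof -
  have h: "(norm ((1 / sqrt 2) *\<^sub>R v))\<^sup>2 = (1/2) * (norm v)\<^sup>2" for v :: 'a
    by (simp add: power_mult_distrib power_divide)
  have "(norm (a + b))\<^sup>2 + (norm (a - b))\<^sup>2 = 2 * (norm a)\<^sup>2 + 2 * (norm b)\<^sup>2"
    by (simp add: power2_norm_eq_inner inner_add inner_diff inner_commute)
  then show ?thesis unfolding h by simp
qed

text \<open>Parseval's identity, level by level: by the parallelogram law, passing to the halves
  adds exactly the squares of the new coefficients.\<close>

lemma sum_haar_synth_sq:
  fixes z :: "nat \<Rightarrow> 'a::real_inner"
  shows "(\<Sum>k<2^N. (norm (haar_synth z (2 ^ N + k)))\<^sup>2) = (\<Sum>m<2^N. (norm (z m))\<^sup>2)"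
proof (induction N)
  case 0 then show ?case by (simp add: haar_synth.simps)
next
  case (Suc N)
  have split: "(\<Sum>k<2 * n. g k) = (\<Sum>k<n. g (2 * k) + g (2 * k + 1))" for g :: "nat \<Rightarrow> real" and n
    by (induction n) (auto simp: algebra_simps)
  have "(\<Sum>k<2^Suc N. (norm (haar_synth z (2 ^ Suc N + k)))\<^sup>2)
    = (\<Sum>k<2^N. (norm (haar_synth z (2 * (2 ^ N + k))))\<^sup>2 + (norm (haar_synth z (2 * (2 ^ N + k) + 1)))\<^sup>2)"
    using split[of "\<lambda>k. (norm (haar_synth z (2 ^ Suc N + k)))\<^sup>2" "2 ^ N"] by (simp add: algebra_simps)
  also have "\<dots> = (\<Sum>k<2^N. (norm (haar_synth z (2 ^ N + k)))\<^sup>2 + (norm (z (2 ^ N + k)))\<^sup>2)"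
    by (intro sum.cong refl, subst haar_synth_children, simp, subst haar_synth_children, simp) (rule parallelogram)
  also have "\<dots> = (\<Sum>m<2^N. (norm (z m))\<^sup>2) + (\<Sum>k<2^N. (norm (z (2 ^ N + k)))\<^sup>2)"
    by (simp add: sum.distrib Suc.IH)
  also have "(\<Sum>k<2^N. (norm (z (2 ^ N + k)))\<^sup>2) = (\<Sum>m=2^N..<2^N+2^N. (norm (z m))\<^sup>2)"
    using sum.shift_bounds_nat_ivl[of "\<lambda>m. (norm (z m))\<^sup>2" 0 "2 ^ N" "2 ^ N"] by (simp add: lessThan_atLeast0 add.commute)
  also have "(\<Sum>m<2^N. (norm (z m))\<^sup>2) + (\<Sum>m=2^N..<2^N+2^N. (norm (z m))\<^sup>2) = (\<Sum>m<2^Suc N. (norm (z m))\<^sup>2)"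
    using sum.atLeastLessThan_concat[of 0 "2^N" "2^N+2^N" "\<lambda>m. (norm (z m))\<^sup>2"] by (simp add: lessThan_atLeast0 mult_2)
  finally show ?case .
qed

text \<open>Parseval's identity for the velocity. The interval is half-open because at
  \<open>s = T\<close> the index \<open>2 ^ N + 2 ^ N\<close> already belongs to the next level of
  the tree.\<close>

lemma haar_step_nn_integral:
  fixes z :: "nat \<Rightarrow> 'a::euclidean_space"
  assumes T: "T > 0"
  shows "(\<integral>\<^sup>+s. ennreal ((norm (haar_step T N z s))\<^sup>2) * indicator {0..<T} s \<partial>lborel) = ennreal (\<Sum>m<2^N. (norm (z m))\<^sup>2)"
proof -
  let ?a = "\<lambda>k. T * real k / 2 ^ N"
  have "(\<integral>\<^sup>+s. ennreal ((norm (haar_step T N z s))\<^sup>2) * indicator {0..<T} s \<partial>lborel)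
    = (\<integral>\<^sup>+s. (\<Sum>k<2^N. ennreal ((2 ^ N / T) * (norm (haar_synth z (2 ^ N + k)))\<^sup>2) * indicator {?a k..<?a (Suc k)} s) \<partial>lborel)"
  proof (rule nn_integral_cong)
    fix s
    define x where "x = s * 2 ^ N / T"
    have sx: "s = T * x / 2 ^ N" using T by (simp add: x_def)
    have I: "s \<in> {?a k..<?a (Suc k)} \<longleftrightarrow> real k \<le> x \<and> x < real k + 1" for k
      unfolding sx using T by (simp add: divide_le_cancel divide_less_cancel add.commute)
    show "ennreal ((norm (haar_step T N z s))\<^sup>2) * indicator {0..<T} s
      = (\<Sum>k<2^N. ennreal ((2 ^ N / T) * (norm (haar_synth z (2 ^ N + k)))\<^sup>2) * indicator {?a k..<?a (Suc k)} s)"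
    proof (cases "s \<in> {0..<T}")
      case True
      then have x: "0 \<le> x" "x < 2 ^ N" using T by (auto simp: x_def divide_less_eq mult.commute)
      define j where "j = nat \<lfloor>x\<rfloor>"
      have j: "real j \<le> x" "x < real j + 1" using x by (auto simp: j_def)
      have jN: "j < 2 ^ N"
      proof -
        have "real j < 2 ^ N" using j x by linarith
        then show ?thesis by (metis of_nat_less_iff of_nat_numeral of_nat_power)
      qed
      have "(\<Sum>k<2^N. ennreal ((2 ^ N / T) * (norm (haar_synth z (2 ^ N + k)))\<^sup>2) * indicator {?a k..<?a (Suc k)} s)
        = (\<Sum>k<2^N. if k = j then ennreal ((2 ^ N / T) * (norm (haar_synth z (2 ^ N + j)))\<^sup>2) else 0)"
      proof (rule sum.cong)
        fix k :: nat
        have "s \<in> {?a k..<?a (Suc k)} \<longleftrightarrow> k = j" unfolding I using j by (cases k j rule: linorder_cases) auto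
        then show "ennreal ((2 ^ N / T) * (norm (haar_synth z (2 ^ N + k)))\<^sup>2) * indicator {?a k..<?a (Suc k)} s
          = (if k = j then ennreal ((2 ^ N / T) * (norm (haar_synth z (2 ^ N + j)))\<^sup>2) else 0)"
          by (simp add: indicator_def)
      qed simp
      also have "\<dots> = ennreal ((2 ^ N / T) * (norm (haar_synth z (2 ^ N + j)))\<^sup>2)" using jN by simp
      also have "(2 ^ N / T) * (norm (haar_synth z (2 ^ N + j)))\<^sup>2 = (norm (haar_step T N z s))\<^sup>2"
        unfolding haar_step_def j_def x_def using T by (simp add: power_mult_distrib)
      finally show ?thesis using True by simp
    next
      case False
      have out: "s \<notin> {?a k..<?a (Suc k)}" if "k < 2 ^ N" for k
      proof
        assume "s \<in> {?a k..<?a (Suc k)}"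
        then have kx: "real k \<le> x" "x < real k + 1" by (simp_all only: I)
        have "Suc k \<le> 2 ^ N" using that by simp
        then have "real (Suc k) \<le> 2 ^ N" by (metis of_nat_le_iff of_nat_numeral of_nat_power)
        then have "0 \<le> x" "x < 2 ^ N" using kx by auto
        then have "0 \<le> s" "s < T" using T by (auto simp: sx divide_less_eq)
        then show False using False by simp
      qed
      have "(\<Sum>k<2^N. ennreal ((2 ^ N / T) * (norm (haar_synth z (2 ^ N + k)))\<^sup>2) * indicator {?a k..<?a (Suc k)} s) = 0"
      proof (intro sum.neutral ballI)
        fix k :: nat assume "k \<in> {..<2^N}"
        then have "indicator {?a k..<?a (Suc k)} s = (0 :: ennreal)"
          by (intro indicator_simps(2) out) simp
        then show "ennreal ((2 ^ N / T) * (norm (haar_synth z (2 ^ N + k)))\<^sup>2) * indicator {?a k..<?a (Suc k)} s = 0"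
          by (simp only: mult_zero_right)
      qed
      moreover have "indicator {0..<T} s = (0 :: ennreal)" using False by (rule indicator_simps(2))
      ultimately show ?thesis by (simp only: mult_zero_right)
    qed
  qed
  also have "\<dots> = (\<Sum>k<2^N. \<integral>\<^sup>+s. ennreal ((2 ^ N / T) * (norm (haar_synth z (2 ^ N + k)))\<^sup>2) * indicator {?a k..<?a (Suc k)} s \<partial>lborel)"
    by (rule nn_integral_sum) auto
  also have "\<dots> = (\<Sum>k<2^N. ennreal ((norm (haar_synth z (2 ^ N + k)))\<^sup>2))"
  proof (rule sum.cong)
    fix k
    have le: "?a k \<le> ?a (Suc k)" using T by (intro divide_right_mono mult_left_mono) auto
    have "?a (Suc k) - ?a k = T / 2 ^ N" by (simp add: field_simps)
    then have "(\<integral>\<^sup>+s. ennreal ((2 ^ N / T) * (norm (haar_synth z (2 ^ N + k)))\<^sup>2) * indicator {?a k..<?a (Suc k)} s \<partial>lborel)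
      = ennreal ((2 ^ N / T) * (norm (haar_synth z (2 ^ N + k)))\<^sup>2) * ennreal (T / 2 ^ N)"
      using le by (subst nn_integral_cmult_indicator) auto
    also have "\<dots> = ennreal ((norm (haar_synth z (2 ^ N + k)))\<^sup>2)"
      using T by (subst ennreal_mult[symmetric]) (auto simp: field_simps)
    finally show "(\<integral>\<^sup>+s. ennreal ((2 ^ N / T) * (norm (haar_synth z (2 ^ N + k)))\<^sup>2) * indicator {?a k..<?a (Suc k)} s \<partial>lborel)
      = ennreal ((norm (haar_synth z (2 ^ N + k)))\<^sup>2)" .
  qed simp
  also have "\<dots> = ennreal (\<Sum>m<2^N. (norm (z m))\<^sup>2)" by (simp add: sum_ennreal sum_haar_synth_sq)
  finally show ?thesis .
qed

lemma measurable_haar_step[measurable]: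
  fixes z :: "nat \<Rightarrow> 'a::euclidean_space"
  shows "haar_step T N z \<in> borel_measurable borel"
proof -
  have [measurable]: "(\<lambda>k::nat. haar_synth z (2 ^ N + k)) \<in> borel_measurable (count_space UNIV)" by simp
  show ?thesis unfolding haar_step_def by measurable
qed

text \<open>Where the coefficients vanish, an increment is split evenly between the halves, and the
  factor \<open>1 / sqrt 2\<close> is compensated by the finer normalization.\<close>

lemma haar_step_refine:
  assumes T: "T > 0" and s: "0 \<le> s" and z: "\<And>m. 2 ^ N \<le> m \<Longrightarrow> m < 2 ^ M \<Longrightarrow> z m = 0" and NM: "N \<le> M" and sT: "s < T"
  shows "haar_step T M z s = haar_step T N z s"
  using NM z
proof (induction rule: dec_induct)
  case (step n)
  have IH: "haar_step T n z s = haar_step T N z s" using step by (auto intro!: step.IH step.prems less_le_trans[OF _ power_increasing])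
  define x where "x = s * 2 ^ n / T"
  define j where "j = nat \<lfloor>x\<rfloor>"
  define i where "i = nat \<lfloor>2 * x\<rfloor>"
  have x: "0 \<le> x" "x < 2 ^ n" using T s sT by (auto simp: x_def divide_less_eq mult.commute)
  have j: "real j \<le> x" "x < real j + 1" using x by (auto simp: j_def)
  have i: "real i \<le> 2 * x" "2 * x < real i + 1" using x by (auto simp: i_def)
  have jn: "j < 2 ^ n"
  proof -
    have "real j < 2 ^ n" using j x by linarith
    then show ?thesis by (metis of_nat_less_iff of_nat_numeral of_nat_power)
  qed
  have "2 ^ N \<le> (2::nat) ^ n" using step by (intro power_increasing) auto
  then have "2 ^ N \<le> 2 ^ n + j" by linarith
  moreover have "2 ^ n + j < 2 ^ Suc n" using jn by simp
  ultimately have z0: "z (2 ^ n + j) = 0" by (rule step.prems)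
  have m1: "1 \<le> 2 ^ n + j" by (simp add: trans_le_add1)
  consider "i = 2 * j" | "i = 2 * j + 1" using i j by linarith
  then have "haar_synth z (2 ^ Suc n + i) = (1 / sqrt 2) *\<^sub>R haar_synth z (2 ^ n + j)"
  proof cases
    case 1
    then have "2 ^ Suc n + i = 2 * (2 ^ n + j)" by simp
    then show ?thesis using haar_synth_children(1)[OF m1, of z] z0 by simp
  next
    case 2
    then have "2 ^ Suc n + i = 2 * (2 ^ n + j) + 1" by simp
    then show ?thesis using haar_synth_children(2)[OF m1, of z] z0 by simp
  qed
  moreover have "s * 2 ^ Suc n / T = 2 * x" by (simp add: x_def)
  moreover have "sqrt (2 ^ Suc n / T) * (1 / sqrt 2) = sqrt (2 ^ n / T)"
    by (simp add: real_sqrt_mult real_sqrt_divide)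
  ultimately have "haar_step T (Suc n) z s = haar_step T n z s"
    unfolding haar_step_def by (simp add: i_def[symmetric] j_def[symmetric] x_def[symmetric])
  then show ?case using IH by simp
qed simp

text \<open>A difference of partial sums is the partial sum of the tail coefficients, so its energy
  is a piece of the tail of the series of squares and the partial sums are Cauchy in L2.\<close>

lemma haar_step_tail:
  fixes z :: "nat \<Rightarrow> 'a::real_vector"
  assumes T: "T > 0" and s: "s \<in> {0..<T}" and NM: "N \<le> M"
  shows "haar_step T M z s - haar_step T N z s = haar_step T M (\<lambda>m. if m < 2 ^ N then 0 else z m) s"
proof -
  define y where "y m = (if m < 2 ^ N then z m else 0)" for m
  have "haar_step T N z s = haar_step T N y s"
  proof -
    have "s * 2 ^ N / T < 2 ^ N" using T s by (auto simp: divide_less_eq mult.commute)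
    moreover have "0 \<le> s * 2 ^ N / T" using T s by simp
    ultimately have "real (nat \<lfloor>s * 2 ^ N / T\<rfloor>) < 2 ^ N" by linarith
    then have "nat \<lfloor>s * 2 ^ N / T\<rfloor> < 2 ^ N" by (metis of_nat_less_iff of_nat_numeral of_nat_power)
    then show ?thesis unfolding haar_step_def by (subst haar_synth_cong[of N z y]) (auto simp: y_def)
  qed
  also have "\<dots> = haar_step T M y s" using s NM by (intro haar_step_refine[symmetric] T) (auto simp: y_def)
  finally have "haar_step T M z s - haar_step T N z s = haar_step T M (\<lambda>m. z m - y m) s" by (simp add: haar_step_diff)
  also have "(\<lambda>m. z m - y m) = (\<lambda>m. if m < 2 ^ N then 0 else z m)" by (auto simp: y_def)
  finally show ?thesis .
qed

text \<open>The series of the Haar expansion need not converge absolutely, so its limit is taken along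
  a subsequence of the dyadic levels whose tails decay geometrically.\<close>

lemma CM_density_of_schauder_limit:
  fixes c :: "nat \<Rightarrow> real^'n" and u :: "real \<Rightarrow> real^'n"
  assumes T: "T > 0" and c: "summable (\<lambda>m. (norm (c m))\<^sup>2)"
    and u: "\<And>t. t \<in> {0..T} \<Longrightarrow> (\<lambda>N. schauder T N c t) \<longlonglongrightarrow> u t"
  shows "\<exists>h. CM_density T u h \<and> (\<integral>\<^sup>+s. ennreal ((norm (h s))\<^sup>2) * indicator {0..T} s \<partial>lborel) \<le> ennreal (\<Sum>m. (norm (c m))\<^sup>2)"
proof -
  let ?S = "\<Sum>m. (norm (c m))\<^sup>2"
  define f where "f N s = indicator {0..<T} s *\<^sub>R haar_step T N c s" for N s
  have fm[measurable]: "f N \<in> borel_measurable borel" for N unfolding f_def by measurable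
  have f2: "(\<integral>\<^sup>+s. ennreal ((norm (f N s))\<^sup>2) \<partial>lborel) \<le> ennreal ?S" for N
  proof -
    have "(\<integral>\<^sup>+s. ennreal ((norm (f N s))\<^sup>2) \<partial>lborel) = ennreal (\<Sum>m<2^N. (norm (c m))\<^sup>2)"
      unfolding haar_step_nn_integral[OF T, symmetric] f_def by (intro nn_integral_cong) (auto simp: indicator_def)
    also have "\<dots> \<le> ennreal ?S" by (intro ennreal_leI sum_le_suminf c) auto
    finally show ?thesis .
  qed
  \<comment> \<open>A tail of squares of size \<open>(1/4) ^ j\<close> is an L2 norm of size
    \<open>(1/2) ^ j\<close>, which makes the differences \<open>g j\<close> below summable.\<close>
  have "\<exists>n. \<forall>j. (\<Sum>m. (norm (c (m + 2 ^ n j)))\<^sup>2) \<le> (1/4) ^ j \<and> n j < n (Suc j)"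
  proof (rule dependent_nat_choice)
    have ev: "\<forall>\<^sub>F k in sequentially. (\<Sum>m. (norm (c (m + k)))\<^sup>2) < e" if "e > 0" for e
      using order_tendstoD(2)[OF suminf_exist_split2[OF c] that] .
    show "\<exists>x. (\<Sum>m. (norm (c (m + 2 ^ x)))\<^sup>2) \<le> (1/4) ^ 0"
    proof -
      obtain k0 where k0: "\<And>k. k \<ge> k0 \<Longrightarrow> (\<Sum>m. (norm (c (m + k)))\<^sup>2) < 1"
        using ev[of 1] unfolding eventually_sequentially by auto
      have "k0 \<le> 2 ^ k0" using less_exp[of k0] by simp
      from k0[OF this] show ?thesis by (intro exI[of _ k0]) simp
    qed
    fix x j
    obtain k0 where k0: "\<And>k. k \<ge> k0 \<Longrightarrow> (\<Sum>m. (norm (c (m + k)))\<^sup>2) < (1/4) ^ Suc j"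
      using ev[of "(1/4) ^ Suc j"] unfolding eventually_sequentially by auto
    have "k0 \<le> 2 ^ max k0 (Suc x)"
      by (rule order_trans[OF max.cobounded1[of k0 "Suc x"] less_imp_le[OF less_exp]])
    from k0[OF this] show "\<exists>y. (\<Sum>m. (norm (c (m + 2 ^ y)))\<^sup>2) \<le> (1/4) ^ Suc j \<and> x < y"
      by (intro exI[of _ "max k0 (Suc x)"]) auto
  qed
  then obtain n where n: "\<And>j. (\<Sum>m. (norm (c (m + 2 ^ n j)))\<^sup>2) \<le> (1/4) ^ j" "\<And>j. n j < n (Suc j)" by blast
  have n_mono: "strict_mono n" using n(2) by (simp add: strict_mono_Suc_iff)
  define g where "g j s = f (n (Suc j)) s - f (n j) s" for j s
  have gm[measurable]: "g j \<in> borel_measurable borel" for j unfolding g_def by measurable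
  have g2: "(\<integral>\<^sup>+s. ennreal ((norm (g j s))\<^sup>2) \<partial>lborel) \<le> ennreal ((1/4) ^ j)" for j
  proof -
    let ?y = "\<lambda>m. if m < 2 ^ n j then 0 else c m"
    have "(\<integral>\<^sup>+s. ennreal ((norm (g j s))\<^sup>2) \<partial>lborel) = ennreal (\<Sum>m<2^n (Suc j). (norm (?y m))\<^sup>2)"
      unfolding haar_step_nn_integral[OF T, symmetric]
    proof (rule nn_integral_cong)
      fix s
      show "ennreal ((norm (g j s))\<^sup>2) = ennreal ((norm (haar_step T (n (Suc j)) ?y s))\<^sup>2) * indicator {0..<T} s"
        using haar_step_tail[OF T, of s "n j" "n (Suc j)" c] n(2)[of j]
        by (auto simp: g_def f_def indicator_def)
    qed
    also have "(\<Sum>m<2^n (Suc j). (norm (?y m))\<^sup>2) = (\<Sum>m=2^n j..<2^n (Suc j). (norm (c m))\<^sup>2)"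
      by (rule sum.mono_neutral_cong_right) auto
    also have "\<dots> = (\<Sum>m<2^n (Suc j) - 2^n j. (norm (c (m + 2 ^ n j)))\<^sup>2)"
      using n(2)[of j] sum.shift_bounds_nat_ivl[of "\<lambda>m. (norm (c m))\<^sup>2" 0 "2 ^ n j" "2^n (Suc j) - 2^n j"]
      by (simp add: lessThan_atLeast0)
    also have "\<dots> \<le> (\<Sum>m. (norm (c (m + 2 ^ n j)))\<^sup>2)"
      by (intro sum_le_suminf) (auto simp: summable_iff_shift[of "\<lambda>m. (norm (c m))\<^sup>2"] c)
    also have "\<dots> \<le> (1/4) ^ j" by (rule n)
    finally show ?thesis by (simp add: ennreal_leI)
  qed
  \<comment> \<open>On an interval of length \<open>T\<close> the inequality
    \<open>r \<le> q / 2 * r\<^sup>2 + 1 / (2 * q)\<close> with \<open>q = 2 ^ j\<close> turns the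
    L2 bound into the L1 bound \<open>(1 + T) / 2 * (1/2) ^ j\<close>.\<close>
  define K where "K = (1 + T) / 2"
  have g1: "(\<integral>\<^sup>+s. ennreal (norm (g j s)) \<partial>lborel) \<le> ennreal (K * (1/2) ^ j)" for j
  proof -
    have "(\<integral>\<^sup>+s. ennreal (norm (g j s)) \<partial>lborel)
      \<le> (\<integral>\<^sup>+s. ennreal (2 ^ j / 2) * ennreal ((norm (g j s))\<^sup>2) + ennreal ((1/2) ^ j / 2) * indicator {0..<T} s \<partial>lborel)"
    proof (rule nn_integral_mono)
      fix s
      show "ennreal (norm (g j s)) \<le> ennreal (2 ^ j / 2) * ennreal ((norm (g j s))\<^sup>2) + ennreal ((1/2) ^ j / 2) * indicator {0..<T} s"
      proof (cases "s \<in> {0..<T}")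
        case True
        define q :: real where "q = 2 ^ j"
        have q: "q > 0" "(1/2) ^ j = 1 / q" by (simp_all add: q_def power_one_over)
        have "0 \<le> (q * norm (g j s) - 1)\<^sup>2 / (2 * q)" using q by simp
        also have "\<dots> = q / 2 * (norm (g j s))\<^sup>2 + 1 / q / 2 - norm (g j s)"
          using q by (simp add: power2_eq_square field_simps)
        finally have "norm (g j s) \<le> q / 2 * (norm (g j s))\<^sup>2 + 1 / q / 2" by simp
        then have "ennreal (norm (g j s)) \<le> ennreal (q / 2 * (norm (g j s))\<^sup>2 + 1 / q / 2)" by (rule ennreal_leI)
        also have "\<dots> = ennreal (q / 2) * ennreal ((norm (g j s))\<^sup>2) + ennreal (1 / q / 2)"
          using q ennreal_mult[of "q / 2" "(norm (g j s))\<^sup>2"] by (subst ennreal_plus) auto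
        finally show ?thesis using True by (simp add: q q_def)
      qed (simp add: g_def f_def)
    qed
    also have "\<dots> = ennreal (2 ^ j / 2) * (\<integral>\<^sup>+s. ennreal ((norm (g j s))\<^sup>2) \<partial>lborel) + ennreal ((1/2) ^ j / 2) * ennreal T"
      using T by (subst nn_integral_add) (auto simp: nn_integral_cmult nn_integral_cmult_indicator)
    also have "\<dots> \<le> ennreal (2 ^ j / 2) * ennreal ((1/4) ^ j) + ennreal ((1/2) ^ j / 2) * ennreal T"
      by (intro add_mono mult_left_mono g2) auto
    also have "\<dots> = ennreal (2 ^ j / 2 * (1/4) ^ j + (1/2) ^ j / 2 * T)"
      using T ennreal_mult[of "2 ^ j / 2" "(1/4) ^ j"] ennreal_mult[of "(1/2) ^ j / 2" T]
      by (subst ennreal_plus) auto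
    also have "2 ^ j / 2 * (1/4) ^ j + (1/2) ^ j / 2 * T = K * (1/2) ^ j"
    proof -
      have "2 ^ j * (1/4) ^ j = ((1/2) ^ j :: real)" by (simp add: power_mult_distrib[symmetric])
      then show ?thesis by (simp add: K_def field_simps)
    qed
    finally show ?thesis .
  qed
  have g_int: "integrable lborel (g j)" for j
    using g1[of j] by (intro integrableI_bounded) (auto intro: le_less_trans)
  have f_int: "integrable lborel (f N)" for N
  proof -
    have "set_integrable lborel {0..<T} (\<lambda>s. 1 + (norm (haar_step T N c s))\<^sup>2)"
    proof -
      have "integrable lborel (\<lambda>s. (norm (f N s))\<^sup>2)"
        using f2[of N] by (intro integrableI_bounded) (auto intro: le_less_trans)
      then have "set_integrable lborel {0..<T} (\<lambda>s. (norm (haar_step T N c s))\<^sup>2)"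
        unfolding set_integrable_def by (rule Bochner_Integration.integrable_cong[THEN iffD1, rotated 2]) (auto simp: f_def indicator_def)
      moreover have "integrable lborel (indicat_real {0..<T})" using T by (intro integrable_real_indicator) auto
      ultimately show ?thesis by (intro set_integral_add) (auto simp: set_integrable_def)
    qed
    then show ?thesis unfolding set_integrable_def
    proof (rule Bochner_Integration.integrable_bound)
      have r: "r \<le> 1 + r\<^sup>2" for r :: real using zero_le_power2[of "r - 1/2"] by (simp add: power2_eq_square algebra_simps)
      show "AE s in lborel. norm (f N s) \<le> norm (indicat_real {0..<T} s *\<^sub>R (1 + (norm (haar_step T N c s))\<^sup>2))"
      proof (rule AE_I2)
        fix s
        show "norm (f N s) \<le> norm (indicat_real {0..<T} s *\<^sub>R (1 + (norm (haar_step T N c s))\<^sup>2))"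
          using r[of "norm (haar_step T N c s)"] by (simp add: f_def indicator_def)
      qed
    qed simp
  qed
  have gnorm: "(\<integral>s. norm (g j s) \<partial>lborel) \<le> K * (1/2) ^ j" for j
  proof -
    have "ennreal (\<integral>s. norm (g j s) \<partial>lborel) = (\<integral>\<^sup>+s. ennreal (norm (g j s)) \<partial>lborel)"
      using g_int by (intro nn_integral_eq_integral[symmetric]) auto
    also note g1
    finally show ?thesis using T by (subst (asm) ennreal_le_iff) (auto simp: K_def)
  qed
  have gsum: "summable (\<lambda>j. \<integral>s. norm (g j s) \<partial>lborel)"
    by (rule summable_comparison_test'[where g="\<lambda>j. K * (1/2) ^ j" and N=0])
       (use gnorm in \<open>auto intro!: summable_mult summable_geometric\<close>)
  have gAE: "AE s in lborel. summable (\<lambda>j. norm (g j s))"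
  proof -
    have "(\<integral>\<^sup>+s. (\<Sum>j. ennreal (norm (g j s))) \<partial>lborel) = (\<Sum>j. \<integral>\<^sup>+s. ennreal (norm (g j s)) \<partial>lborel)"
      by (rule nn_integral_suminf) auto
    also have "\<dots> \<le> (\<Sum>j. ennreal (K * (1/2) ^ j))" by (intro suminf_le g1) auto
    also have "\<dots> = ennreal (\<Sum>j. K * (1/2) ^ j)"
      using T by (intro suminf_ennreal2) (auto simp: K_def intro!: summable_mult summable_geometric)
    finally have "(\<integral>\<^sup>+s. (\<Sum>j. ennreal (norm (g j s))) \<partial>lborel) \<noteq> \<infinity>" by (auto simp: top_unique)
    then have "AE s in lborel. (\<Sum>j. ennreal (norm (g j s))) \<noteq> \<infinity>"
      by (intro nn_integral_noteq_infinite) auto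
    then show ?thesis by eventually_elim (auto intro!: summable_suminf_not_top)
  qed
  \<comment> \<open>Telescoping limit of the partial sums along \<open>n\<close>, which exists in L1
    and almost everywhere.\<close>
  define h where "h s = f (n 0) s + (\<Sum>j. g j s)" for s
  have h_int: "integrable lborel h" unfolding h_def
    by (intro Bochner_Integration.integrable_add f_int integrable_suminf g_int gAE gsum)
  then have hm[measurable]: "h \<in> borel_measurable borel" using borel_measurable_integrable[OF h_int] by simp
  have part: "f (n 0) s + (\<Sum>j<J. g j s) = f (n J) s" for J s
  proof -
    have "(\<Sum>j<J. g j s) = f (n J) s - f (n 0) s" unfolding g_def by (rule sum_lessThan_telescope)
    then show ?thesis by simp
  qed
  have lim: "AE s in lborel. (\<lambda>J. f (n J) s) \<longlonglongrightarrow> h s"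
    using gAE
  proof eventually_elim
    case (elim s)
    have "(\<lambda>J. \<Sum>j<J. g j s) \<longlonglongrightarrow> (\<Sum>j. g j s)" by (rule summable_LIMSEQ[OF summable_norm_cancel[OF elim]])
    from tendsto_add[OF tendsto_const[of "f (n 0) s"] this] show ?case unfolding part h_def .
  qed
  \<comment> \<open>Fatou's lemma along the subsequence gives the energy bound from almost
    everywhere convergence alone.\<close>
  have h2: "(\<integral>\<^sup>+s. ennreal ((norm (h s))\<^sup>2) \<partial>lborel) \<le> ennreal ?S"
  proof -
    have "(\<integral>\<^sup>+s. ennreal ((norm (h s))\<^sup>2) \<partial>lborel) = (\<integral>\<^sup>+s. liminf (\<lambda>J. ennreal ((norm (f (n J) s))\<^sup>2)) \<partial>lborel)"
    proof (rule nn_integral_cong_AE)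
      show "AE s in lborel. ennreal ((norm (h s))\<^sup>2) = liminf (\<lambda>J. ennreal ((norm (f (n J) s))\<^sup>2))"
        using lim
      proof eventually_elim
        case (elim s)
        have "(\<lambda>J. ennreal ((norm (f (n J) s))\<^sup>2)) \<longlonglongrightarrow> ennreal ((norm (h s))\<^sup>2)"
          by (intro tendsto_ennrealI tendsto_intros elim)
        from lim_imp_Liminf[OF _ this] show ?case by simp
      qed
    qed
    also have "\<dots> \<le> liminf (\<lambda>J. \<integral>\<^sup>+s. ennreal ((norm (f (n J) s))\<^sup>2) \<partial>lborel)"
      by (rule nn_integral_liminf) measurable
    also have "\<dots> \<le> liminf (\<lambda>J::nat. ennreal ?S)" by (intro Liminf_mono always_eventually allI f2)
    finally show ?thesis by (simp add: Liminf_const)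
  qed
  have hi2: "integrable lborel (\<lambda>s. (norm (h s))\<^sup>2)"
    using h2 by (intro integrableI_bounded) (auto intro: le_less_trans)
  have ut: "u t = set_lebesgue_integral lborel {0..t} h" if t: "t \<in> {0..T}" for t
  proof -
    have si: "integrable lborel (\<lambda>s. indicat_real {0..t} s *\<^sub>R k s)" if "integrable lborel k" for k :: "real \<Rightarrow> real^'n"
      using integrable_mult_indicator[of "{0..t}" lborel k] that by simp
    have gt: "(\<lambda>j. \<integral>s. indicat_real {0..t} s *\<^sub>R g j s \<partial>lborel) sums (\<integral>s. (\<Sum>j. indicat_real {0..t} s *\<^sub>R g j s) \<partial>lborel)"
    proof (rule sums_integral)
      show "AE s in lborel. summable (\<lambda>j. norm (indicat_real {0..t} s *\<^sub>R g j s))"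
        using gAE by eventually_elim (auto simp: indicator_def)
      show "summable (\<lambda>j. \<integral>s. norm (indicat_real {0..t} s *\<^sub>R g j s) \<partial>lborel)"
      proof (rule summable_comparison_test'[OF gsum, where N=0])
        fix j
        have "(\<integral>s. norm (indicat_real {0..t} s *\<^sub>R g j s) \<partial>lborel) \<le> (\<integral>s. norm (g j s) \<partial>lborel)"
          by (intro integral_mono integrable_norm si g_int) (auto simp: indicator_def)
        then show "norm (\<integral>s. norm (indicat_real {0..t} s *\<^sub>R g j s) \<partial>lborel) \<le> (\<integral>s. norm (g j s) \<partial>lborel)"
          by simp
      qed
    qed (intro si g_int)
    have l0: "(\<lambda>J. (\<integral>s. indicat_real {0..t} s *\<^sub>R f (n 0) s \<partial>lborel) + (\<Sum>j<J. \<integral>s. indicat_real {0..t} s *\<^sub>R g j s \<partial>lborel))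
      \<longlonglongrightarrow> (\<integral>s. indicat_real {0..t} s *\<^sub>R f (n 0) s \<partial>lborel) + (\<integral>s. (\<Sum>j. indicat_real {0..t} s *\<^sub>R g j s) \<partial>lborel)"
      using gt by (intro tendsto_add tendsto_const) (simp add: sums_def)
    have e1: "(\<integral>s. indicat_real {0..t} s *\<^sub>R f (n 0) s \<partial>lborel) + (\<Sum>j<J. \<integral>s. indicat_real {0..t} s *\<^sub>R g j s \<partial>lborel)
        = (\<integral>s. indicat_real {0..t} s *\<^sub>R f (n J) s \<partial>lborel)" for J
    proof -
      have "(\<integral>s. indicat_real {0..t} s *\<^sub>R f (n J) s \<partial>lborel)
        = (\<integral>s. indicat_real {0..t} s *\<^sub>R f (n 0) s + (\<Sum>j<J. indicat_real {0..t} s *\<^sub>R g j s) \<partial>lborel)"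
        unfolding part[of _ J, symmetric] scaleR_right_distrib scaleR_sum_right ..
      also have "\<dots> = (\<integral>s. indicat_real {0..t} s *\<^sub>R f (n 0) s \<partial>lborel) + (\<integral>s. (\<Sum>j<J. indicat_real {0..t} s *\<^sub>R g j s) \<partial>lborel)"
        by (intro Bochner_Integration.integral_add Bochner_Integration.integrable_sum si f_int g_int)
      also have "(\<integral>s. (\<Sum>j<J. indicat_real {0..t} s *\<^sub>R g j s) \<partial>lborel) = (\<Sum>j<J. \<integral>s. indicat_real {0..t} s *\<^sub>R g j s \<partial>lborel)"
        by (intro Bochner_Integration.integral_sum si g_int)
      finally show ?thesis by (rule sym)
    qed
    have e2: "(\<integral>s. indicat_real {0..t} s *\<^sub>R f (n J) s \<partial>lborel) = schauder T (n J) c t" for J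
    proof -
      \<comment> \<open>\<open>f\<close> is cut off at \<open>T\<close> and \<open>haar_step\<close>
        is not, so for \<open>t = T\<close> the two may differ at one point.\<close>
      have seq: "AE s in lborel. indicat_real {0..t} s *\<^sub>R f (n J) s = indicat_real {0..t} s *\<^sub>R haar_step T (n J) c s"
        using AE_lborel_singleton[of T] by eventually_elim (use t in \<open>auto simp: f_def indicator_def\<close>)
      have "set_integrable lborel {0..t} (haar_step T (n J) c)"
        unfolding set_integrable_def using seq
        by (rule integrable_cong_AE_imp[rotated 2, where g="\<lambda>s. indicat_real {0..t} s *\<^sub>R f (n J) s"])
           (auto intro!: si f_int elim!: eventually_mono)
      then have "set_lebesgue_integral lborel {0..t} (haar_step T (n J) c) = integral {0..t} (haar_step T (n J) c)"
        by (rule set_borel_integral_eq_integral(2))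
      also have "\<dots> = schauder T (n J) c t" by (rule integral_unique[OF schauder_has_integral[OF T t]])
      finally show "(\<integral>s. indicat_real {0..t} s *\<^sub>R f (n J) s \<partial>lborel) = schauder T (n J) c t"
        unfolding set_lebesgue_integral_def using seq by (subst integral_cong_AE[OF _ _ seq]) auto
    qed
    have l1: "(\<lambda>J. schauder T (n J) c t) \<longlonglongrightarrow>
      (\<integral>s. indicat_real {0..t} s *\<^sub>R f (n 0) s \<partial>lborel) + (\<integral>s. (\<Sum>j. indicat_real {0..t} s *\<^sub>R g j s) \<partial>lborel)"
      using l0[unfolded e1, unfolded e2] unfolding e2 .
    have "(\<lambda>J. schauder T (n J) c t) \<longlonglongrightarrow> u t"
      using LIMSEQ_subseq_LIMSEQ[OF u[OF t] n_mono] by (simp add: comp_def)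
    from LIMSEQ_unique[OF this l1] have "u t = (\<integral>s. indicat_real {0..t} s *\<^sub>R f (n 0) s \<partial>lborel) + (\<integral>s. (\<Sum>j. indicat_real {0..t} s *\<^sub>R g j s) \<partial>lborel)" .
    also have "(\<integral>s. (\<Sum>j. indicat_real {0..t} s *\<^sub>R g j s) \<partial>lborel) = (\<integral>s. indicat_real {0..t} s *\<^sub>R (\<Sum>j. g j s) \<partial>lborel)"
      by (intro Bochner_Integration.integral_cong) (auto simp: indicator_def)
    also have "(\<integral>s. indicat_real {0..t} s *\<^sub>R f (n 0) s \<partial>lborel) + \<dots> = (\<integral>s. indicat_real {0..t} s *\<^sub>R h s \<partial>lborel)"
      unfolding h_def scaleR_right_distrib
      by (intro Bochner_Integration.integral_add[symmetric] si f_int integrable_suminf g_int gAE gsum)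
    finally show ?thesis by (simp add: set_lebesgue_integral_def)
  qed
  have "CM_density T u h" unfolding CM_density_def
  proof (intro conjI ballI)
    show "set_integrable lborel {0..T} (\<lambda>s. (norm (h s))\<^sup>2)"
      unfolding set_integrable_def by (rule integrable_mult_indicator[OF _ hi2]) simp
  qed (auto simp: ut)
  moreover have "(\<integral>\<^sup>+s. ennreal ((norm (h s))\<^sup>2) * indicator {0..T} s \<partial>lborel) \<le> ennreal ?S"
    by (rule order_trans[OF nn_integral_mono h2]) (auto simp: indicator_def)
  ultimately show ?thesis by blast
qed

section \<open>Uniqueness of the density and the Cameron-Martin norm\<close>

lemma CM_density_integrable:
  fixes h :: "real \<Rightarrow> real^'n"
  assumes "CM_density T D h"
  shows "set_integrable lborel {0..T} h"
proof -
  have hm[measurable]: "h \<in> borel_measurable borel" and h2: "set_integrable lborel {0..T} (\<lambda>s. (norm (h s))\<^sup>2)"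
    using assms by (auto simp: CM_density_def)
  have i: "integrable lborel (indicat_real {0..T})"
    by (intro integrable_real_indicator) (auto simp: emeasure_lborel_Icc_eq)
  have "set_integrable lborel {0..T} (\<lambda>s. 1 + (norm (h s))\<^sup>2)"
    by (intro set_integral_add h2) (use i in \<open>simp add: set_integrable_def\<close>)
  then show ?thesis unfolding set_integrable_def
  proof (rule Bochner_Integration.integrable_bound)
    have r: "r \<le> 1 + r\<^sup>2" for r :: real using zero_le_power2[of "r - 1/2"] by (simp add: power2_eq_square algebra_simps)
    show "AE s in lborel. norm (indicat_real {0..T} s *\<^sub>R h s) \<le> norm (indicat_real {0..T} s *\<^sub>R (1 + (norm (h s))\<^sup>2))"
    proof (rule AE_I2)
      fix s
      show "norm (indicat_real {0..T} s *\<^sub>R h s) \<le> norm (indicat_real {0..T} s *\<^sub>R (1 + (norm (h s))\<^sup>2))"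
        using r[of "norm (h s)"] by (simp add: indicator_def)
    qed
  qed simp
qed

text \<open>The norm refers to a density picked by choice, so uniqueness is what makes it
  accessible. The difference of two densities has integral 0 over every half-line, hence over every
  Borel set, as half-lines generate the Borel sets and are stable under intersection; so it vanishes
  almost everywhere.\<close>

lemma CM_density_unique:
  fixes h h' :: "real \<Rightarrow> real^'n"
  assumes h: "CM_density T D h" and h': "CM_density T D h'"
  shows "AE s in lborel. s \<in> {0..T} \<longrightarrow> h s = h' s"
proof -
  define k where "k s = indicat_real {0..T} s *\<^sub>R (h s - h' s)" for s
  note hi = CM_density_integrable[OF h] and hi' = CM_density_integrable[OF h']
  have k: "integrable lborel k"
    using set_integral_diff(1)[OF hi hi'] unfolding set_integrable_def k_def .
  have ki: "set_integrable lborel A k" if "A \<in> sets borel" for A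
    using integrable_mult_indicator[of A lborel k] k that by (simp add: set_integrable_def)
  have sub: "set_integrable lborel {0..t} f" if "set_integrable lborel {0..T} f" "t \<le> T" for t and f :: "real \<Rightarrow> real^'n"
    by (rule set_integrable_subset[OF that(1)]) (use that(2) in auto)
  have zero: "set_lebesgue_integral lborel {..a} k = 0" for a
  proof -
    have "set_lebesgue_integral lborel {..a} k = set_lebesgue_integral lborel {0..min a T} (\<lambda>s. h s - h' s)"
    proof -
      have "indicat_real {..a} s * indicat_real {0..T} s = indicat_real {0..min a T} s" for s
        by (simp add: indicator_def)
      then show ?thesis unfolding set_lebesgue_integral_def k_def scaleR_scaleR by (simp only:)
    qed
    also have "\<dots> = set_lebesgue_integral lborel {0..min a T} h - set_lebesgue_integral lborel {0..min a T} h'"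
      by (rule set_integral_diff(2)[OF sub[OF hi] sub[OF hi']]) auto
    also have "\<dots> = 0"
    proof (cases "0 \<le> min a T")
      case True
      then have "min a T \<in> {0..T}" by auto
      then have "D (min a T) = set_lebesgue_integral lborel {0..min a T} h" "D (min a T) = set_lebesgue_integral lborel {0..min a T} h'"
        using h h' unfolding CM_density_def by blast+
      then show ?thesis by simp
    next
      case False
      then have "{0..min a T} = {}" by auto
      then show ?thesis by (simp add: set_lebesgue_integral_def)
    qed
    finally show ?thesis .
  qed
  have all: "(\<integral>s. k s \<partial>lborel) = 0"
  proof -
    have "(\<integral>s. k s \<partial>lborel) = set_lebesgue_integral lborel {..T} k"
    proof -
      have "indicat_real {..T} s * indicat_real {0..T} s = indicat_real {0..T} s" for s
        by (simp add: indicator_def)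
      then show ?thesis unfolding set_lebesgue_integral_def k_def scaleR_scaleR by (simp only:)
    qed
    then show ?thesis by (simp add: zero)
  qed
  have "AE s in lborel. k s = 0"
  proof (rule sigma_finite_measure.density_zero[OF sigma_finite_lborel k])
    fix A assume A: "A \<in> sets (lborel :: real measure)"
    have stable: "Int_stable (range (\<lambda>a::real. {..a}))"
      by (auto simp: Int_stable_def Int_atMost)
    have range_pow: "range (\<lambda>a::real. {..a}) \<subseteq> Pow UNIV" by simp
    have sb: "sigma_sets UNIV (range (\<lambda>a::real. {..a})) = sets borel"
      unfolding borel_eq_atMost by simp
    then have "A \<in> sigma_sets UNIV (range (\<lambda>a::real. {..a}))" using A by simp
    then show "set_lebesgue_integral lborel A k = 0"
    proof (induction rule: sigma_sets_induct_disjoint[OF stable range_pow, consumes 1, case_names basic empty compl union])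
      case (compl A)
      then have Ab: "A \<in> sets borel" by (simp add: sb)
      have "(\<integral>s. k s \<partial>lborel) = set_lebesgue_integral lborel ((UNIV - A) \<union> A) k"
        by (simp add: set_lebesgue_integral_def)
      also have "\<dots> = set_lebesgue_integral lborel (UNIV - A) k + set_lebesgue_integral lborel A k"
        using Ab by (intro set_integral_Un ki) auto
      finally show ?case using compl all by simp
    next
      case (union A)
      then have Ab: "\<And>i. A i \<in> sets borel" by (auto simp: sb)
      have "set_lebesgue_integral lborel (\<Union>i. A i) k = (\<Sum>i. set_lebesgue_integral lborel (A i) k)"
        using union(1) Ab by (intro lebesgue_integral_countable_add ki) (auto simp: disjoint_family_on_def)
      then show ?case using union by simp
    qed (use zero in \<open>auto simp: set_lebesgue_integral_def\<close>)
  qed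
  then show ?thesis by eventually_elim (auto simp: k_def)
qed

text \<open>By uniqueness a bound for any one density is a bound for the chosen one.\<close>

lemma CM_norm_le:
  fixes h :: "real \<Rightarrow> real^'n"
  assumes h: "CM_density T D h"
    and E: "(\<integral>\<^sup>+s. ennreal ((norm (h s))\<^sup>2) * indicator {0..T} s \<partial>lborel) \<le> ennreal E" "0 \<le> E"
  shows "(CM_norm T D)\<^sup>2 \<le> E"
proof -
  define h0 where "h0 = (SOME h. CM_density T D h)"
  have h0: "CM_density T D h0" unfolding h0_def by (rule someI[of "CM_density T D", OF h])
  have [measurable]: "h \<in> borel_measurable borel" "h0 \<in> borel_measurable borel"
    using h h0 by (auto simp: CM_density_def)
  have "set_lebesgue_integral lborel {0..T} (\<lambda>s. (norm (h0 s))\<^sup>2) = set_lebesgue_integral lborel {0..T} (\<lambda>s. (norm (h s))\<^sup>2)"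
    unfolding set_lebesgue_integral_def
  proof (rule integral_cong_AE)
    show "AE s in lborel. indicat_real {0..T} s *\<^sub>R (norm (h0 s))\<^sup>2 = indicat_real {0..T} s *\<^sub>R (norm (h s))\<^sup>2"
      using CM_density_unique[OF h0 h] by eventually_elim (auto simp: indicator_def)
  qed measurable
  also have "\<dots> \<le> E"
  proof -
    have si: "set_integrable lborel {0..T} (\<lambda>s. (norm (h s))\<^sup>2)" using h by (simp add: CM_density_def)
    have "ennreal (set_lebesgue_integral lborel {0..T} (\<lambda>s. (norm (h s))\<^sup>2))
      = (\<integral>\<^sup>+s. ennreal (indicat_real {0..T} s *\<^sub>R (norm (h s))\<^sup>2) \<partial>lborel)"
      unfolding set_lebesgue_integral_def
      by (rule nn_integral_eq_integral[symmetric]) (use si in \<open>auto simp: set_integrable_def\<close>)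
    also have "\<dots> = (\<integral>\<^sup>+s. ennreal ((norm (h s))\<^sup>2) * indicator {0..T} s \<partial>lborel)"
      by (intro nn_integral_cong) (auto simp: indicator_def)
    also note E(1)
    finally show ?thesis using E(2) by (simp add: ennreal_le_iff)
  qed
  finally have "set_lebesgue_integral lborel {0..T} (\<lambda>s. (norm (h0 s))\<^sup>2) \<le> E" .
  moreover have "0 \<le> set_lebesgue_integral lborel {0..T} (\<lambda>s. (norm (h0 s))\<^sup>2)"
    unfolding set_lebesgue_integral_def by (intro integral_nonneg_AE) auto
  ultimately show ?thesis unfolding CM_norm_def h0_def[symmetric] by simp
qed

lemma haar_step_square_integral:
  fixes c :: "nat \<Rightarrow> 'a::euclidean_space"
  assumes T: "T > 0" and t: "t \<in> {0..T}"
  shows "(\<lambda>s. (norm (haar_step T N c s))\<^sup>2) integrable_on {0..t}"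
    and "integral {0..t} (\<lambda>s. (norm (haar_step T N c s))\<^sup>2) \<le> (\<Sum>m<2^N. (norm (c m))\<^sup>2)"
proof -
  let ?f = "\<lambda>s. (norm (haar_step T N c s))\<^sup>2"
  have le: "(\<integral>\<^sup>+s. ennreal (indicat_real {0..t} s *\<^sub>R ?f s) \<partial>lborel) \<le> ennreal (\<Sum>m<2^N. (norm (c m))\<^sup>2)"
    unfolding haar_step_nn_integral[OF T, symmetric]
  proof (rule nn_integral_mono_AE)
    show "AE s in lborel. ennreal (indicat_real {0..t} s *\<^sub>R ?f s) \<le> ennreal (?f s) * indicator {0..<T} s"
      using AE_lborel_singleton[of T]
    proof eventually_elim
      case (elim s)
      then show ?case using t by (cases "s \<in> {0..t}") (simp_all add: indicator_def)
    qed
  qed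
  have si: "set_integrable lborel {0..t} ?f" unfolding set_integrable_def
    using le by (intro integrableI_bounded) (auto simp: indicator_def intro: le_less_trans)
  then show "?f integrable_on {0..t}" by (rule set_borel_integral_eq_integral(1))
  have "ennreal (integral {0..t} ?f) = ennreal (\<integral>s. indicat_real {0..t} s *\<^sub>R ?f s \<partial>lborel)"
    using set_borel_integral_eq_integral(2)[OF si] by (simp add: set_lebesgue_integral_def)
  also have "\<dots> = (\<integral>\<^sup>+s. ennreal (indicat_real {0..t} s *\<^sub>R ?f s) \<partial>lborel)"
    by (rule nn_integral_eq_integral[symmetric]) (use si in \<open>auto simp: set_integrable_def\<close>)
  also note le
  finally show "integral {0..t} ?f \<le> (\<Sum>m<2^N. (norm (c m))\<^sup>2)"
    by (subst (asm) ennreal_le_iff) (auto intro: sum_nonneg)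
qed

section \<open>The energy estimate\<close>

text \<open>\<open>D\<close> is the difference of two solutions, \<open>u\<close> that of the driving paths and \<open>\<beta>\<close> that of
  the drifts.\<close>

locale perturbed_flow =
  fixes T K B C :: real and c :: "nat \<Rightarrow> 'a::euclidean_space" and D u \<beta> :: "real \<Rightarrow> 'a"
  assumes T: "T > 0" and C: "\<And>N. (\<Sum>m<2^N. (norm (c m))\<^sup>2) \<le> C"
    and u: "uniform_limit {0..T} (\<lambda>N. schauder T N c) u sequentially"
    and D: "\<And>t. t \<in> {0..T} \<Longrightarrow> D t = u t + integral {0..t} \<beta>"
    and Dcont: "continuous_on {0..T} D"
    and \<beta>cont: "continuous_on {0..T} \<beta>"
    and K: "\<And>t. t \<in> {0..T} \<Longrightarrow> norm (\<beta> t) \<le> K * norm (D t)"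
    and B: "\<And>t. t \<in> {0..T} \<Longrightarrow> D t \<bullet> \<beta> t \<le> B * (norm (D t))\<^sup>2"
begin

lemma C_nonneg: "0 \<le> C"
  using C[of 0] by (intro order_trans[OF _ C[of 0]] sum_nonneg) auto

text \<open>Differentiate \<open>\<rho> |D|\<^sup>2\<close> and split \<open>2 \<langle>D, u'\<rangle> \<le> lam |D|\<^sup>2 + |u'|\<^sup>2 / lam\<close>, with \<open>u\<close>
  replaced by its piecewise linear Schauder approximations.\<close>

lemma energy_step:
  fixes \<rho> \<rho>' lam :: "real \<Rightarrow> real"
  assumes t: "t \<in> {0..T}"
    and \<rho>: "\<And>s. s \<in> {0..T} \<Longrightarrow> (\<rho> has_real_derivative \<rho>' s) (at s)" "\<And>s. s \<in> {0..T} \<Longrightarrow> 0 < \<rho> s"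
    and lam: "\<And>s. s \<in> {0..T} \<Longrightarrow> 0 < lam s" "\<And>s. s \<in> {0..T} \<Longrightarrow> \<rho> s \<le> q * lam s"
    and cont: "continuous_on {0..T} \<rho>'" "continuous_on {0..T} lam"
  shows "\<rho> t * (norm (D t))\<^sup>2 \<le> integral {0..t} (\<lambda>s. (\<rho>' s + \<rho> s * lam s + 2 * B * \<rho> s) * (norm (D s))\<^sup>2) + q * C"
proof -
  have \<rho>cont: "continuous_on {0..T} \<rho>"
    by (intro continuous_at_imp_continuous_on ballI DERIV_isCont[OF \<rho>(1)]) auto
  have q: "0 \<le> q"
  proof -
    have "0 < q * lam 0" using lam(2)[of 0] \<rho>(2)[of 0] T by force
    then show ?thesis using lam(1)[of 0] T by (simp add: zero_less_mult_iff less_imp_le)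
  qed
  have bdd: "\<exists>A\<ge>0. \<forall>s\<in>{0..T}. norm (f s) \<le> A" if "continuous_on {0..T} f" for f :: "real \<Rightarrow> 'b::real_normed_vector"
  proof -
    have "bounded (f ` {0..T})" by (intro compact_imp_bounded compact_continuous_image that) simp
    then obtain A where A: "\<forall>y\<in>f ` {0..T}. norm y \<le> A" unfolding bounded_iff by blast
    show ?thesis
    proof (intro exI[of _ "max A 0"] conjI ballI)
      fix s assume "s \<in> {0..T}"
      then have "norm (f s) \<le> A" using A by blast
      then show "norm (f s) \<le> max A 0" by simp
    qed simp
  qed
  \<comment> \<open>What stands before the squared norm, apart from the drift term, once
    \<open>lam\<close> has absorbed the cross term with the velocity of \<open>u\<close>.\<close>
  define a where "a s = \<rho>' s + \<rho> s * lam s" for s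
  have acont: "continuous_on {0..T} a" unfolding a_def by (intro continuous_intros cont \<rho>cont)
  obtain A where A: "A \<ge> 0" "\<And>s. s \<in> {0..T} \<Longrightarrow> \<bar>a s\<bar> \<le> A" using bdd[OF acont] by auto
  obtain P where P: "P \<ge> 0" "\<And>s. s \<in> {0..T} \<Longrightarrow> \<bar>\<rho> s\<bar> \<le> P" using bdd[OF \<rho>cont] by auto
  obtain R where R: "R \<ge> 0" "\<And>s. s \<in> {0..T} \<Longrightarrow> norm (D s) \<le> R" using bdd[OF Dcont] by auto
  obtain b0 where b0: "b0 \<ge> 0" "\<And>s. s \<in> {0..T} \<Longrightarrow> norm (\<beta> s) \<le> b0" using bdd[OF \<beta>cont] by auto
  let ?G = "\<lambda>s. (a s + 2 * B * \<rho> s) * (norm (D s))\<^sup>2"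
  \<comment> \<open>\<open>X\<close> bounds the error in the integrand and \<open>Z\<close> the
    total error, both per unit of \<open>e\<close>, when \<open>D\<close> is replaced by an
    approximation within \<open>e\<close>; the 1 in \<open>2 * R + 1\<close> absorbs
    \<open>e \<le> 1\<close>.\<close>
  define X where "X = A * (2 * R + 1) + 2 * P * b0"
  define Z where "Z = T * X + P * (2 * R + 1)"
  have Z0: "0 \<le> Z" unfolding Z_def X_def using A(1) P(1) R(1) b0(1) T by auto
  have sub: "{0..t} \<subseteq> {0..T}" using t by auto
  have Gint: "?G integrable_on {0..t}"
    by (intro integrable_continuous_real continuous_on_subset[OF _ sub] continuous_intros acont \<rho>cont Dcont)
  have main: "\<rho> t * (norm (D t))\<^sup>2 \<le> (integral {0..t} ?G + q * C) + e * Z" if e: "0 < e" "e \<le> 1" for e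
  proof -
    obtain N where "\<forall>s\<in>{0..T}. dist (schauder T N c s) (u s) < e"
      using uniform_limitD[OF u e(1)] unfolding eventually_sequentially by blast
    note N = bspec[OF this]
    \<comment> \<open>\<open>u\<close> is given only as a uniform limit, so \<open>D\<close> cannot
      be differentiated directly; \<open>DN\<close> is differentiable off a finite grid and stays
      within \<open>e\<close> of \<open>D\<close>.\<close>
    define DN where "DN s = schauder T N c s + integral {0..s} \<beta>" for s
    have close: "norm (DN s - D s) \<le> e" if "s \<in> {0..T}" for s
      using N[OF that] D[OF that] by (simp add: DN_def dist_norm)
    have \<beta>int: "continuous_on {0..T} (\<lambda>s. integral {0..s} \<beta>)"
      by (rule indefinite_integral_continuous_1) (rule integrable_continuous_real[OF \<beta>cont])
    have DNcont: "continuous_on {0..T} DN" unfolding DN_def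
      by (intro continuous_intros \<beta>int continuous_on_schauder T)
    have DNd: "(DN has_vector_derivative haar_step T N c s + \<beta> s) (at s)" if s: "s \<in> {0<..<T} - grid T N" for s
    proof -
      have "((\<lambda>s. integral {0..s} \<beta>) has_vector_derivative \<beta> s) (at s within {0..T})"
        by (rule integral_has_vector_derivative[OF \<beta>cont]) (use s in auto)
      then have "((\<lambda>s. integral {0..s} \<beta>) has_vector_derivative \<beta> s) (at s)"
        using s by (simp add: at_within_Icc_at)
      then show ?thesis unfolding DN_def[abs_def]
        by (intro has_vector_derivative_add schauder_has_derivative T s)
    qed
    define I where "I s = \<rho>' s * (norm (DN s))\<^sup>2 + 2 * \<rho> s * (DN s \<bullet> (haar_step T N c s + \<beta> s))" for s
    have "(I has_integral \<rho> t * (norm (DN t))\<^sup>2 - \<rho> 0 * (norm (DN 0))\<^sup>2) {0..t}"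
    proof (rule fundamental_theorem_of_calculus_interior_strong[OF finite_grid[of T N]])
      fix s assume "s \<in> {0<..<t} - grid T N"
      then have s: "s \<in> {0<..<T} - grid T N" "s \<in> {0..T}" using t by auto
      have "((\<lambda>s. DN s \<bullet> DN s) has_real_derivative DN s \<bullet> (haar_step T N c s + \<beta> s) + (haar_step T N c s + \<beta> s) \<bullet> DN s) (at s)"
        using DNd[OF s(1)] unfolding has_real_derivative_iff_has_vector_derivative
        by (auto simp: has_vector_derivative_def inner_add_left inner_add_right algebra_simps intro!: derivative_eq_intros)
      from DERIV_mult[OF \<rho>(1)[OF s(2)] this]
      show "((\<lambda>s. \<rho> s * (norm (DN s))\<^sup>2) has_vector_derivative I s) (at s)"
        unfolding has_real_derivative_iff_has_vector_derivative[symmetric] power2_norm_eq_inner I_def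
        by (simp add: inner_commute algebra_simps)
    qed (use t in \<open>auto intro!: continuous_intros continuous_on_subset[OF \<rho>cont] continuous_on_subset[OF DNcont]\<close>)
    moreover have "DN 0 = 0" by (simp add: DN_def schauder_0[OF T])
    ultimately have FT: "(I has_integral \<rho> t * (norm (DN t))\<^sup>2) {0..t}" by simp
    have est: "I s \<le> (?G s + e * X) + q * (norm (haar_step T N c s))\<^sup>2" if "s \<in> {0..t}" for s
    proof -
      have s: "s \<in> {0..T}" using that sub by auto
      define h where "h = haar_step T N c s"
      have l: "lam s > 0" and r: "\<rho> s > 0" using lam(1)[OF s] \<rho>(2)[OF s] by auto
      have n: "norm (DN s) \<le> norm (D s) + e" "norm (D s) \<le> norm (DN s) + e"
        using close[OF s] norm_triangle_sub[of "DN s" "D s"] norm_triangle_sub[of "D s" "DN s"] by (auto simp: norm_minus_commute)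
      have "2 * (DN s \<bullet> h) \<le> lam s * (norm (DN s))\<^sup>2 + (norm h)\<^sup>2 / lam s"
      proof -
        have "2 * (DN s \<bullet> h) \<le> 2 * (norm (DN s) * norm h)" using norm_cauchy_schwarz[of "DN s" h] by simp
        also have "\<dots> \<le> lam s * (norm (DN s))\<^sup>2 + (norm h)\<^sup>2 / lam s"
        proof -
          have "0 \<le> (lam s * norm (DN s) - norm h)\<^sup>2 / lam s" using l by simp
          also have "\<dots> = lam s * (norm (DN s))\<^sup>2 + (norm h)\<^sup>2 / lam s - 2 * (norm (DN s) * norm h)"
            using l by (simp add: power2_eq_square field_simps)
          finally show ?thesis by simp
        qed
        finally show ?thesis .
      qed
      then have "\<rho> s * (2 * (DN s \<bullet> h)) \<le> \<rho> s * (lam s * (norm (DN s))\<^sup>2 + (norm h)\<^sup>2 / lam s)"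
        using r by (intro mult_left_mono) auto
      also have "\<dots> \<le> \<rho> s * lam s * (norm (DN s))\<^sup>2 + q * (norm h)\<^sup>2"
      proof -
        have "\<rho> s / lam s \<le> q" using lam(2)[OF s] l by (simp add: divide_le_eq)
        then have "\<rho> s / lam s * (norm h)\<^sup>2 \<le> q * (norm h)\<^sup>2" by (intro mult_right_mono) auto
        then show ?thesis by (simp add: algebra_simps)
      qed
      finally have 1: "2 * \<rho> s * (DN s \<bullet> h) \<le> \<rho> s * lam s * (norm (DN s))\<^sup>2 + q * (norm h)\<^sup>2" by (simp add: algebra_simps)
      \<comment> \<open>\<open>\<beta>\<close> is tied to \<open>D\<close> and not to
        \<open>DN\<close>: the one-sided bound is applied to \<open>D\<close>, and the difference
        costs at most \<open>e * b0\<close>.\<close>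
      have "DN s \<bullet> \<beta> s = D s \<bullet> \<beta> s + (DN s - D s) \<bullet> \<beta> s" by (simp add: inner_diff_left)
      also have "\<dots> \<le> B * (norm (D s))\<^sup>2 + e * b0"
      proof (intro add_mono B[OF s])
        have "(DN s - D s) \<bullet> \<beta> s \<le> norm (DN s - D s) * norm (\<beta> s)" by (rule norm_cauchy_schwarz)
        also have "\<dots> \<le> e * b0" using close[OF s] b0(2)[OF s] e by (intro mult_mono) auto
        finally show "(DN s - D s) \<bullet> \<beta> s \<le> e * b0" .
      qed
      finally have "2 * \<rho> s * (DN s \<bullet> \<beta> s) \<le> 2 * \<rho> s * (B * (norm (D s))\<^sup>2 + e * b0)"
        using r by (intro mult_left_mono) auto
      also have "\<dots> \<le> 2 * B * \<rho> s * (norm (D s))\<^sup>2 + e * (2 * P * b0)"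
      proof -
        have "\<rho> s * (e * b0) \<le> P * (e * b0)" using P(2)[OF s] e b0(1) by (intro mult_right_mono) auto
        then show ?thesis by (simp add: algebra_simps)
      qed
      finally have 2: "2 * \<rho> s * (DN s \<bullet> \<beta> s) \<le> 2 * B * \<rho> s * (norm (D s))\<^sup>2 + e * (2 * P * b0)" .
      have sq: "\<bar>(norm (DN s))\<^sup>2 - (norm (D s))\<^sup>2\<bar> \<le> e * (2 * R + 1)"
      proof -
        have "(norm (DN s))\<^sup>2 - (norm (D s))\<^sup>2 = (norm (DN s) - norm (D s)) * (norm (DN s) + norm (D s))"
          by (simp add: power2_eq_square algebra_simps)
        moreover have "\<bar>norm (DN s) - norm (D s)\<bar> \<le> e" using n by simp
        moreover have "\<bar>norm (DN s) + norm (D s)\<bar> \<le> 2 * R + 1"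
          using n R(2)[OF s] e norm_ge_zero[of "DN s"] norm_ge_zero[of "D s"] by simp
        ultimately show ?thesis using e by (auto simp: abs_mult intro!: mult_mono)
      qed
      have "a s * (norm (DN s))\<^sup>2 = a s * (norm (D s))\<^sup>2 + a s * ((norm (DN s))\<^sup>2 - (norm (D s))\<^sup>2)" by (simp add: algebra_simps)
      also have "\<dots> \<le> a s * (norm (D s))\<^sup>2 + A * (e * (2 * R + 1))"
      proof -
        have "a s * ((norm (DN s))\<^sup>2 - (norm (D s))\<^sup>2) \<le> \<bar>a s\<bar> * \<bar>(norm (DN s))\<^sup>2 - (norm (D s))\<^sup>2\<bar>"
          by (simp add: abs_mult[symmetric])
        also have "\<dots> \<le> A * (e * (2 * R + 1))" using A(2)[OF s] sq A(1) by (intro mult_mono) auto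
        finally show ?thesis by simp
      qed
      finally have 3: "a s * (norm (DN s))\<^sup>2 \<le> a s * (norm (D s))\<^sup>2 + A * (e * (2 * R + 1))" .
      have "I s = a s * (norm (DN s))\<^sup>2 - \<rho> s * lam s * (norm (DN s))\<^sup>2 + 2 * \<rho> s * (DN s \<bullet> h) + 2 * \<rho> s * (DN s \<bullet> \<beta> s)"
        unfolding I_def h_def[symmetric] a_def inner_add_right by (simp add: algebra_simps)
      also have "\<dots> \<le> a s * (norm (D s))\<^sup>2 + A * (e * (2 * R + 1)) + q * (norm h)\<^sup>2 + (2 * B * \<rho> s * (norm (D s))\<^sup>2 + e * (2 * P * b0))"
        using 1 2 3 by linarith
      also have "\<dots> = (?G s + e * X) + q * (norm h)\<^sup>2" by (simp add: X_def algebra_simps)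
      finally show ?thesis unfolding h_def .
    qed
    have hi: "(\<lambda>s. q * (norm (haar_step T N c s))\<^sup>2) integrable_on {0..t}"
      using integrable_cmul[OF haar_step_square_integral(1)[OF T t, of N c], of q] by simp
    have Gi: "(\<lambda>s. ?G s + e * X) integrable_on {0..t}" by (intro integrable_add Gint integrable_const_ivl)
    have "\<rho> t * (norm (DN t))\<^sup>2 = integral {0..t} I" using FT by (simp add: integral_unique)
    also have "\<dots> \<le> integral {0..t} (\<lambda>s. (?G s + e * X) + q * (norm (haar_step T N c s))\<^sup>2)"
      by (rule integral_le[OF _ integrable_add[OF Gi hi] est]) (use FT in auto)
    also have "\<dots> = integral {0..t} (\<lambda>s. ?G s + e * X) + integral {0..t} (\<lambda>s. q * (norm (haar_step T N c s))\<^sup>2)"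
      by (rule integral_add[OF Gi hi])
    also have "integral {0..t} (\<lambda>s. ?G s + e * X) = integral {0..t} ?G + t * (e * X)"
      using t by (subst integral_add[OF Gint integrable_const_ivl]) simp
    also have "integral {0..t} (\<lambda>s. q * (norm (haar_step T N c s))\<^sup>2) \<le> q * C"
      using haar_step_square_integral(2)[OF T t, of N c] C[of N] q by (auto intro!: mult_left_mono)
    also have "t * (e * X) \<le> e * (T * X)"
    proof -
      have "t * (e * X) \<le> T * (e * X)" using t e A(1) P(1) R(1) b0(1) by (intro mult_right_mono) (auto simp: X_def)
      then show ?thesis by (simp add: algebra_simps)
    qed
    finally have F: "\<rho> t * (norm (DN t))\<^sup>2 \<le> integral {0..t} ?G + e * (T * X) + q * C" by simp
    have "(norm (D t))\<^sup>2 \<le> (norm (DN t))\<^sup>2 + e * (2 * R + 1)"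
    proof -
      have n: "norm (DN t) \<le> norm (D t) + e" "norm (D t) \<le> norm (DN t) + e"
        using close[OF t] norm_triangle_sub[of "DN t" "D t"] norm_triangle_sub[of "D t" "DN t"] by (auto simp: norm_minus_commute)
      have "(norm (D t))\<^sup>2 - (norm (DN t))\<^sup>2 = (norm (D t) - norm (DN t)) * (norm (D t) + norm (DN t))"
        by (simp add: power2_eq_square algebra_simps)
      also have "\<dots> \<le> e * (2 * R + 1)" using n R(2)[OF t] e by (intro mult_mono) auto
      finally show ?thesis by simp
    qed
    then have "\<rho> t * (norm (D t))\<^sup>2 \<le> \<rho> t * ((norm (DN t))\<^sup>2 + e * (2 * R + 1))"
      using \<rho>(2)[OF t] by (intro mult_left_mono) auto
    also have "\<dots> \<le> \<rho> t * (norm (DN t))\<^sup>2 + P * (e * (2 * R + 1))"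
    proof -
      have "\<rho> t \<le> P" using P(2)[OF t] by simp
      then have "\<rho> t * (e * (2 * R + 1)) \<le> P * (e * (2 * R + 1))"
        using e R(1) by (intro mult_right_mono mult_nonneg_nonneg) auto
      then show ?thesis unfolding distrib_left[of "\<rho> t" "(norm (DN t))\<^sup>2"] by simp
    qed
    also have "\<dots> \<le> (integral {0..t} ?G + q * C) + e * Z" using F by (simp add: Z_def algebra_simps)
    finally show ?thesis .
  qed
  have "\<rho> t * (norm (D t))\<^sup>2 \<le> integral {0..t} ?G + q * C"
  proof (rule field_le_epsilon)
    fix \<epsilon> :: real assume \<epsilon>: "0 < \<epsilon>"
    define e where "e = min 1 (\<epsilon> / (Z + 1))"
    have e: "0 < e" "e \<le> 1" using \<epsilon> Z0 by (auto simp: e_def)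
    have "e * Z \<le> \<epsilon> / (Z + 1) * Z" using Z0 by (intro mult_right_mono) (auto simp: e_def)
    also have "\<dots> \<le> \<epsilon>" using Z0 \<epsilon> by (simp add: field_simps)
    finally show "\<rho> t * (norm (D t))\<^sup>2 \<le> integral {0..t} ?G + q * C + \<epsilon>" using main[OF e] by linarith
  qed
  then show ?thesis by (simp add: a_def)
qed

text \<open>The weight depends on the sign of \<open>B\<close>. For \<open>B < 0\<close> the
  constant weight with \<open>lam = - B\<close> leaves the negative coefficient \<open>B\<close> in
  the integral, which can be moved to the left. Otherwise \<open>lam = \<rho>\<close>, and
  \<open>\<rho>\<close> solves the Riccati equation
  \<open>\<rho>' + \<rho>\<^sup>2 + 2 * B * \<rho> = 0\<close>; the integral drops out, and a
  pointwise bound for \<open>D\<close> remains, which is integrated in time.\<close>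

lemma energy:
  "integral {0..T} (\<lambda>s. (norm (D s))\<^sup>2) \<le>
    (if B < 0 then 1 / B\<^sup>2 else if B > 0 then exp (2 * B * T) / (2 * B\<^sup>2) else T\<^sup>2 / 2) * C"
proof -
  have D2: "(\<lambda>s. (norm (D s))\<^sup>2) integrable_on {0..T}"
    by (intro integrable_continuous_real continuous_intros Dcont)
  consider "B < 0" | "B > 0" | "B = 0" by linarith
  then show ?thesis
  proof cases
    case 1
    have le: "1 * (norm (D T))\<^sup>2 \<le> integral {0..T} (\<lambda>s. (0 + 1 * (- B) + 2 * B * 1) * (norm (D s))\<^sup>2) + (1 / (- B)) * C"
      by (rule energy_step[where \<rho>="\<lambda>_. 1" and \<rho>'="\<lambda>_. 0" and lam="\<lambda>_. - B"]) (use 1 T in auto)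
    have "0 \<le> integral {0..T} (\<lambda>s. B * (norm (D s))\<^sup>2) + (1 / (- B)) * C"
    proof -
      have "0 + 1 * (- B) + 2 * B * 1 = B" by simp
      from le[unfolded this] show ?thesis by (intro order_trans[OF zero_le_power2[of "norm (D T)"]]) simp
    qed
    then have "- B * integral {0..T} (\<lambda>s. (norm (D s))\<^sup>2) \<le> (1 / (- B)) * C" by simp
    then have "integral {0..T} (\<lambda>s. (norm (D s))\<^sup>2) * B\<^sup>2 \<le> C"
      using 1 by (simp add: field_simps power2_eq_square)
    then have "integral {0..T} (\<lambda>s. (norm (D s))\<^sup>2) \<le> (1 / B\<^sup>2) * C"
      using 1 by (simp add: pos_le_divide_eq)
    then show ?thesis using 1 by simp
  next
    case 2
    \<comment> \<open>With \<open>1 / \<rho> = \<phi> s * exp (2 * B * s)\<close> the Riccati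
      equation becomes \<open>\<phi>' = exp (- 2 * B * s)\<close>. The constant of integration keeps
      \<open>\<phi>\<close> positive at 0 and gives \<open>\<phi> \<le> 1 / B\<close>; integrating
      \<open>exp (2 * B * t) / B\<close> in time produces
      \<open>exp (2 * B * T) / (2 * B\<^sup>2)\<close>.\<close>
    define \<phi> where "\<phi> s = (2 - exp (- 2 * B * s)) / (2 * B)" for s
    have \<phi>pos: "0 < \<phi> s" if "0 \<le> s" for s
    proof -
      have "exp (- 2 * B * s) \<le> 1" using 2 that by simp
      then have "0 < 2 - exp (- 2 * B * s)" by linarith
      then show ?thesis unfolding \<phi>_def using 2 by (intro divide_pos_pos) auto
    qed
    have \<phi>d: "(\<phi> has_real_derivative exp (- 2 * B * s)) (at s)" for s
      unfolding \<phi>_def using 2 by (auto intro!: derivative_eq_intros simp: field_simps)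
    have \<phi>c: "continuous_on A \<phi>" for A
      by (intro continuous_at_imp_continuous_on ballI DERIV_isCont[OF \<phi>d])
    have D2le: "(norm (D t))\<^sup>2 \<le> exp (2 * B * t) / B * C" if t: "t \<in> {0..T}" for t
    proof -
      let ?\<rho> = "\<lambda>s. exp (- 2 * B * s) / \<phi> s"
      let ?\<rho>' = "\<lambda>s. - 2 * B * (exp (- 2 * B * s) / \<phi> s) - (exp (- 2 * B * s) / \<phi> s) * (exp (- 2 * B * s) / \<phi> s)"
      have "?\<rho> t * (norm (D t))\<^sup>2 \<le> integral {0..t} (\<lambda>s. (?\<rho>' s + ?\<rho> s * ?\<rho> s + 2 * B * ?\<rho> s) * (norm (D s))\<^sup>2) + 1 * C"
      proof (rule energy_step[OF t, where \<rho>="?\<rho>" and \<rho>'="?\<rho>'" and lam="?\<rho>"])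
        fix s assume s: "s \<in> {0..T}"
        then have p: "\<phi> s \<noteq> 0" using \<phi>pos[of s] by auto
        show "(?\<rho> has_real_derivative ?\<rho>' s) (at s)"
          using p by (auto intro!: derivative_eq_intros \<phi>d simp: field_simps)
      qed (use \<phi>pos in \<open>force intro!: continuous_intros \<phi>c\<close>)+
      also have "integral {0..t} (\<lambda>s. (?\<rho>' s + ?\<rho> s * ?\<rho> s + 2 * B * ?\<rho> s) * (norm (D s))\<^sup>2) = 0"
        by (rule integral_unique) (simp add: algebra_simps)
      finally have "exp (- 2 * B * t) / \<phi> t * (norm (D t))\<^sup>2 \<le> C" by simp
      then have "(norm (D t))\<^sup>2 \<le> C * \<phi> t * exp (2 * B * t)"
        using \<phi>pos[of t] t by (simp add: exp_minus field_simps)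
      also have "\<dots> \<le> C * (1 / B) * exp (2 * B * t)"
        using C_nonneg 2 by (intro mult_right_mono mult_left_mono) (auto simp: \<phi>_def field_simps)
      finally show ?thesis by (simp add: field_simps)
    qed
    define J where "J s = exp (2 * B * s) / (2 * B\<^sup>2) * C" for s
    have Ji: "((\<lambda>s. exp (2 * B * s) / B * C) has_integral J T - J 0) {0..T}"
    proof (rule fundamental_theorem_of_calculus)
      fix s
      have "(J has_real_derivative exp (2 * B * s) / B * C) (at s)"
        unfolding J_def using 2 by (auto intro!: derivative_eq_intros simp: field_simps power2_eq_square)
      then show "(J has_vector_derivative exp (2 * B * s) / B * C) (at s within {0..T})"
        by (simp add: has_real_derivative_iff_has_vector_derivative has_vector_derivative_at_within)
    qed (use T in simp)
    have "integral {0..T} (\<lambda>s. (norm (D s))\<^sup>2) \<le> integral {0..T} (\<lambda>s. exp (2 * B * s) / B * C)"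
      using Ji by (intro integral_le D2 D2le) auto
    also have "\<dots> = J T - J 0" by (rule integral_unique[OF Ji])
    also have "\<dots> \<le> J T" using C_nonneg by (simp add: J_def)
    finally show ?thesis using 2 by (simp add: J_def)
  next
    case 3
    have D2le: "(norm (D t))\<^sup>2 \<le> t * C" if t: "t \<in> {0..T}" for t
    proof (rule field_le_epsilon)
      fix \<epsilon> :: real assume \<epsilon>: "0 < \<epsilon>"
      \<comment> \<open>The natural weight \<open>1 / s\<close> is singular at 0. The shift by
        \<open>\<delta>\<close> removes the singularity, still solves the equation, and costs
        \<open>\<delta> * C \<le> \<epsilon>\<close>.\<close>
      define \<delta> where "\<delta> = \<epsilon> / (C + 1)"
      have \<delta>: "0 < \<delta>" "\<delta> * C \<le> \<epsilon>" using \<epsilon> C_nonneg by (auto simp: \<delta>_def field_simps)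
      let ?\<rho> = "\<lambda>s. 1 / (s + \<delta>)"
      let ?\<rho>' = "\<lambda>s. - (1 / (s + \<delta>) * (1 / (s + \<delta>)))"
      have "?\<rho> t * (norm (D t))\<^sup>2 \<le> integral {0..t} (\<lambda>s. (?\<rho>' s + ?\<rho> s * ?\<rho> s + 2 * B * ?\<rho> s) * (norm (D s))\<^sup>2) + 1 * C"
      proof (rule energy_step[OF t, where \<rho>="?\<rho>" and \<rho>'="?\<rho>'" and lam="?\<rho>"])
        fix s assume s: "s \<in> {0..T}"
        then have p: "s + \<delta> \<noteq> 0" using \<delta> by auto
        show "(?\<rho> has_real_derivative ?\<rho>' s) (at s)"
          using p by (auto intro!: derivative_eq_intros simp: field_simps)
      qed (use \<delta> in \<open>force intro!: continuous_intros\<close>)+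
      then have "?\<rho> t * (norm (D t))\<^sup>2 \<le> C" by (simp add: 3)
      then have "(norm (D t))\<^sup>2 \<le> (t + \<delta>) * C" using t \<delta> by (simp add: field_simps)
      then show "(norm (D t))\<^sup>2 \<le> t * C + \<epsilon>" using \<delta> by (simp add: algebra_simps)
    qed
    define J where "J s = s\<^sup>2 / 2 * C" for s
    have Ji: "((\<lambda>s. s * C) has_integral J T - J 0) {0..T}"
    proof (rule fundamental_theorem_of_calculus)
      fix s
      have "(J has_real_derivative s * C) (at s)"
        unfolding J_def by (auto intro!: derivative_eq_intros)
      then show "(J has_vector_derivative s * C) (at s within {0..T})"
        by (simp add: has_real_derivative_iff_has_vector_derivative has_vector_derivative_at_within)
    qed (use T in simp)
    have "integral {0..T} (\<lambda>s. (norm (D s))\<^sup>2) \<le> integral {0..T} (\<lambda>s. s * C)"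
      using Ji by (intro integral_le D2 D2le) auto
    also have "\<dots> = J T - J 0" by (rule integral_unique[OF Ji])
    finally show ?thesis using 3 by (simp add: J_def)
  qed
qed

end

section \<open>The equation driven by a continuous path\<close>

text \<open>Explicit iterates in place of an abstract fixed point: each one depends measurably on
  the driving path, and so does the limit.\<close>

primrec picard :: "('a::euclidean_space \<Rightarrow> 'a) \<Rightarrow> 'a \<Rightarrow> (real \<Rightarrow> 'a) \<Rightarrow> nat \<Rightarrow> real \<Rightarrow> 'a" where
  "picard b x w 0 t = x + w t"
| "picard b x w (Suc n) t = x + w t + integral {0..t} (\<lambda>s. b (picard b x w n s))"

definition flow :: "('a::euclidean_space \<Rightarrow> 'a) \<Rightarrow> 'a \<Rightarrow> (real \<Rightarrow> 'a) \<Rightarrow> real \<Rightarrow> 'a" where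
  "flow b x w t = lim (\<lambda>n. picard b x w n t)"

locale lipschitz_drift =
  fixes b :: "'a::euclidean_space \<Rightarrow> 'a" and K T :: real
  assumes lip: "\<And>x y. norm (b x - b y) \<le> K * norm (x - y)" and K: "K \<ge> 0" and T: "T > 0"
begin

lemma continuous_on_b: "continuous_on A b"
proof (rule continuous_on_subset[OF _ subset_UNIV], rule lipschitz_on_continuous_on[of K])
  show "K-lipschitz_on UNIV b" by (rule lipschitz_onI) (simp_all add: dist_norm lip K)
qed

lemma continuous_on_b_comp: "continuous_on A y \<Longrightarrow> continuous_on A (\<lambda>s. b (y s))"
  by (rule continuous_on_compose2[OF continuous_on_b[of UNIV]]) auto

lemma picard_continuous:
  assumes w: "continuous_on {0..T} w" shows "continuous_on {0..T} (picard b x w n)"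
proof (induction n)
  case 0
  have "picard b x w 0 = (\<lambda>t. x + w t)" by (rule ext) simp
  then show ?case using w by (auto intro!: continuous_intros)
next
  case (Suc n)
  have "picard b x w (Suc n) = (\<lambda>t. x + w t + integral {0..t} (\<lambda>s. b (picard b x w n s)))" by (rule ext) simp
  moreover have "continuous_on {0..T} (\<lambda>t. integral {0..t} (\<lambda>s. b (picard b x w n s)))"
    by (intro indefinite_integral_continuous_1 integrable_continuous_real continuous_on_b_comp Suc)
  ultimately show ?case using w by (auto intro!: continuous_intros)
qed

text \<open>The factorial bound for successive differences is summable for every \<open>T\<close>,
  so the whole interval is treated at once.\<close>

lemma picard_uniform_limit:
  assumes w: "continuous_on {0..T} w"
  shows "uniform_limit {0..T} (picard b x w) (flow b x w) sequentially"
proof -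
  let ?p = "picard b x w"
  have sub: "{0..t} \<subseteq> {0..T}" if "t \<in> {0..T}" for t using that by auto
  have ci: "(\<lambda>s. b (?p n s)) integrable_on {0..t}" if "t \<in> {0..T}" for n t
    by (intro integrable_continuous_real continuous_on_b_comp continuous_on_subset[OF picard_continuous[OF w] sub[OF that]])
  have "compact ((\<lambda>t. ?p 1 t - ?p 0 t) ` {0..T})"
    by (intro compact_continuous_image continuous_on_diff picard_continuous w compact_Icc)
  from compact_imp_bounded[OF this]
  obtain M where M: "\<forall>y\<in>(\<lambda>t. ?p 1 t - ?p 0 t) ` {0..T}. norm y \<le> M"
    unfolding bounded_iff ..
  have M': "norm (?p 1 t - ?p 0 t) \<le> M" if "t \<in> {0..T}" for t by (rule bspec[OF M imageI[OF that]])
  have step: "norm (?p (Suc n) t - ?p n t) \<le> M * (K * t) ^ n / fact n" if "t \<in> {0..T}" for n t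
    using that
  proof (induction n arbitrary: t)
    case 0 then show ?case using M'[of t] by simp
  next
    case (Suc n)
    \<comment> \<open>The bound for \<open>Suc n\<close>; its derivative is \<open>K\<close> times
      the bound for \<open>n\<close>.\<close>
    define J where "J s = M * (K * s) ^ Suc n / fact (Suc n)" for s
    have J: "((\<lambda>s. K * (M * (K * s) ^ n / fact n)) has_integral J t - J 0) {0..t}"
    proof (rule fundamental_theorem_of_calculus)
      fix s
      have "((\<lambda>s. (K * s) ^ Suc n) has_real_derivative (real (Suc n) * (K * s) ^ n * K)) (at s)"
        by (auto intro!: derivative_eq_intros simp del: power_Suc)
      from DERIV_cdivide[OF DERIV_cmult[OF this, of M], of "fact (Suc n)"]
      have "(J has_real_derivative M * (real (Suc n) * (K * s) ^ n * K) / fact (Suc n)) (at s)"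
        unfolding J_def .
      also have "M * (real (Suc n) * (K * s) ^ n * K) / fact (Suc n) = K * (M * (K * s) ^ n / fact n)"
        by (simp add: fact_Suc field_simps del: of_nat_Suc)
      finally show "(J has_vector_derivative K * (M * (K * s) ^ n / fact n)) (at s within {0..t})"
        by (simp add: has_real_derivative_iff_has_vector_derivative has_vector_derivative_at_within)
    qed (use Suc.prems in simp)
    have "?p (Suc (Suc n)) t - ?p (Suc n) t = integral {0..t} (\<lambda>s. b (?p (Suc n) s)) - integral {0..t} (\<lambda>s. b (?p n s))"
      unfolding picard.simps(2)[of b x w "Suc n" t] picard.simps(2)[of b x w n t] by (simp only: add_diff_cancel_left)
    then have "norm (?p (Suc (Suc n)) t - ?p (Suc n) t) = norm (integral {0..t} (\<lambda>s. b (?p (Suc n) s) - b (?p n s)))"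
      by (simp only: integral_diff[OF ci[OF Suc.prems] ci[OF Suc.prems]])
    also have "\<dots> \<le> integral {0..t} (\<lambda>s. K * (M * (K * s) ^ n / fact n))"
    proof (rule integral_norm_bound_integral)
      show "(\<lambda>s. b (?p (Suc n) s) - b (?p n s)) integrable_on {0..t}"
        by (intro integrable_diff ci Suc.prems)
      show "(\<lambda>s. K * (M * (K * s) ^ n / fact n)) integrable_on {0..t}" using J by blast
      fix s assume "s \<in> {0..t}"
      then have s: "s \<in> {0..T}" using Suc.prems by auto
      show "norm (b (?p (Suc n) s) - b (?p n s)) \<le> K * (M * (K * s) ^ n / fact n)"
        using lip[of "?p (Suc n) s" "?p n s"] mult_left_mono[OF Suc.IH[OF s] K] by linarith
    qed
    also have "\<dots> = J t" using integral_unique[OF J] by (simp add: J_def)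
    finally show ?case by (simp add: J_def)
  qed
  have M0: "0 \<le> M" using order_trans[OF norm_ge_zero M'[of 0]] T by simp
  have "uniform_limit {0..T} (\<lambda>n t. \<Sum>i<n. ?p (Suc i) t - ?p i t) (\<lambda>t. \<Sum>i. ?p (Suc i) t - ?p i t) sequentially"
  proof (rule Weierstrass_m_test)
    show "summable (\<lambda>n. M * (K * T) ^ n / fact n)"
      using summable_mult[OF summable_exp[of "K * T"], of M] by (simp add: divide_inverse mult_ac)
    fix n t assume t: "t \<in> {0..T}"
    have "M * (K * t) ^ n / fact n \<le> M * (K * T) ^ n / fact n"
      using t K M0 by (intro divide_right_mono mult_left_mono power_mono) auto
    then show "norm (?p (Suc n) t - ?p n t) \<le> M * (K * T) ^ n / fact n" using step[OF t, of n] by linarith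
  qed
  then have "uniform_limit {0..T} (\<lambda>n t. ?p 0 t + (\<Sum>i<n. ?p (Suc i) t - ?p i t)) (\<lambda>t. ?p 0 t + (\<Sum>i. ?p (Suc i) t - ?p i t)) sequentially"
    by (intro uniform_limit_add uniform_limit_const)
  moreover have "?p 0 t + (\<Sum>i<n. ?p (Suc i) t - ?p i t) = ?p n t" for n t
    using sum_lessThan_telescope[of "\<lambda>i. ?p i t" n] by simp
  ultimately have ul: "uniform_limit {0..T} ?p (\<lambda>t. ?p 0 t + (\<Sum>i. ?p (Suc i) t - ?p i t)) sequentially"
    by (simp only:)
  have "flow b x w t = ?p 0 t + (\<Sum>i. ?p (Suc i) t - ?p i t)" if "t \<in> {0..T}" for t
    unfolding flow_def using tendsto_uniform_limitI[OF ul that] by (rule limI)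
  then show ?thesis by (rule uniform_limit_cong'[THEN iffD2, OF refl _ ul])
qed

lemma flow_continuous:
  assumes "continuous_on {0..T} w" shows "continuous_on {0..T} (flow b x w)"
  by (rule uniform_limit_theorem[OF _ picard_uniform_limit[OF assms]]) (auto intro!: always_eventually picard_continuous[OF assms])

lemma flow_solution:
  assumes w: "continuous_on {0..T} w" and t: "t \<in> {0..T}"
  shows "flow b x w t = x + w t + integral {0..t} (\<lambda>s. b (flow b x w s))"
proof -
  let ?p = "picard b x w"
  have sub: "{0..t} \<subseteq> {0..T}" using t by auto
  have fi: "(\<lambda>s. b (flow b x w s)) integrable_on {0..t}"
    by (intro integrable_continuous_real continuous_on_b_comp continuous_on_subset[OF flow_continuous[OF w] sub])
  have pi: "(\<lambda>s. b (?p n s)) integrable_on {0..t}" for n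
    by (intro integrable_continuous_real continuous_on_b_comp continuous_on_subset[OF picard_continuous[OF w] sub])
  have "(\<lambda>n. integral {0..t} (\<lambda>s. b (?p n s))) \<longlonglongrightarrow> integral {0..t} (\<lambda>s. b (flow b x w s))"
  proof (rule LIMSEQ_I)
    fix r :: real assume r: "0 < r"
    \<comment> \<open>Makes \<open>K * T * e\<close> smaller than \<open>r\<close>, also when
      \<open>K = 0\<close>.\<close>
    define e where "e = r / (2 * (K * T + 1))"
    have KT: "0 \<le> K * T" using K T by simp
    have e: "0 < e" using r KT by (simp add: e_def)
    obtain N where N: "\<And>n s. n \<ge> N \<Longrightarrow> s \<in> {0..T} \<Longrightarrow> dist (?p n s) (flow b x w s) < e"
      using uniform_limitD[OF picard_uniform_limit[OF w, of x] e] unfolding eventually_sequentially by blast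
    show "\<exists>N. \<forall>n\<ge>N. norm (integral {0..t} (\<lambda>s. b (?p n s)) - integral {0..t} (\<lambda>s. b (flow b x w s))) < r"
    proof (intro exI[of _ N] allI impI)
      fix n assume n: "N \<le> n"
      have "norm (integral {0..t} (\<lambda>s. b (?p n s) - b (flow b x w s))) \<le> integral {0..t} (\<lambda>s. K * e)"
      proof (rule integral_norm_bound_integral)
        show "(\<lambda>s. b (?p n s) - b (flow b x w s)) integrable_on {0..t}" by (intro integrable_diff pi fi)
        show "(\<lambda>s. K * e) integrable_on {0..t}" by (rule integrable_const_ivl)
        fix s assume "s \<in> {0..t}"
        then have "norm (?p n s - flow b x w s) \<le> e" using N[OF n, of s] sub by (auto simp: dist_norm less_imp_le)
        then show "norm (b (?p n s) - b (flow b x w s)) \<le> K * e"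
          using lip[of "?p n s" "flow b x w s"] mult_left_mono[OF _ K] order_trans by blast
      qed
      also have "\<dots> = t * (K * e)" using t by simp
      also have "\<dots> \<le> T * (K * e)" using t K e by (intro mult_right_mono) auto
      also have "\<dots> < r"
      proof -
        have "T * (K * e) = (K * T) / (K * T + 1) * (r / 2)" by (simp add: e_def mult_ac)
        also have "\<dots> \<le> 1 * (r / 2)" using KT r by (intro mult_right_mono) (auto simp: divide_le_eq)
        finally show ?thesis using r by simp
      qed
      finally show "norm (integral {0..t} (\<lambda>s. b (?p n s)) - integral {0..t} (\<lambda>s. b (flow b x w s))) < r"
        by (simp add: integral_diff pi fi)
    qed
  qed
  then have "(\<lambda>n. ?p (Suc n) t) \<longlonglongrightarrow> x + w t + integral {0..t} (\<lambda>s. b (flow b x w s))"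
    unfolding picard.simps by (intro tendsto_intros)
  moreover have "(\<lambda>n. ?p (Suc n) t) \<longlonglongrightarrow> flow b x w t"
    using tendsto_uniform_limitI[OF picard_uniform_limit[OF w] t] by (rule LIMSEQ_Suc)
  ultimately show ?thesis by (rule LIMSEQ_unique[rotated])
qed

text \<open>Two solutions with the same driver differ by a perturbed flow with zero coefficients,
  \<open>C = 0\<close> and one-sided constant \<open>K\<close>, so the energy estimate takes the
  place of Gronwall's lemma.\<close>

lemma flow_unique:
  assumes w: "continuous_on {0..T} w" and X: "continuous_on {0..T} X"
    and eq: "\<And>t. t \<in> {0..T} \<Longrightarrow> X t = x + w t + integral {0..t} (\<lambda>s. b (X s))" and t: "t \<in> {0..T}"
  shows "X t = flow b x w t"
proof -
  let ?Y = "flow b x w"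
  note Y = flow_continuous[OF w]
  define D where "D s = X s - ?Y s" for s
  define \<beta> where "\<beta> s = b (X s) - b (?Y s)" for s
  have [simp]: "haar_synth (\<lambda>_. 0) m = (0 :: 'a)" for m using haar_synth_diff[of "\<lambda>_. 0" "\<lambda>_. 0 :: 'a" m] by simp
  interpret perturbed_flow T K K 0 "\<lambda>_. 0" D "\<lambda>_. 0" \<beta>
  proof
    show "uniform_limit {0..T} (\<lambda>N. schauder T N (\<lambda>_. 0)) (\<lambda>_. 0 :: 'a) sequentially"
      by (simp add: schauder_def[abs_def] uniform_limit_const)
    show "continuous_on {0..T} D" unfolding D_def by (intro continuous_intros X Y)
    show "continuous_on {0..T} \<beta>" unfolding \<beta>_def by (intro continuous_intros continuous_on_b_comp X Y)
    fix t assume t: "t \<in> {0..T}"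
    then have sub: "{0..t} \<subseteq> {0..T}" by auto
    have i: "(\<lambda>s. b (X s)) integrable_on {0..t}" "(\<lambda>s. b (?Y s)) integrable_on {0..t}"
      by (intro integrable_continuous_real continuous_on_b_comp continuous_on_subset[OF _ sub] X Y)+
    show "D t = 0 + integral {0..t} \<beta>"
      unfolding D_def \<beta>_def integral_diff[OF i] eq[OF t] flow_solution[OF w t] by simp
    show n: "norm (\<beta> t) \<le> K * norm (D t)" unfolding \<beta>_def D_def by (rule lip)
    have "D t \<bullet> \<beta> t \<le> norm (D t) * norm (\<beta> t)" by (rule norm_cauchy_schwarz)
    also have "\<dots> \<le> norm (D t) * (K * norm (D t))" by (intro mult_left_mono n) simp
    finally show "D t \<bullet> \<beta> t \<le> K * (norm (D t))\<^sup>2" by (simp add: power2_eq_square mult_ac)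
  qed (use T in auto)
  have c: "continuous_on {0..T} (\<lambda>s. (norm (D s))\<^sup>2)" by (intro continuous_intros Dcont)
  have "integral {0..T} (\<lambda>s. (norm (D s))\<^sup>2) \<le> 0" using energy by simp
  moreover have "0 \<le> integral {0..T} (\<lambda>s. (norm (D s))\<^sup>2)"
    by (intro integral_nonneg integrable_continuous_real c) simp
  ultimately have "integral {0..T} (\<lambda>s. (norm (D s))\<^sup>2) = 0" by simp
  then have "(norm (D t))\<^sup>2 = 0"
    using integral_eq_0_iff[OF c] T t by auto
  then show ?thesis by (simp add: D_def)
qed

end

section \<open>Measurability into path space\<close>

lemma path_space_mspace: "mspace (path_metric T) = {f :: real \<Rightarrow> real^'n. f \<in> extensional {0..T} \<and> continuous_on {0..T} f}"
  unfolding path_metric_def by (subst compactin_mspace_cfunspace) (auto simp: continuous_map_iff_continuous)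

lemma path_metric_le:
  assumes "T \<ge> 0" "f \<in> mspace (path_metric T)" "g \<in> mspace (path_metric T :: (real \<Rightarrow> real^'n) metric)"
  shows "mdist (path_metric T) f g \<le> r \<longleftrightarrow> (\<forall>t\<in>{0..T}. dist (f t) (g t) \<le> r)"
  using cfunspace_mdist_le[of f "top_of_set {0..T}" euclidean_metric g r] assms unfolding path_metric_def by auto

lemma openin_mtopology_of_subset: "openin (mtopology_of m) U \<Longrightarrow> U \<subseteq> mspace m"
  using openin_subset[of "mtopology_of m" U] by simp

text \<open>Interpolates the first \<open>2 ^ N + 1\<close> entries of a list on the dyadic grid.
  Encoding by lists makes the family countable when the entries range over a countable set.\<close>

definition pl_path :: "real \<Rightarrow> nat \<Rightarrow> 'a::real_vector list \<Rightarrow> real \<Rightarrow> 'a" where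
  "pl_path T N qs t = qs ! 0 + (\<Sum>k<2^N. clamp01 (t * 2 ^ N / T - real k) *\<^sub>R (qs ! Suc k - qs ! k))"

lemma pl_path_dense:
  fixes p :: "real \<Rightarrow> 'a::real_normed_vector"
  assumes T: "T > 0" and p: "continuous_on {0..T} p" and e: "e > 0"
    and Q: "\<And>v d. d > 0 \<Longrightarrow> \<exists>q\<in>Q. norm (q - v) \<le> d"
  shows "\<exists>N qs. set qs \<subseteq> Q \<and> (\<forall>t\<in>{0..T}. dist (p t) (pl_path T N qs t) \<le> e)"
proof -
  have "uniformly_continuous_on {0..T} p" using p by (intro compact_uniformly_continuous) auto
  from this[unfolded uniformly_continuous_on_def, rule_format, of "e / 4"] e
  obtain d where d: "d > 0" "\<forall>s\<in>{0..T}. \<forall>r\<in>{0..T}. dist r s < d \<longrightarrow> dist (p r) (p s) < e / 4" by auto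
  obtain N where N: "T / d < 2 ^ N" using real_arch_pow[of 2 "T / d"] by auto
  then have Td: "T / 2 ^ N < d" using d T by (simp add: field_simps)
  have osc: "norm (p r - p s) \<le> e / 4" if "r \<in> {0..T}" "s \<in> {0..T}" "\<bar>r - s\<bar> \<le> T / 2 ^ N" for r s
    using d(2)[THEN bspec, OF that(2), THEN bspec, OF that(1)] that(3) Td by (simp add: dist_norm)
  \<comment> \<open>The grid values are approximated within \<open>\<delta>\<close>. The starting
    value contributes one such error and each of the \<open>2 ^ N\<close> ramps at most two,
    together \<open>e / 2\<close>; the other half is the interpolation error of
    \<open>p\<close>.\<close>
  define \<delta> where "\<delta> = e / (2 * (1 + 2 * 2 ^ N))"
  have \<delta>: "\<delta> > 0" using e by (simp add: \<delta>_def add_pos_pos)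
  let ?d = "\<lambda>k. p (T * real k / 2 ^ N)"
  have "\<forall>k. \<exists>q. q \<in> Q \<and> norm (q - ?d k) \<le> \<delta>" using Q[OF \<delta>] by blast
  from choice[OF this] obtain q where q: "\<And>k. q k \<in> Q" "\<And>k. norm (q k - ?d k) \<le> \<delta>" by blast
  define qs where "qs = map q [0..<Suc (2 ^ N)]"
  have qn: "qs ! k = q k" if "k \<le> 2 ^ N" for k unfolding qs_def using that by (subst nth_map) (auto simp del: upt_Suc)
  have "dist (p t) (pl_path T N qs t) \<le> e" if t: "t \<in> {0..T}" for t
  proof -
    let ?c = "\<lambda>k. clamp01 (t * 2 ^ N / T - real k)"
    have c: "\<bar>?c k\<bar> \<le> 1" for k by (simp add: clamp01_def)
    have pl: "pl_path T N qs t = q 0 + (\<Sum>k<2^N. ?c k *\<^sub>R (q (Suc k) - q k))"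
      unfolding pl_path_def
    proof (rule arg_cong2[where f="(+)"])
      show "qs ! 0 = q 0" by (rule qn) simp
      show "(\<Sum>k<2^N. ?c k *\<^sub>R (qs ! Suc k - qs ! k)) = (\<Sum>k<2^N. ?c k *\<^sub>R (q (Suc k) - q k))"
      proof (rule sum.cong[OF refl])
        fix k :: nat assume "k \<in> {..<2^N}"
        then have "qs ! Suc k = q (Suc k)" "qs ! k = q k" by (auto intro!: qn)
        then show "?c k *\<^sub>R (qs ! Suc k - qs ! k) = ?c k *\<^sub>R (q (Suc k) - q k)" by (simp only:)
      qed
    qed
    have "(\<Sum>k<2^N. ?c k *\<^sub>R (q (Suc k) - q k)) - (\<Sum>k<2^N. ?c k *\<^sub>R (?d (Suc k) - ?d k))
      = (\<Sum>k<2^N. ?c k *\<^sub>R ((q (Suc k) - ?d (Suc k)) - (q k - ?d k)))"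
      unfolding sum_subtractf[symmetric]
    proof (rule sum.cong[OF refl])
      have "c *\<^sub>R (u - v) - c *\<^sub>R (u' - v') = c *\<^sub>R ((u - u') - (v - v'))" for c and u v u' v' :: 'a
        by (simp add: scaleR_diff_right)
      then show "?c k *\<^sub>R (q (Suc k) - q k) - ?c k *\<^sub>R (?d (Suc k) - ?d k) = ?c k *\<^sub>R ((q (Suc k) - ?d (Suc k)) - (q k - ?d k))" for k .
    qed
    moreover have "(q0 + S) - (d0 + S') = (q0 - d0) + (S - S')" for q0 S d0 S' :: 'a by simp
    ultimately have "pl_path T N qs t - (?d 0 + schauder T N (haar T p) t)
      = (q 0 - ?d 0) + (\<Sum>k<2^N. ?c k *\<^sub>R ((q (Suc k) - ?d (Suc k)) - (q k - ?d k)))"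
      unfolding pl schauder_haar_eq[OF T] by (simp only:)
    also have "norm \<dots> \<le> \<delta> + (\<Sum>k<(2::nat)^N. 2 * \<delta>)"
    proof (intro norm_triangle_le add_mono q sum_norm_le)
      fix k :: nat
      have "norm ((q (Suc k) - ?d (Suc k)) - (q k - ?d k)) \<le> \<delta> + \<delta>"
        by (rule order_trans[OF norm_triangle_ineq4]) (intro add_mono q)
      then have "\<bar>?c k\<bar> * norm ((q (Suc k) - ?d (Suc k)) - (q k - ?d k)) \<le> 1 * (2 * \<delta>)"
        using c[of k] by (intro mult_mono) auto
      then show "norm (?c k *\<^sub>R ((q (Suc k) - ?d (Suc k)) - (q k - ?d k))) \<le> 2 * \<delta>" by simp
    qed
    also have "\<dots> = (1 + 2 * 2 ^ N) * \<delta>" by (simp add: algebra_simps)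
    also have "\<dots> = e / 2"
    proof -
      have "(1 + 2 * 2 ^ N :: real) \<noteq> 0" by (simp add: add_pos_pos less_imp_neq[symmetric])
      then show ?thesis unfolding \<delta>_def by (simp add: divide_simps)
    qed
    finally have 1: "norm (pl_path T N qs t - (?d 0 + schauder T N (haar T p) t)) \<le> e / 2" .
    have 2: "norm (schauder T N (haar T p) t - (p t - p 0)) \<le> 2 * (e / 4)"
      by (rule schauder_haar[OF T t osc])
    have tri: "norm v \<le> norm a + norm b'" if "v = - a - b'" for v a b' :: 'a
      using norm_triangle_ineq4[of "- a" b'] that by simp
    have "norm (p t - pl_path T N qs t) \<le> norm (pl_path T N qs t - (?d 0 + schauder T N (haar T p) t)) + norm (schauder T N (haar T p) t - (p t - p 0))"
      by (rule tri) simp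
    then have "norm (p t - pl_path T N qs t) \<le> e" using 1 2 by linarith
    then show ?thesis by (simp add: dist_norm)
  qed
  moreover have "set qs \<subseteq> Q" using q by (auto simp: qs_def)
  ultimately show ?thesis by blast
qed

lemma dist_le_on_rationals:
  fixes f g :: "real \<Rightarrow> 'a::metric_space"
  assumes T: "T > 0" and f: "continuous_on {0..T} f" and g: "continuous_on {0..T} g"
    and le: "\<And>t. t \<in> \<rat> \<inter> {0..T} \<Longrightarrow> dist (f t) (g t) \<le> r" and t: "t \<in> {0..T}"
  shows "dist (f t) (g t) \<le> r"
proof -
  let ?R = "\<rat> \<inter> {0..T}"
  have dense: "{0..T} \<subseteq> closure ?R"
  proof
    fix t assume t: "t \<in> {0..T}"
    show "t \<in> closure ?R" unfolding closure_approachable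
    proof (intro allI impI)
      fix e :: real assume e: "e > 0"
      have "max 0 (t - e) < min T (t + e)" using t e T by auto
      then obtain s where s: "s \<in> \<rat>" "max 0 (t - e) < s" "s < min T (t + e)" using Rats_dense_in_real by blast
      then show "\<exists>y\<in>?R. dist y t < e" by (intro bexI[of _ s]) (auto simp: dist_real_def)
    qed
  qed
  have cl: "closure ?R = {0..T}" using dense closure_minimal[of ?R "{0..T}"] by auto
  then have "continuous_on (closure ?R) (\<lambda>t. dist (f t) (g t))"
    using f g by (simp add: continuous_on_dist)
  moreover have "t \<in> closure ?R" unfolding cl by (rule t)
  ultimately show ?thesis by (rule continuous_le_on_closure) (rule le)
qed

text \<open>By separability an open set is a countable union of closed sup-norm balls with rational
  radius around piecewise linear paths, and by continuity membership in such a ball is a condition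
  at rational times. Measurability at fixed times therefore suffices.\<close>

lemma measurable_path_space:
  fixes f :: "'w \<Rightarrow> real \<Rightarrow> real^'n"
  assumes T: "T > 0" and cont: "\<And>\<omega>. \<omega> \<in> space M \<Longrightarrow> continuous_on {0..T} (f \<omega>)"
    and meas: "\<And>t. t \<in> {0..T} \<Longrightarrow> (\<lambda>\<omega>. f \<omega> t) \<in> borel_measurable M"
  shows "(\<lambda>\<omega>. restrict (f \<omega>) {0..T}) \<in> M \<rightarrow>\<^sub>M path_space T"
  unfolding path_space_def
proof (rule measurable_measure_of)
  let ?m = "path_metric T :: (real \<Rightarrow> real^'n) metric"
  let ?S = "mspace ?m"
  let ?r = "\<lambda>\<omega>. restrict (f \<omega>) {0..T}"
  show "{U. openin (mtopology_of ?m) U} \<subseteq> Pow ?S" by (auto dest!: openin_mtopology_of_subset)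
  show rS: "?r \<in> space M \<rightarrow> ?S"
  proof
    fix \<omega> assume "\<omega> \<in> space M"
    then have "continuous_on {0..T} (?r \<omega>)" by (rule continuous_on_eq[OF cont]) simp
    then show "?r \<omega> \<in> ?S" unfolding path_space_mspace by (intro CollectI conjI restrict_extensional)
  qed
  obtain Q :: "(real^'n) set" where Q: "countable Q" "\<forall>X. open X \<longrightarrow> X \<noteq> {} \<longrightarrow> (\<exists>q\<in>Q. q \<in> X)"
    using countable_dense_exists[where 'a="real^'n"] by auto
  have Qd: "\<exists>q\<in>Q. norm (q - v) \<le> d" if "d > 0" for v d
  proof -
    have "\<exists>q\<in>Q. q \<in> ball v d" using Q(2) that by (metis centre_in_ball empty_iff open_ball)
    then obtain q where "q \<in> Q" "q \<in> ball v d" by blast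
    then show ?thesis by (intro bexI[of _ q]) (simp_all add: dist_norm norm_minus_commute less_imp_le)
  qed
  define C where "C g r = {p \<in> ?S. \<forall>t\<in>{0..T}. dist (p t) (g t) \<le> r}" for g :: "real \<Rightarrow> real^'n" and r
  have Cm: "?r -` C (pl_path T N qs) r \<inter> space M \<in> sets M" for N qs r
  proof -
    let ?g = "pl_path T N qs"
    have gc: "continuous_on {0..T} ?g"
      unfolding pl_path_def[abs_def] clamp01_def using T by (intro continuous_intros) auto
    let ?R = "\<rat> \<inter> {0..T}"
    have "?r -` C ?g r \<inter> space M = {\<omega> \<in> space M. \<forall>t\<in>?R. dist (f \<omega> t) (?g t) \<le> r}"
    proof (rule set_eqI, rule iffI)
      fix \<omega> assume "\<omega> \<in> ?r -` C ?g r \<inter> space M"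
      then show "\<omega> \<in> {\<omega> \<in> space M. \<forall>t\<in>?R. dist (f \<omega> t) (?g t) \<le> r}" by (auto simp: C_def)
    next
      fix \<omega> assume w: "\<omega> \<in> {\<omega> \<in> space M. \<forall>t\<in>?R. dist (f \<omega> t) (?g t) \<le> r}"
      then have ws: "\<omega> \<in> space M" by simp
      have "dist (f \<omega> t) (?g t) \<le> r" if "t \<in> {0..T}" for t
        by (rule dist_le_on_rationals[OF T cont[OF ws] gc _ that]) (use w in auto)
      then show "\<omega> \<in> ?r -` C ?g r \<inter> space M" using rS ws by (auto simp: C_def)
    qed
    also have "\<dots> \<in> sets M"
    proof (rule sets.sets_Collect_countable_All')
      show "countable ?R" using countable_rat by (rule countable_Int1)
      fix t assume "t \<in> ?R"
      then have [measurable]: "(\<lambda>\<omega>. f \<omega> t) \<in> borel_measurable M" using meas by simp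
      show "{\<omega> \<in> space M. dist (f \<omega> t) (?g t) \<le> r} \<in> sets M" by measurable
    qed
    finally show ?thesis .
  qed
  fix U assume "U \<in> {U. openin (mtopology_of ?m) U}"
  then have U: "openin (mtopology_of ?m) U" by simp
  interpret MS: Metric_space ?S "mdist ?m" by (rule Metric_space_mspace_mdist)
  define I where "I = {(N, qs, r). qs \<in> lists Q \<and> r \<in> \<rat> \<and> C (pl_path T N qs) r \<subseteq> U}"
  have cI: "countable I"
    by (rule countable_subset[of _ "UNIV \<times> lists Q \<times> \<rat>"]) (auto simp: I_def countable_rat Q(1))
  have "U = (\<Union>(N, qs, r)\<in>I. C (pl_path T N qs) r)"
  proof
    show "U \<subseteq> (\<Union>(N, qs, r)\<in>I. C (pl_path T N qs) r)"
    proof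
      fix p assume pU: "p \<in> U"
      then have pS: "p \<in> ?S" using openin_mtopology_of_subset[OF U] by blast
      obtain \<epsilon> where \<epsilon>: "\<epsilon> > 0" "MS.mball p \<epsilon> \<subseteq> U"
        using U pU unfolding mtopology_of_def MS.openin_mtopology by blast
      \<comment> \<open>A radius above \<open>\<epsilon> / 4\<close> keeps \<open>p\<close> in the
        ball around the approximating path; one below \<open>\<epsilon> / 2\<close> keeps that ball
        within \<open>3 * \<epsilon> / 4\<close> of \<open>p\<close>.\<close>
      obtain r where r: "r \<in> \<rat>" "\<epsilon> / 4 < r" "r < \<epsilon> / 2" using Rats_dense_in_real[of "\<epsilon> / 4" "\<epsilon> / 2"] \<epsilon>(1) by auto
      have cp: "continuous_on {0..T} p" using pS by (simp add: path_space_mspace)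
      have "0 < \<epsilon> / 4" using \<epsilon>(1) by simp
      from pl_path_dense[OF T cp this Qd]
      obtain N qs where qs1: "set qs \<subseteq> Q" and qs2: "\<forall>t\<in>{0..T}. dist (p t) (pl_path T N qs t) \<le> \<epsilon> / 4"
        by blast
      note qs = qs1 bspec[OF qs2]
      have pC: "p \<in> C (pl_path T N qs) r" unfolding C_def using pS qs(2) r(2) by fastforce
      have "C (pl_path T N qs) r \<subseteq> U"
      proof
        fix p' assume p': "p' \<in> C (pl_path T N qs) r"
        then have p'S: "p' \<in> ?S" by (simp add: C_def)
        have "mdist ?m p p' \<le> \<epsilon> / 4 + r"
        proof (subst path_metric_le)
          show "\<forall>t\<in>{0..T}. dist (p t) (p' t) \<le> \<epsilon> / 4 + r"
          proof
            fix t assume t: "t \<in> {0..T}"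
            have "dist (p' t) (pl_path T N qs t) \<le> r" using p' t by (simp add: C_def)
            then show "dist (p t) (p' t) \<le> \<epsilon> / 4 + r"
              using qs(2)[OF t] dist_triangle2[of "p t" "p' t" "pl_path T N qs t"] by linarith
          qed
        qed (use pS p'S T in auto)
        then have "mdist ?m p p' < \<epsilon>" using r(3) \<epsilon>(1) by linarith
        then have "p' \<in> MS.mball p \<epsilon>" using pS p'S by (simp add: MS.in_mball)
        then show "p' \<in> U" using \<epsilon>(2) by blast
      qed
      then have "(N, qs, r) \<in> I" using qs(1) r(1) by (auto simp: I_def)
      then show "p \<in> (\<Union>(N, qs, r)\<in>I. C (pl_path T N qs) r)" using pC by blast
    qed
    show "(\<Union>(N, qs, r)\<in>I. C (pl_path T N qs) r) \<subseteq> U" by (auto simp: I_def)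
  qed
  then have "?r -` U \<inter> space M = (\<Union>i\<in>I. case i of (N, qs, r) \<Rightarrow> ?r -` C (pl_path T N qs) r \<inter> space M)"
    by auto
  also have "\<dots> \<in> sets M" using cI by (rule sets.countable_UN') (auto simp: Cm split: prod.splits)
  finally show "?r -` U \<inter> space M \<in> sets M" .
qed

text \<open>Continuity in time and measurability at fixed times give joint measurability, by
  rounding time down to a grid of mesh \<open>1 / real (Suc n)\<close>; the integral over time is
  then measurable in the parameter.\<close>

lemma measurable_integral_continuous:
  fixes Y :: "'w \<Rightarrow> real \<Rightarrow> 'a::euclidean_space"
  assumes t: "t \<in> {0..T}" and cont: "\<And>\<omega>. \<omega> \<in> space M \<Longrightarrow> continuous_on {0..T} (Y \<omega>)"
    and meas: "\<And>s. s \<in> {0..T} \<Longrightarrow> (\<lambda>\<omega>. Y \<omega> s) \<in> borel_measurable M"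
  shows "(\<lambda>\<omega>. integral {0..t} (Y \<omega>)) \<in> borel_measurable M"
proof -
  \<comment> \<open>Clamping time to \<open>{0..T}\<close> extends each path continuously to the
    line, so rounded times never leave the domain.\<close>
  define c where "c s = max 0 (min T s)" for s
  have c: "c s \<in> {0..T}" for s using t by (auto simp: c_def)
  have cc: "continuous_on UNIV c" unfolding c_def by (intro continuous_intros)
  define A where "A n s = real_of_int \<lfloor>real (Suc n) * s\<rfloor> / real (Suc n)" for n and s :: real
  have Alim: "(\<lambda>n. A n s) \<longlonglongrightarrow> s" for s
  proof (rule tendsto_sandwich)
    show "\<forall>\<^sub>F n in sequentially. s - inverse (real (Suc n)) \<le> A n s"
    proof (intro always_eventually allI)
      fix n
      have "real (Suc n) * s - 1 \<le> real_of_int \<lfloor>real (Suc n) * s\<rfloor>" by linarith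
      then have "(real (Suc n) * s - 1) / real (Suc n) \<le> A n s" unfolding A_def by (intro divide_right_mono) auto
      then show "s - inverse (real (Suc n)) \<le> A n s" by (simp add: diff_divide_distrib inverse_eq_divide del: of_nat_Suc)
    qed
    show "\<forall>\<^sub>F n in sequentially. A n s \<le> s"
    proof (intro always_eventually allI)
      fix n
      have "real_of_int \<lfloor>real (Suc n) * s\<rfloor> \<le> real (Suc n) * s" by linarith
      then show "A n s \<le> s" unfolding A_def by (simp add: divide_le_eq mult.commute del: of_nat_Suc)
    qed
    show "(\<lambda>n. s - inverse (real (Suc n))) \<longlonglongrightarrow> s"
      using tendsto_diff[OF tendsto_const LIMSEQ_inverse_real_of_nat] by simp
  qed simp
  have joint: "(\<lambda>(\<omega>, s). Y \<omega> (c s)) \<in> borel_measurable (M \<Otimes>\<^sub>M lborel)"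
  proof (rule borel_measurable_LIMSEQ_metric[where f="\<lambda>n p. Y (fst p) (c (A n (snd p)))"])
    fix n
    have "(\<lambda>p. (\<lambda>i p. Y (fst p) (c (real_of_int i / real (Suc n)))) \<lfloor>real (Suc n) * snd p\<rfloor> p) \<in> borel_measurable (M \<Otimes>\<^sub>M lborel)"
    proof (rule measurable_compose_countable[where f="\<lambda>i p. Y (fst p) (c (real_of_int i / real (Suc n)))" and g="\<lambda>p. \<lfloor>real (Suc n) * snd p\<rfloor>"])
      fix i :: int
      show "(\<lambda>p. Y (fst p) (c (real_of_int i / real (Suc n)))) \<in> borel_measurable (M \<Otimes>\<^sub>M lborel)"
        by (rule measurable_compose[OF measurable_fst meas[OF c]])
    qed measurable
    then show "(\<lambda>p. Y (fst p) (c (A n (snd p)))) \<in> borel_measurable (M \<Otimes>\<^sub>M lborel)"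
      by (simp add: A_def)
  next
    fix p assume "p \<in> space (M \<Otimes>\<^sub>M (lborel :: real measure))"
    then have w: "fst p \<in> space M" by (auto simp: space_pair_measure)
    have "continuous_on UNIV (\<lambda>s. Y (fst p) (c s))"
      by (rule continuous_on_compose2[OF cont[OF w] cc]) (use c in auto)
    then have "isCont (\<lambda>s. Y (fst p) (c s)) (snd p)" by (simp add: continuous_on_eq_continuous_at)
    from isCont_tendsto_compose[OF this Alim]
    show "(\<lambda>n. Y (fst p) (c (A n (snd p)))) \<longlonglongrightarrow> (case p of (\<omega>, s) \<Rightarrow> Y \<omega> (c s))"
      unfolding case_prod_beta .
  qed
  then have "(\<lambda>(\<omega>, s). indicat_real {0..t} s *\<^sub>R Y \<omega> (c s)) \<in> borel_measurable (M \<Otimes>\<^sub>M lborel)"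
    by (simp add: case_prod_unfold)
  then have "(\<lambda>\<omega>. \<integral>s. indicat_real {0..t} s *\<^sub>R Y \<omega> (c s) \<partial>lborel) \<in> borel_measurable M"
    by (rule lborel.borel_measurable_lebesgue_integral)
  moreover have "(\<integral>s. indicat_real {0..t} s *\<^sub>R Y \<omega> (c s) \<partial>lborel) = integral {0..t} (Y \<omega>)" if w: "\<omega> \<in> space M" for \<omega>
  proof -
    have ct: "continuous_on {0..t} (Y \<omega>)" using cont[OF w] by (rule continuous_on_subset) (use t in auto)
    have "set_integrable lborel {0..t} (Y \<omega>)"
      unfolding set_integrable_def by (rule borel_integrable_compact) (use ct in auto)
    then have "integral {0..t} (Y \<omega>) = (\<integral>s. indicat_real {0..t} s *\<^sub>R Y \<omega> s \<partial>lborel)"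
      by (simp add: set_borel_integral_eq_integral(2)[symmetric] set_lebesgue_integral_def)
    also have "\<dots> = (\<integral>s. indicat_real {0..t} s *\<^sub>R Y \<omega> (c s) \<partial>lborel)"
    proof (rule Bochner_Integration.integral_cong[OF refl])
      fix s
      have "c s = s" if "s \<in> {0..t}" using that t by (auto simp: c_def)
      then show "indicat_real {0..t} s *\<^sub>R Y \<omega> s = indicat_real {0..t} s *\<^sub>R Y \<omega> (c s)"
        by (cases "s \<in> {0..t}") simp_all
    qed
    finally show ?thesis by simp
  qed
  ultimately show ?thesis by (simp cong: measurable_cong)
qed

section \<open>The driving path as a functional of scalar coefficients\<close>

lemma measurable_pack[measurable]: "(\<lambda>z. pack z m :: real^'n) \<in> borel_measurable gauss_seq"
proof -
  have [measurable]: "(\<lambda>z. z k) \<in> borel_measurable gauss_seq" for k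
    using measurable_component_singleton[of k UNIV "\<lambda>_. gauss"] by simp
  have "pack z m = (\<Sum>i\<in>UNIV. z (inv idx (m, i)) *\<^sub>R axis i (1::real) :: real^'n)" for z
    by (simp add: pack_def vec_eq_iff axis_def if_distrib cong: if_cong)
  then show ?thesis by simp
qed

lemma measurable_schauder_pack[measurable]:
  "(\<lambda>z. schauder T N (pack z :: nat \<Rightarrow> real^'n) t) \<in> borel_measurable gauss_seq"
proof -
  have [measurable]: "(\<lambda>z. haar_synth (pack z :: nat \<Rightarrow> real^'n) m) \<in> borel_measurable gauss_seq" for m
  proof (induction m rule: less_induct)
    case (less m)
    show ?case
    proof (cases "m < 2")
      case True
      then show ?thesis by (subst haar_synth.simps) simp
    next
      case False
      then have [measurable]: "(\<lambda>z. haar_synth (pack z :: nat \<Rightarrow> real^'n) (m div 2)) \<in> borel_measurable gauss_seq"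
        by (intro less.IH) auto
      show ?thesis using False by (subst haar_synth.simps) (cases "even m"; simp)
    qed
  qed
  show ?thesis unfolding schauder_def by measurable
qed

text \<open>The type argument records the dimension, which a sequence of scalars does not
  determine.\<close>

definition good :: "real \<Rightarrow> 'n::finite itself \<Rightarrow> (nat \<Rightarrow> real) set" where
  "good T _ = {z. uniformly_convergent_on {0..T} (\<lambda>N. schauder T N (pack z :: nat \<Rightarrow> real^'n))}"

text \<open>Uniform convergence as a Cauchy criterion with errors
  \<open>inverse (real (Suc j))\<close>; continuity restricts the times to rationals, so only
  countable quantifiers are left.\<close>

lemma sets_good:
  assumes T: "T > 0"
  shows "good T TYPE('n::finite) \<in> sets gauss_seq"
proof -
  let ?s = "\<lambda>N z. schauder T N (pack z :: nat \<Rightarrow> real^'n)"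
  let ?R = "\<rat> \<inter> {0..T}"
  have "good T TYPE('n) = {z \<in> space gauss_seq. \<forall>j::nat. \<exists>M. \<forall>m. \<forall>n. \<forall>t\<in>?R. M \<le> m \<longrightarrow> M \<le> n \<longrightarrow> dist (?s m z t) (?s n z t) \<le> inverse (real (Suc j))}"
  proof (rule set_eqI)
    fix z
    have "z \<in> good T TYPE('n) \<longleftrightarrow> uniformly_Cauchy_on {0..T} (\<lambda>N. ?s N z)"
      unfolding good_def by (simp add: uniformly_convergent_eq_Cauchy)
    also have "\<dots> \<longleftrightarrow> (\<forall>j::nat. \<exists>M. \<forall>m. \<forall>n. \<forall>t\<in>?R. M \<le> m \<longrightarrow> M \<le> n \<longrightarrow> dist (?s m z t) (?s n z t) \<le> inverse (real (Suc j)))"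
    proof
      assume C: "uniformly_Cauchy_on {0..T} (\<lambda>N. ?s N z)"
      show "\<forall>j::nat. \<exists>M. \<forall>m. \<forall>n. \<forall>t\<in>?R. M \<le> m \<longrightarrow> M \<le> n \<longrightarrow> dist (?s m z t) (?s n z t) \<le> inverse (real (Suc j))"
      proof
        fix j :: nat
        have "0 < inverse (real (Suc j))" by simp
        with C obtain M where M: "\<forall>t\<in>{0..T}. \<forall>m\<ge>M. \<forall>n\<ge>M. dist (?s m z t) (?s n z t) < inverse (real (Suc j))"
          unfolding uniformly_Cauchy_on_def by blast
        show "\<exists>M. \<forall>m. \<forall>n. \<forall>t\<in>?R. M \<le> m \<longrightarrow> M \<le> n \<longrightarrow> dist (?s m z t) (?s n z t) \<le> inverse (real (Suc j))"
        proof (intro exI[of _ M] allI ballI impI)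
          fix m n t assume "t \<in> ?R" "M \<le> m" "M \<le> n"
          then have "dist (?s m z t) (?s n z t) < inverse (real (Suc j))" using M by blast
          then show "dist (?s m z t) (?s n z t) \<le> inverse (real (Suc j))" by (rule less_imp_le)
        qed
      qed
    next
      assume C: "\<forall>j::nat. \<exists>M. \<forall>m. \<forall>n. \<forall>t\<in>?R. M \<le> m \<longrightarrow> M \<le> n \<longrightarrow> dist (?s m z t) (?s n z t) \<le> inverse (real (Suc j))"
      show "uniformly_Cauchy_on {0..T} (\<lambda>N. ?s N z)"
      proof (rule uniformly_Cauchy_onI)
        fix e :: real assume "0 < e"
        then obtain j where j: "inverse (real (Suc j)) < e" using reals_Archimedean by blast
        from C obtain M where M: "\<forall>m. \<forall>n. \<forall>t\<in>?R. M \<le> m \<longrightarrow> M \<le> n \<longrightarrow> dist (?s m z t) (?s n z t) \<le> inverse (real (Suc j))"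
          by blast
        show "\<exists>M. \<forall>x\<in>{0..T}. \<forall>m\<ge>M. \<forall>n\<ge>M. dist (?s m z x) (?s n z x) < e"
        proof (intro exI[of _ M] ballI allI impI)
          fix t m n assume t: "t \<in> {0..T}" and mn: "M \<le> m" "M \<le> n"
          have "dist (?s m z t) (?s n z t) \<le> inverse (real (Suc j))"
            by (rule dist_le_on_rationals[OF T continuous_on_schauder[OF T] continuous_on_schauder[OF T] _ t])
               (use M mn in blast)
          then show "dist (?s m z t) (?s n z t) < e" using j by linarith
        qed
      qed
    qed
    finally show "z \<in> good T TYPE('n) \<longleftrightarrow> z \<in> {z \<in> space gauss_seq. \<forall>j::nat. \<exists>M. \<forall>m. \<forall>n. \<forall>t\<in>?R. M \<le> m \<longrightarrow> M \<le> n \<longrightarrow> dist (?s m z t) (?s n z t) \<le> inverse (real (Suc j))}"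
      by (simp add: space_gauss_seq)
  qed
  also have "\<dots> \<in> sets gauss_seq"
  proof (intro sets.sets_Collect_countable_All sets.sets_Collect_countable_Ex sets.sets_Collect_countable_All')
    show "countable ?R" using countable_rat by (rule countable_Int1)
    show "{z \<in> space gauss_seq. M \<le> m \<longrightarrow> M \<le> n \<longrightarrow> dist (?s m z t) (?s n z t) \<le> inverse (real (Suc j))} \<in> sets gauss_seq" for M m n j t
      by measurable
  qed
  finally show ?thesis .
qed

text \<open>The value 0 off the good set makes every path continuous and not just almost every one,
  as the measurability of the flow requires.\<close>

definition wiener :: "real \<Rightarrow> (nat \<Rightarrow> real) \<Rightarrow> real \<Rightarrow> real^'n" where
  "wiener T z t = (if z \<in> good T TYPE('n) then lim (\<lambda>N. schauder T N (pack z) t) else 0)"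

lemma wiener_uniform_limit:
  assumes "z \<in> good T TYPE('n::finite)"
  shows "uniform_limit {0..T} (\<lambda>N. schauder T N (pack z :: nat \<Rightarrow> real^'n)) (wiener T z) sequentially"
proof -
  have "wiener T z = (\<lambda>t. lim (\<lambda>N. schauder T N (pack z :: nat \<Rightarrow> real^'n) t))"
    using assms by (simp add: wiener_def fun_eq_iff)
  then show ?thesis using assms unfolding good_def by (simp add: uniformly_convergent_uniform_limit_iff)
qed

lemma wiener_continuous:
  assumes T: "T > 0" shows "continuous_on {0..T} (wiener T z :: real \<Rightarrow> real^'n)"
proof (cases "z \<in> good T TYPE('n)")
  case True
  show ?thesis
    by (rule uniform_limit_theorem[OF _ wiener_uniform_limit[OF True]])
       (auto intro!: always_eventually continuous_on_schauder[OF T])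
next
  case False
  then have "wiener T z = (\<lambda>_. 0 :: real^'n)" by (simp add: wiener_def fun_eq_iff)
  then show ?thesis by simp
qed

lemma measurable_wiener:
  assumes T: "T > 0" and t: "t \<in> {0..T}"
  shows "(\<lambda>z. wiener T z t :: real^'n) \<in> borel_measurable gauss_seq"
proof (rule borel_measurable_LIMSEQ_metric[where f="\<lambda>N z. if z \<in> good T TYPE('n) then schauder T N (pack z) t else 0"])
  fix N
  have [measurable]: "Measurable.pred gauss_seq (\<lambda>z. z \<in> good T TYPE('n))"
    using sets_good[OF T, where 'n='n] by (simp add: pred_def space_gauss_seq)
  show "(\<lambda>z. if z \<in> good T TYPE('n) then schauder T N (pack z) t else 0 :: real^'n) \<in> borel_measurable gauss_seq"
    by measurable
next
  fix z
  show "(\<lambda>N. if z \<in> good T TYPE('n) then schauder T N (pack z) t else 0 :: real^'n) \<longlonglongrightarrow> wiener T z t"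
  proof (cases "z \<in> good T TYPE('n)")
    case True
    then show ?thesis using tendsto_uniform_limitI[OF wiener_uniform_limit[OF True] t] by simp
  qed (simp add: wiener_def)
qed

text \<open>Uniform continuity makes the interpolations of \<open>w\<close> converge to
  \<open>w\<close>. Applied to Brownian paths, this shows that Gaussian coefficients are good almost
  surely, with no estimate of a random series.\<close>

lemma wiener_haar:
  fixes w :: "real \<Rightarrow> real^'n"
  assumes T: "T > 0" and w: "continuous_on {0..T} w" and 0: "w 0 = 0"
  shows "unpack (haar T w) \<in> good T TYPE('n)" "\<And>t. t \<in> {0..T} \<Longrightarrow> wiener T (unpack (haar T w)) t = w t"
proof -
  have ul: "uniform_limit {0..T} (\<lambda>N. schauder T N (pack (unpack (haar T w)) :: nat \<Rightarrow> real^'n)) w sequentially"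
    unfolding pack_unpack
  proof (rule uniform_limitI)
    fix e :: real assume e: "0 < e"
    have "uniformly_continuous_on {0..T} w" using w by (intro compact_uniformly_continuous) auto
    from this[unfolded uniformly_continuous_on_def, rule_format, of "e / 4"] e
    obtain d where d: "d > 0" "\<forall>s\<in>{0..T}. \<forall>r\<in>{0..T}. dist r s < d \<longrightarrow> dist (w r) (w s) < e / 4" by auto
    have "(\<lambda>N. T * (1/2) ^ N) \<longlonglongrightarrow> T * 0" by (intro tendsto_mult tendsto_const LIMSEQ_realpow_zero) auto
    then have "\<forall>\<^sub>F N in sequentially. T * (1/2) ^ N < d" using d(1) by (auto simp: order_tendsto_iff)
    then show "\<forall>\<^sub>F N in sequentially. \<forall>t\<in>{0..T}. dist (schauder T N (haar T w) t) (w t) < e"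
    proof eventually_elim
      case (elim N)
      then have Td: "T / 2 ^ N < d" by (simp add: power_one_over)
      show ?case
      proof
        fix t assume t: "t \<in> {0..T}"
        have "norm (schauder T N (haar T w) t - (w t - w 0)) \<le> 2 * (e / 4)"
        proof (rule schauder_haar[OF T t])
          fix r s assume rs: "r \<in> {0..T}" "s \<in> {0..T}" "\<bar>r - s\<bar> \<le> T / 2 ^ N"
          then have "dist r s < d" using Td by (simp add: dist_real_def)
          then have "dist (w r) (w s) < e / 4" using d(2) rs by blast
          then show "norm (w r - w s) \<le> e / 4" by (simp add: dist_norm)
        qed
        then show "dist (schauder T N (haar T w) t) (w t) < e" using e by (simp add: 0 dist_norm)
      qed
    qed
  qed
  show g: "unpack (haar T w) \<in> good T TYPE('n)"
    unfolding good_def uniformly_convergent_on_def using ul by blast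
  show "wiener T (unpack (haar T w)) t = w t" if t: "t \<in> {0..T}" for t
    by (rule LIMSEQ_unique[OF tendsto_uniform_limitI[OF wiener_uniform_limit[OF g] t] tendsto_uniform_limitI[OF ul t]])
qed

definition sol :: "real \<Rightarrow> (real^'n \<Rightarrow> real^'n) \<Rightarrow> real^'n \<Rightarrow> (nat \<Rightarrow> real) \<Rightarrow> real \<Rightarrow> real^'n" where
  "sol T b x z = restrict (flow b x (wiener T z)) {0..T}"

lemma (in lipschitz_drift) measurable_flow_param:
  assumes w: "\<And>\<omega>. \<omega> \<in> space M \<Longrightarrow> continuous_on {0..T} (w \<omega>)"
    and m: "\<And>t. t \<in> {0..T} \<Longrightarrow> (\<lambda>\<omega>. w \<omega> t) \<in> borel_measurable M" and t: "t \<in> {0..T}"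
  shows "(\<lambda>\<omega>. flow b x (w \<omega>) t) \<in> borel_measurable M"
proof (rule borel_measurable_LIMSEQ_metric[where f="\<lambda>n \<omega>. picard b x (w \<omega>) n t"])
  have [measurable]: "b \<in> borel_measurable borel"
    by (rule borel_measurable_continuous_onI[OF continuous_on_b])
  show "(\<lambda>\<omega>. picard b x (w \<omega>) n t) \<in> borel_measurable M" for n
    using t
  proof (induction n arbitrary: t)
    case 0 then show ?case using m by simp
  next
    case (Suc n)
    have "(\<lambda>\<omega>. integral {0..t} (\<lambda>s. b (picard b x (w \<omega>) n s))) \<in> borel_measurable M"
    proof (rule measurable_integral_continuous[OF Suc.prems])
      show "continuous_on {0..T} (\<lambda>s. b (picard b x (w \<omega>) n s))" if "\<omega> \<in> space M" for \<omega>
        by (intro continuous_on_b_comp picard_continuous w that)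
      show "(\<lambda>\<omega>. b (picard b x (w \<omega>) n s)) \<in> borel_measurable M" if "s \<in> {0..T}" for s
        using Suc.IH[OF that] by measurable
    qed
    then show ?case using m[OF Suc.prems] by simp
  qed
  show "(\<lambda>n. picard b x (w \<omega>) n t) \<longlonglongrightarrow> flow b x (w \<omega>) t" if "\<omega> \<in> space M" for \<omega>
    by (rule tendsto_uniform_limitI[OF picard_uniform_limit[OF w[OF that]] t])
qed

section \<open>Transport on path space\<close>

lemma C1_map_has_derivative:
  assumes "C1_map b"
  shows "(b has_derivative (\<lambda>v. jacobian b (at y) *v v)) (at y)"
  using assms jacobian_works unfolding C1_map_def by blast

lemma lipschitz_of_jacobian_bound:
  fixes b :: "real^'n \<Rightarrow> real^'n"
  assumes "C1_map b" "\<And>y. operator_norm (jacobian b (at y)) \<le> K"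
  shows "norm (b x - b y) \<le> K * norm (x - y)"
  by (rule differentiable_bound[where S=UNIV and f'="\<lambda>y v. jacobian b (at y) *v v"])
     (use assms C1_map_has_derivative in \<open>auto simp: operator_norm_def\<close>)

text \<open>The antisymmetric part of the Jacobian drops out of the quadratic form.\<close>

lemma sym_grad_quadratic: "v \<bullet> (sym_grad b y *v v) = v \<bullet> (jacobian b (at y) *v v)"
proof -
  let ?J = "jacobian b (at y)"
  have "sym_grad b y = (1/2) *\<^sub>R (transpose ?J + ?J)"
    by (simp add: sym_grad_def vec_eq_iff transpose_def)
  then have "sym_grad b y *v v = (1/2) *\<^sub>R (transpose ?J *v v + ?J *v v)"
    by (simp add: scaleR_matrix_vector_assoc[symmetric] matrix_vector_mult_add_rdistrib)
  moreover have "v \<bullet> (transpose ?J *v v) = v \<bullet> (?J *v v)"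
    unfolding transpose_matrix_vector by (subst inner_commute) (rule dot_lmul_matrix)
  ultimately show ?thesis by (simp add: inner_add_right)
qed

text \<open>Mean value theorem along the segment from \<open>y\<close> to \<open>x\<close>, for the
  component of \<open>b\<close> in the direction \<open>v = x - y\<close>; its derivative is the
  quadratic form of the symmetrized gradient at \<open>v\<close>.\<close>

lemma one_sided_lipschitz:
  fixes b :: "real^'n \<Rightarrow> real^'n"
  assumes "C1_map b" "\<And>y. loewner_le (sym_grad b y) (mat B)"
  shows "(x - y) \<bullet> (b x - b y) \<le> B * (norm (x - y))\<^sup>2"
proof -
  define v where "v = x - y"
  have J: "v \<bullet> (jacobian b (at p) *v v) \<le> B * (norm v)\<^sup>2" for p
  proof -
    have "0 \<le> v \<bullet> ((mat B - sym_grad b p) *v v)"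
      using assms(2)[of p] by (simp add: loewner_le_def nonneg_definite_def)
    moreover have "mat B *v v = B *\<^sub>R v"
      by (simp add: vec_eq_iff matrix_vector_mult_def mat_def if_distrib[of "\<lambda>c. c * _"] cong: if_cong)
    ultimately show ?thesis
      by (simp add: matrix_vector_mult_diff_rdistrib inner_diff_right sym_grad_quadratic power2_norm_eq_inner)
  qed
  define \<phi> where "\<phi> s = v \<bullet> b (y + s *\<^sub>R v)" for s :: real
  have d: "(\<phi> has_real_derivative v \<bullet> (jacobian b (at (y + s *\<^sub>R v)) *v v)) (at s)" for s
  proof -
    have 1: "((\<lambda>s. y + s *\<^sub>R v) has_derivative (\<lambda>h. h *\<^sub>R v)) (at s)"
      by (auto intro!: derivative_eq_intros)
    have 2: "((\<lambda>s. b (y + s *\<^sub>R v)) has_derivative (\<lambda>h. jacobian b (at (y + s *\<^sub>R v)) *v (h *\<^sub>R v))) (at s)"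
      using has_derivative_compose[OF 1 C1_map_has_derivative[OF assms(1)]] .
    have "(\<phi> has_derivative (\<lambda>h. v \<bullet> (jacobian b (at (y + s *\<^sub>R v)) *v (h *\<^sub>R v)))) (at s)"
      unfolding \<phi>_def by (rule has_derivative_inner_right[OF 2])
    then show ?thesis unfolding has_field_derivative_def
      by (simp add: matrix_vector_mult_scaleR mult.commute[of _ "v \<bullet> _"])
  qed
  obtain \<xi> where "\<phi> 1 - \<phi> 0 = (1 - 0) * (v \<bullet> (jacobian b (at (y + \<xi> *\<^sub>R v)) *v v))"
    using MVT2[of 0 1 \<phi> "\<lambda>s. v \<bullet> (jacobian b (at (y + s *\<^sub>R v)) *v v)"] d by auto
  then have "\<phi> 1 - \<phi> 0 \<le> B * (norm v)\<^sup>2" using J by simp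
  then show ?thesis by (simp add: \<phi>_def v_def inner_diff_right)
qed

section \<open>The Cameron-Martin distance of two solutions\<close>

lemma alpha_sq_eq:
  "alpha_sq T K B = 2 * (1 + K\<^sup>2 * (if B < 0 then 1 / B\<^sup>2 else if B > 0 then exp (2 * B * T) / (2 * B\<^sup>2) else T\<^sup>2 / 2))"
  by (simp add: alpha_sq_def)

lemma alpha_sq_pos: "0 < alpha_sq T K B"
  unfolding alpha_sq_eq by (auto intro!: add_pos_nonneg)

text \<open>\<open>\<beta>\<close> is continuous on \<open>{0..T}\<close> only; cut off by the
  indicator it is Borel on the line, as a density must be.\<close>

lemma (in lipschitz_drift) CM_density_add_drift:
  fixes h u \<beta> D :: "real \<Rightarrow> real^'n"
  assumes h: "CM_density T u h" and \<beta>: "continuous_on {0..T} \<beta>"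
    and D: "\<And>t. t \<in> {0..T} \<Longrightarrow> D t = u t + integral {0..t} \<beta>"
  shows "CM_density T D (\<lambda>s. h s + indicator {0..T} s *\<^sub>R \<beta> s)"
proof -
  let ?\<beta> = "\<lambda>s. indicat_real {0..T} s *\<^sub>R \<beta> s"
  have hm[measurable]: "h \<in> borel_measurable borel" and h2: "set_integrable lborel {0..T} (\<lambda>s. (norm (h s))\<^sup>2)"
    and hu: "\<And>t. t \<in> {0..T} \<Longrightarrow> u t = set_lebesgue_integral lborel {0..t} h"
    using h by (auto simp: CM_density_def)
  have \<beta>m[measurable]: "?\<beta> \<in> borel_measurable borel"
    by (rule borel_measurable_continuous_on_indicator[OF _ \<beta>]) simp
  have \<beta>2: "set_integrable lborel {0..T} (\<lambda>s. (norm (\<beta> s))\<^sup>2)"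
    unfolding set_integrable_def by (rule borel_integrable_compact) (auto intro!: continuous_intros \<beta>)
  have \<beta>i: "set_integrable lborel {0..t} \<beta>" if "t \<in> {0..T}" for t
    unfolding set_integrable_def by (rule borel_integrable_compact) (use that in \<open>auto intro!: continuous_on_subset[OF \<beta>]\<close>)
  show ?thesis unfolding CM_density_def
  proof (intro conjI ballI)
    show "(\<lambda>s. h s + ?\<beta> s) \<in> borel_measurable borel" by measurable
    have "set_integrable lborel {0..T} (\<lambda>s. 2 * (norm (h s))\<^sup>2 + 2 * (norm (\<beta> s))\<^sup>2)"
      by (intro set_integral_add set_integrable_mult_right h2 \<beta>2)
    then show "set_integrable lborel {0..T} (\<lambda>s. (norm (h s + ?\<beta> s))\<^sup>2)"
      unfolding set_integrable_def
    proof (rule Bochner_Integration.integrable_bound)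
      show "AE s in lborel. norm (indicat_real {0..T} s *\<^sub>R (norm (h s + ?\<beta> s))\<^sup>2)
        \<le> norm (indicat_real {0..T} s *\<^sub>R (2 * (norm (h s))\<^sup>2 + 2 * (norm (\<beta> s))\<^sup>2))"
      proof (rule AE_I2)
        fix s
        have "(norm (h s + \<beta> s))\<^sup>2 \<le> 2 * (norm (h s))\<^sup>2 + 2 * (norm (\<beta> s))\<^sup>2"
          using zero_le_power2[of "norm (h s - \<beta> s)"]
          by (simp add: power2_norm_eq_inner inner_add inner_diff inner_commute)
        then show "norm (indicat_real {0..T} s *\<^sub>R (norm (h s + ?\<beta> s))\<^sup>2)
          \<le> norm (indicat_real {0..T} s *\<^sub>R (2 * (norm (h s))\<^sup>2 + 2 * (norm (\<beta> s))\<^sup>2))"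
          by (cases "s \<in> {0..T}") simp_all
      qed
    qed measurable
    fix t assume t: "t \<in> {0..T}"
    have hi: "set_integrable lborel {0..t} h"
      by (rule set_integrable_subset[OF CM_density_integrable[OF h]]) (use t in auto)
    have "set_lebesgue_integral lborel {0..t} (\<lambda>s. h s + ?\<beta> s) = set_lebesgue_integral lborel {0..t} (\<lambda>s. h s + \<beta> s)"
      unfolding set_lebesgue_integral_def
    proof (rule Bochner_Integration.integral_cong[OF refl])
      fix s
      show "indicat_real {0..t} s *\<^sub>R (h s + ?\<beta> s) = indicat_real {0..t} s *\<^sub>R (h s + \<beta> s)"
        using t by (cases "s \<in> {0..t}") simp_all
    qed
    also have "\<dots> = set_lebesgue_integral lborel {0..t} h + set_lebesgue_integral lborel {0..t} \<beta>"
      by (rule set_integral_add(2)[OF hi \<beta>i[OF t]])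
    also have "set_lebesgue_integral lborel {0..t} \<beta> = integral {0..t} \<beta>"
      by (rule set_borel_integral_eq_integral(2)[OF \<beta>i[OF t]])
    finally show "D t = set_lebesgue_integral lborel {0..t} (\<lambda>s. h s + ?\<beta> s)" using D[OF t] hu[OF t] by simp
  qed
qed

text \<open>The difference \<open>D\<close> of the solutions has velocity
  \<open>h + \<beta>\<close>, where \<open>h\<close> belongs to the driving paths and has energy at
  most \<open>C\<close>, and \<open>norm (\<beta> s) \<le> K * norm (D s)\<close>. Hence its energy
  is at most \<open>2 * C + 2 * K\<^sup>2 * (\<kappa> * C)\<close>, which is
  \<open>alpha_sq T K B * C\<close>.\<close>

lemma d_H_sol_le:
  fixes b :: "real^'n \<Rightarrow> real^'n"
  assumes "lipschitz_drift b K T"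
    and os: "\<And>x y. (x - y) \<bullet> (b x - b y) \<le> B * (norm (x - y))\<^sup>2"
    and z: "z \<in> good T TYPE('n)" "z' \<in> good T TYPE('n)"
  shows "(d_H T (sol T b x z) (sol T b x z'))\<^sup>2 \<le> ennreal (alpha_sq T K B) * (\<Sum>k. ennreal ((z k - z' k)\<^sup>2))"
\<comment> \<open>If the displacement is infinite, so is the bound, because \<open>alpha_sq\<close>
  is positive; for a zero factor the product would be 0.\<close>
proof (cases "(\<Sum>k. ennreal ((z k - z' k)\<^sup>2)) = \<infinity>")
  case True
  then show ?thesis using alpha_sq_pos[of T K B] by (simp add: ennreal_mult_top)
next
  case False
  interpret lipschitz_drift b K T by fact
  let ?w = "wiener T z :: real \<Rightarrow> real^'n" and ?w' = "wiener T z' :: real \<Rightarrow> real^'n"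
  note wc = wiener_continuous[OF T, of z, where 'n='n] wiener_continuous[OF T, of z', where 'n='n]
  define c where "c m = (pack z m - pack z' m :: real^'n)" for m
  have c: "c = pack (\<lambda>k. z k - z' k)" by (simp add: c_def pack_def fun_eq_iff vec_eq_iff)
  have sum_c: "(\<Sum>m. ennreal ((norm (c m))\<^sup>2)) = (\<Sum>k. ennreal ((z k - z' k)\<^sup>2))"
    unfolding c by (rule suminf_pack)
  have cs: "summable (\<lambda>m. (norm (c m))\<^sup>2)"
    by (rule summable_suminf_not_top) (use False sum_c in auto)
  define C where "C = (\<Sum>m. (norm (c m))\<^sup>2)"
  have C: "ennreal C = (\<Sum>k. ennreal ((z k - z' k)\<^sup>2))"
    unfolding C_def sum_c[symmetric] by (rule suminf_ennreal2[symmetric]) (auto simp: cs)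
  have C0: "0 \<le> C" unfolding C_def by (intro suminf_nonneg cs) simp
  define u where "u t = ?w t - ?w' t" for t
  define X where "X = flow b x ?w"
  define Y where "Y = flow b x ?w'"
  define D where "D t = X t - Y t" for t
  define \<beta> where "\<beta> t = b (X t) - b (Y t)" for t
  have Xc: "continuous_on {0..T} X" and Yc: "continuous_on {0..T} Y"
    unfolding X_def Y_def by (intro flow_continuous wc)+
  have sch: "schauder T N c t = schauder T N (pack z) t - schauder T N (pack z') t" for N t
    unfolding c_def by (rule schauder_diff)
  have ul: "uniform_limit {0..T} (\<lambda>N. schauder T N c) u sequentially"
    using uniform_limit_minus[OF wiener_uniform_limit[OF z(1)] wiener_uniform_limit[OF z(2)]]
    unfolding sch[abs_def] u_def[abs_def] .
  have Dt: "D t = u t + integral {0..t} \<beta>" if t: "t \<in> {0..T}" for t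
  proof -
    have sub: "{0..t} \<subseteq> {0..T}" using t by auto
    have i: "(\<lambda>s. b (X s)) integrable_on {0..t}" "(\<lambda>s. b (Y s)) integrable_on {0..t}"
      by (intro integrable_continuous_real continuous_on_b_comp continuous_on_subset[OF _ sub] Xc Yc)+
    show ?thesis unfolding D_def u_def \<beta>_def integral_diff[OF i]
      using flow_solution[OF wc(1) t, of x] flow_solution[OF wc(2) t, of x]
      unfolding X_def Y_def by simp
  qed
  interpret P: perturbed_flow T K B C c D u \<beta>
  proof
    show "(\<Sum>m<2^N. (norm (c m))\<^sup>2) \<le> C" for N unfolding C_def by (intro sum_le_suminf cs) auto
    show "continuous_on {0..T} D" unfolding D_def by (intro continuous_on_diff Xc Yc)
    show "continuous_on {0..T} \<beta>" unfolding \<beta>_def by (intro continuous_on_diff continuous_on_b_comp Xc Yc)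
    show "norm (\<beta> t) \<le> K * norm (D t)" for t unfolding \<beta>_def D_def by (rule lip)
    show "D t \<bullet> \<beta> t \<le> B * (norm (D t))\<^sup>2" for t unfolding \<beta>_def D_def by (rule os)
  qed (use T ul Dt in auto)
  define \<kappa> where "\<kappa> = (if B < 0 then 1 / B\<^sup>2 else if B > 0 then exp (2 * B * T) / (2 * B\<^sup>2) else T\<^sup>2 / 2)"
  have en: "integral {0..T} (\<lambda>s. (norm (D s))\<^sup>2) \<le> \<kappa> * C" unfolding \<kappa>_def by (rule P.energy)
  obtain h where h: "CM_density T u h"
    and h2: "(\<integral>\<^sup>+s. ennreal ((norm (h s))\<^sup>2) * indicator {0..T} s \<partial>lborel) \<le> ennreal C"
    using CM_density_of_schauder_limit[OF T cs tendsto_uniform_limitI[OF ul]] unfolding C_def by blast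
  have hm[measurable]: "h \<in> borel_measurable borel" using h by (simp add: CM_density_def)
  define g where "g s = h s + indicator {0..T} s *\<^sub>R \<beta> s" for s
  have g: "CM_density T D g"
    unfolding g_def by (rule CM_density_add_drift[OF h P.\<beta>cont Dt])
  have D2i: "set_integrable lborel {0..T} (\<lambda>s. (norm (D s))\<^sup>2)"
    unfolding set_integrable_def by (rule borel_integrable_compact) (auto intro!: continuous_intros P.Dcont)
  have D2: "(\<integral>\<^sup>+s. ennreal (indicator {0..T} s *\<^sub>R (norm (D s))\<^sup>2) \<partial>lborel) \<le> ennreal (\<kappa> * C)"
  proof -
    have "(\<integral>\<^sup>+s. ennreal (indicator {0..T} s *\<^sub>R (norm (D s))\<^sup>2) \<partial>lborel) = ennreal (set_lebesgue_integral lborel {0..T} (\<lambda>s. (norm (D s))\<^sup>2))"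
      unfolding set_lebesgue_integral_def
      by (rule nn_integral_eq_integral) (use D2i in \<open>auto simp: set_integrable_def\<close>)
    also have "set_lebesgue_integral lborel {0..T} (\<lambda>s. (norm (D s))\<^sup>2) = integral {0..T} (\<lambda>s. (norm (D s))\<^sup>2)"
      by (rule set_borel_integral_eq_integral(2)[OF D2i])
    finally show ?thesis using en by (simp add: ennreal_leI)
  qed
  have \<kappa>0: "0 \<le> \<kappa>" by (simp add: \<kappa>_def)
  have D2m[measurable]: "(\<lambda>s. indicat_real {0..T} s *\<^sub>R (norm (D s))\<^sup>2) \<in> borel_measurable borel"
    using D2i by (simp add: set_integrable_def borel_measurable_integrable)
  have "(\<integral>\<^sup>+s. ennreal ((norm (g s))\<^sup>2) * indicator {0..T} s \<partial>lborel)
    \<le> (\<integral>\<^sup>+s. 2 * (ennreal ((norm (h s))\<^sup>2) * indicator {0..T} s) + ennreal (2 * K\<^sup>2) * ennreal (indicat_real {0..T} s *\<^sub>R (norm (D s))\<^sup>2) \<partial>lborel)"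
  proof (rule nn_integral_mono)
    fix s
    show "ennreal ((norm (g s))\<^sup>2) * indicator {0..T} s
      \<le> 2 * (ennreal ((norm (h s))\<^sup>2) * indicator {0..T} s) + ennreal (2 * K\<^sup>2) * ennreal (indicat_real {0..T} s *\<^sub>R (norm (D s))\<^sup>2)"
    proof (cases "s \<in> {0..T}")
      case True
      have "(norm (h s + \<beta> s))\<^sup>2 \<le> 2 * (norm (h s))\<^sup>2 + 2 * (norm (\<beta> s))\<^sup>2"
        using zero_le_power2[of "norm (h s - \<beta> s)"]
        by (simp add: power2_norm_eq_inner inner_add inner_diff inner_commute)
      also have "(norm (\<beta> s))\<^sup>2 \<le> (K * norm (D s))\<^sup>2" using P.K[OF True] by (intro power_mono) auto
      finally have "(norm (g s))\<^sup>2 \<le> 2 * (norm (h s))\<^sup>2 + 2 * K\<^sup>2 * (norm (D s))\<^sup>2"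
        using True by (simp add: g_def power_mult_distrib mult.assoc)
      then have "ennreal ((norm (g s))\<^sup>2) \<le> ennreal (2 * (norm (h s))\<^sup>2 + 2 * K\<^sup>2 * (norm (D s))\<^sup>2)" by (rule ennreal_leI)
      also have "\<dots> = 2 * ennreal ((norm (h s))\<^sup>2) + ennreal (2 * K\<^sup>2) * ennreal ((norm (D s))\<^sup>2)"
        using ennreal_mult[of "2 * K\<^sup>2" "(norm (D s))\<^sup>2"] ennreal_mult[of 2 "(norm (h s))\<^sup>2"] by (subst ennreal_plus) auto
      finally show ?thesis using True by simp
    qed simp
  qed
  also have "\<dots> = 2 * (\<integral>\<^sup>+s. ennreal ((norm (h s))\<^sup>2) * indicator {0..T} s \<partial>lborel)
    + ennreal (2 * K\<^sup>2) * (\<integral>\<^sup>+s. ennreal (indicat_real {0..T} s *\<^sub>R (norm (D s))\<^sup>2) \<partial>lborel)"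
    by (subst nn_integral_add) (simp_all add: nn_integral_cmult del: real_scaleR_def)
  also have "\<dots> \<le> 2 * ennreal C + ennreal (2 * K\<^sup>2) * ennreal (\<kappa> * C)"
    by (intro add_mono mult_left_mono h2 D2) auto
  also have "\<dots> = ennreal (alpha_sq T K B * C)"
  proof -
    have "2 * ennreal C + ennreal (2 * K\<^sup>2) * ennreal (\<kappa> * C) = ennreal (2 * C + 2 * K\<^sup>2 * (\<kappa> * C))"
      using ennreal_mult[of "2 * K\<^sup>2" "\<kappa> * C"] ennreal_mult[of 2 C] C0 \<kappa>0 by (subst ennreal_plus) auto
    also have "2 * C + 2 * K\<^sup>2 * (\<kappa> * C) = alpha_sq T K B * C"
      unfolding alpha_sq_eq \<kappa>_def[symmetric] by (simp add: algebra_simps)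
    finally show ?thesis .
  qed
  finally have g2: "(\<integral>\<^sup>+s. ennreal ((norm (g s))\<^sup>2) * indicator {0..T} s \<partial>lborel) \<le> ennreal (alpha_sq T K B * C)" .
  let ?\<gamma> = "\<lambda>t. sol T b x z t - sol T b x z' t"
  \<comment> \<open>\<open>sol\<close> is restricted to \<open>{0..T}\<close>, and a density
    constrains the path on that interval only.\<close>
  have g': "CM_density T ?\<gamma> g" unfolding CM_density_def
  proof (intro conjI ballI)
    fix t assume t: "t \<in> {0..T}"
    have "?\<gamma> t = D t" using t by (simp add: sol_def D_def X_def Y_def)
    then show "?\<gamma> t = set_lebesgue_integral lborel {0..t} g" using g t by (simp add: CM_density_def)
  qed (use g in \<open>auto simp: CM_density_def\<close>)
  have a0: "0 \<le> alpha_sq T K B * C" using alpha_sq_pos[of T K B] C0 by simp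
  have "d_H T (sol T b x z) (sol T b x z') = ennreal (CM_norm T ?\<gamma>)"
    using g' by (auto simp: d_H_def CM_space_def)
  moreover have "0 \<le> CM_norm T ?\<gamma>"
    by (auto simp: CM_norm_def set_lebesgue_integral_def intro!: integral_nonneg_AE)
  ultimately have "(d_H T (sol T b x z) (sol T b x z'))\<^sup>2 = ennreal ((CM_norm T ?\<gamma>)\<^sup>2)"
    by (simp add: ennreal_power)
  also have "\<dots> \<le> ennreal (alpha_sq T K B * C)" by (intro ennreal_leI CM_norm_le[OF g' g2 a0])
  also have "\<dots> = ennreal (alpha_sq T K B) * (\<Sum>k. ennreal ((z k - z' k)\<^sup>2))"
    using alpha_sq_pos[of T K B] C0 by (simp add: ennreal_mult C[symmetric])
  finally show ?thesis .
qed

text \<open>An inequality only, because the integrand need not be measurable.\<close>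

lemma nn_integral_distr_le:
  assumes g: "g \<in> M \<rightarrow>\<^sub>M N"
  shows "(\<integral>\<^sup>+x. f x \<partial>distr M N g) \<le> (\<integral>\<^sup>+x. f (g x) \<partial>M)"
  unfolding nn_integral_def[of "distr M N g"]
proof (rule SUP_least)
  fix h assume "h \<in> {h. simple_function (distr M N g) h \<and> h \<le> f}"
  then have h: "simple_function (distr M N g) h" "\<And>x. h x \<le> f x" by (auto simp: le_fun_def)
  have hm: "h \<in> borel_measurable (distr M N g)" by (rule borel_measurable_simple_function[OF h(1)])
  have "integral\<^sup>S (distr M N g) h = (\<integral>\<^sup>+x. h x \<partial>distr M N g)" by (rule nn_integral_eq_simple_integral[OF h(1), symmetric])
  also have "\<dots> = (\<integral>\<^sup>+x. h (g x) \<partial>M)" by (rule nn_integral_distr[OF g hm])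
  also have "\<dots> \<le> (\<integral>\<^sup>+x. f (g x) \<partial>M)" by (intro nn_integral_mono h)
  finally show "integral\<^sup>S (distr M N g) h \<le> (\<integral>\<^sup>+x. f (g x) \<partial>M)" .
qed

lemma sqrt_ennreal_mono: "u \<le> v \<Longrightarrow> sqrt_ennreal u \<le> sqrt_ennreal v"
  by (auto simp: sqrt_ennreal_def top_unique less_top intro!: ennreal_leI enn2real_mono)

text \<open>The terms \<open>- u + 1\<close> of \<open>ent\<close> integrate to 0 because the
  density has mass 1, so the integral is the divergence; integrability of the logarithm under
  \<open>\<nu>\<close> allows the terms to be separated.\<close>

lemma nn_integral_ent_RN_deriv:
  assumes \<mu>: "prob_space \<mu>" and \<nu>: "prob_space \<nu>" and s: "sets \<nu> = sets \<mu>"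
    and ac: "absolutely_continuous \<mu> \<nu>" and i: "integrable \<nu> (entropy_density (exp 1) \<mu> \<nu>)"
  shows "(\<integral>\<^sup>+x. ennreal (ent (enn2real (RN_deriv \<mu> \<nu> x))) \<partial>\<mu>) = rel_entropy \<nu> \<mu>"
proof -
  interpret \<mu>: prob_space \<mu> by fact
  interpret \<nu>: prob_space \<nu> by fact
  let ?f = "RN_deriv \<mu> \<nu>"
  define g where "g x = enn2real (?f x)" for x
  have [measurable]: "g \<in> borel_measurable \<mu>" unfolding g_def by measurable
  have dens: "density \<mu> ?f = \<nu>" using ac s by (intro \<mu>.density_RN_deriv) auto
  have f1: "(\<integral>\<^sup>+x. ?f x \<partial>\<mu>) = 1"
  proof -
    have "(\<integral>\<^sup>+x. ?f x \<partial>\<mu>) = emeasure (density \<mu> ?f) (space \<mu>)"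
      by (subst emeasure_density) (auto cong: nn_integral_cong)
    then show ?thesis using \<nu>.emeasure_space_1 sets_eq_imp_space_eq[OF s] unfolding dens by simp
  qed
  have "AE x in \<mu>. ?f x \<noteq> \<infinity>" by (rule nn_integral_noteq_infinite) (auto simp: f1)
  then have fg: "AE x in \<mu>. ?f x = ennreal (g x)" by eventually_elim (simp add: g_def less_top)
  have dens': "\<nu> = density \<mu> (\<lambda>x. ennreal (g x))"
    by (rule trans[OF dens[symmetric] density_cong[OF _ _ fg]]) auto
  have g1: "(\<integral>\<^sup>+x. ennreal (g x) \<partial>\<mu>) = 1" using f1 nn_integral_cong_AE[OF fg] by simp
  have gi: "integrable \<mu> g" by (rule integrableI_nonneg) (auto simp: g1, simp add: g_def)
  have gI: "(\<integral>x. g x \<partial>\<mu>) = 1" using g1 by (subst integral_eq_nn_integral) (auto simp: g_def)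
  have ed: "entropy_density (exp 1) \<mu> \<nu> = (\<lambda>x. ln (g x))"
    by (simp add: entropy_density_def g_def log_def fun_eq_iff)
  have gl: "integrable \<mu> (\<lambda>x. g x * ln (g x))"
  proof -
    have "integrable (density \<mu> (\<lambda>x. ennreal (g x))) (\<lambda>x. ln (g x))" using i unfolding ed dens'[symmetric] .
    then show ?thesis by (subst (asm) integrable_density) (auto simp: g_def)
  qed
  have KL: "KL_divergence (exp 1) \<mu> \<nu> = (\<integral>x. g x * ln (g x) \<partial>\<mu>)"
  proof -
    have "KL_divergence (exp 1) \<mu> \<nu> = (\<integral>x. ln (g x) \<partial>\<nu>)" unfolding KL_divergence_def ed ..
    also have "\<dots> = (\<integral>x. ln (g x) \<partial>density \<mu> (\<lambda>x. ennreal (g x)))" using dens' by simp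
    also have "\<dots> = (\<integral>x. g x * ln (g x) \<partial>\<mu>)" by (subst integral_density) (auto simp: g_def)
    finally show ?thesis .
  qed
  have ei: "integrable \<mu> (\<lambda>x. ent (g x))" unfolding ent_def using gl gi by auto
  have "(\<integral>\<^sup>+x. ennreal (ent (g x)) \<partial>\<mu>) = ennreal (\<integral>x. ent (g x) \<partial>\<mu>)"
    by (rule nn_integral_eq_integral[OF ei]) (auto intro!: ent_nonneg simp: g_def)
  also have "(\<integral>x. ent (g x) \<partial>\<mu>) = (\<integral>x. g x * ln (g x) \<partial>\<mu>)"
    unfolding ent_def using gl gi by (simp add: gI \<mu>.prob_space)
  finally show ?thesis using ac i KL by (simp add: rel_entropy_def g_def)
qed

section \<open>The coupling on the noise and the transport inequality\<close>

theorem proposition5p4: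
  fixes b :: "real^'n \<Rightarrow> real^'n" and B K T :: real and x :: "real^'n"
    and M :: "'w measure" and F :: "real \<Rightarrow> 'w measure"
    and W X :: "real \<Rightarrow> 'w \<Rightarrow> real^'n"
  assumes "C1_map b"
    and "\<And>y. loewner_le (sym_grad b y) (mat B)"
    and "\<And>y. operator_norm (jacobian b (at y)) \<le> K"
    and "K \<ge> 0"
    and "T > 0"
    and "prob_space M"
    and "filtration_on M T F"
    and "brownian_motion M T F W"
    and "sde_solution M T F W b x X"
  shows "path_law M T X \<in> T2 (d_H T) (alpha_sq T K B)"
proof -
  have ld: "lipschitz_drift b K T"
    by unfold_locales (rule lipschitz_of_jacobian_bound[OF assms(1,3)], fact+)
  interpret lipschitz_drift b K T by (rule ld)
  interpret M: prob_space M by fact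
  interpret gs: prob_space gauss_seq by (rule prob_space_gauss_seq)
  have os: "(y - y') \<bullet> (b y - b y') \<le> B * (norm (y - y'))\<^sup>2" for y y'
    by (rule one_sided_lipschitz[OF assms(1,2)])
  define P where "P = path_law M T X"
  define S where "S = sol T b x"
  have Sm: "S \<in> gauss_seq \<rightarrow>\<^sub>M path_space T"
    unfolding S_def sol_def[abs_def]
    by (rule measurable_path_space[OF T flow_continuous[OF wiener_continuous[OF T]]
          measurable_flow_param[OF wiener_continuous[OF T] measurable_wiener[OF T]]])
  have Xm: "X t \<in> borel_measurable M" if "t \<in> {0..T}" for t
    using assms(7,9) that measurable_from_subalg unfolding sde_solution_def filtration_on_def by blast
  have Xc: "continuous_on {0..T} (\<lambda>t. X t \<omega>)" if "\<omega> \<in> space M" for \<omega>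
    using assms(9) that unfolding sde_solution_def by blast
  have Xpm: "(\<lambda>\<omega>. restrict (\<lambda>t. X t \<omega>) {0..T}) \<in> M \<rightarrow>\<^sub>M path_space T"
    by (rule measurable_path_space[OF T Xc Xm])
  interpret P: prob_space P unfolding P_def path_law_def by (rule M.prob_space_distr[OF Xpm])
  have sP: "sets P = sets (path_space T)" by (simp add: P_def path_law_def)
  define Z where "Z \<omega> = unpack (\<lambda>m. haar T (\<lambda>t. W t \<omega>) m)" for \<omega>
  note Z = distr_unpack[OF haar_iid[OF assms(6,7,8) T] assms(6), folded Z_def]
  \<comment> \<open>Almost every Brownian path is continuous and starts at 0, so its Haar
    coefficients rebuild it; uniqueness for the equation then identifies the given solution with
    \<open>S\<close> applied to these coefficients.\<close>
  have good_AE: "AE \<omega> in M. Z \<omega> \<in> good T TYPE('n) \<and> S (Z \<omega>) = restrict (\<lambda>t. X t \<omega>) {0..T}"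
  proof -
    have "AE \<omega> in M. W 0 \<omega> = 0" "AE \<omega> in M. continuous_on {0..T} (\<lambda>t. W t \<omega>)"
      using assms(8) unfolding brownian_motion_def by auto
    moreover have "AE \<omega> in M. \<forall>t\<in>{0..T}. X t \<omega> = x + W t \<omega> + integral {0..t} (\<lambda>s. b (X s \<omega>))"
      using assms(9) unfolding sde_solution_def by blast
    ultimately show ?thesis using AE_space
    proof eventually_elim
      case (elim \<omega>)
      let ?w = "\<lambda>t. W t \<omega>"
      have Zw: "Z \<omega> = unpack (haar T ?w)" by (simp add: Z_def)
      have g: "Z \<omega> \<in> good T TYPE('n)" unfolding Zw by (rule wiener_haar(1)[OF T elim(2,1)])
      have ww: "wiener T (Z \<omega>) t = ?w t" if "t \<in> {0..T}" for t
        unfolding Zw by (rule wiener_haar(2)[OF T elim(2,1) that])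
      have "X t \<omega> = flow b x (wiener T (Z \<omega>)) t" if t: "t \<in> {0..T}" for t
        by (rule flow_unique[OF wiener_continuous[OF T] Xc[OF elim(4)] _ t]) (use elim(3) ww in auto)
      then have "S (Z \<omega>) = restrict (\<lambda>t. X t \<omega>) {0..T}"
        unfolding S_def sol_def by (intro restrict_ext) simp
      with g show ?case by blast
    qed
  qed
  \<comment> \<open>The law of \<open>X\<close> therefore depends on the underlying probability
    space only through the law \<open>gauss_seq\<close> of the coefficients.\<close>
  have law_S: "distr gauss_seq (path_space T) S = P"
  proof -
    have "distr gauss_seq (path_space T) S = distr M (path_space T) (S \<circ> Z)"
      by (subst Z(2)[symmetric]) (rule distr_distr[OF Sm Z(1)])
    also have "\<dots> = P" unfolding P_def path_law_def
    proof (rule distr_cong_AE)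
      show "AE \<omega> in M. (S \<circ> Z) \<omega> = restrict (\<lambda>t. X t \<omega>) {0..T}"
        using good_AE by eventually_elim simp
    qed (auto intro: measurable_comp[OF Z(1) Sm] Xpm)
    finally show ?thesis .
  qed
  \<comment> \<open>Goodness holds almost surely for \<open>Z\<close>, whose law is
    \<open>gauss_seq\<close>, and is transferred to that law.\<close>
  have good_gs: "AE z in gauss_seq. z \<in> good T TYPE('n)"
  proof -
    have "AE z in distr M gauss_seq Z. z \<in> good T TYPE('n)"
    proof (subst AE_distr_iff[OF Z(1)])
      show "{z \<in> space gauss_seq. z \<in> good T TYPE('n)} \<in> sets gauss_seq"
        using sets_good[OF T, where 'n='n] by (simp add: space_gauss_seq)
      show "AE \<omega> in M. Z \<omega> \<in> good T TYPE('n)" using good_AE by eventually_elim simp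
    qed
    then show ?thesis unfolding Z(2) .
  qed
  have transport: "W2 (d_H T) P \<nu> \<le> sqrt_ennreal (2 * ennreal (alpha_sq T K B) * rel_entropy \<nu> P)"
    if \<nu>: "prob_space \<nu>" and s\<nu>: "sets \<nu> = sets P" for \<nu>
  \<comment> \<open>In the negative case the entropy is infinite, and so is the right-hand side
    since \<open>alpha_sq\<close> is positive.\<close>
  proof (cases "absolutely_continuous P \<nu> \<and> integrable \<nu> (entropy_density (exp 1) P \<nu>)")
    case False
    then have "rel_entropy \<nu> P = \<infinity>" unfolding rel_entropy_def by (rule if_not_P)
    then have "2 * ennreal (alpha_sq T K B) * rel_entropy \<nu> P = \<infinity>"
      using alpha_sq_pos[of T K B] by (simp add: ennreal_mult_top)
    then show ?thesis by (simp add: sqrt_ennreal_def)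
  next
    case True
    interpret \<nu>: prob_space \<nu> by (rule \<nu>)
    define f where "f = RN_deriv P \<nu>"
    have fm: "f \<in> borel_measurable (path_space T)"
      using borel_measurable_RN_deriv[of P \<nu>] unfolding f_def measurable_cong_sets[OF sP refl] .
    have dens: "density P f = \<nu>" unfolding f_def using True s\<nu> by (intro P.density_RN_deriv) auto
    have fSm: "(\<lambda>z. f (S z)) \<in> borel_measurable gauss_seq" by (rule measurable_compose[OF Sm fm])
    \<comment> \<open>\<open>S\<close> pushes \<open>gauss_seq\<close> to \<open>P\<close>, so
      composing the density with \<open>S\<close> preserves integrals of its functions, in
      particular its mass and its entropy.\<close>
    have fP: "(\<integral>\<^sup>+z. k (f (S z)) \<partial>gauss_seq) = (\<integral>\<^sup>+p. k (f p) \<partial>P)" if "k \<in> borel_measurable borel" for k :: "ennreal \<Rightarrow> ennreal"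
      unfolding law_S[symmetric] by (rule nn_integral_distr[OF Sm, symmetric]) (simp add: measurable_compose[OF fm that])
    have one: "(\<integral>\<^sup>+z. f (S z) \<partial>gauss_seq) = 1"
    proof -
      have "(\<integral>\<^sup>+p. f p \<partial>P) = emeasure (density P f) (space P)"
        by (subst emeasure_density) (auto simp: f_def cong: nn_integral_cong)
      then show ?thesis
        using fP[of "\<lambda>u. u"] \<nu>.emeasure_space_1 sets_eq_imp_space_eq[OF s\<nu>] unfolding dens by simp
    qed
    interpret Kn: knothe "\<lambda>z. f (S z)" by (standard; fact)
    have law_ST: "distr gauss_seq (path_space T) (S \<circ> Kn.T) = \<nu>"
    proof -
      have "distr gauss_seq (path_space T) (S \<circ> Kn.T) = distr (density gauss_seq (\<lambda>z. f (S z))) (path_space T) S"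
        unfolding Kn.law_T[symmetric] by (rule distr_distr[OF Sm Kn.measurable_T, symmetric])
      also have "\<dots> = density (distr gauss_seq (path_space T) S) f" by (rule density_distr[OF fm Sm, symmetric])
      also have "\<dots> = \<nu>" unfolding law_S by (rule dens)
      finally show ?thesis .
    qed
    \<comment> \<open>The law of \<open>Kn.T\<close> has a density relative to
      \<open>gauss_seq\<close>, so the null set of sequences that are not good stays null for
      it.\<close>
    have good_T: "AE z in gauss_seq. Kn.T z \<in> good T TYPE('n)"
    proof -
      have "AE z in density gauss_seq (\<lambda>z. f (S z)). z \<in> good T TYPE('n)"
        using good_gs by (subst AE_density[OF fSm]) (auto elim!: eventually_mono)
      then have "AE z in distr gauss_seq gauss_seq Kn.T. z \<in> good T TYPE('n)" unfolding Kn.law_T .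
      then show ?thesis by (rule AE_distrD[OF Kn.measurable_T])
    qed
    \<comment> \<open>Both solutions are driven by one Gaussian sequence, taken once as it is and
      once rearranged by the Knothe map, so that displacement of coefficients bounds the distance of
      the paths.\<close>
    define \<pi> where "\<pi> = distr gauss_seq (P \<Otimes>\<^sub>M \<nu>) (\<lambda>z. (S z, S (Kn.T z)))"
    have SP: "S \<in> gauss_seq \<rightarrow>\<^sub>M P" and SN: "(\<lambda>z. S (Kn.T z)) \<in> gauss_seq \<rightarrow>\<^sub>M \<nu>"
      using Sm measurable_compose[OF Kn.measurable_T Sm]
      unfolding measurable_cong_sets[OF refl sP] measurable_cong_sets[OF refl trans[OF s\<nu> sP]] by blast+
    have pm: "(\<lambda>z. (S z, S (Kn.T z))) \<in> gauss_seq \<rightarrow>\<^sub>M P \<Otimes>\<^sub>M \<nu>" by (rule measurable_Pair[OF SP SN])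
    have "\<pi> \<in> couplings P \<nu>" unfolding couplings_def
    proof (intro CollectI conjI)
      show "sets \<pi> = sets (P \<Otimes>\<^sub>M \<nu>)" by (simp add: \<pi>_def)
      have "distr \<pi> P fst = distr gauss_seq P S"
        unfolding \<pi>_def by (subst distr_distr[OF measurable_fst pm]) (simp add: comp_def)
      also have "\<dots> = distr gauss_seq (path_space T) S" by (rule distr_cong) (simp_all add: sP)
      finally show "distr \<pi> P fst = P" unfolding law_S .
      have "distr \<pi> \<nu> snd = distr gauss_seq \<nu> (S \<circ> Kn.T)"
        unfolding \<pi>_def by (subst distr_distr[OF measurable_snd pm]) (simp add: comp_def)
      also have "\<dots> = distr gauss_seq (path_space T) (S \<circ> Kn.T)" by (rule distr_cong) (simp_all add: s\<nu> sP)
      finally show "distr \<pi> \<nu> snd = \<nu>" unfolding law_ST .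
    qed
    then have "W2 (d_H T) P \<nu> \<le> sqrt_ennreal (\<integral>\<^sup>+(p, p'). (d_H T p p')\<^sup>2 \<partial>\<pi>)"
      unfolding W2_def by (rule INF_lower)
    also have "\<dots> \<le> sqrt_ennreal (2 * ennreal (alpha_sq T K B) * rel_entropy \<nu> P)"
    proof (rule sqrt_ennreal_mono)
      let ?q = "\<lambda>z. \<Sum>k. ennreal ((z k - Kn.T z k)\<^sup>2)"
      have [measurable]: "(\<lambda>z. z k) \<in> borel_measurable gauss_seq" "(\<lambda>z. Kn.T z k) \<in> borel_measurable gauss_seq" for k
        using measurable_component_singleton[of k UNIV "\<lambda>_. gauss"]
          measurable_compose[OF Kn.measurable_T measurable_component_singleton[of k UNIV "\<lambda>_. gauss"]] by simp_all
      have "(\<integral>\<^sup>+(p, p'). (d_H T p p')\<^sup>2 \<partial>\<pi>) \<le> (\<integral>\<^sup>+z. (d_H T (S z) (S (Kn.T z)))\<^sup>2 \<partial>gauss_seq)"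
        unfolding \<pi>_def using nn_integral_distr_le[OF pm, of "\<lambda>(p, p'). (d_H T p p')\<^sup>2"] by simp
      also have "\<dots> \<le> (\<integral>\<^sup>+z. ennreal (alpha_sq T K B) * ?q z \<partial>gauss_seq)"
      proof (rule nn_integral_mono_AE)
        show "AE z in gauss_seq. (d_H T (S z) (S (Kn.T z)))\<^sup>2 \<le> ennreal (alpha_sq T K B) * ?q z"
          using good_gs good_T unfolding S_def by eventually_elim (rule d_H_sol_le[OF ld os])
      qed
      also have "\<dots> = ennreal (alpha_sq T K B) * (\<integral>\<^sup>+z. ?q z \<partial>gauss_seq)"
        by (rule nn_integral_cmult) measurable
      also have "\<dots> \<le> ennreal (alpha_sq T K B) * (2 * (\<integral>\<^sup>+z. ennreal (ent (enn2real (f (S z)))) \<partial>gauss_seq))"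
        by (intro mult_left_mono Kn.cost_T) simp
      also have "(\<integral>\<^sup>+z. ennreal (ent (enn2real (f (S z)))) \<partial>gauss_seq) = (\<integral>\<^sup>+p. ennreal (ent (enn2real (f p))) \<partial>P)"
        by (rule fP) measurable
      also have "\<dots> = rel_entropy \<nu> P"
        unfolding f_def using True by (intro nn_integral_ent_RN_deriv P.prob_space_axioms \<nu> s\<nu>) auto
      finally show "(\<integral>\<^sup>+(p, p'). (d_H T p p')\<^sup>2 \<partial>\<pi>) \<le> 2 * ennreal (alpha_sq T K B) * rel_entropy \<nu> P"
        by (simp add: mult_ac)
    qed
    finally show ?thesis .
  qed
  show ?thesis unfolding T2_def P_def[symmetric]
    by (intro CollectI conjI allI impI P.prob_space_axioms, rule transport) (erule conjunct1, erule conjunct2)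
qed

end
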